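(* Given any discrete lamination $\mathcal{L}$ of $\mathcal{C}_\pi^\psi$ and any object $T$ in $\mathcal{L}$, there is, up to isomorphism, exactly one other indecomposable object $T^\ast$ with the property that $\mathcal{L}^\ast=(\mathcal{L}\setminus\{T\})\cup\{T^\ast\}$ is also a discrete lamination.
   Context: **The categories.** $R$ is a discrete valuation ring with uniformizer $u$ and residue field $K=R/(u)$ of characteristic $\neq2$. For $0<b\le\pi$ let $\tilde{\mathcal{X}}_b=\{(x,y,\epsilon)\in\mathbb{R}\times\mathbb{R}\times\{+,-\}: |x-y|\le b\}$, with $(x,y,\epsilon)\le(x',y',\epsilon')$ iff $x\le x'$ and $y\le y'$, and automorphism $\sigma(x,y,\epsilon)=(y+\pi,x+\pi,-\epsilon)$. Let $\mathcal{X}_b$ be the set of $\sigma$-orbits, $M(x,y)$ the orbit of $(x,y,+)$ and $M(x,y)'$ the orbit of $(x,y,-)$; thus $M(x,y)'=M(y+\pi,x+\pi)$ and $M(x+2\pi,y+2\pi)=M(x,y)$. For $X,Y,Z\in\mathcal{X}_b$ with representatives $\tilde X,\tilde Y,\tilde Z$ put $c(X,Y,Z)=i+j-k$ where $i,j,k$ are the minimal integers with $\tilde X\le\sigma^i\tilde Y$, $\tilde Y\le\sigma^j\tilde Z$, $\tilde X\le\sigma^k\tilde Z$. Let $\mathcal{F}_b$ be the additive $R$-category of finite direct sums of elements of $\mathcal{X}_b$, where $\mathrm{Hom}(X,Y)=Rf_{XY}$ is free of rank one for $X,Y\in\mathcal{X}_b$ ($f_{XY}$ is the basic morphism), $f_{XX}=\mathrm{id}$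 and $f_{YZ}f_{XY}=u^{c(X,Y,Z)}f_{XZ}$. It is known that $\mathcal{F}_b$ has a unique exact structure making it a Frobenius category whose indecomposable projective-injectives are the $M(x,y)$ with $|x-y|=b$. Let $\psi$ be the $R$-linear involution of $\mathcal{F}_b$ with $\psi M(x,y)=M(x+\pi,y+\pi)$ and $\psi f_{XY}=f_{\psi X,\psi Y}$. Let $\mathcal{F}_b^\psi$ have objects $(X,\xi)$, $\xi:\psi X\to X$ an isomorphism with $\xi\circ\psi\xi=\mathrm{id}$, morphisms $(X,\xi^X)\to(Y,\xi^Y)$ the $f:X\to Y$ with $f\xi^X=\xi^Y\psi f$, and exact sequences those exact in $\mathcal{F}_b$. It is a Frobenius category; its stable category, a triangulated category with shift $[1]$, is $\mathcal{C}_b^\psi$, and $\mathrm{Ext}^1(A,B)=\mathcal{C}_b^\psi(A,B[1])$. **Objects.** $SX=(X\oplus\psi X,\xi)$ with $\xi$ the swap of summands; $E(x,y)=M(x,y-\pi)$; $Z_\epsilon(x)=(M(x,x),\epsilon\zeta)$ for $\epsilon=\pm$, with $\zeta:\psi M(x,x)\to M(x,x)$ the basic isomorphism. The nonzero indecomposable objects of $\mathcal{C}_b^\psi$ are, up to isomorphism, the regular objects $SM(x,y)$ with $0<|x-y|<b$ and the singular objects $Z_\epsilon(x)$. **Compatibility and laminations.** For $0<b<\pi$, objects $X,Y$ of $\mathcal{C}_b^\psi$ are compatible if $\mathrm{Ext}^1(X,Y)=0=\mathrm{Ext}^1(Y,X)$. Two indecomposable objects of $\mathcal{C}_\pi^\psi$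 are compatible if the objects of $\mathcal{C}_b^\psi$ with the same names ($SM(x,y)$ or $Z_\epsilon(x)$) are compatible for all $b<\pi$ sufficiently close to $\pi$. A lamination in $\mathcal{C}_\pi^\psi$ is a maximal set of pairwise compatible nonisomorphic indecomposable objects. **Discreteness.** $\mathcal{H}=\tilde{\mathcal{H}}/\sim$ with the quotient topology, where $\tilde{\mathcal{H}}=\{(x,y,\epsilon)\in\mathbb{R}^2\times\{+,-\}: x<y\le x+\pi\}$ and $\sim$ is generated by $(x,y,+)\sim(x,y,-)$ if $y<x+\pi$, and $(x,y,\epsilon)\sim(x+\pi,y+\pi,\epsilon)$. Write $[x,y]_\epsilon$ for classes ($[x,y]$ if $y<x+\pi$). Put $h(SE(x,y))=[x,y]$ if $x<y<x+\pi$, $h(SE(x,y))=[y,x+2\pi]$ if $x+\pi<y<x+2\pi$, and $h(Z_\epsilon(x))=[x,x+\pi]_\epsilon$. A lamination $\mathcal{L}$ is discrete if $h(\mathcal{L})=\{h(X):X\in\mathcal{L}\}$ is a discrete subset of $\mathcal{H}$ (discrete in the subspace topology). "Other" means not isomorphic to $T$. *)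

theory Defs
  imports "HOL-Analysis.Abstract_Topology" "Jordan_Normal_Form.Matrix"
begin

section \<open>Preadditive categories, exact structures, stable categories\<close>

text \<open>\<open>Comp C X Y Z g f\<close> is the composite of \<open>f : X \<rightarrow> Y\<close> followed by \<open>g : Y \<rightarrow> Z\<close>.\<close>

record ('o, 'm) addcat =
  Obj :: "'o set"
  Mor :: "'o \<Rightarrow> 'o \<Rightarrow> 'm set"
  Comp :: "'o \<Rightarrow> 'o \<Rightarrow> 'o \<Rightarrow> 'm \<Rightarrow> 'm \<Rightarrow> 'm"
  Idm :: "'o \<Rightarrow> 'm"
  ZeroM :: "'o \<Rightarrow> 'o \<Rightarrow> 'm"
  AddM :: "'m \<Rightarrow> 'm \<Rightarrow> 'm"

definition isomorphism :: "('o, 'm) addcat \<Rightarrow> 'o \<Rightarrow> 'o \<Rightarrow> 'm \<Rightarrow> bool" where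
  "isomorphism C X Y f \<longleftrightarrow> f \<in> Mor C X Y \<and>
     (\<exists>g \<in> Mor C Y X. Comp C X Y X g f = Idm C X \<and> Comp C Y X Y f g = Idm C Y)"

definition isomorphic :: "('o, 'm) addcat \<Rightarrow> 'o \<Rightarrow> 'o \<Rightarrow> bool" where
  "isomorphic C X Y \<longleftrightarrow> (\<exists>f. isomorphism C X Y f)"

definition zero_object :: "('o, 'm) addcat \<Rightarrow> 'o \<Rightarrow> bool" where
  "zero_object C X \<longleftrightarrow> X \<in> Obj C \<and> Idm C X = ZeroM C X X"

definition direct_sum :: "('o, 'm) addcat \<Rightarrow> 'o \<Rightarrow> 'o \<Rightarrow> 'o \<Rightarrow> bool" where
  "direct_sum C X A B \<longleftrightarrow>
     (\<exists>i \<in> Mor C A X. \<exists>j \<in> Mor C B X. \<exists>p \<in> Mor C X A. \<exists>q \<in> Mor C X B.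
        Comp C A X A p i = Idm C A \<and> Comp C B X B q j = Idm C B \<and>
        Comp C A X B q i = ZeroM C A B \<and> Comp C B X A p j = ZeroM C B A \<and>
        AddM C (Comp C X A X i p) (Comp C X B X j q) = Idm C X)"

definition indecomposable :: "('o, 'm) addcat \<Rightarrow> 'o \<Rightarrow> bool" where
  "indecomposable C X \<longleftrightarrow> X \<in> Obj C \<and> \<not> zero_object C X \<and>
     (\<forall>A \<in> Obj C. \<forall>B \<in> Obj C. direct_sum C X A B \<longrightarrow> zero_object C A \<or> zero_object C B)"

definition is_kernel :: "('o, 'm) addcat \<Rightarrow> 'o \<Rightarrow> 'm \<Rightarrow> 'o \<Rightarrow> 'm \<Rightarrow> 'o \<Rightarrow> bool" where
  "is_kernel C X f Y g Z \<longleftrightarrow> f \<in> Mor C X Y \<and> g \<in> Mor C Y Z \<and> Comp C X Y Z g f = ZeroM C X Z \<and>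
     (\<forall>W \<in> Obj C. \<forall>h \<in> Mor C W Y. Comp C W Y Z g h = ZeroM C W Z \<longrightarrow>
        (\<exists>!k. k \<in> Mor C W X \<and> Comp C W X Y f k = h))"

definition is_cokernel :: "('o, 'm) addcat \<Rightarrow> 'o \<Rightarrow> 'm \<Rightarrow> 'o \<Rightarrow> 'm \<Rightarrow> 'o \<Rightarrow> bool" where
  "is_cokernel C X f Y g Z \<longleftrightarrow> f \<in> Mor C X Y \<and> g \<in> Mor C Y Z \<and> Comp C X Y Z g f = ZeroM C X Z \<and>
     (\<forall>W \<in> Obj C. \<forall>h \<in> Mor C Y W. Comp C X Y W h f = ZeroM C X W \<longrightarrow>
        (\<exists>!k. k \<in> Mor C Z W \<and> Comp C Y Z W k g = h))"

text \<open>The squares have \<open>f : X \<rightarrow> Y\<close> and \<open>f' : X' \<rightarrow> Y'\<close> as parallel sides, and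
  \<open>a : X \<rightarrow> X'\<close> and \<open>b : Y \<rightarrow> Y'\<close> as the other two.\<close>

definition is_pushout ::
  "('o, 'm) addcat \<Rightarrow> 'o \<Rightarrow> 'o \<Rightarrow> 'o \<Rightarrow> 'o \<Rightarrow> 'm \<Rightarrow> 'm \<Rightarrow> 'm \<Rightarrow> 'm \<Rightarrow> bool" where
  "is_pushout C X Y X' Y' f f' a b \<longleftrightarrow>
     f \<in> Mor C X Y \<and> f' \<in> Mor C X' Y' \<and> a \<in> Mor C X X' \<and> b \<in> Mor C Y Y' \<and>
     Comp C X Y Y' b f = Comp C X X' Y' f' a \<and>
     (\<forall>W \<in> Obj C. \<forall>s \<in> Mor C Y W. \<forall>t \<in> Mor C X' W. Comp C X Y W s f = Comp C X X' W t a \<longrightarrow>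
        (\<exists>!k. k \<in> Mor C Y' W \<and> Comp C Y Y' W k b = s \<and> Comp C X' Y' W k f' = t))"

definition is_pullback ::
  "('o, 'm) addcat \<Rightarrow> 'o \<Rightarrow> 'o \<Rightarrow> 'o \<Rightarrow> 'o \<Rightarrow> 'm \<Rightarrow> 'm \<Rightarrow> 'm \<Rightarrow> 'm \<Rightarrow> bool" where
  "is_pullback C X Y X' Y' f f' a b \<longleftrightarrow>
     f \<in> Mor C X Y \<and> f' \<in> Mor C X' Y' \<and> a \<in> Mor C X X' \<and> b \<in> Mor C Y Y' \<and>
     Comp C X Y Y' b f = Comp C X X' Y' f' a \<and>
     (\<forall>W \<in> Obj C. \<forall>s \<in> Mor C W Y. \<forall>t \<in> Mor C W X'. Comp C W Y Y' b s = Comp C W X' Y' f' t \<longrightarrow>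
        (\<exists>!k. k \<in> Mor C W X \<and> Comp C W X Y f k = s \<and> Comp C W X X' a k = t))"

text \<open>\<open>(X, f, Y, g, Z)\<close> stands for the sequence \<open>X \<rightarrow> Y \<rightarrow> Z\<close> with maps \<open>f\<close> and \<open>g\<close>.\<close>

type_synonym ('o, 'm) ses = "'o \<times> 'm \<times> 'o \<times> 'm \<times> 'o"

definition inflation :: "('o, 'm) ses set \<Rightarrow> 'o \<Rightarrow> 'o \<Rightarrow> 'm \<Rightarrow> bool" where
  "inflation S X Y f \<longleftrightarrow> (\<exists>g Z. (X, f, Y, g, Z) \<in> S)"

definition deflation :: "('o, 'm) ses set \<Rightarrow> 'o \<Rightarrow> 'o \<Rightarrow> 'm \<Rightarrow> bool" where
  "deflation S Y Z g \<longleftrightarrow> (\<exists>X f. (X, f, Y, g, Z) \<in> S)"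

text \<open>Quillen's axioms for a class \<open>S\<close> of short exact sequences, closed under isomorphism.\<close>

definition exact_structure :: "('o, 'm) addcat \<Rightarrow> ('o, 'm) ses set \<Rightarrow> bool" where
  "exact_structure C S \<longleftrightarrow>
     (\<forall>X f Y g Z. (X, f, Y, g, Z) \<in> S \<longrightarrow>
        X \<in> Obj C \<and> Y \<in> Obj C \<and> Z \<in> Obj C \<and> is_kernel C X f Y g Z \<and> is_cokernel C X f Y g Z) \<and>
     (\<forall>X f Y g Z X' f' Y' g' Z' a b c. (X, f, Y, g, Z) \<in> S \<longrightarrow>
        X' \<in> Obj C \<longrightarrow> Y' \<in> Obj C \<longrightarrow> Z' \<in> Obj C \<longrightarrow> f' \<in> Mor C X' Y' \<longrightarrow> g' \<in> Mor C Y' Z' \<longrightarrow>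
        isomorphism C X X' a \<longrightarrow> isomorphism C Y Y' b \<longrightarrow> isomorphism C Z Z' c \<longrightarrow>
        Comp C X Y Y' b f = Comp C X X' Y' f' a \<longrightarrow> Comp C Y Z Z' c g = Comp C Y Y' Z' g' b \<longrightarrow>
        (X', f', Y', g', Z') \<in> S) \<and>
     (\<forall>X \<in> Obj C. inflation S X X (Idm C X) \<and> deflation S X X (Idm C X)) \<and>
     (\<forall>X Y Z f g. inflation S X Y f \<longrightarrow> inflation S Y Z g \<longrightarrow> inflation S X Z (Comp C X Y Z g f)) \<and>
     (\<forall>X Y Z f g. deflation S X Y f \<longrightarrow> deflation S Y Z g \<longrightarrow> deflation S X Z (Comp C X Y Z g f)) \<and>
     (\<forall>X Y f. \<forall>X' \<in> Obj C. \<forall>a \<in> Mor C X X'. inflation S X Y f \<longrightarrow>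
        (\<exists>Y' \<in> Obj C. \<exists>f' b. is_pushout C X Y X' Y' f f' a b \<and> inflation S X' Y' f')) \<and>
     (\<forall>X' Y' f'. \<forall>Y \<in> Obj C. \<forall>b \<in> Mor C Y Y'. deflation S X' Y' f' \<longrightarrow>
        (\<exists>X \<in> Obj C. \<exists>f a. is_pullback C X Y X' Y' f f' a b \<and> deflation S X Y f))"

definition projective :: "('o, 'm) addcat \<Rightarrow> ('o, 'm) ses set \<Rightarrow> 'o \<Rightarrow> bool" where
  "projective C S P \<longleftrightarrow> P \<in> Obj C \<and>
     (\<forall>Y Z g. \<forall>h \<in> Mor C P Z. deflation S Y Z g \<longrightarrow> (\<exists>k \<in> Mor C P Y. Comp C P Y Z g k = h))"

definition injective :: "('o, 'm) addcat \<Rightarrow> ('o, 'm) ses set \<Rightarrow> 'o \<Rightarrow> bool" where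
  "injective C S I \<longleftrightarrow> I \<in> Obj C \<and>
     (\<forall>X Y f. \<forall>h \<in> Mor C X I. inflation S X Y f \<longrightarrow> (\<exists>k \<in> Mor C Y I. Comp C X Y I k f = h))"

definition frobenius :: "('o, 'm) addcat \<Rightarrow> ('o, 'm) ses set \<Rightarrow> bool" where
  "frobenius C S \<longleftrightarrow> exact_structure C S \<and>
     (\<forall>X \<in> Obj C. \<exists>P g. projective C S P \<and> deflation S P X g) \<and>
     (\<forall>X \<in> Obj C. \<exists>I f. injective C S I \<and> inflation S X I f) \<and>
     (\<forall>X. projective C S X \<longleftrightarrow> injective C S X)"

definition stably_null :: "('o, 'm) addcat \<Rightarrow> ('o, 'm) ses set \<Rightarrow> 'o \<Rightarrow> 'o \<Rightarrow> 'm set" where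
  "stably_null C S X Y =
     {Comp C X P Y g f | P f g. projective C S P \<and> injective C S P \<and> f \<in> Mor C X P \<and> g \<in> Mor C P Y}"

definition stable_class :: "('o, 'm) addcat \<Rightarrow> ('o, 'm) ses set \<Rightarrow> 'o \<Rightarrow> 'o \<Rightarrow> 'm \<Rightarrow> 'm set" where
  "stable_class C S X Y f = {AddM C f n | n. n \<in> stably_null C S X Y}"

definition stable_category ::
  "('o, 'm) addcat \<Rightarrow> ('o, 'm) ses set \<Rightarrow> ('o, 'm set) addcat" where
  "stable_category C S = \<lparr>
     Obj = Obj C,
     Mor = (\<lambda>X Y. stable_class C S X Y ` Mor C X Y),
     Comp = (\<lambda>X Y Z G F. \<Union>g \<in> G. \<Union>f \<in> F. stable_class C S X Z (Comp C X Y Z g f)),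
     Idm = (\<lambda>X. stable_class C S X X (Idm C X)),
     ZeroM = (\<lambda>X Y. stable_class C S X Y (ZeroM C X Y)),
     AddM = (\<lambda>F G. {AddM C f g | f g. f \<in> F \<and> g \<in> G})\<rparr>"

text \<open>The object \<open>X[1]\<close>, which is determined up to isomorphism in the stable category.\<close>

definition shift :: "('o, 'm) addcat \<Rightarrow> ('o, 'm) ses set \<Rightarrow> 'o \<Rightarrow> 'o" where
  "shift C S X = (SOME Z. \<exists>f I g. (X, f, I, g, Z) \<in> S \<and> projective C S I \<and> injective C S I)"

definition Ext1 :: "('o, 'm) addcat \<Rightarrow> ('o, 'm) ses set \<Rightarrow> 'o \<Rightarrow> 'o \<Rightarrow> 'm set set" where
  "Ext1 C S X Y = Mor (stable_category C S) X (shift C S Y)"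

definition Ext1_zero :: "('o, 'm) addcat \<Rightarrow> ('o, 'm) ses set \<Rightarrow> 'o \<Rightarrow> 'o \<Rightarrow> bool" where
  "Ext1_zero C S X Y \<longleftrightarrow> Ext1 C S X Y = {ZeroM (stable_category C S) X (shift C S Y)}"


section \<open>Discrete valuation rings\<close>

definition ring_ideal :: "'r :: comm_ring_1 set \<Rightarrow> bool" where
  "ring_ideal I \<longleftrightarrow> 0 \<in> I \<and> (\<forall>a \<in> I. \<forall>b \<in> I. a + b \<in> I) \<and> (\<forall>r. \<forall>a \<in> I. r * a \<in> I)"

definition principal_ideal :: "'r :: comm_ring_1 \<Rightarrow> 'r set" where
  "principal_ideal a = {r * a | r. True}"

definition maximal_ideal :: "'r :: comm_ring_1 set \<Rightarrow> bool" where
  "maximal_ideal I \<longleftrightarrow> ring_ideal I \<and> I \<noteq> UNIV \<and>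
     (\<forall>J. ring_ideal J \<longrightarrow> I \<subseteq> J \<longrightarrow> J = I \<or> J = UNIV)"

text \<open>The ambient type is a local principal ideal domain that is not a field, and \<open>u\<close> generates
  its maximal ideal. The residue field modulo \<open>principal_ideal u\<close> has characteristic different
  from \<open>2\<close> iff \<open>2 \<notin> principal_ideal u\<close>.\<close>

definition dvr_uniformizer :: "'r :: idom \<Rightarrow> bool" where
  "dvr_uniformizer u \<longleftrightarrow> (\<forall>I :: 'r set. ring_ideal I \<longrightarrow> (\<exists>a. I = principal_ideal a)) \<and>
     u \<noteq> 0 \<and> (\<forall>I. maximal_ideal I \<longleftrightarrow> I = principal_ideal u)"


section \<open>The category \<open>F\<^sub>b\<close>\<close>

text \<open>The sign \<open>+\<close> is encoded as \<^const>\<open>True\<close>, here and below.\<close>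

type_synonym point = "real \<times> real \<times> bool"

definition point_le :: "point \<Rightarrow> point \<Rightarrow> bool" where
  "point_le = (\<lambda>(x, y, e) (x', y', e'). x \<le> x' \<and> y \<le> y')"

definition sigma :: "point \<Rightarrow> point" where
  "sigma = (\<lambda>(x, y, e). (y + pi, x + pi, \<not> e))"

definition sigma_pow :: "int \<Rightarrow> point \<Rightarrow> point" where
  "sigma_pow i = (if 0 \<le> i then sigma ^^ nat i else inv_into UNIV sigma ^^ nat (- i))"

definition orbit :: "point \<Rightarrow> point set" where
  "orbit p = {sigma_pow i p | i. True}"

definition M_orb :: "real \<Rightarrow> real \<Rightarrow> point set" where
  "M_orb x y = orbit (x, y, True)"

definition X_set :: "real \<Rightarrow> point set set" where
  "X_set b = {orbit (x, y, e) | x y e. \<bar>x - y\<bar> \<le> b}"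

definition repr :: "point set \<Rightarrow> point" where
  "repr X = (SOME p. p \<in> X)"

definition min_shift :: "point \<Rightarrow> point \<Rightarrow> int" where
  "min_shift p q = (LEAST i. point_le p (sigma_pow i q))"

definition c_pt :: "point \<Rightarrow> point \<Rightarrow> point \<Rightarrow> int" where
  "c_pt p q r = min_shift p q + min_shift q r - min_shift p r"

definition c_orb :: "point set \<Rightarrow> point set \<Rightarrow> point set \<Rightarrow> int" where
  "c_orb X Y Z = c_pt (repr X) (repr Y) (repr Z)"

lemma sigma_pow_eq:
  "sigma_pow i (x, y, e) = (if even i then (x + of_int i * pi, y + of_int i * pi, e)
                            else (y + of_int i * pi, x + of_int i * pi, \<not> e))"
proof -
  have inv: "inv_into UNIV sigma (x, y, e) = (y - pi, x - pi, \<not> e)" for x y e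
  proof -
    have "inj sigma" by (auto simp: inj_def sigma_def)
    moreover have "sigma (y - pi, x - pi, \<not> e) = (x, y, e)" by (simp add: sigma_def)
    ultimately show ?thesis by (metis inv_f_f)
  qed
  have pos: "(sigma ^^ n) (x, y, e) = (if even n then (x + n * pi, y + n * pi, e)
                            else (y + n * pi, x + n * pi, \<not> e))" for n
    by (induction n) (auto simp: sigma_def algebra_simps)
  have neg: "(inv_into UNIV sigma ^^ n) (x, y, e) = (if even n then (x - n * pi, y - n * pi, e)
                            else (y - n * pi, x - n * pi, \<not> e))" for n
    by (induction n) (auto simp: inv algebra_simps)
  show ?thesis
  proof (cases "0 \<le> i")
    case True
    then show ?thesis by (simp add: sigma_pow_def pos even_nat_iff)
  next
    case False
    moreover have "even (nat (- i)) \<longleftrightarrow> even i" using False by (simp add: even_nat_iff)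
    ultimately show ?thesis by (simp add: sigma_pow_def neg)
  qed
qed

lemma sigma_pow_add: "sigma_pow i (sigma_pow j p) = sigma_pow (i + j) p"
  by (cases p) (auto simp: sigma_pow_eq algebra_simps)

lemma point_le_sigma_pow: "point_le (sigma_pow i p) (sigma_pow i q) \<longleftrightarrow> point_le p q"
  by (cases p; cases q) (auto simp: sigma_pow_eq point_le_def)

lemma point_le_sigma_pow_shift:
  "point_le (sigma_pow m p) (sigma_pow i q) \<longleftrightarrow> point_le p (sigma_pow (i - m) q)"
  using point_le_sigma_pow[of m p "sigma_pow (i - m) q"] by (simp add: sigma_pow_add)

lemma min_shift_exists: "\<exists>i. point_le p (sigma_pow i q) \<and> (\<forall>j. point_le p (sigma_pow j q) \<longrightarrow> i \<le> j)"
proof -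
  obtain x y e where p: "p = (x, y, e)" by (cases p)
  obtain x' y' e' where q: "q = (x', y', e')" by (cases q)
  define B where "B = \<lfloor>(x - max x' y') / pi\<rfloor>"
  define N where "N = \<lceil>(max x y - min x' y') / pi\<rceil>"
  have lower: "B \<le> j" if "point_le p (sigma_pow j q)" for j
  proof -
    have "x \<le> max x' y' + of_int j * pi"
      using that by (auto simp: p q sigma_pow_eq point_le_def split: if_splits)
    then have "(x - max x' y') / pi \<le> of_int j" by (simp add: divide_le_eq)
    then show ?thesis unfolding B_def by linarith
  qed
  have "(max x y - min x' y') / pi \<le> of_int N" unfolding N_def by linarith
  then have "max x y - min x' y' \<le> of_int N * pi" by (simp add: divide_le_eq)
  then have "x \<le> x' + of_int N * pi" "x \<le> y' + of_int N * pi"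
    "y \<le> x' + of_int N * pi" "y \<le> y' + of_int N * pi" by linarith+
  then have N: "point_le p (sigma_pow N q)"
    by (auto simp: p q sigma_pow_eq point_le_def)
  define n where "n = (LEAST n. point_le p (sigma_pow (B + int n) q))"
  have "point_le p (sigma_pow (B + int (nat (N - B))) q)"
    using N lower[OF N] by simp
  then have 1: "point_le p (sigma_pow (B + int n) q)"
    unfolding n_def by (rule LeastI)
  have "B + int n \<le> j" if "point_le p (sigma_pow j q)" for j
  proof -
    have "point_le p (sigma_pow (B + int (nat (j - B))) q)"
      using that lower[OF that] by simp
    then have "n \<le> nat (j - B)" unfolding n_def by (rule Least_le)
    then show ?thesis using lower[OF that] by linarith
  qed
  with 1 show ?thesis by blast
qed

lemma min_shift_eqI:
  assumes "point_le p (sigma_pow i q)" and "\<And>j. point_le p (sigma_pow j q) \<Longrightarrow> i \<le> j"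
  shows "min_shift p q = i"
  unfolding min_shift_def using assms by (rule Least_equality)

lemma min_shift:
  shows "point_le p (sigma_pow (min_shift p q) q)"
    and "point_le p (sigma_pow j q) \<Longrightarrow> min_shift p q \<le> j"
proof -
  obtain i where i: "point_le p (sigma_pow i q)" "\<And>j. point_le p (sigma_pow j q) \<Longrightarrow> i \<le> j"
    using min_shift_exists by blast
  then have eq: "min_shift p q = i" by (rule min_shift_eqI)
  show "point_le p (sigma_pow (min_shift p q) q)" using i(1) eq by simp
  show "point_le p (sigma_pow j q) \<Longrightarrow> min_shift p q \<le> j" using i(2) eq by simp
qed

lemma min_shift_sigma_pow: "min_shift (sigma_pow m p) (sigma_pow n q) = min_shift p q + m - n"
proof (rule min_shift_eqI)
  show "point_le (sigma_pow m p) (sigma_pow (min_shift p q + m - n) (sigma_pow n q))"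
    by (simp add: sigma_pow_add point_le_sigma_pow_shift min_shift)
  fix j
  assume "point_le (sigma_pow m p) (sigma_pow j (sigma_pow n q))"
  then have "min_shift p q \<le> j + n - m"
    by (simp add: sigma_pow_add point_le_sigma_pow_shift min_shift)
  then show "min_shift p q + m - n \<le> j" by linarith
qed

lemma c_orb_independent_of_representatives:
  assumes "X = orbit p" "Y = orbit q" "Z = orbit r" "p' \<in> X" "q' \<in> Y" "r' \<in> Z"
  shows "c_orb X Y Z = c_pt p' q' r'"
proof -
  have "s \<in> orbit s" for s
    unfolding orbit_def by (auto simp: sigma_pow_def intro!: exI[of _ 0])
  then have ex: "repr (orbit s) \<in> orbit s" for s
    unfolding repr_def by (rule someI)
  have eq: "c_pt p1 q1 r1 = c_pt p q r" if mem: "p1 \<in> X" "q1 \<in> Y" "r1 \<in> Z" for p1 q1 r1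
  proof -
    obtain i j k where "p1 = sigma_pow i p" "q1 = sigma_pow j q" "r1 = sigma_pow k r"
      using mem assms(1-3) unfolding orbit_def by blast
    then show ?thesis by (simp add: c_pt_def min_shift_sigma_pow)
  qed
  have "c_orb X Y Z = c_pt p q r"
    unfolding c_orb_def by (rule eq) (simp_all add: assms(1-3) ex)
  then show ?thesis using eq[OF assms(4-6)] by simp
qed

lemma c_pt_nonneg: "0 \<le> c_pt p q r"
proof -
  have "point_le p (sigma_pow (min_shift p q) q)" by (rule min_shift)
  moreover have "point_le (sigma_pow (min_shift p q) q)
      (sigma_pow (min_shift p q) (sigma_pow (min_shift q r) r))"
    by (simp add: point_le_sigma_pow min_shift)
  ultimately have "point_le p (sigma_pow (min_shift p q + min_shift q r) r)"
    unfolding sigma_pow_add[symmetric] by (auto simp: point_le_def split: prod.splits)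
  then have "min_shift p r \<le> min_shift p q + min_shift q r" by (rule min_shift)
  then show ?thesis by (simp add: c_pt_def)
qed

text \<open>An object is a formal direct sum of orbits, given as the list of its summands. A morphism is
  a matrix over the ring whose entry \<open>(i, j)\<close> is the coefficient of the basic morphism from the
  \<open>j\<close>-th summand of the source to the \<open>i\<close>-th summand of the target.\<close>

type_synonym obj = "point set list"

definition F_cat :: "'r :: idom \<Rightarrow> real \<Rightarrow> (obj, 'r mat) addcat" where
  "F_cat u b = \<lparr>
     Obj = lists (X_set b),
     Mor = (\<lambda>X Y. carrier_mat (length Y) (length X)),
     Comp = (\<lambda>X Y Z g f. mat (length Z) (length X) (\<lambda>(k, i).
        \<Sum>j < length Y. g $$ (k, j) * f $$ (j, i) * u ^ nat (c_orb (X ! i) (Y ! j) (Z ! k)))),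
     Idm = (\<lambda>X. 1\<^sub>m (length X)),
     ZeroM = (\<lambda>X Y. 0\<^sub>m (length Y) (length X)),
     AddM = (+)\<rparr>"

text \<open>The exact structure in the definition of \<open>F\<^sub>b\<close> is the unique \<open>S\<close> with this property.\<close>

definition F_exact_structure ::
  "'r :: idom \<Rightarrow> real \<Rightarrow> (obj, 'r mat) ses set \<Rightarrow> bool" where
  "F_exact_structure u b S \<longleftrightarrow> frobenius (F_cat u b) S \<and>
     (\<forall>X \<in> Obj (F_cat u b).
        indecomposable (F_cat u b) X \<and> projective (F_cat u b) S X \<and> injective (F_cat u b) S X \<longleftrightarrow>
        (\<exists>x y. \<bar>x - y\<bar> = b \<and> isomorphic (F_cat u b) X [M_orb x y]))"


section \<open>The categories \<open>F\<^sub>b\<close> and \<open>C\<^sub>b\<close> with involution\<close>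

definition psi_orb :: "point set \<Rightarrow> point set" where
  "psi_orb X = (\<lambda>(x, y, e). (x + pi, y + pi, e)) ` X"

definition psi :: "obj \<Rightarrow> obj" where
  "psi = map psi_orb"

text \<open>Since \<open>\<psi>\<close> is linear and sends basic morphisms to basic morphisms, it does not change the
  matrix of a morphism.\<close>

definition psi_mor :: "'r mat \<Rightarrow> 'r mat" where
  "psi_mor f = f"

type_synonym 'r pobj = "obj \<times> 'r mat"

definition Fpsi_cat :: "'r :: idom \<Rightarrow> real \<Rightarrow> ('r pobj, 'r mat) addcat" where
  "Fpsi_cat u b = (let F = F_cat u b in \<lparr>
     Obj = {(X, \<xi>). X \<in> Obj F \<and> isomorphism F (psi X) X \<xi> \<and>
                    Comp F X (psi X) X \<xi> (psi_mor \<xi>) = Idm F X},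
     Mor = (\<lambda>(X, \<xi>) (Y, \<eta>). {f \<in> Mor F X Y.
              Comp F (psi X) X Y f \<xi> = Comp F (psi X) (psi Y) Y \<eta> (psi_mor f)}),
     Comp = (\<lambda>X Y Z. Comp F (fst X) (fst Y) (fst Z)),
     Idm = (\<lambda>X. Idm F (fst X)),
     ZeroM = (\<lambda>X Y. ZeroM F (fst X) (fst Y)),
     AddM = AddM F\<rparr>)"

definition Fpsi_exact ::
  "'r :: idom \<Rightarrow> real \<Rightarrow> (obj, 'r mat) ses set \<Rightarrow> ('r pobj, 'r mat) ses set" where
  "Fpsi_exact u b S = {(X, f, Y, g, Z).
     X \<in> Obj (Fpsi_cat u b) \<and> Y \<in> Obj (Fpsi_cat u b) \<and> Z \<in> Obj (Fpsi_cat u b) \<and>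
     f \<in> Mor (Fpsi_cat u b) X Y \<and> g \<in> Mor (Fpsi_cat u b) Y Z \<and>
     (fst X, f, fst Y, g, fst Z) \<in> S}"

definition Cpsi_cat ::
  "'r :: idom \<Rightarrow> real \<Rightarrow> (obj, 'r mat) ses set \<Rightarrow> ('r pobj, 'r mat set) addcat" where
  "Cpsi_cat u b S = stable_category (Fpsi_cat u b) (Fpsi_exact u b S)"

text \<open>The summands of \<open>\<psi>(X \<oplus> \<psi>X)\<close> are those of \<open>\<psi>X\<close> followed by those of \<open>\<psi>\<psi>X = X\<close>.\<close>

definition S_obj :: "obj \<Rightarrow> 'r :: idom pobj" where
  "S_obj X = (X @ psi X,
     four_block_mat (0\<^sub>m (length X) (length X)) (1\<^sub>m (length X))
                    (1\<^sub>m (length X)) (0\<^sub>m (length X) (length X)))"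

definition SM :: "real \<Rightarrow> real \<Rightarrow> 'r :: idom pobj" where
  "SM x y = S_obj [M_orb x y]"

definition Z_obj :: "bool \<Rightarrow> real \<Rightarrow> 'r :: idom pobj" where
  "Z_obj e x = ([M_orb x x], mat 1 1 (\<lambda>_. if e then 1 else - 1))"

text \<open>Names of the indecomposable objects of \<open>C\<^sub>\<pi>\<^sup>\<psi>\<close>. The object with a given name is the same for every \<open>b\<close>
  for which it belongs to the category.\<close>

datatype name = Regular real real | Singular bool real

fun obj_of :: "name \<Rightarrow> 'r :: idom pobj" where
  "obj_of (Regular x y) = SM x y"
| "obj_of (Singular e x) = Z_obj e x"

fun is_name :: "name \<Rightarrow> bool" where
  "is_name (Regular x y) \<longleftrightarrow> 0 < \<bar>x - y\<bar> \<and> \<bar>x - y\<bar> < pi"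
| "is_name (Singular e x) \<longleftrightarrow> True"


section \<open>Compatibility and laminations\<close>

text \<open>From here on, \<open>E b\<close> is the exact structure of \<open>F\<^sub>b\<close>.\<close>

type_synonym 'r exacts = "real \<Rightarrow> (obj, 'r mat) ses set"

definition compatible_below ::
  "'r :: idom \<Rightarrow> 'r exacts \<Rightarrow> real \<Rightarrow> 'r pobj \<Rightarrow> 'r pobj \<Rightarrow> bool" where
  "compatible_below u E b X Y \<longleftrightarrow>
     Ext1_zero (Fpsi_cat u b) (Fpsi_exact u b (E b)) X Y \<and>
     Ext1_zero (Fpsi_cat u b) (Fpsi_exact u b (E b)) Y X"

abbreviation Cpi :: "'r :: idom \<Rightarrow> 'r exacts \<Rightarrow> ('r pobj, 'r mat set) addcat" where
  "Cpi u E \<equiv> Cpsi_cat u pi (E pi)"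

text \<open>An indecomposable object of \<open>C\<^sub>\<pi>\<^sup>\<psi>\<close> has several names. Neither compatibility
  nor \<open>h\<close> depends on the choice.\<close>

definition name_of :: "'r :: idom \<Rightarrow> 'r exacts \<Rightarrow> 'r pobj \<Rightarrow> name" where
  "name_of u E X = (SOME n. is_name n \<and> isomorphic (Cpi u E) X (obj_of n))"

definition compatible :: "'r :: idom \<Rightarrow> 'r exacts \<Rightarrow> 'r pobj \<Rightarrow> 'r pobj \<Rightarrow> bool" where
  "compatible u E X Y \<longleftrightarrow>
     (\<forall>\<^sub>F b in at_left pi. compatible_below u E b (obj_of (name_of u E X)) (obj_of (name_of u E Y)))"

definition compatible_set :: "'r :: idom \<Rightarrow> 'r exacts \<Rightarrow> 'r pobj set \<Rightarrow> bool" where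
  "compatible_set u E L \<longleftrightarrow> (\<forall>X \<in> L. indecomposable (Cpi u E) X) \<and>
     pairwise (\<lambda>X Y. \<not> isomorphic (Cpi u E) X Y \<and> compatible u E X Y) L"

definition lamination :: "'r :: idom \<Rightarrow> 'r exacts \<Rightarrow> 'r pobj set \<Rightarrow> bool" where
  "lamination u E L \<longleftrightarrow> compatible_set u E L \<and>
     (\<forall>L'. compatible_set u E L' \<longrightarrow> L \<subseteq> L' \<longrightarrow> L' = L)"


section \<open>Discreteness\<close>

definition H_tilde :: "point set" where
  "H_tilde = {(x, y, e). x < y \<and> y \<le> x + pi}"

inductive H_gen :: "point \<Rightarrow> point \<Rightarrow> bool" where
  sign: "x < y \<Longrightarrow> y < x + pi \<Longrightarrow> H_gen (x, y, True) (x, y, False)"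
| translate: "x < y \<Longrightarrow> y \<le> x + pi \<Longrightarrow> H_gen (x, y, e) (x + pi, y + pi, e)"

definition H_class :: "point \<Rightarrow> point set" where
  "H_class p = {q. equivclp H_gen p q}"

definition H_space :: "point set topology" where
  "H_space = topology (\<lambda>U. U \<subseteq> H_class ` H_tilde \<and>
     openin (top_of_set H_tilde) {p \<in> H_tilde. H_class p \<in> U})"

lemma openin_H_space:
  "openin H_space U \<longleftrightarrow> U \<subseteq> H_class ` H_tilde \<and>
     openin (top_of_set H_tilde) {p \<in> H_tilde. H_class p \<in> U}"
proof -
  have "istopology (\<lambda>U. U \<subseteq> H_class ` H_tilde \<and>
     openin (top_of_set H_tilde) {p \<in> H_tilde. H_class p \<in> U})"
    unfolding istopology_def
  proof (intro conjI allI impI; (elim conjE)?)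
    fix S T
    assume "openin (top_of_set H_tilde) {p \<in> H_tilde. H_class p \<in> S}"
      and "openin (top_of_set H_tilde) {p \<in> H_tilde. H_class p \<in> T}"
    then have "openin (top_of_set H_tilde)
      ({p \<in> H_tilde. H_class p \<in> S} \<inter> {p \<in> H_tilde. H_class p \<in> T})"
      by (rule openin_Int)
    moreover have "{p \<in> H_tilde. H_class p \<in> S} \<inter> {p \<in> H_tilde. H_class p \<in> T} =
      {p \<in> H_tilde. H_class p \<in> S \<inter> T}" by blast
    ultimately show "openin (top_of_set H_tilde) {p \<in> H_tilde. H_class p \<in> S \<inter> T}" by simp
  next
    fix K
    assume "\<forall>U \<in> K. U \<subseteq> H_class ` H_tilde \<and>
      openin (top_of_set H_tilde) {p \<in> H_tilde. H_class p \<in> U}"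
    then have "openin (top_of_set H_tilde) (\<Union>U \<in> K. {p \<in> H_tilde. H_class p \<in> U})"
      by blast
    moreover have "(\<Union>U \<in> K. {p \<in> H_tilde. H_class p \<in> U}) = {p \<in> H_tilde. H_class p \<in> \<Union> K}"
      by blast
    ultimately show "openin (top_of_set H_tilde) {p \<in> H_tilde. H_class p \<in> \<Union> K}" by simp
  qed auto
  then show ?thesis
    unfolding H_space_def by (subst topology_inverse') auto
qed

lemma topspace_H_space: "topspace H_space = H_class ` H_tilde"
proof -
  have "{p \<in> H_tilde. H_class p \<in> H_class ` H_tilde} = H_tilde" by blast
  then have "openin H_space (H_class ` H_tilde)"
    by (simp add: openin_H_space)
  then have "H_class ` H_tilde \<subseteq> topspace H_space" by (rule openin_subset)
  moreover have "topspace H_space \<subseteq> H_class ` H_tilde"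
    using openin_topspace[of H_space] unfolding openin_H_space by (rule conjunct1)
  ultimately show ?thesis by (rule subset_antisym[rotated])
qed

lemma quotient_map_H_class: "quotient_map (top_of_set H_tilde) H_space H_class"
  unfolding quotient_map_def topspace_H_space openin_H_space by simp

text \<open>\<open>h_SE x y\<close> is the value of \<open>h\<close> at \<open>SE(x, y)\<close>, where \<open>E(x, y) = M(x, y - \<pi>)\<close>.\<close>

definition h_SE :: "real \<Rightarrow> real \<Rightarrow> point set" where
  "h_SE x y = (if x < y \<and> y < x + pi then H_class (x, y, True)
     else H_class (y, x + 2 * pi, True))"

fun h_name :: "name \<Rightarrow> point set" where
  "h_name (Regular x y) = h_SE x (y + pi)"
| "h_name (Singular e x) = H_class (x, x + pi, e)"

definition h_map :: "'r :: idom \<Rightarrow> 'r exacts \<Rightarrow> 'r pobj \<Rightarrow> point set" where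
  "h_map u E X = h_name (name_of u E X)"

definition discrete_lamination :: "'r :: idom \<Rightarrow> 'r exacts \<Rightarrow> 'r pobj set \<Rightarrow> bool" where
  "discrete_lamination u E L \<longleftrightarrow> lamination u E L \<and>
     subtopology H_space (h_map u E ` L) = discrete_topology (h_map u E ` L)"

end

theory Submission
  imports Defs "HOL-Analysis.Elementary_Topology"
begin

text \<open>A morphism of \<open>F\<^sub>b\<^sup>\<psi>\<close> is stably trivial iff each of its matrix entries between two orbits that
  are close enough is divisible by \<open>u\<close>. So \<open>C\<^sub>b\<^sup>\<psi>\<close> is computed by matrices: a non-zero object has a
  summand \<open>SM(x, y)\<close> or \<open>Z\<^sub>\<epsilon>(x)\<close>, because averaging over the involution is possible, and for \<open>b\<close> close
  to \<open>\<pi>\<close> the extensions between two such objects vanish iff the associated arcs \<open>[x, y]\<close>, taken modulo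
  translation by \<open>\<pi>\<close> and with a sign at the loops \<open>[x, x + \<pi>]\<close>, do not cross. Laminations thus become
  maximal families of pairwise non-crossing arcs, that is, ideal triangulations of a punctured disc
  with tagged loops, and by compactness discreteness becomes local finiteness. Local finiteness provides
  the two triangles at an arc \<open>T\<close>, and \<open>T\<^sup>*\<close> is the flip of \<open>T\<close> in the quadrilateral they form.\<close>

section \<open>Exact structures on preadditive categories\<close>

text \<open>The exact structure of F_b is never given by formulas; it is only known to be Frobenius
  with the prescribed projective-injectives. So the sequence M(x,y) -> M(x,x+b) + M(y+b,y) ->
  M(y+b,x+b), on which everything rests, has to be proved exact: whatever inflation into an
  injective the axioms provide, it factors through the explicit one and conversely, and this forces
  the explicit sequence into the structure. Its four corners bound a rectangle in the strip. A basic
  morphism survives stably iff it ends inside this rectangle, and \<open>u\<close> times any basic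
  morphism factors through the middle term, whence divisibility by \<open>u\<close>. Since
  \<open>shift\<close> is an arbitrary choice, vanishing of Ext must be shown to be independent of
  it. For b tending to pi the rectangle yields strict inequalities between end points, so arcs that
  merely share an end are compatible. A discrete set of arcs could still accumulate at an arc
  outside it; maximality excludes this, as crossing is an open condition. Near the puncture the two
  triangles at an arc degenerate, which is why several kinds of flip occur.\<close>

locale preadditive =
  fixes C :: "('o, 'm) addcat"
  assumes comp_in [intro]: "f \<in> Mor C X Y \<Longrightarrow> g \<in> Mor C Y Z \<Longrightarrow> Comp C X Y Z g f \<in> Mor C X Z"
    and assoc: "Comp C X Z W h (Comp C X Y Z g f) = Comp C X Y W (Comp C Y Z W h g) f"
    and id_in [intro]: "X \<in> Obj C \<Longrightarrow> Idm C X \<in> Mor C X X"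
    and id_left: "f \<in> Mor C X Y \<Longrightarrow> Comp C X Y Y (Idm C Y) f = f"
    and id_right: "f \<in> Mor C X Y \<Longrightarrow> Comp C X X Y f (Idm C X) = f"
    and add_in [intro]: "f \<in> Mor C X Y \<Longrightarrow> g \<in> Mor C X Y \<Longrightarrow> AddM C f g \<in> Mor C X Y"
    and add_assoc: "f \<in> Mor C X Y \<Longrightarrow> g \<in> Mor C X Y \<Longrightarrow> h \<in> Mor C X Y \<Longrightarrow>
      AddM C (AddM C f g) h = AddM C f (AddM C g h)"
    and add_comm: "f \<in> Mor C X Y \<Longrightarrow> g \<in> Mor C X Y \<Longrightarrow> AddM C f g = AddM C g f"
    and zero_in [intro]: "ZeroM C X Y \<in> Mor C X Y"
    and add_zero: "f \<in> Mor C X Y \<Longrightarrow> AddM C f (ZeroM C X Y) = f"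
    and neg_ex: "f \<in> Mor C X Y \<Longrightarrow> \<exists>g \<in> Mor C X Y. AddM C f g = ZeroM C X Y"
    and distrib_left: "f \<in> Mor C X Y \<Longrightarrow> g \<in> Mor C Y Z \<Longrightarrow> h \<in> Mor C Y Z \<Longrightarrow>
      Comp C X Y Z (AddM C g h) f = AddM C (Comp C X Y Z g f) (Comp C X Y Z h f)"
    and distrib_right: "f \<in> Mor C X Y \<Longrightarrow> g \<in> Mor C X Y \<Longrightarrow> h \<in> Mor C Y Z \<Longrightarrow>
      Comp C X Y Z h (AddM C f g) = AddM C (Comp C X Y Z h f) (Comp C X Y Z h g)"
begin

abbreviation "cmp \<equiv> Comp C"
abbreviation "arr \<equiv> Mor C"
abbreviation "idn \<equiv> Idm C"
abbreviation "zer \<equiv> ZeroM C"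
abbreviation madd (infixl "\<boxplus>" 65) where "f \<boxplus> g \<equiv> AddM C f g"

lemma zero_add: "f \<in> arr X Y \<Longrightarrow> zer X Y \<boxplus> f = f"
  by (metis add_zero add_comm zero_in)

lemma idem_zero: assumes "f \<in> arr X Y" "f \<boxplus> f = f" shows "f = zer X Y"
proof -
  obtain g where g: "g \<in> arr X Y" "f \<boxplus> g = zer X Y" using neg_ex assms by blast
  have "f = f \<boxplus> (f \<boxplus> g)" using g assms add_zero by simp
  also have "\<dots> = f \<boxplus> g" using add_assoc[OF assms(1,1) g(1)] assms(2) by simp
  finally show ?thesis using g by simp
qed

lemma comp_zero_left: assumes "f \<in> arr X Y" shows "cmp X Y Z (zer Y Z) f = zer X Z"
proof (rule idem_zero)
  show "cmp X Y Z (zer Y Z) f \<in> arr X Z" using assms by blast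
  show "cmp X Y Z (zer Y Z) f \<boxplus> cmp X Y Z (zer Y Z) f = cmp X Y Z (zer Y Z) f"
    using distrib_left[OF assms, of "zer Y Z" Z "zer Y Z"] add_zero[of "zer Y Z" Y Z] zero_in by simp
qed

lemma comp_zero_right: assumes "f \<in> arr Y Z" shows "cmp X Y Z f (zer X Y) = zer X Z"
proof (rule idem_zero)
  show "cmp X Y Z f (zer X Y) \<in> arr X Z" using assms by blast
  show "cmp X Y Z f (zer X Y) \<boxplus> cmp X Y Z f (zer X Y) = cmp X Y Z f (zer X Y)"
    using distrib_right[of "zer X Y" X Y "zer X Y" f Z] assms add_zero[of "zer X Y" X Y] zero_in by simp
qed

lemma isomorphismI:
  "f \<in> arr X Y \<Longrightarrow> g \<in> arr Y X \<Longrightarrow> cmp X Y X g f = idn X \<Longrightarrow> cmp Y X Y f g = idn Y \<Longrightarrow> isomorphism C X Y f"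
  by (auto simp: isomorphism_def)

lemma isomorphism_id: "X \<in> Obj C \<Longrightarrow> isomorphism C X X (idn X)"
  using id_left[of "idn X" X X] by (intro isomorphismI[of _ _ _ "idn X"]) auto

lemma kernel_mono:
  assumes "is_kernel C X f Y g Z" "W \<in> Obj C" "k \<in> arr W X" "k' \<in> arr W X"
    "cmp W X Y f k = cmp W X Y f k'"
  shows "k = k'"
proof -
  have fg: "f \<in> arr X Y" "g \<in> arr Y Z" "cmp X Y Z g f = zer X Z" using assms(1) by (auto simp: is_kernel_def)
  have "cmp W Y Z g (cmp W X Y f k) = zer W Z"
    using assoc[of W Y Z g X f k] fg comp_zero_left[OF assms(3)] by simp
  moreover have "cmp W X Y f k \<in> arr W Y" using fg assms(3) by blast
  ultimately have "\<exists>!l. l \<in> arr W X \<and> cmp W X Y f l = cmp W X Y f k"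
    using assms(1,2) unfolding is_kernel_def by blast
  then show ?thesis using assms by metis
qed

lemma kernel_factor:
  assumes "is_kernel C X f Y g Z" "W \<in> Obj C" "h \<in> arr W Y" "cmp W Y Z g h = zer W Z"
  obtains k where "k \<in> arr W X" "cmp W X Y f k = h"
  using assms unfolding is_kernel_def by blast

lemma cokernel_epi:
  assumes "is_cokernel C X f Y g Z" "W \<in> Obj C" "k \<in> arr Z W" "k' \<in> arr Z W"
    "cmp Y Z W k g = cmp Y Z W k' g"
  shows "k = k'"
proof -
  have fg: "f \<in> arr X Y" "g \<in> arr Y Z" "cmp X Y Z g f = zer X Z" using assms(1) by (auto simp: is_cokernel_def)
  have "cmp X Y W (cmp Y Z W k g) f = zer X W"
    using assoc[of X Z W k Y g f] fg comp_zero_right[OF assms(3)] by simp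
  moreover have "cmp Y Z W k g \<in> arr Y W" using fg assms(3) by blast
  ultimately have "\<exists>!l. l \<in> arr Z W \<and> cmp Y Z W l g = cmp Y Z W k g"
    using assms(1,2) unfolding is_cokernel_def by blast
  then show ?thesis using assms by metis
qed

lemma cokernel_factor:
  assumes "is_cokernel C X f Y g Z" "W \<in> Obj C" "h \<in> arr Y W" "cmp X Y W h f = zer X W"
  obtains k where "k \<in> arr Z W" "cmp Y Z W k g = h"
  using assms unfolding is_cokernel_def by blast

end

locale exact_category = preadditive C for C :: "('o, 'm) addcat" +
  fixes S :: "('o, 'm) ses set"
  assumes exact: "exact_structure C S"
begin

lemma
  assumes "(X, f, Y, g, Z) \<in> S"
  shows ses_obj: "X \<in> Obj C \<and> Y \<in> Obj C \<and> Z \<in> Obj C"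
    and ses_kernel: "is_kernel C X f Y g Z"
    and ses_cokernel: "is_cokernel C X f Y g Z"
  using exact[unfolded exact_structure_def, THEN conjunct1] assms by blast+

lemma ses_hom: "(X, f, Y, g, Z) \<in> S \<Longrightarrow> f \<in> arr X Y \<and> g \<in> arr Y Z \<and> cmp X Y Z g f = zer X Z"
  using ses_kernel[of X f Y g Z] by (auto simp: is_kernel_def)

lemma ses_iso: "(X, f, Y, g, Z) \<in> S \<Longrightarrow> X' \<in> Obj C \<Longrightarrow> Y' \<in> Obj C \<Longrightarrow> Z' \<in> Obj C \<Longrightarrow>
   f' \<in> arr X' Y' \<Longrightarrow> g' \<in> arr Y' Z' \<Longrightarrow>
   isomorphism C X X' a \<Longrightarrow> isomorphism C Y Y' b \<Longrightarrow> isomorphism C Z Z' c \<Longrightarrow>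
   cmp X Y Y' b f = cmp X X' Y' f' a \<Longrightarrow> cmp Y Z Z' c g = cmp Y Y' Z' g' b \<Longrightarrow> (X', f', Y', g', Z') \<in> S"
  using exact[unfolded exact_structure_def, THEN conjunct2, THEN conjunct1] by blast

lemma inflation_id: "X \<in> Obj C \<Longrightarrow> inflation S X X (idn X)"
  using exact[unfolded exact_structure_def, THEN conjunct2, THEN conjunct2, THEN conjunct1] by blast

lemma inflation_comp: "inflation S X Y f \<Longrightarrow> inflation S Y Z g \<Longrightarrow> inflation S X Z (cmp X Y Z g f)"
  using exact[unfolded exact_structure_def, THEN conjunct2, THEN conjunct2, THEN conjunct2, THEN conjunct1]
  by blast

lemma deflation_pullback:
  assumes "deflation S X' Y' f'" "Y \<in> Obj C" "b \<in> arr Y Y'"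
  obtains X f a where "X \<in> Obj C" "is_pullback C X Y X' Y' f f' a b" "deflation S X Y f"
  using assms exact[unfolded exact_structure_def, THEN conjunct2, THEN conjunct2, THEN conjunct2,
      THEN conjunct2, THEN conjunct2, THEN conjunct2]
  by blast

lemma pullback_factor:
  assumes "is_pullback C X Y X' Y' f f' a b" "W \<in> Obj C" "s \<in> arr W Y" "t \<in> arr W X'"
    "cmp W Y Y' b s = cmp W X' Y' f' t"
  obtains k where "k \<in> arr W X" "cmp W X Y f k = s" "cmp W X X' a k = t"
  using assms unfolding is_pullback_def by blast

lemma pullback_unique:
  assumes "is_pullback C X Y X' Y' f f' a b" "W \<in> Obj C" "k \<in> arr W X" "k' \<in> arr W X"
    "cmp W X Y f k = cmp W X Y f k'" "cmp W X X' a k = cmp W X X' a k'"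
  shows "k = k'"
proof -
  have pb: "f \<in> arr X Y" "a \<in> arr X X'" "cmp X Y Y' b f = cmp X X' Y' f' a"
    using assms(1) by (auto simp: is_pullback_def)
  have "cmp W Y Y' b (cmp W X Y f k) = cmp W X' Y' f' (cmp W X X' a k)"
    using pb by (simp add: assoc)
  moreover have "cmp W X Y f k \<in> arr W Y" "cmp W X X' a k \<in> arr W X'" using pb assms by blast+
  ultimately have "\<exists>!l. l \<in> arr W X \<and> cmp W X Y f l = cmp W X Y f k \<and> cmp W X X' a l = cmp W X X' a k"
    using assms(1,2) unfolding is_pullback_def by blast
  then show ?thesis using assms by metis
qed

lemma inflation_iso:
  assumes "inflation S X Y f" "Y' \<in> Obj C" "\<phi> \<in> arr Y Y'" "\<phi>' \<in> arr Y' Y"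
    "cmp Y Y' Y \<phi>' \<phi> = idn Y" "cmp Y' Y Y' \<phi> \<phi>' = idn Y'"
  shows "inflation S X Y' (cmp X Y Y' \<phi> f)"
proof -
  obtain g Z where s: "(X, f, Y, g, Z) \<in> S" using assms(1) by (auto simp: inflation_def)
  have o: "X \<in> Obj C" "Z \<in> Obj C" using ses_obj s by blast+
  have h: "f \<in> arr X Y" "g \<in> arr Y Z" using ses_hom s by blast+
  have "(X, cmp X Y Y' \<phi> f, Y', cmp Y' Y Z g \<phi>', Z) \<in> S"
  proof (rule ses_iso[OF s])
    show "isomorphism C Y Y' \<phi>" using assms by (auto intro: isomorphismI)
    show "cmp Y Z Z (idn Z) g = cmp Y Y' Z (cmp Y' Y Z g \<phi>') \<phi>"
      using id_left id_right h assms by (simp add: assoc[symmetric])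
    have "cmp X Y Y' \<phi> f \<in> arr X Y'" using h assms by blast
    then show "cmp X Y Y' \<phi> f = cmp X X Y' (cmp X Y Y' \<phi> f) (idn X)" by (simp add: id_right)
  qed (use h o assms isomorphism_id in auto)
  then show ?thesis by (auto simp: inflation_def)
qed

text \<open>A kernel is determined up to isomorphism by its map, so the kernel of the deflation
  \<open>d\<close> can be compared with \<open>j\<close> once \<open>d\<close> and \<open>q\<close>
  agree up to an isomorphism of their sources; closure of \<open>S\<close> under isomorphism does
  the rest.\<close>

lemma ses_from_deflation:
  assumes "deflation S X\<^sub>0 Y d" "\<sigma> \<in> arr P X\<^sub>0" "\<tau> \<in> arr X\<^sub>0 P"
    "cmp P X\<^sub>0 P \<tau> \<sigma> = idn P" "cmp X\<^sub>0 P X\<^sub>0 \<sigma> \<tau> = idn X\<^sub>0" "cmp P X\<^sub>0 Y d \<sigma> = q"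
    "is_kernel C X j P q Y" "X \<in> Obj C" "P \<in> Obj C"
  shows "(X, j, P, q, Y) \<in> S"
proof -
  obtain K f\<^sub>0 where s: "(K, f\<^sub>0, X\<^sub>0, d, Y) \<in> S" using assms(1) by (auto simp: deflation_def)
  have o: "K \<in> Obj C" "X\<^sub>0 \<in> Obj C" "Y \<in> Obj C" using ses_obj s by blast+
  have h: "f\<^sub>0 \<in> arr K X\<^sub>0" "d \<in> arr X\<^sub>0 Y" "cmp K X\<^sub>0 Y d f\<^sub>0 = zer K Y" using ses_hom s by blast+
  have j: "j \<in> arr X P" "q \<in> arr P Y" "cmp X P Y q j = zer X Y" using assms(7) by (auto simp: is_kernel_def)
  have q\<tau>: "cmp X\<^sub>0 P Y q \<tau> = d" using assms(2,3,5,6) h id_right by (metis assoc)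
  have "cmp K P Y q (cmp K X\<^sub>0 P \<tau> f\<^sub>0) = zer K Y" using q\<tau> h by (simp add: assoc)
  then obtain \<kappa> where \<kappa>: "\<kappa> \<in> arr K X" "cmp K X P j \<kappa> = cmp K X\<^sub>0 P \<tau> f\<^sub>0"
    using kernel_factor[OF assms(7) o(1), of "cmp K X\<^sub>0 P \<tau> f\<^sub>0"] assms(3) h by blast
  have "cmp X X\<^sub>0 Y d (cmp X P X\<^sub>0 \<sigma> j) = zer X Y" using assms(6) j by (simp add: assoc)
  then obtain l where l: "l \<in> arr X K" "cmp X K X\<^sub>0 f\<^sub>0 l = cmp X P X\<^sub>0 \<sigma> j"
    using kernel_factor[OF ses_kernel[OF s] assms(8), of "cmp X P X\<^sub>0 \<sigma> j"] assms(2) j by blast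
  have "cmp K X K l \<kappa> = idn K"
  proof (rule kernel_mono[OF ses_kernel[OF s] o(1)])
    have "cmp K K X\<^sub>0 f\<^sub>0 (cmp K X K l \<kappa>) = cmp K X\<^sub>0 X\<^sub>0 (cmp X\<^sub>0 P X\<^sub>0 \<sigma> \<tau>) f\<^sub>0"
      using l \<kappa> by (metis assoc)
    then show "cmp K K X\<^sub>0 f\<^sub>0 (cmp K X K l \<kappa>) = cmp K K X\<^sub>0 f\<^sub>0 (idn K)"
      using assms(5) h by (simp add: id_left id_right)
  qed (use l \<kappa> o in auto)
  moreover have "cmp X K X \<kappa> l = idn X"
  proof (rule kernel_mono[OF assms(7,8)])
    have "cmp X X P j (cmp X K X \<kappa> l) = cmp X P P (cmp P X\<^sub>0 P \<tau> \<sigma>) j"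
      using l \<kappa> by (metis assoc)
    then show "cmp X X P j (cmp X K X \<kappa> l) = cmp X X P j (idn X)"
      using assms(4) j by (simp add: id_left id_right)
  qed (use l \<kappa> assms in auto)
  ultimately have iso: "isomorphism C K X \<kappa>" using l \<kappa> by (auto intro: isomorphismI)
  show ?thesis
  proof (rule ses_iso[OF s])
    show "isomorphism C X\<^sub>0 P \<tau>" using assms(2-5) by (auto intro: isomorphismI)
    show "cmp X\<^sub>0 Y Y (idn Y) d = cmp X\<^sub>0 P Y q \<tau>" using q\<tau> h by (simp add: id_left)
  qed (use assms o j iso \<kappa> isomorphism_id in auto)
qed

text \<open>Split sequences are not among the axioms. The cokernel of the identity of
  \<open>I\<close> is a zero map \<open>I -> Z\<close>, and its pullback along the zero map
  \<open>P -> Z\<close> is the direct sum with its projection to \<open>P\<close>.\<close>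

lemma direct_sum_ses:
  assumes o: "I \<in> Obj C" "P \<in> Obj C" "Q \<in> Obj C"
    and h: "i\<^sub>1 \<in> arr I Q" "i\<^sub>2 \<in> arr P Q" "p\<^sub>1 \<in> arr Q I" "p\<^sub>2 \<in> arr Q P"
    and eq: "cmp I Q I p\<^sub>1 i\<^sub>1 = idn I" "cmp P Q P p\<^sub>2 i\<^sub>2 = idn P" "cmp I Q P p\<^sub>2 i\<^sub>1 = zer I P"
      "cmp P Q I p\<^sub>1 i\<^sub>2 = zer P I" "cmp Q I Q i\<^sub>1 p\<^sub>1 \<boxplus> cmp Q P Q i\<^sub>2 p\<^sub>2 = idn Q"
  shows "(I, i\<^sub>1, Q, p\<^sub>2, P) \<in> S"
proof -
  obtain g Z where s: "(I, idn I, I, g, Z) \<in> S" using inflation_id[OF o(1)] by (auto simp: inflation_def)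
  have Z: "Z \<in> Obj C" "g \<in> arr I Z" "cmp I I Z g (idn I) = zer I Z" using ses_hom s ses_obj by blast+
  then have g: "g = zer I Z" by (simp add: id_right)
  have "deflation S I Z g" using s by (auto simp: deflation_def)
  then obtain X f a where pb: "X \<in> Obj C" "is_pullback C X P I Z f g a (zer P Z)" "deflation S X P f"
    by (rule deflation_pullback[OF _ o(2) zero_in])
  have fa: "f \<in> arr X P" "a \<in> arr X I" using pb by (auto simp: is_pullback_def)
  have "cmp Q P Z (zer P Z) p\<^sub>2 = cmp Q I Z g p\<^sub>1"
    unfolding g using h by (simp add: comp_zero_left)
  then obtain \<sigma> where \<sigma>: "\<sigma> \<in> arr Q X" "cmp Q X P f \<sigma> = p\<^sub>2" "cmp Q X I a \<sigma> = p\<^sub>1"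
    using pullback_factor[OF pb(2) o(3) h(4,3)] by blast
  define \<tau> where "\<tau> = cmp X I Q i\<^sub>1 a \<boxplus> cmp X P Q i\<^sub>2 f"
  have \<tau>: "\<tau> \<in> arr X Q" unfolding \<tau>_def using h fa by blast
  have "cmp Q X Q \<tau> \<sigma> = idn Q"
    unfolding \<tau>_def using distrib_left[OF \<sigma>(1), of "cmp X I Q i\<^sub>1 a" Q "cmp X P Q i\<^sub>2 f"] h fa \<sigma> eq
    by (simp add: assoc[symmetric] comp_in)
  moreover have p\<tau>: "cmp X Q P p\<^sub>2 \<tau> = f" "cmp X Q I p\<^sub>1 \<tau> = a"
    unfolding \<tau>_def using distrib_right[of "cmp X I Q i\<^sub>1 a" X Q "cmp X P Q i\<^sub>2 f" p\<^sub>2 P]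
      distrib_right[of "cmp X I Q i\<^sub>1 a" X Q "cmp X P Q i\<^sub>2 f" p\<^sub>1 I] h fa eq
    by (simp_all add: assoc comp_in comp_zero_left id_left zero_add[OF fa(1)] add_zero[OF fa(2)])
  have "cmp X Q X \<sigma> \<tau> = idn X"
    by (rule pullback_unique[OF pb(2,1)]) (use \<sigma> \<tau> p\<tau> pb(1) fa in \<open>auto simp: assoc id_right\<close>)
  moreover have "is_kernel C I i\<^sub>1 Q p\<^sub>2 P"
    unfolding is_kernel_def
  proof (intro conjI ballI impI ex_ex1I)
    fix W k assume W: "W \<in> Obj C" "k \<in> arr W Q" "cmp W Q P p\<^sub>2 k = zer W P"
    have "k = cmp W Q Q (idn Q) k" using W by (simp add: id_left)
    also have "\<dots> = cmp W I Q i\<^sub>1 (cmp W Q I p\<^sub>1 k) \<boxplus> cmp W P Q i\<^sub>2 (cmp W Q P p\<^sub>2 k)"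
      unfolding eq(5)[symmetric] assoc using W(2) h by (simp add: distrib_left[OF W(2)] comp_in)
    also have "\<dots> = cmp W I Q i\<^sub>1 (cmp W Q I p\<^sub>1 k)"
      using W h by (simp add: comp_zero_right add_zero[of _ W Q] comp_in)
    finally show "\<exists>l. l \<in> arr W I \<and> cmp W I Q i\<^sub>1 l = k" using W h by (metis comp_in)
    fix l l' assume "l \<in> arr W I \<and> cmp W I Q i\<^sub>1 l = k" "l' \<in> arr W I \<and> cmp W I Q i\<^sub>1 l' = k"
    then show "l = l'" using eq(1) id_left by (metis assoc)
  qed (use h eq in auto)
  ultimately show ?thesis
    using ses_from_deflation[OF pb(3) \<sigma>(1) \<tau>] \<sigma>(2) o by blast
qed

text \<open>As \<open>n\<close> has square zero, \<open>1 + n\<close> has the inverse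
  \<open>1 - n\<close>.\<close>

lemma shear_iso:
  assumes "Q \<in> Obj C" "n \<in> arr Q Q" "cmp Q Q Q n n = zer Q Q"
  obtains m where "m \<in> arr Q Q" "cmp Q Q Q m (idn Q \<boxplus> n) = idn Q" "cmp Q Q Q (idn Q \<boxplus> n) m = idn Q"
proof -
  obtain n' where n': "n' \<in> arr Q Q" "n \<boxplus> n' = zer Q Q" using neg_ex[OF assms(2)] by blast
  note o = id_in[OF assms(1)]
  have "cmp Q Q Q n n \<boxplus> cmp Q Q Q n n' = zer Q Q" "cmp Q Q Q n n \<boxplus> cmp Q Q Q n' n = zer Q Q"
    using distrib_right[OF assms(2) n'(1) assms(2)] distrib_left[OF assms(2) assms(2) n'(1)] n'(2)
      comp_zero_right[OF assms(2)] comp_zero_left[OF assms(2)] by metis+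
  then have nn: "cmp Q Q Q n n' = zer Q Q" "cmp Q Q Q n' n = zer Q Q"
    using assms(2,3) n'(1) by (simp_all add: zero_add[of _ Q Q] comp_in)
  have "n' \<boxplus> n = zer Q Q" using add_comm[OF n'(1) assms(2)] n'(2) by simp
  then have s: "(idn Q \<boxplus> n) \<boxplus> n' = idn Q" "(idn Q \<boxplus> n') \<boxplus> n = idn Q"
    using add_assoc[OF o assms(2) n'(1)] add_assoc[OF o n'(1) assms(2)] n'(2) add_zero[OF o] by simp_all
  have "cmp Q Q Q (idn Q \<boxplus> n') (idn Q \<boxplus> n) = (idn Q \<boxplus> n') \<boxplus> n"
    using o n'(1) assms(2) nn
    by (simp add: distrib_right[of "idn Q" Q Q n] distrib_left[of _ Q Q "idn Q" Q n'] add_in id_left id_right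
        add_zero[OF assms(2)])
  moreover have "cmp Q Q Q (idn Q \<boxplus> n) (idn Q \<boxplus> n') = (idn Q \<boxplus> n) \<boxplus> n'"
    using o n'(1) assms(2) nn
    by (simp add: distrib_right[of "idn Q" Q Q n'] distrib_left[of _ Q Q "idn Q" Q n] add_in id_left id_right
        add_zero[OF n'(1)])
  ultimately show ?thesis using that[of "idn Q \<boxplus> n'"] s o n'(1) by auto
qed

text \<open>On \<open>I \<boxplus> P\<close> the inflation \<open>(i, 0)\<close> is carried by two shears to \<open>(0, j)\<close>; pulling its cokernel
  back along the map from the cokernel of \<open>j\<close> leaves just the sequence through \<open>P\<close>.\<close>

lemma ses_of_equivalent_inflation:
  assumes i: "inflation S X I i"
    and o: "I \<in> Obj C" "P \<in> Obj C" "Q \<in> Obj C" "X \<in> Obj C" "X' \<in> Obj C" and Q: "direct_sum C Q I P"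
    and hk: "h \<in> arr P I" "cmp X P I h j = i" "k \<in> arr I P" "cmp X I P k i = j"
    and ker: "is_kernel C X j P q X'" and coker: "is_cokernel C X j P q X'"
  shows "(X, j, P, q, X') \<in> S"
proof -
  obtain i\<^sub>1 i\<^sub>2 p\<^sub>1 p\<^sub>2 where h: "i\<^sub>1 \<in> arr I Q" "i\<^sub>2 \<in> arr P Q" "p\<^sub>1 \<in> arr Q I" "p\<^sub>2 \<in> arr Q P"
    and eq: "cmp I Q I p\<^sub>1 i\<^sub>1 = idn I" "cmp P Q P p\<^sub>2 i\<^sub>2 = idn P" "cmp I Q P p\<^sub>2 i\<^sub>1 = zer I P"
      "cmp P Q I p\<^sub>1 i\<^sub>2 = zer P I" "cmp Q I Q i\<^sub>1 p\<^sub>1 \<boxplus> cmp Q P Q i\<^sub>2 p\<^sub>2 = idn Q"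
    using Q unfolding direct_sum_def by blast
  have jq: "j \<in> arr X P" "q \<in> arr P X'" "cmp X P X' q j = zer X X'" using ker by (auto simp: is_kernel_def)
  have iX: "i \<in> arr X I" using hk(1,2) jq by blast
  \<comment> \<open>Lower shear: as \<open>k i = j\<close>, the automorphism \<open>1 + a\<close> of
    \<open>I + P\<close> takes \<open>(i, 0)\<close> to \<open>(i, j)\<close>.\<close>
  define a where "a = cmp Q P Q i\<^sub>2 (cmp Q I P k p\<^sub>1)"
  have a: "a \<in> arr Q Q" unfolding a_def using h hk by blast
  have p1a: "cmp Q Q I p\<^sub>1 a = zer Q I"
    unfolding a_def using eq(4) h hk by (simp add: assoc comp_zero_left comp_in)
  have aa: "cmp Q Q Q a a = zer Q Q"
  proof -
    have "cmp Q Q Q a a = cmp Q P Q i\<^sub>2 (cmp Q I P k (cmp Q Q I p\<^sub>1 a))"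
      by (simp add: a_def assoc)
    then show ?thesis using p1a h hk by (simp add: comp_zero_right)
  qed
  obtain k' where k': "k' \<in> arr I P" "k \<boxplus> k' = zer I P" using neg_ex hk(3) by blast
  obtain h' where h': "h' \<in> arr P I" "h \<boxplus> h' = zer P I" using neg_ex hk(1) by blast
  \<comment> \<open>Upper shear with \<open>h' = - h\<close>: as \<open>h j = i\<close>, the
    automorphism \<open>1 + b\<close> takes \<open>(i, j)\<close> to \<open>(0, j)\<close>.\<close>
  define b where "b = cmp Q I Q i\<^sub>1 (cmp Q P I h' p\<^sub>2)"
  have b: "b \<in> arr Q Q" unfolding b_def using h h' by blast
  have p2b: "cmp Q Q P p\<^sub>2 b = zer Q P"
    unfolding b_def using eq(3) h h' by (simp add: assoc comp_zero_left comp_in)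
  have bb: "cmp Q Q Q b b = zer Q Q"
  proof -
    have "cmp Q Q Q b b = cmp Q I Q i\<^sub>1 (cmp Q P I h' (cmp Q Q P p\<^sub>2 b))"
      by (simp add: b_def assoc)
    then show ?thesis using p2b h h' by (simp add: comp_zero_right)
  qed
  have "inflation S I Q i\<^sub>1" using direct_sum_ses[OF o(1-3) h eq] by (auto simp: inflation_def)
  then have 1: "inflation S X Q (cmp X I Q i\<^sub>1 i)" by (rule inflation_comp[OF i])
  obtain a' where a': "a' \<in> arr Q Q" "cmp Q Q Q a' (idn Q \<boxplus> a) = idn Q" "cmp Q Q Q (idn Q \<boxplus> a) a' = idn Q"
    using shear_iso[OF o(3) a aa] by blast
  obtain b' where b': "b' \<in> arr Q Q" "cmp Q Q Q b' (idn Q \<boxplus> b) = idn Q" "cmp Q Q Q (idn Q \<boxplus> b) b' = idn Q"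
    using shear_iso[OF o(3) b bb] by blast
  have i1i: "cmp X I Q i\<^sub>1 i \<in> arr X Q" and i2j: "cmp X P Q i\<^sub>2 j \<in> arr X Q" using h iX jq by blast+
  have 2: "inflation S X Q (cmp X Q Q (idn Q \<boxplus> a) (cmp X I Q i\<^sub>1 i))"
    by (rule inflation_iso[OF 1 o(3)]) (use a a' o(3) in auto)
  have ai: "cmp X Q Q a (cmp X I Q i\<^sub>1 i) = cmp X P Q i\<^sub>2 j"
  proof -
    have "cmp X Q Q a (cmp X I Q i\<^sub>1 i) = cmp X P Q i\<^sub>2 (cmp X I P k (cmp X I I (cmp I Q I p\<^sub>1 i\<^sub>1) i))"
      by (simp add: a_def assoc)
    then show ?thesis using eq(1) iX hk by (simp add: id_left)
  qed
  have s1: "cmp X Q Q (idn Q \<boxplus> a) (cmp X I Q i\<^sub>1 i) = cmp X I Q i\<^sub>1 i \<boxplus> cmp X P Q i\<^sub>2 j"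
    using distrib_left[OF i1i id_in[OF o(3)] a] ai i1i by (simp add: id_left)
  have 3: "inflation S X Q (cmp X Q Q (idn Q \<boxplus> b) (cmp X I Q i\<^sub>1 i \<boxplus> cmp X P Q i\<^sub>2 j))"
    by (rule inflation_iso[OF 2[unfolded s1] o(3)]) (use b b' o(3) in auto)
  have bi: "cmp X Q Q b (cmp X I Q i\<^sub>1 i) = zer X Q"
  proof -
    have "cmp X Q Q b (cmp X I Q i\<^sub>1 i) = cmp X I Q i\<^sub>1 (cmp X P I h' (cmp X I P (cmp I Q P p\<^sub>2 i\<^sub>1) i))"
      by (simp add: b_def assoc)
    then show ?thesis using eq(3) iX h h' by (simp add: comp_zero_left comp_zero_right)
  qed
  have bj: "cmp X Q Q b (cmp X P Q i\<^sub>2 j) = cmp X I Q i\<^sub>1 (cmp X P I h' j)"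
  proof -
    have "cmp X Q Q b (cmp X P Q i\<^sub>2 j) = cmp X I Q i\<^sub>1 (cmp X P I h' (cmp X P P (cmp P Q P p\<^sub>2 i\<^sub>2) j))"
      by (simp add: b_def assoc)
    then show ?thesis using eq(2) jq by (simp add: id_left)
  qed
  have "i \<boxplus> cmp X P I h' j = zer X I"
    using distrib_left[OF jq(1) hk(1) h'(1)] h'(2) hk(2) comp_zero_left[OF jq(1)] by simp
  then have "cmp X I Q i\<^sub>1 i \<boxplus> cmp X I Q i\<^sub>1 (cmp X P I h' j) = zer X Q"
    using distrib_right[OF iX _ h(1), of "cmp X P I h' j"] comp_zero_right[OF h(1), of X] h' jq by (simp add: comp_in)
  moreover have "cmp X I Q i\<^sub>1 (cmp X P I h' j) \<in> arr X Q" using h h' jq by blast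
  ultimately have s2: "cmp X Q Q (idn Q \<boxplus> b) (cmp X I Q i\<^sub>1 i \<boxplus> cmp X P Q i\<^sub>2 j) = cmp X P Q i\<^sub>2 j"
    using distrib_left[OF add_in[OF i1i i2j] id_in[OF o(3)] b] distrib_right[OF i1i i2j b] bi bj i1i i2j
      add_assoc[OF i1i i2j, of "cmp X I Q i\<^sub>1 (cmp X P I h' j)"]
      add_assoc[OF i1i, of "cmp X I Q i\<^sub>1 (cmp X P I h' j)" "cmp X P Q i\<^sub>2 j"]
      add_comm[OF i2j, of "cmp X I Q i\<^sub>1 (cmp X P I h' j)"]
    by (simp add: id_left add_in zero_add)
  then obtain g Z where s: "(X, cmp X P Q i\<^sub>2 j, Q, g, Z) \<in> S" using 3 by (auto simp: inflation_def)
  have Z: "Z \<in> Obj C" "g \<in> arr Q Z" "cmp X Q Z g (cmp X P Q i\<^sub>2 j) = zer X Z" using ses_obj ses_hom s by blast+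
  have "cmp X P Z (cmp P Q Z g i\<^sub>2) j = zer X Z" using Z by (simp add: assoc)
  then obtain \<rho> where \<rho>: "\<rho> \<in> arr X' Z" "cmp P X' Z \<rho> q = cmp P Q Z g i\<^sub>2"
    using cokernel_factor[OF coker Z(1), of "cmp P Q Z g i\<^sub>2"] h Z by blast
  have "deflation S Q Z g" using s by (auto simp: deflation_def)
  then obtain Y d e where pb: "Y \<in> Obj C" "is_pullback C Y X' Q Z d g e \<rho>" "deflation S Y X' d"
    using deflation_pullback[OF _ o(5) \<rho>(1)] by blast
  have de: "d \<in> arr Y X'" "e \<in> arr Y Q" "cmp Y X' Z \<rho> d = cmp Y Q Z g e"
    using pb(2) by (auto simp: is_pullback_def)
  obtain \<sigma> where \<sigma>: "\<sigma> \<in> arr P Y" "cmp P Y X' d \<sigma> = q" "cmp P Y Q e \<sigma> = i\<^sub>2"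
    using pullback_factor[OF pb(2) o(2) jq(2) h(2) \<rho>(2)] by blast
  define \<tau> where "\<tau> = cmp Y Q P p\<^sub>2 e"
  have \<tau>: "\<tau> \<in> arr Y P" unfolding \<tau>_def using h de by blast
  \<comment> \<open>\<open>t\<close> is the component \<open>Z -> I\<close> of the cokernel of
    \<open>(0, j)\<close>. It kills \<open>\<rho>\<close>, so the pullback \<open>Y\<close> has no
    component in \<open>I\<close> and is isomorphic to \<open>P\<close>.\<close>
  have "cmp X Q I p\<^sub>1 (cmp X P Q i\<^sub>2 j) = zer X I" using eq(4) jq by (simp add: assoc comp_zero_left)
  then obtain t where t: "t \<in> arr Z I" "cmp Q Z I t g = p\<^sub>1"
    using cokernel_factor[OF ses_cokernel[OF s] o(1) h(3)] by blast
  have "cmp X' Z I t \<rho> = zer X' I"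
  proof (rule cokernel_epi[OF coker o(1)])
    have "cmp P X' I (cmp X' Z I t \<rho>) q = cmp P Q I (cmp Q Z I t g) i\<^sub>2" using \<rho> by (metis assoc)
    then show "cmp P X' I (cmp X' Z I t \<rho>) q = cmp P X' I (zer X' I) q"
      using t eq(4) jq by (simp add: comp_zero_left)
  qed (use t \<rho> in auto)
  moreover have "cmp Y Q I p\<^sub>1 e = cmp Y X' I (cmp X' Z I t \<rho>) d" using t de by (metis assoc)
  ultimately have p1e: "cmp Y Q I p\<^sub>1 e = zer Y I" using de by (simp add: comp_zero_left)
  have "cmp X Q X' (cmp Q P X' q p\<^sub>2) (cmp X P Q i\<^sub>2 j) = cmp X P X' q (cmp X P P (cmp P Q P p\<^sub>2 i\<^sub>2) j)"
    by (simp add: assoc)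
  then have "cmp X Q X' (cmp Q P X' q p\<^sub>2) (cmp X P Q i\<^sub>2 j) = zer X X'" using eq(2) jq by (simp add: id_left)
  then obtain m where m: "m \<in> arr Z X'" "cmp Q Z X' m g = cmp Q P X' q p\<^sub>2"
    using cokernel_factor[OF ses_cokernel[OF s] o(5), of "cmp Q P X' q p\<^sub>2"] h jq by blast
  have "cmp X' Z X' m \<rho> = idn X'"
  proof (rule cokernel_epi[OF coker o(5)])
    have "cmp P X' X' (cmp X' Z X' m \<rho>) q = cmp P P X' q (cmp P Q P p\<^sub>2 i\<^sub>2)" using \<rho> m by (metis assoc)
    then show "cmp P X' X' (cmp X' Z X' m \<rho>) q = cmp P X' X' (idn X') q"
      using eq(2) jq by (simp add: id_left id_right)
  qed (use m \<rho> o in auto)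
  moreover have "cmp Y P X' q \<tau> = cmp Y X' X' (cmp X' Z X' m \<rho>) d" unfolding \<tau>_def using m de by (metis assoc)
  ultimately have q\<tau>: "cmp Y P X' q \<tau> = d" using de by (simp add: id_left)
  have "e = cmp Y Q Q (cmp Q I Q i\<^sub>1 p\<^sub>1 \<boxplus> cmp Q P Q i\<^sub>2 p\<^sub>2) e" using eq(5) de by (simp add: id_left)
  also have "\<dots> = cmp Y I Q i\<^sub>1 (cmp Y Q I p\<^sub>1 e) \<boxplus> cmp Y P Q i\<^sub>2 \<tau>"
    unfolding \<tau>_def using h de by (simp add: distrib_left[OF de(2)] comp_in assoc)
  also have "\<dots> = cmp Y P Q i\<^sub>2 \<tau>"
    using p1e h \<tau> by (simp add: comp_zero_right zero_add[of _ Y Q] comp_in)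
  finally have e: "cmp Y P Q i\<^sub>2 \<tau> = e" by simp
  have "cmp Y P Y \<sigma> \<tau> = idn Y"
    by (rule pullback_unique[OF pb(2,1)]) (use \<sigma> \<tau> pb(1) de q\<tau> e in \<open>auto simp: assoc id_right\<close>)
  moreover have "cmp P Y P \<tau> \<sigma> = idn P" unfolding \<tau>_def using \<sigma> eq(2) by (simp add: assoc[symmetric])
  ultimately show ?thesis
    using ses_from_deflation[OF pb(3) \<sigma>(1) \<tau>] \<sigma>(2) ker o by blast
qed

end

section \<open>Orbits and the exponents of compositions\<close>

definition co :: "point set \<Rightarrow> point set \<Rightarrow> point set \<Rightarrow> nat" where
  "co X Y Z = nat (c_orb X Y Z)"

text \<open>\<open>same_coords X Y\<close> says that the basic morphism \<open>X \<rightarrow> Y\<close> is an isomorphism: the order on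
  points ignores the sign.\<close>

definition same_coords :: "point set \<Rightarrow> point set \<Rightarrow> bool" where
  "same_coords X Y \<longleftrightarrow> (\<exists>x y e e'. (x, y, e) \<in> X \<and> (x, y, e') \<in> Y)"

text \<open>The half-open rectangle above \<open>(x, y)\<close> with opposite corner
  \<open>(y + b, x + b)\<close>. The other two corners \<open>(x, x + b)\<close> and
  \<open>(y + b, y)\<close> lie on the boundary of the strip and give the injective hull of the
  orbit; to leave the rectangle upwards means to lie above one of them.\<close>

definition near :: "real \<Rightarrow> point \<Rightarrow> point \<Rightarrow> bool" where
  "near b = (\<lambda>(x, y, e) (x', y', e'). x \<le> x' \<and> x' < y + b \<and> y \<le> y' \<and> y' < x + b)"

text \<open>\<open>nz b X Y\<close> says that the basic morphism \<open>X \<rightarrow> Y\<close> does not factor through a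
  projective-injective object of \<open>F\<^sub>b\<close>.\<close>

definition nz :: "real \<Rightarrow> point set \<Rightarrow> point set \<Rightarrow> bool" where
  "nz b X Y \<longleftrightarrow> (\<exists>p \<in> X. \<exists>q \<in> Y. near b p q)"

text \<open>On fixed representatives the exponent is a coboundary of \<open>min_shift\<close>, so
  both sides telescope to the same sum; \<open>c_pt_nonneg\<close> lets \<open>nat\<close> respect
  it.\<close>

lemma co_cocycle: "co X Y Z + co X Z W = co Y Z W + co X Y W"
proof -
  have "c_orb X Y Z + c_orb X Z W = c_orb Y Z W + c_orb X Y W"
    by (simp add: c_orb_def c_pt_def)
  moreover have "0 \<le> c_orb X Y Z" for X Y Z by (simp add: c_orb_def c_pt_nonneg)
  ultimately show ?thesis unfolding co_def by (metis nat_add_distrib)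
qed

lemma sigma_pow_0 [simp]: "sigma_pow 0 p = p"
  by (cases p) (simp add: sigma_pow_eq)

lemma orbit_range: "orbit p = range (\<lambda>i. sigma_pow i p)"
  by (auto simp: orbit_def)

lemma orbit_self [simp]: "p \<in> orbit p"
  unfolding orbit_range by (metis rangeI sigma_pow_0)

lemma orbit_sigma_pow [simp]: "orbit (sigma_pow k p) = orbit p"
proof
  show "orbit (sigma_pow k p) \<subseteq> orbit p"
    unfolding orbit_range sigma_pow_add by blast
  have "sigma_pow i p = sigma_pow (i - k) (sigma_pow k p)" for i by (simp add: sigma_pow_add)
  then show "orbit p \<subseteq> orbit (sigma_pow k p)" unfolding orbit_range by blast
qed

lemma orbit_eq: "q \<in> orbit p \<Longrightarrow> orbit q = orbit p"
  by (auto simp: orbit_range[of p])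

lemma orbit_double: "orbit (x + 2 * pi, y + 2 * pi, e) = orbit (x, y, e)"
  using orbit_sigma_pow[of 2 "(x, y, e)"] by (simp add: sigma_pow_eq)

lemma orbit_flip: "orbit (x, y, \<not> e) = orbit (y + pi, x + pi, e)"
  using orbit_sigma_pow[of 1 "(x, y, \<not> e)"] by (simp add: sigma_pow_eq)

lemma X_set_mono: "b \<le> b' \<Longrightarrow> X_set b \<subseteq> X_set b'"
  unfolding X_set_def by force

lemma M_orb_in: "\<bar>x - y\<bar> \<le> b \<Longrightarrow> M_orb x y \<in> X_set b"
  by (auto simp: X_set_def M_orb_def)

lemma X_setE:
  assumes "X \<in> X_set b"
  obtains x y where "X = M_orb x y" "\<bar>x - y\<bar> \<le> b"
proof -
  obtain x y e where X: "X = orbit (x, y, e)" "\<bar>x - y\<bar> \<le> b" using assms by (auto simp: X_set_def)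
  show ?thesis
  proof (cases e)
    case True then show ?thesis using that X by (auto simp: M_orb_def)
  next
    case False
    then have "X = M_orb (y + pi) (x + pi)" using X orbit_flip[of x y True] by (simp add: M_orb_def)
    then show ?thesis using that[of "y + pi" "x + pi"] X by auto
  qed
qed

lemma X_set_orbit: "X \<in> X_set b \<Longrightarrow> p \<in> X \<Longrightarrow> X = orbit p"
  by (elim X_setE) (auto simp: M_orb_def orbit_eq)

lemma X_set_nonempty: "X \<in> X_set b \<Longrightarrow> \<exists>p. p \<in> X"
  by (elim X_setE) (auto simp: M_orb_def intro: orbit_self)

lemma X_set_bound:
  assumes "X \<in> X_set b" "(x, y, e) \<in> X"
  shows "\<bar>x - y\<bar> \<le> b"
proof -
  obtain x' y' where X: "X = M_orb x' y'" "\<bar>x' - y'\<bar> \<le> b" using assms by (elim X_setE)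
  then obtain i where "(x, y, e) = sigma_pow i (x', y', True)"
    using assms by (auto simp: M_orb_def orbit_def)
  then show ?thesis using X by (auto simp: sigma_pow_eq split: if_splits)
qed

lemma sigma_pow_in: "X \<in> X_set b \<Longrightarrow> p \<in> X \<Longrightarrow> sigma_pow k p \<in> X"
  using X_set_orbit[of X b p] orbit_self[of "sigma_pow k p"] by simp

lemma co_pt:
  assumes "X \<in> X_set b" "Y \<in> X_set b" "Z \<in> X_set b" "p \<in> X" "q \<in> Y" "r \<in> Z"
  shows "co X Y Z = nat (c_pt p q r)"
  unfolding co_def
  using c_orb_independent_of_representatives[of X p Y q Z r p q r] X_set_orbit assms by metis

lemma point_le_sigma: "point_le (x, y, e) (sigma_pow i (x', y', e')) \<longleftrightarrow>
   (if even i then x \<le> x' + of_int i * pi \<and> y \<le> y' + of_int i * pi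
    else x \<le> y' + of_int i * pi \<and> y \<le> x' + of_int i * pi)"
  by (auto simp: sigma_pow_eq point_le_def)

lemma min_shift_sign: "min_shift (x, y, e) (x', y', e') = min_shift (x, y, f) (x', y', f')"
  unfolding min_shift_def point_le_sigma ..

lemma min_shift_le: "point_le p q \<Longrightarrow> min_shift p q \<le> 0"
  using min_shift(2)[of p 0 q] by simp

lemma min_shift_zeroD: "min_shift p q = 0 \<Longrightarrow> point_le p q"
  using min_shift(1)[of p q] by simp

lemma lift_exists:
  assumes "Y \<in> X_set b"
  obtains q where "q \<in> Y" "min_shift p q = 0"
proof -
  obtain q where q: "q \<in> Y" using X_set_nonempty assms by blast
  have "min_shift p (sigma_pow (min_shift p q) q) = 0"
    using min_shift_sigma_pow[of 0 p "min_shift p q" q] by simp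
  then show ?thesis using that sigma_pow_in assms q by blast
qed

lemma lift_shift:
  assumes "Y \<in> X_set b" "q \<in> Y" "q' \<in> Y"
  obtains k where "q' = sigma_pow k q"
proof -
  have "q' \<in> orbit q" using assms X_set_orbit[OF assms(1,2)] by simp
  then show ?thesis using that unfolding orbit_range by blast
qed

text \<open>The last assumption excludes the shift \<open>- 1\<close>, and a shift by
  \<open>- 2\<close> or less would imply the inequalities of the shift \<open>- 1\<close>, because
  the two coordinates of the target differ by at most \<open>pi\<close>.\<close>

lemma min_shift_zeroI:
  assumes "\<bar>x' - y'\<bar> \<le> pi" "x \<le> x'" "y \<le> y'" "\<not> (x \<le> y' - pi \<and> y \<le> x' - pi)"
  shows "min_shift (x, y, e) (x', y', e') = 0"
proof (rule min_shift_eqI)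
  show "point_le (x, y, e) (sigma_pow 0 (x', y', e'))" using assms by (simp add: point_le_def)
  fix j assume j: "point_le (x, y, e) (sigma_pow j (x', y', e'))"
  show "0 \<le> j"
  proof (rule ccontr)
    assume "\<not> 0 \<le> j"
    then consider "j = - 1" | "j \<le> - 2" by linarith
    then show False
    proof cases
      case 1
      then show ?thesis using j assms(4) by (simp add: point_le_sigma)
    next
      case 2
      then have "of_int j \<le> (- 2 :: real)" by linarith
      then have "of_int j * pi \<le> - 2 * pi" by (simp only: mult_right_mono pi_ge_zero)
      then show ?thesis using j assms(1,4) by (auto simp: point_le_sigma split: if_splits)
    qed
  qed
qed

lemma co_eq_0I:
  assumes "X \<in> X_set b" "Y \<in> X_set b" "Z \<in> X_set b" "p \<in> X" "q \<in> Y" "r \<in> Z"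
    "point_le p q" "point_le q r" "min_shift p r = 0"
  shows "co X Y Z = 0"
  using co_pt[OF assms(1-6)] min_shift_le[OF assms(7)] min_shift_le[OF assms(8)] assms(9)
  by (simp add: c_pt_def)

text \<open>Exponent 0 says that the basic morphism from \<open>X\<close> to \<open>Z\<close>
  factors through \<open>Y\<close> without a power of \<open>u\<close>; the minimal lift of
  \<open>Y\<close> above \<open>p\<close> then lies below \<open>r\<close>.\<close>

lemma co_eq_0D:
  assumes "X \<in> X_set b" "Y \<in> X_set b" "Z \<in> X_set b" "co X Y Z = 0" "p \<in> X" "r \<in> Z" "min_shift p r = 0"
  obtains q where "q \<in> Y" "point_le p q" "point_le q r"
proof -
  obtain q where q: "q \<in> Y" "min_shift p q = 0" using lift_exists assms(2) by blast
  have "c_pt p q r \<le> 0" using co_pt[OF assms(1-3,5) q(1) assms(6)] assms(4) by linarith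
  then have "min_shift q r \<le> 0" using q assms(7) by (simp add: c_pt_def)
  moreover have "min_shift q r \<ge> 0"
    using c_pt_nonneg[of p q r] q assms(7) by (simp add: c_pt_def)
  ultimately show ?thesis using that q min_shift_zeroD by (metis order_antisym)
qed

lemma same_coords_co:
  assumes "X \<in> X_set b" "X' \<in> X_set b" "Y \<in> X_set b" "Y' \<in> X_set b" "Z \<in> X_set b" "Z' \<in> X_set b"
    and "same_coords X X'" "same_coords Y Y'" "same_coords Z Z'"
  shows "co X Y Z = co X' Y' Z'"
proof -
  obtain x y e e' where p: "(x, y, e) \<in> X" "(x, y, e') \<in> X'" using assms by (auto simp: same_coords_def)
  obtain x1 y1 e1 e1' where q: "(x1, y1, e1) \<in> Y" "(x1, y1, e1') \<in> Y'" using assms by (auto simp: same_coords_def)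
  obtain x2 y2 e2 e2' where r: "(x2, y2, e2) \<in> Z" "(x2, y2, e2') \<in> Z'" using assms by (auto simp: same_coords_def)
  have "c_pt (x, y, e) (x1, y1, e1) (x2, y2, e2) = c_pt (x, y, e') (x1, y1, e1') (x2, y2, e2')"
    unfolding c_pt_def using min_shift_sign[of x y e x1 y1 e1 e' e1'] min_shift_sign[of x1 y1 e1 x2 y2 e2 e1' e2']
      min_shift_sign[of x y e x2 y2 e2 e' e2'] by simp
  then show ?thesis
    using co_pt[OF assms(1,3,5) p(1) q(1) r(1)] co_pt[OF assms(2,4,6) p(2) q(2) r(2)] by simp
qed

lemma same_coords_refl: "X \<in> X_set b \<Longrightarrow> same_coords X X"
proof -
  assume "X \<in> X_set b"
  then obtain p where "p \<in> X" using X_set_nonempty by blast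
  then show ?thesis by (cases p) (auto simp: same_coords_def)
qed

lemma same_coords_sym: "same_coords X Y \<Longrightarrow> same_coords Y X"
  by (auto simp: same_coords_def)

lemma point_le_antisym: "point_le (x, y, e) (x', y', e') \<Longrightarrow> point_le (x', y', e') (x, y, e) \<Longrightarrow> x = x' \<and> y = y'"
  by (auto simp: point_le_def)

lemma min_shift_self: "min_shift (x, y, e) (x, y, e') = 0"
proof (rule min_shift_eqI)
  show "point_le (x, y, e) (sigma_pow 0 (x, y, e'))" by (simp add: point_le_def)
  fix j assume "point_le (x, y, e) (sigma_pow j (x, y, e'))"
  then have "0 \<le> of_int j * pi" unfolding point_le_sigma by (cases "even j") auto
  then show "0 \<le> j" using pi_gt_zero by (simp add: zero_le_mult_iff not_le)
qed

lemma co_same [simp]: "co X X Y = 0" "co X Y Y = 0"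
proof -
  have "min_shift p p = 0" for p using min_shift_self by (cases p) simp
  then show "co X X Y = 0" "co X Y Y = 0" by (simp_all add: co_def c_orb_def c_pt_def)
qed

text \<open>A round trip without a power of \<open>u\<close> squeezes a lift of \<open>Y\<close>
  between a point of \<open>X\<close> and itself. In this way isomorphisms of orbits are read off
  from unit entries of matrices.\<close>

lemma co_back_forth:
  assumes "X \<in> X_set pi" "Y \<in> X_set pi"
  shows "co X Y X = 0 \<longleftrightarrow> same_coords X Y"
proof
  assume *: "co X Y X = 0"
  obtain x y e where p: "(x, y, e) \<in> X" using X_set_nonempty[OF assms(1)] by (metis prod_cases3)
  have "min_shift (x, y, e) (x, y, e) = 0" by (rule min_shift_self)
  then obtain q where q: "q \<in> Y" "point_le (x, y, e) q" "point_le q (x, y, e)"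
    using co_eq_0D[OF assms(1,2,1) * p p] by blast
  then show "same_coords X Y"
    using p point_le_antisym unfolding same_coords_def by (metis prod_cases3)
next
  assume "same_coords X Y"
  then have "co X Y X = co X X X" using same_coords_co assms same_coords_refl same_coords_sym by meson
  then show "co X Y X = 0" by simp
qed

section \<open>Stably non-zero basic morphisms\<close>

lemma near_sigma_pow [simp]: "near b (sigma_pow k p) (sigma_pow k q) \<longleftrightarrow> near b p q"
  by (cases p; cases q) (auto simp: near_def sigma_pow_eq)

lemma nz_orbit: "nz b (orbit p) (orbit q) \<longleftrightarrow> (\<exists>i. near b p (sigma_pow i q))"
proof
  assume "nz b (orbit p) (orbit q)"
  then obtain k l where "near b (sigma_pow k p) (sigma_pow l q)" by (auto simp: nz_def orbit_def)
  then have "near b (sigma_pow k p) (sigma_pow k (sigma_pow (l - k) q))" by (simp add: sigma_pow_add)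
  then show "\<exists>i. near b p (sigma_pow i q)" by auto
next
  assume "\<exists>i. near b p (sigma_pow i q)"
  then show "nz b (orbit p) (orbit q)" using orbit_self[of p] by (auto simp: nz_def orbit_range[of q])
qed

text \<open>The strict inequalities of \<open>near\<close> and \<open>b \<le> pi\<close> rule out a
  smaller lift, so a witness of \<open>nz\<close> is automatically the minimal lift, on which
  exponents are computed.\<close>

lemma nz_lift:
  assumes "X \<in> X_set pi" "Y \<in> X_set pi" "b \<le> pi" "nz b X Y" "p \<in> X"
  obtains q where "q \<in> Y" "near b p q" "min_shift p q = 0"
proof -
  obtain q0 where "q0 \<in> Y" using X_set_nonempty assms by blast
  then have XY: "X = orbit p" "Y = orbit q0" using X_set_orbit assms by blast+
  then obtain i where i: "near b p (sigma_pow i q0)" using assms(4) nz_orbit by blast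
  define q where "q = sigma_pow i q0"
  have q: "q \<in> Y" unfolding q_def by (rule sigma_pow_in[OF assms(2) \<open>q0 \<in> Y\<close>])
  obtain x y e where p_eq: "p = (x, y, e)" by (cases p)
  obtain x' y' e' where q_eq: "q = (x', y', e')" by (cases q)
  have "min_shift p q = 0"
    unfolding p_eq q_eq
  proof (rule min_shift_zeroI)
    show "\<bar>x' - y'\<bar> \<le> pi" using X_set_bound assms(2) q q_eq by blast
  qed (use i assms(3) in \<open>auto simp: p_eq q_eq near_def q_def[symmetric]\<close>)
  then show ?thesis using that q i q_def by blast
qed

text \<open>The rectangle is convex for the order: if \<open>q\<close> lies between \<open>p\<close>
  and \<open>r\<close>, and \<open>r\<close> is near \<open>p\<close>, then \<open>q\<close> is near
  \<open>p\<close> and \<open>r\<close> is near \<open>q\<close>. This is why null morphisms form an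
  ideal.\<close>

lemma nz_comp:
  assumes "X \<in> X_set pi" "Y \<in> X_set pi" "Z \<in> X_set pi" "b \<le> pi" "nz b X Z" "co X Y Z = 0"
  shows "nz b X Y" "nz b Y Z"
proof -
  obtain p where p: "p \<in> X" using X_set_nonempty assms by blast
  obtain r where r: "r \<in> Z" "near b p r" "min_shift p r = 0" using nz_lift[OF assms(1,3,4,5) p] .
  obtain q where q: "q \<in> Y" "point_le p q" "point_le q r" using co_eq_0D[OF assms(1-3,6) p r(1,3)] .
  have "near b p q" "near b q r"
    using r q by (auto simp: near_def point_le_def split: prod.splits)
  then show "nz b X Y" "nz b Y Z" using p q r by (auto simp: nz_def)
qed

lemma nz_self_iff:
  assumes "X \<in> X_set b" "b \<le> pi" "(x, y, e) \<in> X"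
  shows "nz b X X \<longleftrightarrow> \<bar>x - y\<bar> < b"
proof
  have X: "X \<in> X_set pi" using assms X_set_mono by blast
  assume "nz b X X"
  then obtain q where q: "q \<in> X" "near b (x, y, e) q" "min_shift (x, y, e) q = 0"
    using nz_lift[OF X X assms(2) _ assms(3)] by blast
  obtain k where k: "q = sigma_pow k (x, y, e)" using lift_shift assms q by blast
  have "min_shift (x, y, e) (x, y, e) = 0" by (rule min_shift_self)
  then have "k = 0" using q(3) k min_shift_sigma_pow[of 0 "(x, y, e)" k "(x, y, e)"] by simp
  then show "\<bar>x - y\<bar> < b" using q k by (auto simp: near_def)
next
  assume "\<bar>x - y\<bar> < b"
  then have "near b (x, y, e) (x, y, e)" by (auto simp: near_def)
  then show "nz b X X" using assms(3) by (auto simp: nz_def)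
qed

lemma boundary_not_nz:
  assumes "P \<in> X_set b" "X \<in> X_set b" "b \<le> pi" "\<not> nz b P P"
  shows "\<not> nz b X P" "\<not> nz b P X"
proof -
  obtain x y e where p: "(x, y, e) \<in> P" using X_set_nonempty[OF assms(1)] by (metis prod_cases3)
  have bd: "\<not> \<bar>x - y\<bar> < b" using nz_self_iff[OF assms(1,3) p] assms(4) by simp
  have all: "\<not> \<bar>x' - y'\<bar> < b" if "(x', y', e') \<in> P" for x' y' e'
    using nz_self_iff[OF assms(1,3) that] assms(4) by simp
  have X: "\<bar>x' - y'\<bar> \<le> b" if "(x', y', e') \<in> X" for x' y' e' using X_set_bound assms(2) that by blast
  show "\<not> nz b X P"
  proof
    assume "nz b X P"
    then obtain p q where pq: "p \<in> X" "q \<in> P" "near b p q" by (auto simp: nz_def)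
    then show False using all[of "fst q" "fst (snd q)" "snd (snd q)"] X[of "fst p" "fst (snd p)" "snd (snd p)"]
      by (auto simp: near_def split: prod.splits)
  qed
  show "\<not> nz b P X"
  proof
    assume "nz b P X"
    then obtain p q where pq: "p \<in> P" "q \<in> X" "near b p q" by (auto simp: nz_def)
    then show False using all[of "fst p" "fst (snd p)" "snd (snd p)"] X[of "fst q" "fst (snd q)" "snd (snd q)"]
      by (auto simp: near_def split: prod.splits)
  qed
qed

subsection \<open>The injective hull of an orbit\<close>

lemma M_orb_self: "(x, y, True) \<in> M_orb x y"
  by (simp add: M_orb_def)

text \<open>A target outside the rectangle has passed \<open>y + b\<close> in its first or
  \<open>x + b\<close> in its second coordinate, hence lies above one of the two hull corners. In
  any case one further turn by \<open>sigma\<close> lifts the target above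
  \<open>(x, x + b)\<close>, so at most one factor \<open>u\<close> is lost.\<close>

lemma hull_factor:
  assumes "\<bar>x - y\<bar> \<le> b" "b \<le> pi" "Y \<in> X_set b"
  shows "\<not> nz b (M_orb x y) Y \<Longrightarrow> co (M_orb x y) (M_orb x (x + b)) Y = 0 \<or> co (M_orb x y) (M_orb (y + b) y) Y = 0"
    and "co (M_orb x y) (M_orb x (x + b)) Y \<le> 1"
proof -
  have b: "0 \<le> b" using assms(1) by linarith
  note in_X = M_orb_in[of x y b] M_orb_in[of x "x + b" b] M_orb_in[of "y + b" y b]
  note le = assms(1) b
  obtain r where r: "r \<in> Y" "min_shift (x, y, True) r = 0" using lift_exists[OF assms(3)] .
  obtain x' y' e' where r_eq: "r = (x', y', e')" by (cases r)
  have xr: "x \<le> x'" "y \<le> y'" "\<bar>x' - y'\<bar> \<le> b"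
    using min_shift_zeroD[OF r(2)] X_set_bound[OF assms(3)] r by (auto simp: r_eq point_le_def)
  have "co (M_orb x y) (M_orb x (x + b)) Y = nat (c_pt (x, y, True) (x, x + b, True) r)"
    by (rule co_pt[OF _ _ assms(3) M_orb_self M_orb_self r(1)]; rule M_orb_in; use le in simp)
  also have "\<dots> \<le> 1"
  proof -
    have "point_le (x, x + b, True) (sigma_pow 1 r)" using xr le assms(2) by (simp add: r_eq point_le_sigma)
    then have "min_shift (x, x + b, True) r \<le> 1" by (rule min_shift)
    moreover have "min_shift (x, y, True) (x, x + b, True) \<le> 0"
      using le by (intro min_shift_le) (auto simp: point_le_def)
    ultimately show ?thesis using r(2) by (simp add: c_pt_def)
  qed
  finally show "co (M_orb x y) (M_orb x (x + b)) Y \<le> 1" .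
  assume "\<not> nz b (M_orb x y) Y"
  then have "\<not> near b (x, y, True) r" using r(1) M_orb_self by (auto simp: nz_def)
  then consider "y + b \<le> x'" | "x + b \<le> y'" using xr by (auto simp: r_eq near_def)
  then show "co (M_orb x y) (M_orb x (x + b)) Y = 0 \<or> co (M_orb x y) (M_orb (y + b) y) Y = 0"
  proof cases
    case 1
    have "co (M_orb x y) (M_orb (y + b) y) Y = 0"
      by (rule co_eq_0I[OF _ _ assms(3) M_orb_self M_orb_self r(1) _ _ r(2)])
         (use 1 xr le in \<open>auto simp: r_eq point_le_def intro!: M_orb_in\<close>)
    then show ?thesis ..
  next
    case 2
    have "co (M_orb x y) (M_orb x (x + b)) Y = 0"
      by (rule co_eq_0I[OF _ _ assms(3) M_orb_self M_orb_self r(1) _ _ r(2)])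
         (use 2 xr le in \<open>auto simp: r_eq point_le_def intro!: M_orb_in\<close>)
    then show ?thesis ..
  qed
qed

text \<open>All four edges of the rectangle are minimal lifts, so the two ways round it carry the
  same exponent and the signs \<open>1\<close>, \<open>- 1\<close> of \<open>hull_out\<close> make
  them cancel.\<close>

lemma hull_co:
  assumes "\<bar>x - y\<bar> < b" "b \<le> pi"
  shows "co (M_orb x y) (M_orb x (x + b)) (M_orb (y + b) (x + b)) = co (M_orb x y) (M_orb (y + b) y) (M_orb (y + b) (x + b))"
proof -
  note le = assms
  have ms: "min_shift (x, y, True) (x, x + b, True) = 0" "min_shift (x, x + b, True) (y + b, x + b, True) = 0"
    "min_shift (x, y, True) (y + b, y, True) = 0" "min_shift (y + b, y, True) (y + b, x + b, True) = 0"
    by (rule min_shift_zeroI; use le in linarith)+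
  have "M_orb x y \<in> X_set pi" "M_orb x (x + b) \<in> X_set pi" "M_orb (y + b) y \<in> X_set pi" "M_orb (y + b) (x + b) \<in> X_set pi"
    by (rule M_orb_in; use le in linarith)+
  then show ?thesis
    using co_pt[OF _ _ _ M_orb_self M_orb_self M_orb_self] ms by (simp add: c_pt_def)
qed

text \<open>Of the minimal lifts of \<open>W\<close> above the two hull corners, one already
  dominates \<open>(y + b, x + b)\<close>. The cokernel computation meets both exponents at each
  entry; as one of them is zero, the factor can be read off without division.\<close>

lemma hull_cokernel_co:
  assumes "\<bar>x - y\<bar> < b" "b \<le> pi" "W \<in> X_set b"
  shows "co (M_orb x (x + b)) (M_orb (y + b) (x + b)) W = 0 \<or> co (M_orb (y + b) y) (M_orb (y + b) (x + b)) W = 0"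
proof -
  note le = assms(1,2)
  have in_X: "M_orb x (x + b) \<in> X_set b" "M_orb (y + b) y \<in> X_set b" "M_orb (y + b) (x + b) \<in> X_set b"
    by (rule M_orb_in; use le in linarith)+
  obtain r where r: "r \<in> W" "min_shift (x, x + b, True) r = 0" using lift_exists[OF assms(3)] .
  obtain s where s: "s \<in> W" "min_shift (y + b, y, True) s = 0" using lift_exists[OF assms(3)] .
  obtain x1 y1 e1 where r_eq: "r = (x1, y1, e1)" by (cases r)
  obtain x2 y2 e2 where s_eq: "s = (x2, y2, e2)" by (cases s)
  have rs: "x \<le> x1" "x + b \<le> y1" "y + b \<le> x2" "y \<le> y2"
    using min_shift_zeroD[OF r(2)] min_shift_zeroD[OF s(2)] by (auto simp: r_eq s_eq point_le_def)
  have "y + b \<le> x1 \<or> x + b \<le> y2"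
  proof (rule ccontr)
    assume "\<not> ?thesis"
    then have no: "x1 < y + b" "y2 < x + b" by auto
    obtain k where k: "s = sigma_pow k r" using lift_shift[OF assms(3) r(1) s(1)] .
    have bd: "\<bar>x1 - y1\<bar> \<le> b" using X_set_bound assms(3) r r_eq by blast
    have st: "x2 = x1 + of_int k * pi \<and> y2 = y1 + of_int k * pi \<or> x2 = y1 + of_int k * pi \<and> y2 = x1 + of_int k * pi"
      using k by (auto simp: r_eq s_eq sigma_pow_eq split: if_splits)
    \<comment> \<open>For \<open>k\<close> in -1, 0, 1 the coordinates contradict each other
      directly; otherwise the translation by at least \<open>2 * pi\<close> exceeds what a strip of
      width \<open>b \<le> pi\<close> permits.\<close>
    consider "k = 0" | "k = 1" | "k = - 1" | "k \<ge> 2" | "k \<le> - 2" by linarith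
    then show False
    proof cases
      case 4
      then have "(2::real) \<le> of_int k" by linarith
      then have "2 * pi \<le> of_int k * pi" by (simp only: mult_right_mono pi_ge_zero)
      then show ?thesis using st no rs le bd by (elim disjE) linarith+
    next
      case 5
      then have "of_int k \<le> (-2::real)" by linarith
      then have "of_int k * pi \<le> - 2 * pi" by (simp only: mult_right_mono pi_ge_zero)
      then show ?thesis using st no rs le bd by (elim disjE) linarith+
    qed (use k no rs le bd in \<open>auto simp: r_eq s_eq sigma_pow_eq\<close>)
  qed
  then show ?thesis
  proof
    assume *: "y + b \<le> x1"
    have "co (M_orb x (x + b)) (M_orb (y + b) (x + b)) W = 0"
      by (rule co_eq_0I[OF in_X(1,3) assms(3) M_orb_self M_orb_self r(1) _ _ r(2)])
         (use * rs le in \<open>auto simp: r_eq point_le_def\<close>)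
    then show ?thesis ..
  next
    assume *: "x + b \<le> y2"
    have "co (M_orb (y + b) y) (M_orb (y + b) (x + b)) W = 0"
      by (rule co_eq_0I[OF in_X(2,3) assms(3) M_orb_self M_orb_self s(1) _ _ s(2)])
         (use * rs le in \<open>auto simp: s_eq point_le_def\<close>)
    then show ?thesis ..
  qed
qed

text \<open>Dual to \<open>hull_cokernel_co\<close>, with lifts of \<open>W\<close> below the hull
  corners: one of the two lies below \<open>(x, y)\<close>.\<close>

lemma hull_kernel_co:
  assumes "\<bar>x - y\<bar> < b" "b \<le> pi" "W \<in> X_set b"
  shows "co W (M_orb x y) (M_orb x (x + b)) = 0 \<or> co W (M_orb x y) (M_orb (y + b) y) = 0"
proof -
  note le = assms(1,2)
  have in_X: "M_orb x (x + b) \<in> X_set b" "M_orb (y + b) y \<in> X_set b" "M_orb x y \<in> X_set b"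
    by (rule M_orb_in; use le in linarith)+
  obtain w where w: "w \<in> W" using X_set_nonempty assms by blast
  have lift: "\<exists>r. r \<in> W \<and> min_shift r p = 0" for p
  proof (intro exI conjI)
    show "sigma_pow (- min_shift w p) w \<in> W" using sigma_pow_in assms w by blast
    show "min_shift (sigma_pow (- min_shift w p) w) p = 0"
      using min_shift_sigma_pow[of "- min_shift w p" w 0 p] by simp
  qed
  obtain r where r: "r \<in> W" "min_shift r (x, x + b, True) = 0" using lift by blast
  obtain s where s: "s \<in> W" "min_shift s (y + b, y, True) = 0" using lift by blast
  obtain x1 y1 e1 where r_eq: "r = (x1, y1, e1)" by (cases r)
  obtain x2 y2 e2 where s_eq: "s = (x2, y2, e2)" by (cases s)
  have rs: "x1 \<le> x" "y1 \<le> x + b" "x2 \<le> y + b" "y2 \<le> y"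
    using min_shift_zeroD[OF r(2)] min_shift_zeroD[OF s(2)] by (auto simp: r_eq s_eq point_le_def)
  have "y1 \<le> y \<or> x2 \<le> x"
  proof (rule ccontr)
    assume "\<not> ?thesis"
    then have no: "y < y1" "x < x2" by auto
    obtain k where k: "s = sigma_pow k r" using lift_shift[OF assms(3) r(1) s(1)] .
    have bd: "\<bar>x1 - y1\<bar> \<le> b" using X_set_bound assms(3) r r_eq by blast
    have st: "x2 = x1 + of_int k * pi \<and> y2 = y1 + of_int k * pi \<or> x2 = y1 + of_int k * pi \<and> y2 = x1 + of_int k * pi"
      using k by (auto simp: r_eq s_eq sigma_pow_eq split: if_splits)
    consider "k = 0" | "k = 1" | "k = - 1" | "k \<ge> 2" | "k \<le> - 2" by linarith
    then show False
    proof cases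
      case 4
      then have "(2::real) \<le> of_int k" by linarith
      then have "2 * pi \<le> of_int k * pi" by (simp only: mult_right_mono pi_ge_zero)
      then show ?thesis using st no rs le bd by (elim disjE) linarith+
    next
      case 5
      then have "of_int k \<le> (-2::real)" by linarith
      then have "of_int k * pi \<le> - 2 * pi" by (simp only: mult_right_mono pi_ge_zero)
      then show ?thesis using st no rs le bd by (elim disjE) linarith+
    qed (use k no rs le bd in \<open>auto simp: r_eq s_eq sigma_pow_eq\<close>)
  qed
  then show ?thesis
  proof
    assume *: "y1 \<le> y"
    have "co W (M_orb x y) (M_orb x (x + b)) = 0"
      by (rule co_eq_0I[OF assms(3) in_X(3,1) r(1) M_orb_self M_orb_self _ _ r(2)])
         (use * rs le in \<open>auto simp: r_eq point_le_def\<close>)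
    then show ?thesis ..
  next
    assume *: "x2 \<le> x"
    have "co W (M_orb x y) (M_orb (y + b) y) = 0"
      by (rule co_eq_0I[OF assms(3) in_X(3,2) s(1) M_orb_self M_orb_self _ _ s(2)])
         (use * rs le in \<open>auto simp: s_eq point_le_def\<close>)
    then show ?thesis ..
  qed
qed

subsection \<open>The rotation of orbits\<close>

lemma psi_orb_orbit: "psi_orb (orbit (x, y, e)) = orbit (x + pi, y + pi, e)"
proof -
  have "(\<lambda>(x, y, e). (x + pi, y + pi, e)) (sigma_pow i (x, y, e)) = sigma_pow i (x + pi, y + pi, e)" for i
    by (simp add: sigma_pow_eq)
  then show ?thesis unfolding psi_orb_def orbit_range image_image by simp
qed

lemma psi_orb_M: "psi_orb (M_orb x y) = M_orb (x + pi) (y + pi)"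
  by (simp add: M_orb_def psi_orb_orbit)

lemma psi_orb_in: "X \<in> X_set b \<Longrightarrow> psi_orb X \<in> X_set b"
  by (elim X_setE) (auto simp: psi_orb_M intro: M_orb_in)

lemma psi_orb_psi_orb: "X \<in> X_set b \<Longrightarrow> psi_orb (psi_orb X) = X"
proof (elim X_setE)
  fix x y assume "X = M_orb x y"
  then show ?thesis using orbit_double[of x y True] by (simp add: psi_orb_orbit M_orb_def add.assoc)
qed

lemma psi_orb_mem: "(x, y, e) \<in> X \<Longrightarrow> (x + pi, y + pi, e) \<in> psi_orb X"
  unfolding psi_orb_def by (rule image_eqI[where x = "(x, y, e)"]) simp_all

lemma min_shift_translate: "min_shift (x + a, y + a, e) (x' + a, y' + a, e') = min_shift (x, y, e) (x', y', e')"
proof -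
  have "u + a \<le> v + a + t \<longleftrightarrow> u \<le> v + t" for u v t :: real by linarith
  then show ?thesis unfolding min_shift_def point_le_sigma by simp
qed

lemma co_psi:
  assumes "X \<in> X_set b" "Y \<in> X_set b" "Z \<in> X_set b"
  shows "co (psi_orb X) (psi_orb Y) (psi_orb Z) = co X Y Z"
proof -
  obtain x y e where p: "(x, y, e) \<in> X" using X_set_nonempty[OF assms(1)] by (metis prod_cases3)
  obtain x1 y1 e1 where q: "(x1, y1, e1) \<in> Y" using X_set_nonempty[OF assms(2)] by (metis prod_cases3)
  obtain x2 y2 e2 where r: "(x2, y2, e2) \<in> Z" using X_set_nonempty[OF assms(3)] by (metis prod_cases3)
  show ?thesis
    using co_pt[OF psi_orb_in[OF assms(1)] psi_orb_in[OF assms(2)] psi_orb_in[OF assms(3)]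
        psi_orb_mem[OF p] psi_orb_mem[OF q] psi_orb_mem[OF r]] co_pt[OF assms p q r]
    by (simp add: c_pt_def min_shift_translate)
qed

lemma nz_psi:
  assumes "X \<in> X_set b'" "Y \<in> X_set b'"
  shows "nz b (psi_orb X) (psi_orb Y) \<longleftrightarrow> nz b X Y"
proof -
  have "near b (x + pi, y + pi, e) (x' + pi, y' + pi, e') \<longleftrightarrow> near b (x, y, e) (x', y', e')" for x y x' y' e e'
    by (auto simp: near_def)
  then show ?thesis unfolding nz_def psi_orb_def by (auto simp: image_iff split: prod.splits) blast+
qed

lemma same_coords_psi_diagonal: "same_coords (psi_orb (M_orb x x)) (M_orb x x)"
proof -
  have "(x + pi, x + pi, True) \<in> psi_orb (M_orb x x)" using psi_orb_mem[OF M_orb_self] .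
  moreover have "sigma_pow 1 (x, x, True) \<in> M_orb x x" using sigma_pow_in[OF M_orb_in[of x x 0] M_orb_self] by simp
  ultimately show ?thesis unfolding same_coords_def by (auto simp: sigma_pow_eq)
qed

lemma same_coords_M_orb: "same_coords (M_orb x y) (M_orb x' y') \<longleftrightarrow>
   (\<exists>i. sigma_pow i (x', y', True) = (x, y, even i))"
proof
  assume "same_coords (M_orb x y) (M_orb x' y')"
  then obtain k l a c e e' where "(a, c, e) = sigma_pow k (x, y, True)" "(a, c, e') = sigma_pow l (x', y', True)"
    unfolding same_coords_def M_orb_def orbit_def by blast
  then have "sigma_pow (l - k) (x', y', True) = (x, y, even (l - k))"
    by (auto simp: sigma_pow_eq algebra_simps split: if_splits)
  then show "\<exists>i. sigma_pow i (x', y', True) = (x, y, even i)" ..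
next
  assume "\<exists>i. sigma_pow i (x', y', True) = (x, y, even i)"
  then obtain i where "sigma_pow i (x', y', True) = (x, y, even i)" ..
  then have "(x, y, even i) \<in> M_orb x' y'" unfolding M_orb_def orbit_range by (metis rangeI)
  then show "same_coords (M_orb x y) (M_orb x' y')" using M_orb_self unfolding same_coords_def by blast
qed

text \<open>Together with \<open>same_coords_psi_diagonal\<close> this separates the two kinds of
  objects: off the diagonal an orbit and its rotation are not isomorphic and have to be paired by
  \<open>SM\<close>, on the diagonal a sign suffices.\<close>

lemma psi_same_coords_imp_diagonal:
  assumes "same_coords (M_orb x y) (psi_orb (M_orb x y))" shows "x = y"
proof -
  obtain i where i: "sigma_pow i (x + pi, y + pi, True) = (x, y, even i)"
    using assms unfolding psi_orb_M same_coords_M_orb by blast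
  then have "x = y + pi + of_int i * pi \<and> y = x + pi + of_int i * pi \<or> x = x + pi + of_int i * pi \<and> even i"
    by (auto simp: sigma_pow_eq split: if_splits)
  then show ?thesis
  proof
    assume *: "x = x + pi + of_int i * pi \<and> even i"
    then have "(1 + of_int i) * pi = 0" by (simp add: algebra_simps)
    then have "(1 + of_int i :: real) = 0" using pi_neq_zero by (metis mult_eq_0_iff)
    then have "i = - 1" by linarith
    then show ?thesis using * by simp
  qed linarith
qed

section \<open>The category \<open>F\<^sub>b\<close>\<close>

definition tmul :: "'r::idom \<Rightarrow> obj \<Rightarrow> obj \<Rightarrow> obj \<Rightarrow> 'r mat \<Rightarrow> 'r mat \<Rightarrow> 'r mat" where
  "tmul u X Y Z g f = mat (length Z) (length X) (\<lambda>(k, i).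
     \<Sum>j < length Y. g $$ (k, j) * f $$ (j, i) * u ^ co (X ! i) (Y ! j) (Z ! k))"

lemma F_cat_simps [simp]:
  "Obj (F_cat u b) = lists (X_set b)"
  "Mor (F_cat u b) = (\<lambda>X Y. carrier_mat (length Y) (length X))"
  "Comp (F_cat u b) = tmul u"
  "Idm (F_cat u b) = (\<lambda>X. 1\<^sub>m (length X))"
  "ZeroM (F_cat u b) = (\<lambda>X Y. 0\<^sub>m (length Y) (length X))"
  "AddM (F_cat u b) = (+)"
  by (simp_all add: F_cat_def tmul_def[abs_def] co_def)

lemma tmul_carrier [simp, intro]: "tmul u X Y Z g f \<in> carrier_mat (length Z) (length X)"
  by (simp add: tmul_def)

lemma tmul_dim [simp]: "dim_row (tmul u X Y Z g f) = length Z" "dim_col (tmul u X Y Z g f) = length X"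
  by (simp_all add: tmul_def)

lemma tmul_index: "k < length Z \<Longrightarrow> i < length X \<Longrightarrow>
    tmul u X Y Z g f $$ (k, i) = (\<Sum>j < length Y. g $$ (k, j) * f $$ (j, i) * u ^ co (X ! i) (Y ! j) (Z ! k))"
  by (simp add: tmul_def)

text \<open>The two exponents agree by \<open>co_cocycle\<close>. As \<open>tmul\<close> reads only
  entries in range, the identity holds for arbitrary matrices, as the unconditional
  \<open>assoc\<close> of \<open>preadditive\<close> asks.\<close>

lemma tmul_assoc: "tmul u X Z W h (tmul u X Y Z g f) = tmul u X Y W (tmul u Y Z W h g) f"
proof (rule eq_matI)
  fix l i
  assume "l < dim_row (tmul u X Y W (tmul u Y Z W h g) f)" "i < dim_col (tmul u X Y W (tmul u Y Z W h g) f)"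
  then have li: "l < length W" "i < length X" by simp_all
  have "tmul u X Z W h (tmul u X Y Z g f) $$ (l, i)
      = (\<Sum>k < length Z. \<Sum>j < length Y. h $$ (l, k) * g $$ (k, j) * f $$ (j, i) *
           u ^ (co (X ! i) (Y ! j) (Z ! k) + co (X ! i) (Z ! k) (W ! l)))"
    using li by (simp add: tmul_index sum_distrib_left sum_distrib_right power_add mult_ac)
  also have "\<dots> = (\<Sum>j < length Y. \<Sum>k < length Z. h $$ (l, k) * g $$ (k, j) * f $$ (j, i) *
           u ^ (co (Y ! j) (Z ! k) (W ! l) + co (X ! i) (Y ! j) (W ! l)))"
    by (subst sum.swap, intro sum.cong refl arg_cong2[where f = "(*)"] arg_cong2[where f = "(^)"]) (rule co_cocycle)
  also have "\<dots> = tmul u X Y W (tmul u Y Z W h g) f $$ (l, i)"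
    using li by (simp add: tmul_index sum_distrib_left sum_distrib_right power_add mult_ac)
  finally show "tmul u X Z W h (tmul u X Y Z g f) $$ (l, i) = tmul u X Y W (tmul u Y Z W h g) f $$ (l, i)" .
qed simp_all

lemma tmul_one [simp]:
  assumes "f \<in> carrier_mat (length Y) (length X)"
  shows "tmul u X Y Y (1\<^sub>m (length Y)) f = f" "tmul u X X Y f (1\<^sub>m (length X)) = f"
proof -
  have *: "(\<Sum>j<n. (if i = j then 1 else 0) * a j * c j) = (a i * c i :: 'a)"
    "(\<Sum>j<n. a j * (if j = i then 1 else 0) * c j) = a i * c i" if "i < n" for i n and a c :: "nat \<Rightarrow> 'a"
    using that by (simp_all add: if_distrib[of "\<lambda>x. x * _"] if_distrib[of "\<lambda>x. _ * x"] cong: if_cong)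
  show "tmul u X Y Y (1\<^sub>m (length Y)) f = f" "tmul u X X Y f (1\<^sub>m (length X)) = f"
    using assms by (auto intro!: eq_matI simp: tmul_index *)
qed

lemma tmul_add_left:
  assumes "g \<in> carrier_mat (length Z) (length Y)" "h \<in> carrier_mat (length Z) (length Y)"
  shows "tmul u X Y Z (g + h) f = tmul u X Y Z g f + tmul u X Y Z h f"
  using assms by (auto intro!: eq_matI simp: tmul_index sum.distrib[symmetric] algebra_simps)

lemma tmul_add_right:
  assumes "g \<in> carrier_mat (length Y) (length X)" "h \<in> carrier_mat (length Y) (length X)"
  shows "tmul u X Y Z f (g + h) = tmul u X Y Z f g + tmul u X Y Z f h"
  using assms by (auto intro!: eq_matI simp: tmul_index sum.distrib[symmetric] algebra_simps)

lemma preadditive_F: "preadditive (F_cat (u::'r::idom) b)"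
proof (unfold_locales, goal_cases)
  case 3
  then show ?case by simp
next
  case (9 X Y)
  then show ?case by simp
next
  case (11 f X Y)
  then show ?case by (auto intro!: bexI[of _ "- f"])
qed (auto simp: tmul_assoc tmul_add_left tmul_add_right comm_add_mat assoc_add_mat)

lemma tmul_smult_left:
  "g \<in> carrier_mat (length Z) (length Y) \<Longrightarrow> tmul u X Y Z (a \<cdot>\<^sub>m g) f = a \<cdot>\<^sub>m tmul u X Y Z g f"
  by (auto intro!: eq_matI simp: tmul_index sum_distrib_left mult_ac)

lemma tmul_smult_right:
  "f \<in> carrier_mat (length Y) (length X) \<Longrightarrow> tmul u X Y Z g (a \<cdot>\<^sub>m f) = a \<cdot>\<^sub>m tmul u X Y Z g f"
  by (auto intro!: eq_matI simp: tmul_index sum_distrib_left mult_ac)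

subsection \<open>Direct sums\<close>

definition in1 :: "nat \<Rightarrow> nat \<Rightarrow> 'r::idom mat" where
  "in1 n m = mat (n + m) n (\<lambda>(l, i). if l = i then 1 else 0)"
definition in2 :: "nat \<Rightarrow> nat \<Rightarrow> 'r::idom mat" where
  "in2 n m = mat (n + m) m (\<lambda>(l, i). if l = n + i then 1 else 0)"
definition pr1 :: "nat \<Rightarrow> nat \<Rightarrow> 'r::idom mat" where
  "pr1 n m = mat n (n + m) (\<lambda>(i, l). if l = i then 1 else 0)"
definition pr2 :: "nat \<Rightarrow> nat \<Rightarrow> 'r::idom mat" where
  "pr2 n m = mat m (n + m) (\<lambda>(i, l). if l = n + i then 1 else 0)"

lemma biproduct_carrier [simp, intro]:
  "in1 n m \<in> carrier_mat (n + m) n" "in2 n m \<in> carrier_mat (n + m) m"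
  "pr1 n m \<in> carrier_mat n (n + m)" "pr2 n m \<in> carrier_mat m (n + m)"
  by (simp_all add: in1_def in2_def pr1_def pr2_def)

lemma sum_append:
  "(\<Sum>l < n + m. F l) = (\<Sum>l<n. F l) + (\<Sum>l<m. F (n + l :: nat) :: 'a::comm_monoid_add)"
  by (induction m) (simp_all add: add.assoc)

lemma sum_select:
  fixes a c :: "nat \<Rightarrow> 'a::idom"
  assumes "i < n"
  shows "(\<Sum>j<n. (if j = i then 1 else 0) * a j * c j) = a i * c i"
    "(\<Sum>j<n. a j * (if j = i then 1 else 0) * c j) = a i * c i"
    "(\<Sum>j<n. (if i = j then 1 else 0) * a j * c j) = a i * c i"
    "(\<Sum>j<n. a j * (if i = j then 1 else 0) * c j) = a i * c i"
  using assms by (simp_all add: if_distrib[of "\<lambda>x. x * _"] if_distrib[of "\<lambda>x. _ * x"] cong: if_cong)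

lemma direct_sum_append: "direct_sum (F_cat (u::'r::idom) b) (A @ B) A B"
proof -
  let ?n = "length A" and ?m = "length B"
  have "tmul u A (A @ B) A (pr1 ?n ?m) (in1 ?n ?m) = 1\<^sub>m ?n"
    by (rule eq_matI) (auto simp: tmul_index sum_append in1_def pr1_def sum_select nth_append)
  moreover have "tmul u B (A @ B) B (pr2 ?n ?m) (in2 ?n ?m) = 1\<^sub>m ?m"
    by (rule eq_matI) (auto simp: tmul_index sum_append in2_def pr2_def sum_select)
  moreover have "tmul u A (A @ B) B (pr2 ?n ?m) (in1 ?n ?m) = 0\<^sub>m ?m ?n"
    by (rule eq_matI) (auto simp: tmul_index sum_append in1_def pr2_def)
  moreover have "tmul u B (A @ B) A (pr1 ?n ?m) (in2 ?n ?m) = 0\<^sub>m ?n ?m"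
    by (rule eq_matI) (auto simp: tmul_index sum_append in2_def pr1_def)
  moreover have "tmul u (A @ B) A (A @ B) (in1 ?n ?m) (pr1 ?n ?m) +
      tmul u (A @ B) B (A @ B) (in2 ?n ?m) (pr2 ?n ?m) = 1\<^sub>m (?n + ?m)"
  proof (rule eq_matI)
    fix l i assume "l < dim_row (1\<^sub>m (?n + ?m) :: 'r mat)" "i < dim_col (1\<^sub>m (?n + ?m) :: 'r mat)"
    then have li: "l < ?n + ?m" "i < ?n + ?m" by simp_all
    have 1: "(\<Sum>j<?n. (if l = j then 1 else 0) * (if i = j then 1 else 0) * u ^ co ((A @ B) ! i) (A ! j) ((A @ B) ! l))
        = (if l = i \<and> l < ?n then 1 else (0::'r))"
      by (cases "l < ?n") (auto simp: sum_select nth_append)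
    have 2: "(\<Sum>j<?m. (if l = ?n + j then 1 else 0) * (if i = ?n + j then 1 else 0) * u ^ co ((A @ B) ! i) (B ! j) ((A @ B) ! l))
        = (if l = i \<and> \<not> l < ?n then 1 else (0::'r))"
    proof (cases "l < ?n")
      case False
      then obtain l' where l': "l = ?n + l'" by (metis le_Suc_ex not_less)
      then show ?thesis using li by (auto simp: sum_select nth_append)
    qed auto
    show "(tmul u (A @ B) A (A @ B) (in1 ?n ?m) (pr1 ?n ?m) +
      tmul u (A @ B) B (A @ B) (in2 ?n ?m) (pr2 ?n ?m)) $$ (l, i) = 1\<^sub>m (?n + ?m) $$ (l, i)"
      using li 1 2 by (simp add: tmul_index in1_def in2_def pr1_def pr2_def)
  qed simp_all
  ultimately show ?thesis
    unfolding direct_sum_def F_cat_simps length_append using biproduct_carrier by blast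
qed

subsection \<open>Morphisms vanishing in the stable category\<close>

definition nul :: "'r::idom \<Rightarrow> real \<Rightarrow> obj \<Rightarrow> obj \<Rightarrow> 'r mat \<Rightarrow> bool" where
  "nul u b X Y f \<longleftrightarrow> (\<forall>i < length Y. \<forall>j < length X. nz b (X ! j) (Y ! i) \<longrightarrow> u dvd f $$ (i, j))"

lemma X_nth: "X \<in> lists (X_set b) \<Longrightarrow> b \<le> b' \<Longrightarrow> i < length X \<Longrightarrow> X ! i \<in> X_set b'"
  using X_set_mono by (metis in_lists_conv_set nth_mem subsetD)

text \<open>Each summand either carries a positive power of \<open>u\<close>, or has exponent 0; in
  the latter case \<open>nz_comp\<close> puts both factors at non-null positions, where one of them
  is divisible by \<open>u\<close>.\<close>

lemma nul_tmul:
  assumes "X \<in> lists (X_set b)" "Y \<in> lists (X_set b)" "Z \<in> lists (X_set b)" "b \<le> pi"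
    and "nul u b X Y f \<or> nul u b Y Z g"
  shows "nul u b X Z (tmul u X Y Z g f)"
  unfolding nul_def
proof (intro allI impI)
  fix k i assume ki: "k < length Z" "i < length X" and nz: "nz b (X ! i) (Z ! k)"
  show "u dvd tmul u X Y Z g f $$ (k, i)"
    unfolding tmul_index[OF ki]
  proof (rule dvd_sum)
    fix j assume "j \<in> {..<length Y}"
    then have j: "j < length Y" by simp
    show "u dvd g $$ (k, j) * f $$ (j, i) * u ^ co (X ! i) (Y ! j) (Z ! k)"
    proof (cases "co (X ! i) (Y ! j) (Z ! k) = 0")
      case True
      then have "nz b (X ! i) (Y ! j)" "nz b (Y ! j) (Z ! k)"
        using nz_comp[OF _ _ _ assms(4) nz True] X_nth assms(1-4) ki j by blast+
      then have "u dvd g $$ (k, j) \<or> u dvd f $$ (j, i)"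
        using assms(5) ki j unfolding nul_def by blast
      then show ?thesis by auto
    next
      case False
      then show ?thesis by (cases "co (X ! i) (Y ! j) (Z ! k)") auto
    qed
  qed
qed

lemma nul_add: "f \<in> carrier_mat (length Y) (length X) \<Longrightarrow> g \<in> carrier_mat (length Y) (length X) \<Longrightarrow>
    nul u b X Y f \<Longrightarrow> nul u b X Y g \<Longrightarrow> nul u b X Y (f + g)"
  by (auto simp: nul_def)

lemma nul_uminus: "f \<in> carrier_mat (length Y) (length X) \<Longrightarrow> nul u b X Y f \<Longrightarrow> nul u b X Y (- f)"
  by (auto simp: nul_def)

lemma nul_zero: "nul u b X Y (0\<^sub>m (length Y) (length X))"
  by (auto simp: nul_def)

definition boundary :: "real \<Rightarrow> obj \<Rightarrow> bool" where
  "boundary b X \<longleftrightarrow> (\<forall>P \<in> set X. \<not> nz b P P)"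

lemma boundary_nul:
  assumes "X \<in> lists (X_set b)" "Y \<in> lists (X_set b)" "b \<le> pi" "boundary b X \<or> boundary b Y"
  shows "nul u b X Y f"
proof -
  have "\<not> nz b (X ! j) (Y ! i)" if "i < length Y" "j < length X" for i j
  proof -
    have "X ! j \<in> X_set b" "Y ! i \<in> X_set b" using X_nth assms(1,2) that by blast+
    then show ?thesis using boundary_not_nz assms(3,4) that unfolding boundary_def by (metis nth_mem)
  qed
  then show ?thesis by (auto simp: nul_def)
qed

subsection \<open>Hulls\<close>

definition obj_list :: "(real \<times> real) list \<Rightarrow> obj" where
  "obj_list = map (\<lambda>(x, y). M_orb x y)"
text \<open>Each orbit contributes the two boundary corners of its rectangle. All first corners
  precede all second ones, so that inclusion and projection are the block matrices with entries 1, 1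
  and 1, -1; \<open>cohull\<close> collects the opposite corners.\<close>

definition phull :: "real \<Rightarrow> (real \<times> real) list \<Rightarrow> obj" where
  "phull b xs = map (\<lambda>(x, y). M_orb x (x + b)) xs @ map (\<lambda>(x, y). M_orb (y + b) y) xs"
definition cohull :: "real \<Rightarrow> (real \<times> real) list \<Rightarrow> obj" where
  "cohull b = map (\<lambda>(x, y). M_orb (y + b) (x + b))"
definition hull_in :: "nat \<Rightarrow> 'r::idom mat" where
  "hull_in n = mat (n + n) n (\<lambda>(l, i). if l = i \<or> l = n + i then 1 else 0)"
definition hull_out :: "nat \<Rightarrow> 'r::idom mat" where
  "hull_out n = mat n (n + n) (\<lambda>(i, l). if l = i then 1 else if l = n + i then - 1 else 0)"

lemma hull_length [simp]: "length (obj_list xs) = length xs" "length (phull b xs) = length xs + length xs"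
  "length (cohull b xs) = length xs"
  by (simp_all add: obj_list_def phull_def cohull_def)

lemma hull_carrier [simp, intro]: "hull_in n \<in> carrier_mat (n + n) n" "hull_out n \<in> carrier_mat n (n + n)"
  by (simp_all add: hull_in_def hull_out_def)

lemma hull_nth:
  assumes "i < length xs"
  shows "obj_list xs ! i = M_orb (fst (xs ! i)) (snd (xs ! i))"
    "phull b xs ! i = M_orb (fst (xs ! i)) (fst (xs ! i) + b)"
    "phull b xs ! (length xs + i) = M_orb (snd (xs ! i) + b) (snd (xs ! i))"
    "cohull b xs ! i = M_orb (snd (xs ! i) + b) (fst (xs ! i) + b)"
  using assms by (simp_all add: obj_list_def phull_def cohull_def nth_append split_beta)

lemma tmul_hull_in_right:
  assumes "k < length W" "i < length xs"
  shows "tmul u (obj_list xs) (phull b xs) W h (hull_in (length xs)) $$ (k, i) =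
     h $$ (k, i) * u ^ co (obj_list xs ! i) (phull b xs ! i) (W ! k) +
     h $$ (k, length xs + i) * u ^ co (obj_list xs ! i) (phull b xs ! (length xs + i)) (W ! k)"
  using assms by (simp add: tmul_index sum_append hull_in_def sum_select)

lemma tmul_hull_in_left:
  assumes "w < length W" "i < length xs"
  shows "tmul u W (obj_list xs) (phull b xs) (hull_in (length xs)) f $$ (i, w) =
       f $$ (i, w) * u ^ co (W ! w) (obj_list xs ! i) (phull b xs ! i)"
    "tmul u W (obj_list xs) (phull b xs) (hull_in (length xs)) f $$ (length xs + i, w) =
       f $$ (i, w) * u ^ co (W ! w) (obj_list xs ! i) (phull b xs ! (length xs + i))"
  using assms by (simp_all add: tmul_index hull_in_def sum_select)

lemma tmul_hull_out_left:
  assumes "w < length W" "i < length xs"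
  shows "tmul u W (phull b xs) (cohull b xs) (hull_out (length xs)) h $$ (i, w) =
     h $$ (i, w) * u ^ co (W ! w) (phull b xs ! i) (cohull b xs ! i) -
     h $$ (length xs + i, w) * u ^ co (W ! w) (phull b xs ! (length xs + i)) (cohull b xs ! i)"
proof -
  let ?n = "length xs"
  have "(\<Sum>j<?n. (if ?n + j = i then 1 else if ?n + j = ?n + i then - 1 else 0) * h $$ (?n + j, w) *
      u ^ co (W ! w) (phull b xs ! (?n + j)) (cohull b xs ! i))
    = (\<Sum>j<?n. - ((if i = j then 1 else 0) * h $$ (?n + j, w) * u ^ co (W ! w) (phull b xs ! (?n + j)) (cohull b xs ! i)))"
    using assms by (intro sum.cong) auto
  moreover have "(\<Sum>j<?n. (if j = i then 1 else if j = ?n + i then - 1 else 0) * h $$ (j, w) *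
      u ^ co (W ! w) (phull b xs ! j) (cohull b xs ! i))
    = (\<Sum>j<?n. (if i = j then 1 else 0) * h $$ (j, w) * u ^ co (W ! w) (phull b xs ! j) (cohull b xs ! i))"
    using assms by (intro sum.cong) auto
  ultimately show ?thesis
    using assms by (simp add: tmul_index sum_append hull_out_def sum_select sum_negf)
qed

lemma tmul_hull_out_right:
  assumes "w < length W" "i < length xs"
  shows "tmul u (phull b xs) (cohull b xs) W k (hull_out (length xs)) $$ (w, i) =
       k $$ (w, i) * u ^ co (phull b xs ! i) (cohull b xs ! i) (W ! w)"
    "tmul u (phull b xs) (cohull b xs) W k (hull_out (length xs)) $$ (w, length xs + i) =
       - (k $$ (w, i) * u ^ co (phull b xs ! (length xs + i)) (cohull b xs ! i) (W ! w))"
proof -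
  let ?n = "length xs"
  have "(\<Sum>j<?n. k $$ (w, j) * (if ?n + i = j then 1 else if ?n + i = ?n + j then - 1 else 0) *
      u ^ co (phull b xs ! (?n + i)) (cohull b xs ! j) (W ! w))
    = (\<Sum>j<?n. - (k $$ (w, j) * (if i = j then 1 else 0) * u ^ co (phull b xs ! (?n + i)) (cohull b xs ! j) (W ! w)))"
    using assms by (intro sum.cong) auto
  moreover have "(\<Sum>j<?n. k $$ (w, j) * (if i = j then 1 else if i = ?n + j then - 1 else 0) *
      u ^ co (phull b xs ! i) (cohull b xs ! j) (W ! w))
    = (\<Sum>j<?n. k $$ (w, j) * (if i = j then 1 else 0) * u ^ co (phull b xs ! i) (cohull b xs ! j) (W ! w))"
    using assms by (intro sum.cong) auto
  ultimately show "tmul u (phull b xs) (cohull b xs) W k (hull_out ?n) $$ (w, i) =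
       k $$ (w, i) * u ^ co (phull b xs ! i) (cohull b xs ! i) (W ! w)"
    "tmul u (phull b xs) (cohull b xs) W k (hull_out ?n) $$ (w, ?n + i) =
       - (k $$ (w, i) * u ^ co (phull b xs ! (?n + i)) (cohull b xs ! i) (W ! w))"
    using assms by (simp_all add: tmul_index hull_out_def sum_select sum_negf)
qed

lemma hull_obj:
  assumes "\<And>x y. (x, y) \<in> set xs \<Longrightarrow> \<bar>x - y\<bar> \<le> b" "0 < b"
  shows "obj_list xs \<in> lists (X_set b)" "phull b xs \<in> lists (X_set b)" "cohull b xs \<in> lists (X_set b)"
proof -
  have "\<bar>x - y\<bar> \<le> b \<Longrightarrow> M_orb x y \<in> X_set b \<and> M_orb x (x + b) \<in> X_set b \<and> M_orb (y + b) y \<in> X_set b \<and>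
      M_orb (y + b) (x + b) \<in> X_set b" for x y
    using assms(2) by (intro conjI M_orb_in) linarith+
  then show "obj_list xs \<in> lists (X_set b)" "phull b xs \<in> lists (X_set b)" "cohull b xs \<in> lists (X_set b)"
    using assms(1) by (auto simp: obj_list_def phull_def cohull_def in_lists_conv_set)
qed

lemma hull_boundary:
  assumes "\<And>x y. (x, y) \<in> set xs \<Longrightarrow> \<bar>x - y\<bar> \<le> b" "0 < b" "b \<le> pi"
  shows "boundary b (phull b xs)"
proof -
  have "\<not> nz b (M_orb x (x + b)) (M_orb x (x + b))" "\<not> nz b (M_orb (x + b) x) (M_orb (x + b) x)" for x
    using nz_self_iff[OF M_orb_in assms(3) M_orb_self] assms(2) by auto
  then show ?thesis by (auto simp: boundary_def phull_def)
qed

lemma obj_listE: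
  assumes "X \<in> lists (X_set b)"
  obtains xs where "X = obj_list xs" "\<And>x y. (x, y) \<in> set xs \<Longrightarrow> \<bar>x - y\<bar> \<le> b"
proof -
  have "\<exists>xs. X = obj_list xs \<and> (\<forall>(x, y) \<in> set xs. \<bar>x - y\<bar> \<le> b)"
    using assms
  proof (induction X rule: lists.induct)
    case Nil
    then show ?case by (auto simp: obj_list_def)
  next
    case (Cons a l)
    then obtain xs where xs: "l = obj_list xs" "\<forall>(x, y) \<in> set xs. \<bar>x - y\<bar> \<le> b" by blast
    obtain x y where "a = M_orb x y" "\<bar>x - y\<bar> \<le> b" using Cons(1) by (elim X_setE)
    then show ?case using xs by (intro exI[of _ "(x, y) # xs"]) (auto simp: obj_list_def)
  qed
  then show ?thesis using that by auto
qed

text \<open>Solved entry by entry: at a null position one hull corner has exponent 0 and takes the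
  whole entry; elsewhere the entry is divisible by \<open>u\<close>, which pays for the exponent of
  the first corner, at most 1.\<close>

lemma nul_factors_through_hull:
  assumes "\<And>x y. (x, y) \<in> set xs \<Longrightarrow> \<bar>x - y\<bar> \<le> b" "b \<le> pi" "Y \<in> lists (X_set b)"
    and f: "f \<in> carrier_mat (length Y) (length xs)" "nul u b (obj_list xs) Y f"
  obtains h where "h \<in> carrier_mat (length Y) (length xs + length xs)"
    "tmul u (obj_list xs) (phull b xs) Y h (hull_in (length xs)) = f"
proof -
  let ?n = "length xs"
  let ?c1 = "\<lambda>k i. co (obj_list xs ! i) (phull b xs ! i) (Y ! k)"
  let ?c2 = "\<lambda>k i. co (obj_list xs ! i) (phull b xs ! (?n + i)) (Y ! k)"
  have "\<exists>a c. a * u ^ ?c1 k i + c * u ^ ?c2 k i = f $$ (k, i)" if ki: "k < length Y" "i < ?n" for k i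
  proof -
    obtain x y where xy: "xs ! i = (x, y)" by (cases "xs ! i")
    have "(x, y) \<in> set xs" using nth_mem[OF ki(2)] xy by simp
    then have b: "\<bar>x - y\<bar> \<le> b" using assms(1) by blast
    have Y: "Y ! k \<in> X_set b" using X_nth assms(3) ki by blast
    note nth = hull_nth[OF ki(2)]
    note hf = hull_factor[OF b assms(2) Y]
    show ?thesis
    proof (cases "nz b (M_orb x y) (Y ! k)")
      case False
      then show ?thesis
        using hf(1)[OF False] xy by (auto simp: nth intro: exI[of _ 0] exI[of _ "f $$ (k, i)"])
    next
      case True
      then have "u dvd f $$ (k, i)" using f(2) ki xy by (simp add: nul_def nth)
      then obtain g where g: "f $$ (k, i) = u * g" by (elim dvdE)
      have "co (M_orb x y) (M_orb x (x + b)) (Y ! k) = 0 \<or> co (M_orb x y) (M_orb x (x + b)) (Y ! k) = 1"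
        using hf(2) by linarith
      then show ?thesis
      proof
        assume "co (M_orb x y) (M_orb x (x + b)) (Y ! k) = 0"
        then show ?thesis using xy by (intro exI[of _ "u * g"] exI[of _ 0]) (simp add: nth g)
      next
        assume "co (M_orb x y) (M_orb x (x + b)) (Y ! k) = 1"
        then show ?thesis using xy by (intro exI[of _ g] exI[of _ 0]) (simp add: nth g)
      qed
    qed
  qed
  then obtain a c where ac: "\<And>k i. k < length Y \<Longrightarrow> i < ?n \<Longrightarrow> a k i * u ^ ?c1 k i + c k i * u ^ ?c2 k i = f $$ (k, i)"
    by metis
  define h where "h = mat (length Y) (?n + ?n) (\<lambda>(k, l). if l < ?n then a k l else c k (l - ?n))"
  have "tmul u (obj_list xs) (phull b xs) Y h (hull_in ?n) = f"
  proof (rule eq_matI)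
    fix k i assume "k < dim_row f" "i < dim_col f"
    then have ki: "k < length Y" "i < ?n" using f by auto
    show "tmul u (obj_list xs) (phull b xs) Y h (hull_in ?n) $$ (k, i) = f $$ (k, i)"
      unfolding tmul_hull_in_right[OF ki] using ac[OF ki] ki by (simp add: h_def)
  qed (use f in auto)
  then show ?thesis using that[of h] by (simp add: h_def)
qed

subsection \<open>The ring\<close>

lemma dvd_principal: "a \<in> principal_ideal u \<longleftrightarrow> u dvd (a::'r::comm_ring_1)"
  by (auto simp: principal_ideal_def dvd_def mult.commute)

lemma injectiveD: "injective C S I \<Longrightarrow> inflation S X Y f \<Longrightarrow> h \<in> Mor C X I \<Longrightarrow> \<exists>k \<in> Mor C Y I. Comp C X Y I k f = h"
  unfolding injective_def by blast

lemma projectiveD: "projective C S P \<Longrightarrow> deflation S Y Z g \<Longrightarrow> h \<in> Mor C P Z \<Longrightarrow> \<exists>k \<in> Mor C P Y. Comp C P Y Z g k = h"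
  unfolding projective_def by blast

locale dvr =
  fixes u :: "'r::idom"
  assumes uniformizer: "dvr_uniformizer u" and two: "2 \<notin> principal_ideal u"
begin

lemma u_nonzero: "u \<noteq> 0"
  using uniformizer by (simp add: dvr_uniformizer_def)

lemma u_maximal: "maximal_ideal (principal_ideal u)" "maximal_ideal I \<Longrightarrow> I = principal_ideal u"
  using uniformizer by (auto simp: dvr_uniformizer_def)

lemma u_not_unit: "\<not> u dvd 1"
proof
  assume "u dvd 1"
  then have "principal_ideal u = UNIV" by (auto simp: dvd_principal intro: dvd_trans[OF _ one_dvd])
  then show False using u_maximal(1) by (simp add: maximal_ideal_def)
qed

lemma u_power_dvd_1: "u ^ n dvd 1 \<longleftrightarrow> n = 0"
proof
  assume *: "u ^ n dvd 1"
  show "n = 0"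
  proof (cases n)
    case (Suc m)
    then have "u dvd u ^ n" by simp
    then show ?thesis using * u_not_unit dvd_trans by blast
  qed simp
qed simp

text \<open>Zorn's lemma, applied to the proper ideals containing \<open>a\<close>, yields a maximal
  ideal, and \<open>principal_ideal u\<close> is the only one.\<close>

lemma nonunit_in_maximal:
  fixes a :: 'r
  assumes "\<not> a dvd 1" shows "u dvd a"
proof -
  define A where "A = {I. ring_ideal I \<and> a \<in> I \<and> 1 \<notin> I}"
  have "ring_ideal (principal_ideal a)"
    unfolding ring_ideal_def by (auto simp: dvd_principal intro: dvd_add dvd_mult)
  then have ne: "principal_ideal a \<in> A" using assms by (simp add: A_def dvd_principal)
  have "\<exists>M \<in> A. \<forall>X \<in> A. M \<subseteq> X \<longrightarrow> X = M"
  proof (rule subset_Zorn_nonempty)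
    show "A \<noteq> {}" using ne by blast
    fix c assume c: "c \<noteq> {}" "subset.chain A c"
    then have cA: "I \<in> A" if "I \<in> c" for I using that by (auto simp: subset_chain_def)
    have tot: "I \<subseteq> J \<or> J \<subseteq> I" if "I \<in> c" "J \<in> c" for I J using that c by (auto simp: subset_chain_def)
    have "ring_ideal (\<Union> c)"
      unfolding ring_ideal_def
    proof (intro conjI ballI allI)
      show "0 \<in> \<Union> c" using c(1) cA by (auto simp: A_def ring_ideal_def)
      fix x y assume "x \<in> \<Union> c" "y \<in> \<Union> c"
      then obtain I J where IJ: "I \<in> c" "x \<in> I" "J \<in> c" "y \<in> J" by blast
      then have "\<exists>K \<in> c. x \<in> K \<and> y \<in> K" using tot by blast
      then obtain K where K: "K \<in> c" "x \<in> K" "y \<in> K" by blast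
      then have "ring_ideal K" using cA by (simp add: A_def)
      then have "x + y \<in> K" using K by (simp add: ring_ideal_def)
      then show "x + y \<in> \<Union> c" using K by blast
    next
      fix r x assume "x \<in> \<Union> c"
      then obtain K where K: "K \<in> c" "x \<in> K" by blast
      then have "ring_ideal K" using cA by (simp add: A_def)
      then have "r * x \<in> K" using K by (simp add: ring_ideal_def)
      then show "r * x \<in> \<Union> c" using K by blast
    qed
    then show "\<Union> c \<in> A" using cA c(1) by (auto simp: A_def)
  qed
  then obtain M where M: "M \<in> A" "\<And>X. X \<in> A \<Longrightarrow> M \<subseteq> X \<Longrightarrow> X = M" by blast
  have "maximal_ideal M"
    unfolding maximal_ideal_def
  proof (intro conjI allI impI)
    show "ring_ideal M" "M \<noteq> UNIV" using M(1) by (auto simp: A_def)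
    fix J assume J: "ring_ideal J" "M \<subseteq> J"
    show "J = M \<or> J = UNIV"
    proof (cases "1 \<in> J")
      case True
      have "x \<in> J" for x
        using J(1) True unfolding ring_ideal_def by (metis mult.right_neutral)
      then show ?thesis by blast
    next
      case False
      then show ?thesis using M J by (auto simp: A_def)
    qed
  qed
  then have "M = principal_ideal u" by (rule u_maximal)
  then show ?thesis using M(1) by (auto simp: A_def dvd_principal)
qed

lemma unit_iff: "a dvd 1 \<longleftrightarrow> \<not> u dvd a"
  using nonunit_in_maximal u_not_unit dvd_trans by blast

lemma half: obtains h where "2 * h = (1::'r)"
  using two unit_iff[of 2] unfolding dvd_principal by (metis dvdE)

lemma u_dvd_mult: "u dvd a * c \<longleftrightarrow> u dvd a \<or> u dvd c"
  using unit_iff[of a] unit_iff[of c] unit_iff[of "a * c"] mult_dvd_mono[of a 1 c 1] by auto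

end

section \<open>Identification of the exact structure of F_b\<close>

locale F_structure = dvr u for u :: "'r::idom" +
  fixes b :: real and S :: "(obj, 'r mat) ses set"
  assumes b_pos: "0 < b" and b_le: "b \<le> pi" and exact_str: "F_exact_structure u b S"
begin

lemma frob: "frobenius (F_cat u b) S"
  using exact_str by (simp add: F_exact_structure_def)

sublocale F: exact_category "F_cat u b" S
proof -
  interpret preadditive "F_cat u b" by (rule preadditive_F)
  show "exact_category (F_cat u b) S"
    by unfold_locales (use frob in \<open>simp add: frobenius_def\<close>)
qed

lemma projective_iff_injective: "projective (F_cat u b) S X \<longleftrightarrow> injective (F_cat u b) S X"
  using frob by (simp add: frobenius_def)

lemma injective_hull_exists:
  assumes "X \<in> lists (X_set b)"
  obtains I f where "injective (F_cat u b) S I" "inflation S X I f"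
  using frob assms unfolding frobenius_def F_cat_simps by blast

text \<open>If both summands were non-empty, an entry of \<open>q\<close> and one of
  \<open>i\<close> would be non-zero, being factors of 1, while their product with a power of
  \<open>u\<close> vanishes; this is impossible in a domain.\<close>

lemma single_indecomposable:
  assumes "P \<in> X_set b" shows "indecomposable (F_cat u b) [P]"
  unfolding indecomposable_def
proof (intro conjI ballI impI)
  show "[P] \<in> Obj (F_cat u b)" using assms by simp
  have "(1\<^sub>m 1 :: 'r mat) $$ (0, 0) \<noteq> 0\<^sub>m 1 1 $$ (0, 0)" by simp
  then have "(1\<^sub>m 1 :: 'r mat) \<noteq> 0\<^sub>m 1 1" by metis
  then show "\<not> zero_object (F_cat u b) [P]" by (simp add: zero_object_def)
  fix A B assume "A \<in> Obj (F_cat u b)" "B \<in> Obj (F_cat u b)" "direct_sum (F_cat u b) [P] A B"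
  then obtain i j p q :: "'r mat" where
    eq: "tmul u A [P] A p i = 1\<^sub>m (length A)" "tmul u B [P] B q j = 1\<^sub>m (length B)"
      "tmul u A [P] B q i = 0\<^sub>m (length B) (length A)"
    unfolding direct_sum_def F_cat_simps by blast
  have A0: "p $$ (k, 0) * i $$ (0, k) * u ^ co (A ! k) P (A ! k) = 1" if "k < length A" for k
    using arg_cong[OF eq(1), of "\<lambda>m. m $$ (k, k)"] that by (simp add: tmul_index lessThan_Suc)
  have A1: "p $$ (k, 0) * i $$ (0, l) * u ^ co (A ! l) P (A ! k) = 0" if "k < length A" "l < length A" "k \<noteq> l" for k l
    using arg_cong[OF eq(1), of "\<lambda>m. m $$ (k, l)"] that by (simp add: tmul_index lessThan_Suc)
  have B0: "q $$ (k, 0) * j $$ (0, k) * u ^ co (B ! k) P (B ! k) = 1" if "k < length B" for k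
    using arg_cong[OF eq(2), of "\<lambda>m. m $$ (k, k)"] that by (simp add: tmul_index lessThan_Suc)
  have C0: "q $$ (k, 0) * i $$ (0, l) * u ^ co (A ! l) P (B ! k) = 0" if "k < length B" "l < length A" for k l
    using arg_cong[OF eq(3), of "\<lambda>m. m $$ (k, l)"] that by (simp add: tmul_index lessThan_Suc)
  have "length A = 0 \<or> length B = 0"
  proof (rule ccontr)
    assume "\<not> ?thesis"
    then have "0 < length A" "0 < length B" by auto
    then show False using A0[of 0] B0[of 0] C0[of 0 0] u_nonzero by auto
  qed
  then show "zero_object (F_cat u b) A \<or> zero_object (F_cat u b) B"
    using \<open>A \<in> _\<close> \<open>B \<in> _\<close> by (auto simp: zero_object_def intro: eq_matI)
qed

text \<open>The exact structure describes its indecomposable projective-injectives only up to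
  isomorphism. Mutually inverse maps compose to 1, so the exponent of the round trip is 0 and
  \<open>co_back_forth\<close> identifies the coordinates.\<close>

lemma projective_single_iff:
  assumes "P \<in> X_set b"
  shows "projective (F_cat u b) S [P] \<longleftrightarrow> \<not> nz b P P"
proof -
  have key: "projective (F_cat u b) S [P] \<longleftrightarrow> (\<exists>x y. \<bar>x - y\<bar> = b \<and> isomorphic (F_cat u b) [P] [M_orb x y])"
  proof -
    have "[P] \<in> Obj (F_cat u b)" using assms by simp
    then have "indecomposable (F_cat u b) [P] \<and> projective (F_cat u b) S [P] \<and> injective (F_cat u b) S [P] \<longleftrightarrow>
        (\<exists>x y. \<bar>x - y\<bar> = b \<and> isomorphic (F_cat u b) [P] [M_orb x y])"
      using exact_str unfolding F_exact_structure_def by blast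
    then show ?thesis using single_indecomposable[OF assms] projective_iff_injective[of "[P]"] by blast
  qed
  obtain x y where P: "P = M_orb x y" "\<bar>x - y\<bar> \<le> b" using assms by (elim X_setE)
  have nz: "nz b P P \<longleftrightarrow> \<bar>x - y\<bar> < b" using nz_self_iff[OF assms b_le] P M_orb_self by blast
  show ?thesis
  proof
    assume "projective (F_cat u b) S [P]"
    then obtain x' y' where xy: "\<bar>x' - y'\<bar> = b" "isomorphic (F_cat u b) [P] [M_orb x' y']" using key by blast
    then obtain f g :: "'r mat" where fg: "tmul u [P] [M_orb x' y'] [P] g f = 1\<^sub>m 1"
      unfolding isomorphic_def isomorphism_def by auto
    have "g $$ (0, 0) * f $$ (0, 0) * u ^ co P (M_orb x' y') P = 1"
      using arg_cong[OF fg, of "\<lambda>m. m $$ (0, 0)"] by (simp add: tmul_index lessThan_Suc)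
    then have "u ^ co P (M_orb x' y') P dvd 1" by (metis dvd_triv_right)
    then have "co P (M_orb x' y') P = 0" using u_power_dvd_1 by blast
    moreover have M: "M_orb x' y' \<in> X_set pi" "P \<in> X_set pi"
      using subsetD[OF X_set_mono[OF b_le] assms] M_orb_in[of x' y' pi] xy b_le by auto
    ultimately have "same_coords P (M_orb x' y')" using co_back_forth by blast
    then obtain a c e e' where ac: "(a, c, e) \<in> P" "(a, c, e') \<in> M_orb x' y'" by (auto simp: same_coords_def)
    have Mb: "M_orb x' y' \<in> X_set b" using xy(1) by (intro M_orb_in) simp
    have "\<not> nz b (M_orb x' y') (M_orb x' y')" using nz_self_iff[OF Mb b_le M_orb_self] xy(1) by simp
    then show "\<not> nz b P P"
      using nz_self_iff[OF Mb b_le ac(2)] nz_self_iff[OF assms b_le ac(1)] by blast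
  next
    assume "\<not> nz b P P"
    then have "\<bar>x - y\<bar> = b" using nz P by linarith
    moreover have "isomorphic (F_cat u b) [P] [M_orb x y]"
      using F.isomorphism_id[of "[P]"] assms P unfolding isomorphic_def by auto
    ultimately show "projective (F_cat u b) S [P]" using key by blast
  qed
qed

lemma projective_entries:
  assumes "P \<in> lists (X_set b)"
  shows "projective (F_cat u b) S P \<longleftrightarrow> (\<forall>k < length P. projective (F_cat u b) S [P ! k])"
proof (intro iffI allI impI)
  fix k assume proj: "projective (F_cat u b) S P" and k: "k < length P"
  show "projective (F_cat u b) S [P ! k]"
    unfolding projective_def
  proof (intro conjI allI ballI impI)
    show "[P ! k] \<in> Obj (F_cat u b)" using assms k by (auto simp: in_lists_conv_set)
    fix Y Z g h assume h: "h \<in> Mor (F_cat u b) [P ! k] Z" and g: "deflation S Y Z g"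
    define H where "H = mat (length Z) (length P) (\<lambda>(i, l). if l = k then h $$ (i, 0) else 0)"
    obtain K where K: "K \<in> carrier_mat (length Y) (length P)" "tmul u P Y Z g K = H"
      using proj g unfolding projective_def F_cat_simps H_def by (metis mat_carrier)
    define m where "m = mat (length Y) 1 (\<lambda>(i, l). K $$ (i, k))"
    have "tmul u [P ! k] Y Z g m = h"
    proof (rule eq_matI)
      fix i l assume "i < dim_row h" "l < dim_col h"
      then have il: "i < length Z" "l = 0" using h by auto
      then have "tmul u [P ! k] Y Z g m $$ (i, l) = tmul u P Y Z g K $$ (i, k)"
        using k by (simp add: tmul_index m_def)
      then show "tmul u [P ! k] Y Z g m $$ (i, l) = h $$ (i, l)" using K il k by (simp add: H_def)
    qed (use h in auto)
    then show "\<exists>k' \<in> Mor (F_cat u b) [P ! k] Y. Comp (F_cat u b) [P ! k] Y Z g k' = h"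
      by (auto simp: m_def)
  qed
next
  assume proj: "\<forall>k < length P. projective (F_cat u b) S [P ! k]"
  show "projective (F_cat u b) S P"
    unfolding projective_def
  proof (intro conjI allI ballI impI)
    show "P \<in> Obj (F_cat u b)" using assms by simp
    fix Y Z g h assume h: "h \<in> Mor (F_cat u b) P Z" and g: "deflation S Y Z g"
    have "\<exists>m. m \<in> carrier_mat (length Y) 1 \<and>
        tmul u [P ! k] Y Z g m = mat (length Z) 1 (\<lambda>(i, l). h $$ (i, k))" if "k < length P" for k
      using proj g that unfolding projective_def by simp (metis mat_carrier)
    then obtain m where m: "\<And>k. k < length P \<Longrightarrow> m k \<in> carrier_mat (length Y) 1 \<and>
        tmul u [P ! k] Y Z g (m k) = mat (length Z) 1 (\<lambda>(i, l). h $$ (i, k))" by metis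
    define K where "K = mat (length Y) (length P) (\<lambda>(i, k). m k $$ (i, 0))"
    have "tmul u P Y Z g K = h"
    proof (rule eq_matI)
      fix i k assume "i < dim_row h" "k < dim_col h"
      then have ik: "i < length Z" "k < length P" using h by auto
      then have "tmul u P Y Z g K $$ (i, k) = tmul u [P ! k] Y Z g (m k) $$ (i, 0)"
        by (simp add: tmul_index K_def)
      then show "tmul u P Y Z g K $$ (i, k) = h $$ (i, k)" using m[OF ik(2)] ik by simp
    qed (use h in auto)
    then show "\<exists>k \<in> Mor (F_cat u b) P Y. Comp (F_cat u b) P Y Z g k = h"
      by (auto simp: K_def)
  qed
qed

lemma projective_iff_boundary:
  assumes "P \<in> lists (X_set b)"
  shows "projective (F_cat u b) S P \<longleftrightarrow> boundary b P"
proof -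
  have "projective (F_cat u b) S [P ! k] \<longleftrightarrow> \<not> nz b (P ! k) (P ! k)" if "k < length P" for k
    using projective_single_iff X_nth[OF assms order_refl that] by blast
  then show ?thesis unfolding projective_entries[OF assms] boundary_def all_set_conv_all_nth by blast
qed

text \<open>The equations say that \<open>h\<close> and \<open>h'\<close> are in the ratio of
  \<open>u ^ \<gamma>\<close> to \<open>u ^ \<delta>\<close>. If one of these powers is 1, the
  corresponding entry is itself the common factor \<open>k\<close>.\<close>

lemma scalar_factor:
  assumes "h * u ^ \<alpha> = h' * u ^ \<beta>" "\<alpha> + \<gamma> = \<beta> + \<delta>" "\<gamma> = 0 \<or> \<delta> = 0"
  shows "\<exists>k. h = k * u ^ \<gamma> \<and> h' = k * u ^ \<delta>"
  using assms(3)
proof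
  assume "\<gamma> = 0"
  then have "h' * u ^ \<beta> = h * u ^ \<delta> * u ^ \<beta>" using assms(1)[symmetric] assms(2) by (simp add: power_add mult_ac)
  then have "h' = h * u ^ \<delta>" using mult_right_cancel[of "u ^ \<beta>"] u_nonzero by simp
  then show ?thesis using \<open>\<gamma> = 0\<close> by (intro exI[of _ h]) simp
next
  assume "\<delta> = 0"
  then have "h * u ^ \<alpha> = h' * u ^ \<gamma> * u ^ \<alpha>" using assms(1) assms(2)[symmetric] by (simp add: power_add mult_ac)
  then have "h = h' * u ^ \<gamma>" using mult_right_cancel[of "u ^ \<alpha>"] u_nonzero by simp
  then show ?thesis using \<open>\<delta> = 0\<close> by (intro exI[of _ h']) simp
qed

context
  fixes xs :: "(real \<times> real) list"
  assumes inner: "\<And>x y. (x, y) \<in> set xs \<Longrightarrow> \<bar>x - y\<bar> < b"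
begin

abbreviation (input) "hX \<equiv> obj_list xs"
abbreviation (input) "hP \<equiv> phull b xs"
abbreviation (input) "hC \<equiv> cohull b xs"
abbreviation (input) "hn \<equiv> length xs"

lemma hull_objs: "hX \<in> lists (X_set b)" "hP \<in> lists (X_set b)" "hC \<in> lists (X_set b)"
  using inner b_pos by (intro hull_obj; force)+

lemma inner_nth: "i < hn \<Longrightarrow> \<bar>fst (xs ! i) - snd (xs ! i)\<bar> < b"
  using inner[of "fst (xs ! i)" "snd (xs ! i)"] by simp

lemma hull_comp_zero: "tmul u hX hP hC (hull_out hn) (hull_in hn) = 0\<^sub>m hn hn"
proof (rule eq_matI)
  fix k i assume "k < dim_row (0\<^sub>m hn hn :: 'r mat)" "i < dim_col (0\<^sub>m hn hn :: 'r mat)"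
  then have ki: "k < hn" "i < hn" by auto
  have "co (hX ! i) (hP ! i) (hC ! i) = co (hX ! i) (hP ! (hn + i)) (hC ! i)"
    using hull_co[OF inner_nth[OF ki(2)] b_le] by (simp add: hull_nth[OF ki(2)])
  then show "tmul u hX hP hC (hull_out hn) (hull_in hn) $$ (k, i) = (0\<^sub>m hn hn :: 'r mat) $$ (k, i)"
    using ki tmul_hull_in_right[of k hC i xs u b "hull_out hn"] by (auto simp: hull_out_def)
qed simp_all

lemma hull_cokernel: "is_cokernel (F_cat u b) hX (hull_in hn) hP (hull_out hn) hC"
  unfolding is_cokernel_def F_cat_simps
proof (intro conjI ballI impI)
  fix W h assume W: "W \<in> lists (X_set b)" and h: "h \<in> carrier_mat (length W) (length hP)"
    and zero: "tmul u hX hP W h (hull_in hn) = 0\<^sub>m (length W) (length hX)"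
  let ?c1 = "\<lambda>w i. co (hP ! i) (hC ! i) (W ! w)" and ?c2 = "\<lambda>w i. co (hP ! (hn + i)) (hC ! i) (W ! w)"
  have ex: "\<exists>k. h $$ (w, i) = k * u ^ ?c1 w i \<and> - h $$ (w, hn + i) = k * u ^ ?c2 w i"
    if wi: "w < length W" "i < hn" for w i
  proof (rule scalar_factor)
    show "h $$ (w, i) * u ^ co (hX ! i) (hP ! i) (W ! w) =
        - h $$ (w, hn + i) * u ^ co (hX ! i) (hP ! (hn + i)) (W ! w)"
      using arg_cong[OF zero, of "\<lambda>m. m $$ (w, i)"] wi
      by (simp add: tmul_hull_in_right eq_neg_iff_add_eq_0)
    show "co (hX ! i) (hP ! i) (W ! w) + ?c1 w i = co (hX ! i) (hP ! (hn + i)) (W ! w) + ?c2 w i"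
      using co_cocycle[of "hX ! i" "hP ! i" "hC ! i" "W ! w"] co_cocycle[of "hX ! i" "hP ! (hn + i)" "hC ! i" "W ! w"]
        hull_co[OF inner_nth[OF wi(2)] b_le] by (simp add: hull_nth[OF wi(2)])
    show "?c1 w i = 0 \<or> ?c2 w i = 0"
      using hull_cokernel_co[OF inner_nth[OF wi(2)] b_le X_nth[OF W order_refl wi(1)]]
      by (simp add: hull_nth[OF wi(2)])
  qed
  then obtain k where k: "\<And>w i. w < length W \<Longrightarrow> i < hn \<Longrightarrow>
      h $$ (w, i) = k w i * u ^ ?c1 w i \<and> - h $$ (w, hn + i) = k w i * u ^ ?c2 w i" by metis
  define K where "K = mat (length W) hn (\<lambda>(w, i). k w i)"
  show "\<exists>!k. k \<in> carrier_mat (length W) (length hC) \<and> tmul u hP hC W k (hull_out hn) = h"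
  proof (rule ex1I[of _ K])
    have "tmul u hP hC W K (hull_out hn) = h"
    proof (rule eq_matI)
      fix w l assume "w < dim_row h" "l < dim_col h"
      then have wl: "w < length W" "l < hn + hn" using h by auto
      show "tmul u hP hC W K (hull_out hn) $$ (w, l) = h $$ (w, l)"
      proof (cases "l < hn")
        case True
        then show ?thesis using wl k[of w l] by (simp add: tmul_hull_out_right K_def)
      next
        case False
        then obtain i where i: "l = hn + i" "i < hn" using wl by (metis add_less_cancel_left le_Suc_ex not_less)
        have "- h $$ (w, hn + i) = k w i * u ^ ?c2 w i" using k[of w i] wl i by blast
        then have "h $$ (w, hn + i) = - (k w i * u ^ ?c2 w i)" by (metis minus_minus)
        then show ?thesis using wl i by (simp add: tmul_hull_out_right K_def)
      qed
    qed (use h in auto)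
    then show "K \<in> carrier_mat (length W) (length hC) \<and> tmul u hP hC W K (hull_out hn) = h"
      by (simp add: K_def)
    fix K' assume K': "K' \<in> carrier_mat (length W) (length hC) \<and> tmul u hP hC W K' (hull_out hn) = h"
    show "K' = K"
    proof (rule eq_matI)
      fix w i assume "w < dim_row K" "i < dim_col K"
      then have wi: "w < length W" "i < hn" by (auto simp: K_def)
      have "K' $$ (w, i) * u ^ ?c1 w i = h $$ (w, i)"
        using K' tmul_hull_out_right(1)[OF wi, of u b K'] by simp
      then show "K' $$ (w, i) = K $$ (w, i)" using k[OF wi] wi u_nonzero by (simp add: K_def)
    qed (use K' in \<open>auto simp: K_def\<close>)
  qed
qed (simp_all add: hull_comp_zero)

lemma hull_kernel: "is_kernel (F_cat u b) hX (hull_in hn) hP (hull_out hn) hC"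
  unfolding is_kernel_def F_cat_simps
proof (intro conjI ballI impI)
  fix W h assume W: "W \<in> lists (X_set b)" and h: "h \<in> carrier_mat (length hP) (length W)"
    and zero: "tmul u W hP hC (hull_out hn) h = 0\<^sub>m (length hC) (length W)"
  let ?c1 = "\<lambda>w i. co (W ! w) (hX ! i) (hP ! i)" and ?c2 = "\<lambda>w i. co (W ! w) (hX ! i) (hP ! (hn + i))"
  have ex: "\<exists>k. h $$ (i, w) = k * u ^ ?c1 w i \<and> h $$ (hn + i, w) = k * u ^ ?c2 w i"
    if wi: "w < length W" "i < hn" for w i
  proof (rule scalar_factor)
    show "h $$ (i, w) * u ^ co (W ! w) (hP ! i) (hC ! i) =
        h $$ (hn + i, w) * u ^ co (W ! w) (hP ! (hn + i)) (hC ! i)"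
      using arg_cong[OF zero, of "\<lambda>m. m $$ (i, w)"] wi by (simp add: tmul_hull_out_left)
    show "co (W ! w) (hP ! i) (hC ! i) + ?c1 w i = co (W ! w) (hP ! (hn + i)) (hC ! i) + ?c2 w i"
      using co_cocycle[of "W ! w" "hX ! i" "hP ! i" "hC ! i"] co_cocycle[of "W ! w" "hX ! i" "hP ! (hn + i)" "hC ! i"]
        hull_co[OF inner_nth[OF wi(2)] b_le] by (simp add: hull_nth[OF wi(2)])
    show "?c1 w i = 0 \<or> ?c2 w i = 0"
      using hull_kernel_co[OF inner_nth[OF wi(2)] b_le X_nth[OF W order_refl wi(1)]]
      by (simp add: hull_nth[OF wi(2)])
  qed
  then obtain k where k: "\<And>w i. w < length W \<Longrightarrow> i < hn \<Longrightarrow>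
      h $$ (i, w) = k w i * u ^ ?c1 w i \<and> h $$ (hn + i, w) = k w i * u ^ ?c2 w i" by metis
  define K where "K = mat hn (length W) (\<lambda>(i, w). k w i)"
  show "\<exists>!k. k \<in> carrier_mat (length hX) (length W) \<and> tmul u W hX hP (hull_in hn) k = h"
  proof (rule ex1I[of _ K])
    have "tmul u W hX hP (hull_in hn) K = h"
    proof (rule eq_matI)
      fix l w assume "l < dim_row h" "w < dim_col h"
      then have wl: "w < length W" "l < hn + hn" using h by auto
      show "tmul u W hX hP (hull_in hn) K $$ (l, w) = h $$ (l, w)"
      proof (cases "l < hn")
        case True
        then show ?thesis using wl k[of w l] by (simp add: tmul_hull_in_left K_def)
      next
        case False
        then obtain i where i: "l = hn + i" "i < hn" using wl by (metis add_less_cancel_left le_Suc_ex not_less)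
        then show ?thesis using wl k[of w i] by (simp add: tmul_hull_in_left K_def)
      qed
    qed (use h in auto)
    then show "K \<in> carrier_mat (length hX) (length W) \<and> tmul u W hX hP (hull_in hn) K = h"
      by (simp add: K_def)
    fix K' assume K': "K' \<in> carrier_mat (length hX) (length W) \<and> tmul u W hX hP (hull_in hn) K' = h"
    show "K' = K"
    proof (rule eq_matI)
      fix i w assume "i < dim_row K" "w < dim_col K"
      then have wi: "w < length W" "i < hn" by (auto simp: K_def)
      have "K' $$ (i, w) * u ^ ?c1 w i = h $$ (i, w)"
        using K' tmul_hull_in_left(1)[OF wi, of u b K'] by simp
      then show "K' $$ (i, w) = K $$ (i, w)" using k[OF wi] wi u_nonzero by (simp add: K_def)
    qed (use K' in \<open>auto simp: K_def\<close>)
  qed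
qed (simp_all add: hull_comp_zero)

text \<open>The Frobenius property provides some inflation \<open>i\<close> into an injective
  \<open>I\<close>. All orbits of \<open>I\<close> lie on the boundary, so \<open>i\<close> is null
  and factors through \<open>hull_in\<close>; the hull is injective as well, so
  \<open>hull_in\<close> factors through \<open>i\<close>. These are the inputs of
  \<open>ses_of_equivalent_inflation\<close>.\<close>

lemma hull_ses: "(hX, hull_in hn, hP, hull_out hn, hC) \<in> S"
proof -
  obtain I i where I: "injective (F_cat u b) S I" "inflation S hX I i"
    using injective_hull_exists[OF hull_objs(1)] .
  have IO: "I \<in> lists (X_set b)" using I(1) by (simp add: injective_def)
  have i: "i \<in> carrier_mat (length I) hn" using I(2) F.ses_hom unfolding inflation_def by fastforce
  have le: "\<bar>x - y\<bar> \<le> b" if "(x, y) \<in> set xs" for x y using inner[OF that] by simp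
  have "boundary b I" using I(1) projective_iff_injective projective_iff_boundary[OF IO] by blast
  then have "nul u b hX I i" using boundary_nul[OF hull_objs(1) IO b_le] by blast
  then obtain h where h: "h \<in> carrier_mat (length I) (hn + hn)" "tmul u hX hP I h (hull_in hn) = i"
    using nul_factors_through_hull[OF le b_le IO i] by blast
  have "projective (F_cat u b) S hP"
    using projective_iff_boundary[OF hull_objs(2)] hull_boundary[OF le b_pos b_le] by blast
  then have "injective (F_cat u b) S hP" using projective_iff_injective by blast
  then obtain k where k: "k \<in> carrier_mat (hn + hn) (length I)" "tmul u hX I hP k i = hull_in hn"
    using injectiveD[of "F_cat u b" S hP hX I i "hull_in hn"] I(2) by auto
  show ?thesis
    by (rule F.ses_of_equivalent_inflation[OF I(2) _ _ _ _ _ direct_sum_append _ _ _ _ hull_kernel hull_cokernel])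
       (use IO hull_objs h k in auto)
qed

end

end

section \<open>The category with involution\<close>

lemma psi_length [simp]: "length (psi X) = length X"
  by (simp add: psi_def)

lemma psi_nth: "i < length X \<Longrightarrow> psi X ! i = psi_orb (X ! i)"
  by (simp add: psi_def)

lemma psi_in: "X \<in> lists (X_set b) \<Longrightarrow> psi X \<in> lists (X_set b)"
  unfolding psi_def by (auto simp: in_lists_conv_set intro: psi_orb_in)

lemma psi_psi: "X \<in> lists (X_set b) \<Longrightarrow> psi (psi X) = X"
  by (rule nth_equalityI) (simp_all add: psi_nth psi_orb_psi_orb[OF X_nth[OF _ order_refl]])

lemma tmul_carrier_eq [simp]: "length Z = n \<Longrightarrow> length X = m \<Longrightarrow> tmul u X Y Z g f \<in> carrier_mat n m"
  by auto

lemma tmul_psi: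
  assumes "X \<in> lists (X_set b)" "Y \<in> lists (X_set b)" "Z \<in> lists (X_set b)"
  shows "tmul u (psi X) (psi Y) (psi Z) g f = tmul u X Y Z g f"
proof (rule eq_matI)
  fix k i assume "k < dim_row (tmul u X Y Z g f)" "i < dim_col (tmul u X Y Z g f)"
  then have ki: "k < length Z" "i < length X" by simp_all
  have "co (psi X ! i) (psi Y ! j) (psi Z ! k) = co (X ! i) (Y ! j) (Z ! k)" if "j < length Y" for j
    using ki that co_psi[OF X_nth[OF assms(1) order_refl] X_nth[OF assms(2) order_refl] X_nth[OF assms(3) order_refl]]
    by (simp add: psi_nth)
  then show "tmul u (psi X) (psi Y) (psi Z) g f $$ (k, i) = tmul u X Y Z g f $$ (k, i)"
    using ki by (simp add: tmul_index)
qed simp_all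

text \<open>The map \<open>\<eta> \<circ> \<psi> f \<circ> \<psi> \<xi>\<close>, where
  \<open>\<psi> \<xi>\<close> is the inverse of \<open>\<xi>\<close>; on matrices
  \<open>\<psi>\<close> is the identity and only the objects change. Morphisms of
  \<open>F\<^sub>b\<^sup>\<psi>\<close> are its fixed points, so equivariance becomes invariance
  under an involution.\<close>

definition conj_mor :: "'r::idom \<Rightarrow> 'r pobj \<Rightarrow> 'r pobj \<Rightarrow> 'r mat \<Rightarrow> 'r mat" where
  "conj_mor u A B f = tmul u (fst A) (psi (fst B)) (fst B) (snd B)
     (tmul u (fst A) (psi (fst A)) (psi (fst B)) f (snd A))"

context F_structure
begin

abbreviation PC where "PC \<equiv> Fpsi_cat u b"
abbreviation PS where "PS \<equiv> Fpsi_exact u b S"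
abbreviation cj where "cj \<equiv> conj_mor u"

lemma Fpsi_simps [simp]:
  "Comp PC A B C = tmul u (fst A) (fst B) (fst C)"
  "Idm PC A = 1\<^sub>m (length (fst A))"
  "ZeroM PC A B = 0\<^sub>m (length (fst B)) (length (fst A))"
  "AddM PC = (+)"
  by (simp_all add: Fpsi_cat_def Let_def)

text \<open>The identity for \<open>\<xi>\<close>, read a second time after applying
  \<open>psi\<close>, exhibits an inverse of \<open>\<xi>\<close> and so contains the isomorphism
  condition.\<close>

lemma Fpsi_obj_iff: "A \<in> Obj PC \<longleftrightarrow> fst A \<in> lists (X_set b) \<and> snd A \<in> carrier_mat (length (fst A)) (length (fst A)) \<and>
   tmul u (fst A) (psi (fst A)) (fst A) (snd A) (snd A) = 1\<^sub>m (length (fst A))"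
proof -
  obtain X \<xi> where A: "A = (X, \<xi>)" by (cases A)
  have "isomorphism (F_cat u b) (psi X) X \<xi>"
    if "X \<in> lists (X_set b)" "\<xi> \<in> carrier_mat (length X) (length X)" "tmul u X (psi X) X \<xi> \<xi> = 1\<^sub>m (length X)"
  proof -
    have "tmul u (psi X) X (psi X) \<xi> \<xi> = 1\<^sub>m (length X)"
      using tmul_psi[OF that(1) psi_in[OF that(1)] that(1), of u \<xi> \<xi>] psi_psi[OF that(1)] that(3) by simp
    then show ?thesis using that unfolding isomorphism_def F_cat_simps by auto
  qed
  then show ?thesis unfolding A by (auto simp: Fpsi_cat_def Let_def psi_mor_def isomorphism_def)
qed

lemma obj_list_in: "A \<in> Obj PC \<Longrightarrow> fst A \<in> lists (X_set b)" and
  obj_carrier: "A \<in> Obj PC \<Longrightarrow> snd A \<in> carrier_mat (length (fst A)) (length (fst A))"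
  by (auto simp: Fpsi_obj_iff)

lemma obj_involution: "A \<in> Obj PC \<Longrightarrow> tmul u (fst A) (psi (fst A)) (fst A) (snd A) (snd A) = 1\<^sub>m (length (fst A))"
  by (simp add: Fpsi_obj_iff)

lemma obj_involution': "A \<in> Obj PC \<Longrightarrow> tmul u (psi (fst A)) (fst A) (psi (fst A)) (snd A) (snd A) = 1\<^sub>m (length (fst A))"
  using tmul_psi[OF obj_list_in psi_in[OF obj_list_in] obj_list_in, of A A A u "snd A" "snd A"]
    psi_psi[OF obj_list_in, of A] obj_involution by simp

lemma cancel_involution:
  assumes "A \<in> Obj PC" "g \<in> carrier_mat (length Z) (length (fst A))"
  shows "tmul u (psi (fst A)) (fst A) Z (tmul u (fst A) (psi (fst A)) Z g (snd A)) (snd A) = g"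
    "tmul u (fst A) (psi (fst A)) Z (tmul u (psi (fst A)) (fst A) Z g (snd A)) (snd A) = g"
  using assms tmul_one(2)[of g Z "psi (fst A)" u] obj_involution[of A] obj_involution'[of A]
  unfolding tmul_assoc[symmetric] by simp_all

lemma conj_carrier [simp, intro]: "cj A B f \<in> carrier_mat (length (fst B)) (length (fst A))"
  by (simp add: conj_mor_def)

lemma Fpsi_mor_iff:
  assumes "A \<in> Obj PC" "B \<in> Obj PC"
  shows "f \<in> Mor PC A B \<longleftrightarrow> f \<in> carrier_mat (length (fst B)) (length (fst A)) \<and> cj A B f = f"
proof -
  obtain X \<xi> Y \<eta> where AB: "A = (X, \<xi>)" "B = (Y, \<eta>)" by (cases A; cases B)
  have *: "f \<in> Mor PC A B \<longleftrightarrow> f \<in> carrier_mat (length Y) (length X) \<and>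
      tmul u (psi X) X Y f \<xi> = tmul u (psi X) (psi Y) Y \<eta> f"
    by (simp add: AB Fpsi_cat_def Let_def psi_mor_def)
  have "cj A B f = f \<longleftrightarrow> tmul u (psi X) X Y f \<xi> = tmul u (psi X) (psi Y) Y \<eta> f"
    if f: "f \<in> carrier_mat (length Y) (length X)"
  proof
    assume "cj A B f = f"
    then have "tmul u (psi X) X Y f \<xi> = tmul u (psi X) X Y (tmul u X (psi X) Y (tmul u (psi X) (psi Y) Y \<eta> f) \<xi>) \<xi>"
      by (simp add: conj_mor_def AB tmul_assoc)
    moreover have "tmul u (psi X) X Y (tmul u X (psi X) Y (tmul u (psi X) (psi Y) Y \<eta> f) \<xi>) \<xi>
        = tmul u (psi X) (psi Y) Y \<eta> f"
      using cancel_involution(1)[OF assms(1)[unfolded AB], of "tmul u (psi X) (psi Y) Y \<eta> f" Y] by simp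
    ultimately show "tmul u (psi X) X Y f \<xi> = tmul u (psi X) (psi Y) Y \<eta> f" by (rule trans)
  next
    assume "tmul u (psi X) X Y f \<xi> = tmul u (psi X) (psi Y) Y \<eta> f"
    then have "cj A B f = tmul u X (psi X) Y (tmul u (psi X) X Y f \<xi>) \<xi>"
      by (simp add: conj_mor_def AB tmul_assoc)
    then show "cj A B f = f" using cancel_involution(2)[OF assms(1)] f by (simp add: AB)
  qed
  then show ?thesis using * AB by auto
qed

lemma mor_carrier: "A \<in> Obj PC \<Longrightarrow> B \<in> Obj PC \<Longrightarrow> f \<in> Mor PC A B \<Longrightarrow> f \<in> carrier_mat (length (fst B)) (length (fst A))"
  and mor_conj: "A \<in> Obj PC \<Longrightarrow> B \<in> Obj PC \<Longrightarrow> f \<in> Mor PC A B \<Longrightarrow> cj A B f = f"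
  by (simp_all add: Fpsi_mor_iff)

lemma conj_comp:
  assumes "A \<in> Obj PC" "B \<in> Obj PC" "C \<in> Obj PC"
    "f \<in> carrier_mat (length (fst B)) (length (fst A))" "g \<in> carrier_mat (length (fst C)) (length (fst B))"
  shows "tmul u (fst A) (fst B) (fst C) (cj B C g) (cj A B f) = cj A C (tmul u (fst A) (fst B) (fst C) g f)"
proof -
  have "tmul u (psi (fst B)) (fst B) (fst C) (tmul u (fst B) (psi (fst B)) (fst C)
      (tmul u (psi (fst B)) (psi (fst C)) (fst C) (snd C) g) (snd B)) (snd B)
    = tmul u (psi (fst B)) (psi (fst C)) (fst C) (snd C) g"
    by (rule cancel_involution(1)[OF assms(2)]) simp
  moreover have "cj A C (tmul u (fst A) (fst B) (fst C) g f) = tmul u (fst A) (psi (fst C)) (fst C) (snd C)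
      (tmul u (fst A) (psi (fst A)) (psi (fst C)) (tmul u (psi (fst A)) (psi (fst B)) (psi (fst C)) g f) (snd A))"
    by (simp add: conj_mor_def tmul_psi[OF assms(1-3)[THEN obj_list_in]])
  ultimately show ?thesis by (simp add: conj_mor_def tmul_assoc)
qed

lemma conj_id: assumes "A \<in> Obj PC" shows "cj A A (1\<^sub>m (length (fst A))) = 1\<^sub>m (length (fst A))"
  using tmul_one(1)[of "snd A" "psi (fst A)" "fst A" u] obj_carrier[OF assms] obj_involution[OF assms]
  by (simp add: conj_mor_def)

lemma conj_conj:
  assumes "A \<in> Obj PC" "B \<in> Obj PC" "f \<in> carrier_mat (length (fst B)) (length (fst A))"
  shows "cj A B (cj A B f) = f"
proof -
  let ?X = "fst A" and ?Y = "fst B"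
  note o = obj_list_in[OF assms(1)] obj_list_in[OF assms(2)]
  have 1: "cj A B f = tmul u (psi ?X) ?Y (psi ?Y) (snd B) (tmul u (psi ?X) ?X ?Y f (snd A))"
    using tmul_psi[OF o(1) psi_in[OF o(2)] o(2), of u] tmul_psi[OF o(1) psi_in[OF o(1)] psi_in[OF o(2)], of u]
      psi_psi[OF o(1)] psi_psi[OF o(2)] by (simp add: conj_mor_def)
  have "cj A B (cj A B f) = tmul u ?X (psi ?Y) ?Y (snd B) (tmul u ?X (psi ?X) (psi ?Y)
      (tmul u (psi ?X) ?Y (psi ?Y) (snd B) (tmul u (psi ?X) ?X ?Y f (snd A))) (snd A))"
    unfolding conj_mor_def[of u A B "cj A B f"] unfolding 1 ..
  also have "\<dots> = tmul u ?X (psi ?X) ?Y (tmul u (psi ?X) ?X ?Y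
      (tmul u ?X ?Y ?Y (tmul u ?Y (psi ?Y) ?Y (snd B) (snd B)) f) (snd A)) (snd A)"
    by (simp add: tmul_assoc)
  also have "\<dots> = f"
    using obj_involution[OF assms(2)] assms(3) cancel_involution(2)[OF assms(1), of f] by simp
  finally show ?thesis .
qed

lemma conj_add:
  assumes "A \<in> Obj PC" "B \<in> Obj PC"
    "f \<in> carrier_mat (length (fst B)) (length (fst A))" "g \<in> carrier_mat (length (fst B)) (length (fst A))"
  shows "cj A B (f + g) = cj A B f + cj A B g"
  unfolding conj_mor_def using assms(3,4)
  by (simp add: tmul_add_left[of _ "psi (fst B)" "psi (fst A)"] tmul_add_right[of _ "psi (fst B)" "fst A"])

lemma conj_smult:
  assumes "f \<in> carrier_mat (length (fst B)) (length (fst A))"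
  shows "cj A B (a \<cdot>\<^sub>m f) = a \<cdot>\<^sub>m cj A B f"
  unfolding conj_mor_def using assms
  by (simp add: tmul_smult_left[of _ "psi (fst B)" "psi (fst A)"] tmul_smult_right[of _ "psi (fst B)" "fst A"])

text \<open>Since 2 is invertible, averaging projects \<open>F\<^sub>b\<close>-morphisms onto the equivariant ones.\<close>

lemma average_mor:
  assumes "A \<in> Obj PC" "B \<in> Obj PC" "f \<in> carrier_mat (length (fst B)) (length (fst A))"
  shows "f + cj A B f \<in> Mor PC A B"
  using assms conj_add[OF assms(1,2,3) conj_carrier] conj_conj[OF assms]
  by (simp add: Fpsi_mor_iff comm_add_mat[OF conj_carrier assms(3)])

lemma mor_smult: "A \<in> Obj PC \<Longrightarrow> B \<in> Obj PC \<Longrightarrow> f \<in> Mor PC A B \<Longrightarrow> a \<cdot>\<^sub>m f \<in> Mor PC A B"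
  by (simp add: Fpsi_mor_iff conj_smult)

lemma mor_add: "A \<in> Obj PC \<Longrightarrow> B \<in> Obj PC \<Longrightarrow> f \<in> Mor PC A B \<Longrightarrow> g \<in> Mor PC A B \<Longrightarrow> f + g \<in> Mor PC A B"
  by (simp add: Fpsi_mor_iff conj_add)

lemma mor_uminus: assumes "A \<in> Obj PC" "B \<in> Obj PC" "f \<in> Mor PC A B" shows "- f \<in> Mor PC A B"
proof -
  have "- f = (- 1) \<cdot>\<^sub>m f" by (rule eq_matI) auto
  then show ?thesis using mor_smult[OF assms, of "- 1"] by simp
qed

lemma mor_zero: assumes "A \<in> Obj PC" "B \<in> Obj PC" shows "0\<^sub>m (length (fst B)) (length (fst A)) \<in> Mor PC A B"
proof -
  have "0 \<cdot>\<^sub>m cj A B (0\<^sub>m (length (fst B)) (length (fst A))) = 0\<^sub>m (length (fst B)) (length (fst A))"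
    by (rule eq_matI) (auto simp: conj_mor_def)
  moreover have "0 \<cdot>\<^sub>m (0\<^sub>m (length (fst B)) (length (fst A)) :: 'r mat) = 0\<^sub>m (length (fst B)) (length (fst A))"
    by (rule eq_matI) auto
  ultimately show ?thesis
    using conj_smult[of "0\<^sub>m (length (fst B)) (length (fst A))" B A 0] by (simp add: Fpsi_mor_iff[OF assms])
qed

lemma mor_comp: "A \<in> Obj PC \<Longrightarrow> B \<in> Obj PC \<Longrightarrow> C \<in> Obj PC \<Longrightarrow> f \<in> Mor PC A B \<Longrightarrow> g \<in> Mor PC B C \<Longrightarrow>
    tmul u (fst A) (fst B) (fst C) g f \<in> Mor PC A C"
  using conj_comp[of A B C f g] by (simp add: Fpsi_mor_iff)

lemma mor_id: "A \<in> Obj PC \<Longrightarrow> 1\<^sub>m (length (fst A)) \<in> Mor PC A A"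
  by (simp add: Fpsi_mor_iff conj_id)

lemma half_average:
  assumes "2 * h = (1::'r)" "f \<in> carrier_mat n m" shows "h \<cdot>\<^sub>m (f + f) = f"
proof (rule eq_matI)
  fix i j assume "i < dim_row f" "j < dim_col f"
  then have "(h \<cdot>\<^sub>m (f + f)) $$ (i, j) = (2 * h) * f $$ (i, j)" by (simp add: algebra_simps)
  then show "(h \<cdot>\<^sub>m (f + f)) $$ (i, j) = f $$ (i, j)" using assms(1) by simp
qed auto

lemma Fpsi_exactD:
  assumes "(A, f, B, g, C) \<in> PS"
  shows "A \<in> Obj PC" "B \<in> Obj PC" "C \<in> Obj PC" "f \<in> Mor PC A B" "g \<in> Mor PC B C"
    "(fst A, f, fst B, g, fst C) \<in> S"
  using assms by (auto simp: Fpsi_exact_def)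

text \<open>Projectivity in F_b gives a lift \<open>k\<close> of \<open>h\<close>. Its conjugate
  lifts \<open>h\<close> too, so the sum of both is equivariant and lifts \<open>2 h\<close>, and 2
  is invertible.\<close>

lemma boundary_projective:
  assumes P: "P \<in> Obj PC" "boundary b (fst P)"
  shows "projective PC PS P"
  unfolding projective_def
proof (intro conjI allI ballI impI)
  fix Y Z g h assume h: "h \<in> Mor PC P Z" and "deflation PS Y Z g"
  then obtain X f where s: "(X, f, Y, g, Z) \<in> PS" by (auto simp: deflation_def)
  note D = Fpsi_exactD[OF s]
  have "deflation S (fst Y) (fst Z) g" using D by (auto simp: deflation_def)
  moreover have "projective (F_cat u b) S (fst P)"
    using projective_iff_boundary[OF obj_list_in[OF P(1)]] P(2) by blast
  moreover have hc: "h \<in> carrier_mat (length (fst Z)) (length (fst P))" using mor_carrier P D h by blast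
  ultimately obtain k where k: "k \<in> carrier_mat (length (fst Y)) (length (fst P))" "tmul u (fst P) (fst Y) (fst Z) g k = h"
    using projectiveD[of "F_cat u b" S "fst P" "fst Y" "fst Z" g h] by auto
  have gc: "g \<in> carrier_mat (length (fst Z)) (length (fst Y))" using mor_carrier D by blast
  have "tmul u (fst P) (fst Y) (fst Z) g (cj P Y k) = h"
    using conj_comp[OF P(1) D(2,3) k(1) gc] mor_conj[OF D(2,3,5)] mor_conj[OF P(1) D(3) h] k(2) by simp
  then have eq: "tmul u (fst P) (fst Y) (fst Z) g (k + cj P Y k) = h + h"
    using tmul_add_right[OF k(1) conj_carrier] k(2) by simp
  obtain c where c: "2 * c = (1::'r)" by (rule half)
  have "c \<cdot>\<^sub>m (k + cj P Y k) \<in> Mor PC P Y" using average_mor mor_smult P D k by blast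
  moreover have "Comp PC P Y Z g (c \<cdot>\<^sub>m (k + cj P Y k)) = h"
    using eq half_average[OF c hc] k(1) by (simp add: tmul_smult_right)
  ultimately show "\<exists>k \<in> Mor PC P Y. Comp PC P Y Z g k = h" by blast
qed (rule P)

lemma boundary_injective:
  assumes I: "I \<in> Obj PC" "boundary b (fst I)"
  shows "injective PC PS I"
  unfolding injective_def
proof (intro conjI allI ballI impI)
  fix X Y f h assume h: "h \<in> Mor PC X I" and "inflation PS X Y f"
  then obtain Z g where s: "(X, f, Y, g, Z) \<in> PS" by (auto simp: inflation_def)
  note D = Fpsi_exactD[OF s]
  have "inflation S (fst X) (fst Y) f" using D by (auto simp: inflation_def)
  moreover have "injective (F_cat u b) S (fst I)"
    using projective_iff_boundary[OF obj_list_in[OF I(1)]] I(2) projective_iff_injective by blast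
  moreover have hc: "h \<in> carrier_mat (length (fst I)) (length (fst X))" using mor_carrier I D h by blast
  ultimately obtain k where k: "k \<in> carrier_mat (length (fst I)) (length (fst Y))" "tmul u (fst X) (fst Y) (fst I) k f = h"
    using injectiveD[of "F_cat u b" S "fst I" "fst X" "fst Y" f h] by auto
  have fc: "f \<in> carrier_mat (length (fst Y)) (length (fst X))" using mor_carrier D by blast
  have "tmul u (fst X) (fst Y) (fst I) (cj Y I k) f = h"
    using conj_comp[OF D(1,2) I(1) fc k(1)] mor_conj[OF D(1,2,4)] mor_conj[OF D(1) I(1) h] k(2) by simp
  then have eq: "tmul u (fst X) (fst Y) (fst I) (k + cj Y I k) f = h + h"
    using tmul_add_left[OF k(1) conj_carrier] k(2) by simp
  obtain c where c: "2 * c = (1::'r)" by (rule half)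
  have "c \<cdot>\<^sub>m (k + cj Y I k) \<in> Mor PC Y I" using average_mor mor_smult I D k by blast
  moreover have "Comp PC X Y I (c \<cdot>\<^sub>m (k + cj Y I k)) f = h"
    using eq half_average[OF c hc] k(1) by (simp add: tmul_smult_left)
  ultimately show "\<exists>k \<in> Mor PC Y I. Comp PC X Y I k f = h" by blast
qed (rule I)

end

subsection \<open>Rigid matrices\<close>

text \<open>Matrices with non-zero entries only at isomorphic pairs of orbits compose without twist.\<close>

definition rigid :: "obj \<Rightarrow> obj \<Rightarrow> 'r::idom mat \<Rightarrow> bool" where
  "rigid X Y f \<longleftrightarrow> (\<forall>j < length Y. \<forall>i < length X. f $$ (j, i) \<noteq> 0 \<longrightarrow> same_coords (X ! i) (Y ! j))"

lemma co_same_coords: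
  assumes "X \<in> X_set pi" "Y \<in> X_set pi" "Z \<in> X_set pi" "same_coords X Y \<or> same_coords Y Z"
  shows "co X Y Z = 0"
  using same_coords_co[OF assms(1,2,2,2,3,3)] same_coords_co[OF assms(1,1,2,2,3,2)] assms same_coords_refl
    same_coords_sym by fastforce

lemma tmul_rigid_right:
  assumes "X \<in> lists (X_set b)" "Y \<in> lists (X_set b)" "Z \<in> lists (X_set b)" "b \<le> pi" "rigid X Y f"
    "f \<in> carrier_mat (length Y) (length X)" "g \<in> carrier_mat (length Z) (length Y)"
  shows "tmul u X Y Z g f = g * f"
proof (rule eq_matI)
  fix k i assume "k < dim_row (g * f)" "i < dim_col (g * f)"
  then have ki: "k < length Z" "i < length X" using assms by auto
  have "g $$ (k, j) * f $$ (j, i) * u ^ co (X ! i) (Y ! j) (Z ! k) = g $$ (k, j) * f $$ (j, i)" if "j < length Y" for j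
  proof (cases "f $$ (j, i) = 0")
    case False
    then have "co (X ! i) (Y ! j) (Z ! k) = 0"
      using assms(5) ki that X_nth[OF assms(1,4)] X_nth[OF assms(2,4)] X_nth[OF assms(3,4)]
      by (intro co_same_coords) (auto simp: rigid_def)
    then show ?thesis by simp
  qed simp
  then have "(\<Sum>j<length Y. g $$ (k, j) * f $$ (j, i) * u ^ co (X ! i) (Y ! j) (Z ! k)) =
      (\<Sum>j<length Y. g $$ (k, j) * f $$ (j, i))" by (intro sum.cong) simp_all
  then show "tmul u X Y Z g f $$ (k, i) = (g * f) $$ (k, i)"
    using ki assms(6,7) by (simp add: tmul_index scalar_prod_def lessThan_atLeast0)
qed (use assms in auto)

lemma tmul_rigid_left:
  assumes "X \<in> lists (X_set b)" "Y \<in> lists (X_set b)" "Z \<in> lists (X_set b)" "b \<le> pi" "rigid Y Z g"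
    "f \<in> carrier_mat (length Y) (length X)" "g \<in> carrier_mat (length Z) (length Y)"
  shows "tmul u X Y Z g f = g * f"
proof (rule eq_matI)
  fix k i assume "k < dim_row (g * f)" "i < dim_col (g * f)"
  then have ki: "k < length Z" "i < length X" using assms by auto
  have "g $$ (k, j) * f $$ (j, i) * u ^ co (X ! i) (Y ! j) (Z ! k) = g $$ (k, j) * f $$ (j, i)" if "j < length Y" for j
  proof (cases "g $$ (k, j) = 0")
    case False
    then have "co (X ! i) (Y ! j) (Z ! k) = 0"
      using assms(5) ki that X_nth[OF assms(1,4)] X_nth[OF assms(2,4)] X_nth[OF assms(3,4)]
      by (intro co_same_coords) (auto simp: rigid_def)
    then show ?thesis by simp
  qed simp
  then have "(\<Sum>j<length Y. g $$ (k, j) * f $$ (j, i) * u ^ co (X ! i) (Y ! j) (Z ! k)) =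
      (\<Sum>j<length Y. g $$ (k, j) * f $$ (j, i))" by (intro sum.cong) simp_all
  then show "tmul u X Y Z g f $$ (k, i) = (g * f) $$ (k, i)"
    using ki assms(6,7) by (simp add: tmul_index scalar_prod_def lessThan_atLeast0)
qed (use assms in auto)

context F_structure
begin

lemma rigid_obj:
  assumes "X \<in> lists (X_set b)" "\<xi> \<in> carrier_mat (length X) (length X)" "rigid (psi X) X \<xi>" "\<xi> * \<xi> = 1\<^sub>m (length X)"
  shows "(X, \<xi>) \<in> Obj PC"
  using assms tmul_rigid_left[OF assms(1) psi_in[OF assms(1)] assms(1) b_le assms(3), of \<xi> u]
  by (simp add: Fpsi_obj_iff)

lemma rigid_mor:
  assumes "(X, \<xi>) \<in> Obj PC" "(Y, \<eta>) \<in> Obj PC" "rigid (psi X) X \<xi>" "rigid (psi Y) Y \<eta>"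
  shows "f \<in> Mor PC (X, \<xi>) (Y, \<eta>) \<longleftrightarrow> f \<in> carrier_mat (length Y) (length X) \<and> f * \<xi> = \<eta> * f"
proof -
  have X: "X \<in> lists (X_set b)" "\<xi> \<in> carrier_mat (length X) (length X)"
    and Y: "Y \<in> lists (X_set b)" "\<eta> \<in> carrier_mat (length Y) (length Y)"
    using obj_list_in[OF assms(1)] obj_carrier[OF assms(1)] obj_list_in[OF assms(2)] obj_carrier[OF assms(2)] by auto
  have "tmul u (psi X) X Y f \<xi> = f * \<xi>" "tmul u (psi X) (psi Y) Y \<eta> f = \<eta> * f"
    if "f \<in> carrier_mat (length Y) (length X)"
    using tmul_rigid_right[OF psi_in[OF X(1)] X(1) Y(1) b_le assms(3), of f]
      tmul_rigid_left[OF psi_in[OF X(1)] psi_in[OF Y(1)] Y(1) b_le assms(4), of f] X Y that by simp_all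
  then show ?thesis
    by (auto simp: Fpsi_cat_def Let_def psi_mor_def)
qed

end

subsection \<open>The objects with names\<close>

fun coords :: "name \<Rightarrow> (real \<times> real) list" where
  "coords (Regular x y) = [(x, y), (x + pi, y + pi)]"
| "coords (Singular e x) = [(x, x)]"

fun xi_of :: "name \<Rightarrow> 'r::idom mat" where
  "xi_of (Regular x y) = mat 2 2 (\<lambda>(i, j). if i = j then 0 else 1)"
| "xi_of (Singular e x) = mat 1 1 (\<lambda>_. if e then 1 else - 1)"

text \<open>The involution on the hull. For a regular name the rotation by \<open>pi\<close>
  exchanges the positions 0 and 1 (first corners) and the positions 2 and 3 (second corners). For a
  singular name it exchanges the two corners themselves, since the rotated \<open>(x, x + b)\<close>
  is a turn of \<open>(x + b, x)\<close>.\<close>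

fun eta_of :: "name \<Rightarrow> 'r::idom mat" where
  "eta_of (Regular x y) = mat 4 4 (\<lambda>(i, j). if i \<noteq> j \<and> i div 2 = j div 2 then 1 else 0)"
| "eta_of (Singular e x) = mat 2 2 (\<lambda>(i, j). if i = j then 0 else if e then 1 else - 1)"

text \<open>The minus sign in \<^const>\<open>hull_out\<close> turns the sign of a singular object around under the shift.\<close>

fun shift_name :: "real \<Rightarrow> name \<Rightarrow> name" where
  "shift_name b (Regular x y) = Regular (y + b) (x + b)"
| "shift_name b (Singular e x) = Singular (\<not> e) (x + b)"

fun inner_name :: "real \<Rightarrow> name \<Rightarrow> bool" where
  "inner_name b (Regular x y) \<longleftrightarrow> \<bar>x - y\<bar> < b"
| "inner_name b (Singular e x) \<longleftrightarrow> 0 < b"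

text \<open>Unlike \<open>inner_name\<close>, which suffices for the hull sequence, it excludes
  \<open>Regular x x\<close>, where the orbit is isomorphic to its rotation and the object splits
  into two singular ones.\<close>

fun proper_name :: "real \<Rightarrow> name \<Rightarrow> bool" where
  "proper_name b (Regular x y) \<longleftrightarrow> 0 < \<bar>x - y\<bar> \<and> \<bar>x - y\<bar> < b"
| "proper_name b (Singular e x) \<longleftrightarrow> 0 < b"

lemma proper_inner: "proper_name b n \<Longrightarrow> inner_name b n"
  by (cases n) auto

lemma obj_of_eq: "obj_of n = (obj_list (coords n), xi_of n)"
proof (cases n)
  case (Regular x y)
  have "four_block_mat (0\<^sub>m 1 1) (1\<^sub>m 1) (1\<^sub>m 1) (0\<^sub>m 1 1) = (mat 2 2 (\<lambda>(i, j). if i = j then 0 else 1) :: 'a mat)"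
    by (rule eq_matI) (auto simp: four_block_mat_def Let_def less_2_cases_iff)
  then show ?thesis using Regular by (simp add: SM_def S_obj_def psi_def psi_orb_M obj_list_def)
next
  case (Singular e x)
  then show ?thesis by (simp add: Z_obj_def obj_list_def)
qed

lemma cohull_coords: "cohull b (coords n) = obj_list (coords (shift_name b n))"
  by (cases n) (simp_all add: cohull_def obj_list_def add_ac)

lemma length_coords [simp]: "length (coords (shift_name b n)) = length (coords n)"
  by (cases n) simp_all

lemma xi_carrier [simp]: "xi_of n \<in> carrier_mat (length (coords n)) (length (coords n))"
  by (cases n) (auto intro!: carrier_matI)

lemma eta_carrier [simp]: "eta_of n \<in> carrier_mat (length (coords n) + length (coords n)) (length (coords n) + length (coords n))"
  by (cases n) (auto intro!: carrier_matI)

lemma same_coords_M_orb_eq: "same_coords (M_orb x y) (M_orb x y)"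
  using M_orb_self unfolding same_coords_def by blast

lemma same_coords_M_orb_double: "same_coords (M_orb (x + 2 * pi) (y + 2 * pi)) (M_orb x y)"
  using same_coords_M_orb_eq[of x y] orbit_double[of x y True] by (simp add: M_orb_def)

lemma same_coords_M_orb_turn: "same_coords (M_orb (y + pi) (x + pi)) (M_orb x y)"
  unfolding same_coords_M_orb by (rule exI[of _ 1]) (simp add: sigma_pow_eq)

lemma less_four: "(i::nat) < 4 \<longleftrightarrow> i = 0 \<or> i = 1 \<or> i = 2 \<or> i = 3"
  by auto

lemma rigid_xi: "rigid (psi (obj_list (coords n))) (obj_list (coords n)) (xi_of n)"
proof (cases n)
  case (Regular x y)
  then show ?thesis
    using same_coords_M_orb_eq[of "x + pi" "y + pi"] same_coords_M_orb_double[of x y]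
    by (auto simp: rigid_def less_Suc_eq psi_def obj_list_def psi_orb_M add_ac)
next
  case (Singular e x)
  then show ?thesis
    using same_coords_psi_diagonal[of x] by (auto simp: rigid_def psi_def obj_list_def)
qed

lemma rigid_eta: "rigid (psi (phull b (coords n))) (phull b (coords n)) (eta_of n :: 'a::idom mat)"
proof (cases n)
  case (Regular x y)
  have "same_coords (psi_orb (phull b (coords n) ! j)) (phull b (coords n) ! i)"
    if "(i, j) \<in> {(0, 1), (1, 0), (2, 3), (3, 2)}" for i j
    using that same_coords_M_orb_eq[of "x + pi" "x + pi + b"] same_coords_M_orb_double[of x "x + b"]
      same_coords_M_orb_eq[of "y + pi + b" "y + pi"] same_coords_M_orb_double[of "y + b" y]
    by (auto simp: Regular phull_def psi_orb_M add_ac numeral_3_eq_3)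
  moreover have "(i, j) \<in> {(0, 1), (1, 0), (2, 3), (3, 2)}"
    if "i < length (phull b (coords n))" "j < length (phull b (coords n))" "(eta_of n :: 'a mat) $$ (i, j) \<noteq> 0" for i j
  proof -
    have "i < 4" "j < 4" using that(1,2) by (simp_all add: Regular)
    then show ?thesis using that(3) by (auto simp: less_four Regular)
  qed
  ultimately show ?thesis by (simp add: rigid_def psi_nth)
next
  case (Singular e x)
  then show ?thesis
    using same_coords_M_orb_turn[of x "x + b"] same_coords_M_orb_turn[of "x + b" x]
    by (auto simp: rigid_def less_Suc_eq psi_def phull_def psi_orb_M add_ac)
qed

lemma sum_two_four:
  "(\<Sum>i = 0..<2::nat. F i) = (F 0 + F 1 :: 'a::comm_monoid_add)"
  "(\<Sum>i = 0..<4::nat. F i) = F 0 + F 1 + F 2 + F 3"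
  "(\<Sum>i<2::nat. F i) = F 0 + F 1"
  by (simp_all add: eval_nat_numeral)

lemma named_matrices:
  "length (coords (Regular x y)) = 2" "length (coords (Singular e x)) = 1"
  "xi_of (Regular x y) = mat 2 2 (\<lambda>(i, j). if i = j then 0 else 1)"
  "xi_of (Singular e x) = mat 1 1 (\<lambda>_. if e then 1 else - 1)"
  "eta_of (Regular x y) = mat 4 4 (\<lambda>(i, j). if i \<noteq> j \<and> i div 2 = j div 2 then 1 else 0)"
  "eta_of (Singular e x) = mat 2 2 (\<lambda>(i, j). if i = j then 0 else if e then 1 else - 1)"
  "hull_in 2 = mat 4 2 (\<lambda>(l, i). if l = i \<or> l = 2 + i then 1 else 0)"
  "hull_in 1 = mat 2 1 (\<lambda>(l, i). if l = i \<or> l = 1 + i then 1 else 0)"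
  "hull_out 2 = mat 2 4 (\<lambda>(i, l). if l = i then 1 else if l = 2 + i then - 1 else 0)"
  "hull_out 1 = mat 1 2 (\<lambda>(i, l). if l = i then 1 else if l = 1 + i then - 1 else 0)"
  "shift_name b (Regular x y) = Regular (y + b) (x + b)" "shift_name b (Singular e x) = Singular (\<not> e) (x + b)"
  by (simp add: hull_in_def hull_out_def; auto intro!: eq_matI)+

lemma mat_eqI4:
  assumes "dim_row A = n" "dim_row B = n" "dim_col A = m" "dim_col B = m" "n \<in> {1, 2, 4}" "m \<in> {1, 2, 4}"
    "\<forall>i \<in> {0, 1, 2, 3}. \<forall>j \<in> {0, 1, 2, 3}. i < n \<longrightarrow> j < m \<longrightarrow> A $$ (i, j) = B $$ (i, j)"
  shows "A = B"
proof (rule eq_matI)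
  fix i j assume ij: "i < dim_row B" "j < dim_col B"
  then have "i < n" "j < m" using assms(2,4) by auto
  moreover have "i < 4" "j < 4" using calculation assms(5,6) by auto
  ultimately show "A $$ (i, j) = B $$ (i, j)" using assms(7) unfolding less_four by blast
qed (use assms in auto)

lemma mat_mult_entry: "i < n \<Longrightarrow> j < m \<Longrightarrow> (mat n k f * mat k m g) $$ (i, j) = (\<Sum>l = 0..<k. f (i, l) * g (l, j))"
  by (simp add: scalar_prod_def)

definition swap2 :: "'a::idom mat" where
  "swap2 = mat 2 2 (\<lambda>(i, j). if i = j then 0 else 1)"

lemma swap2_dim [simp]: "swap2 \<in> carrier_mat 2 2" "dim_row swap2 = 2" "dim_col swap2 = 2"
  by (simp_all add: swap2_def)

lemma swap2_left: "H \<in> carrier_mat 2 n \<Longrightarrow> i < 2 \<Longrightarrow> j < n \<Longrightarrow> (swap2 * H) $$ (i, j) = H $$ (1 - i, j)"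
  by (auto simp: swap2_def scalar_prod_def sum_two_four less_2_cases_iff)

lemma swap2_right: "H \<in> carrier_mat n 2 \<Longrightarrow> i < n \<Longrightarrow> j < 2 \<Longrightarrow> (H * swap2) $$ (i, j) = H $$ (i, 1 - j)"
  by (auto simp: swap2_def scalar_prod_def sum_two_four less_2_cases_iff)

lemma named_matrix_equations:
  "mat 2 2 (\<lambda>(i, j). if i = j then 0 else 1) * mat 2 2 (\<lambda>(i, j). if i = j then 0 else 1) = (1\<^sub>m 2 :: 'r::idom mat)"
  "mat 4 4 (\<lambda>(i, j). if i \<noteq> j \<and> i div 2 = j div 2 then 1 else 0) * mat 4 4 (\<lambda>(i, j). if i \<noteq> j \<and> i div 2 = j div 2 then 1 else 0) = (1\<^sub>m (2 + 2) :: 'r mat)"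
  "mat 1 1 (\<lambda>_. if e then 1 else - 1) * mat 1 1 (\<lambda>_. if e then 1 else - 1) = (1\<^sub>m 1 :: 'r mat)"
  "mat 2 2 (\<lambda>(i, j). if i = j then 0 else if e then 1 else - 1) * mat 2 2 (\<lambda>(i, j). if i = j then 0 else if e then 1 else - 1) = (1\<^sub>m (1 + 1) :: 'r mat)"
  "mat 4 2 (\<lambda>(l, i). if l = i \<or> l = 2 + i then 1 else 0) * mat 2 2 (\<lambda>(i, j). if i = j then 0 else 1) =
   (mat 4 4 (\<lambda>(i, j). if i \<noteq> j \<and> i div 2 = j div 2 then 1 else 0) * mat 4 2 (\<lambda>(l, i). if l = i \<or> l = 2 + i then 1 else 0) :: 'r mat)"
  "mat 2 1 (\<lambda>(l, i). if l = i \<or> l = 1 + i then 1 else 0) * mat 1 1 (\<lambda>_. if e then 1 else - 1) =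
   (mat 2 2 (\<lambda>(i, j). if i = j then 0 else if e then 1 else - 1) * mat 2 1 (\<lambda>(l, i). if l = i \<or> l = 1 + i then 1 else 0) :: 'r mat)"
  "mat 2 4 (\<lambda>(i, l). if l = i then 1 else if l = 2 + i then - 1 else 0) * mat 4 4 (\<lambda>(i, j). if i \<noteq> j \<and> i div 2 = j div 2 then 1 else 0) =
   (mat 2 2 (\<lambda>(i, j). if i = j then 0 else 1) * mat 2 4 (\<lambda>(i, l). if l = i then 1 else if l = 2 + i then - 1 else 0) :: 'r mat)"
  "mat 1 2 (\<lambda>(i, l). if l = i then 1 else if l = 1 + i then - 1 else 0) * mat 2 2 (\<lambda>(i, j). if i = j then 0 else if e then 1 else - 1) =
   (mat 1 1 (\<lambda>_. if \<not> e then 1 else - 1) * mat 1 2 (\<lambda>(i, l). if l = i then 1 else if l = 1 + i then - 1 else 0) :: 'r mat)"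
  subgoal by (rule mat_eqI4[where n = 2 and m = 2]) (simp_all add: mat_mult_entry sum_two_four del: index_mult_mat(1))
  subgoal by (rule mat_eqI4[where n = 4 and m = 4]) (simp_all add: mat_mult_entry sum_two_four del: index_mult_mat(1))
  subgoal by (rule mat_eqI4[where n = 1 and m = 1]) (simp_all add: mat_mult_entry sum_two_four del: index_mult_mat(1))
  subgoal by (rule mat_eqI4[where n = 2 and m = 2]) (simp_all add: mat_mult_entry sum_two_four del: index_mult_mat(1))
  subgoal by (rule mat_eqI4[where n = 4 and m = 2]) (simp_all add: mat_mult_entry sum_two_four del: index_mult_mat(1))
  subgoal by (rule mat_eqI4[where n = 2 and m = 1]) (simp_all add: mat_mult_entry sum_two_four del: index_mult_mat(1))
  subgoal by (rule mat_eqI4[where n = 2 and m = 4]) (simp_all add: mat_mult_entry sum_two_four del: index_mult_mat(1))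
  subgoal by (rule mat_eqI4[where n = 1 and m = 2]) (simp_all add: mat_mult_entry sum_two_four del: index_mult_mat(1))
  done

lemma xi_square: "xi_of n * xi_of n = (1\<^sub>m (length (coords n)) :: 'r::idom mat)"
  and eta_square: "eta_of n * eta_of n = (1\<^sub>m (length (coords n) + length (coords n)) :: 'r::idom mat)"
  and hull_in_equivariant: "hull_in (length (coords n)) * xi_of n = (eta_of n * hull_in (length (coords n)) :: 'r::idom mat)"
  and hull_out_equivariant:
    "hull_out (length (coords n)) * eta_of n = (xi_of (shift_name b n) * hull_out (length (coords n)) :: 'r::idom mat)"
  by (cases n; simp only: named_matrices named_matrix_equations)+

context F_structure
begin

lemma coords_inner: "inner_name b n \<Longrightarrow> (x, y) \<in> set (coords n) \<Longrightarrow> \<bar>x - y\<bar> < b"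
  by (cases n) (auto simp: b_pos)

lemma inner_shift: "inner_name b n \<Longrightarrow> inner_name b (shift_name b n)"
  by (cases n) auto

lemma obj_of_in: assumes "inner_name b n" shows "obj_of n \<in> Obj PC"
proof -
  have "obj_list (coords n) \<in> lists (X_set b)" by (rule hull_objs(1)) (rule coords_inner[OF assms])
  then show ?thesis unfolding obj_of_eq by (intro rigid_obj) (simp_all add: rigid_xi xi_square)
qed

lemma hull_of_in: assumes "inner_name b n" shows "(phull b (coords n), eta_of n) \<in> Obj PC"
proof -
  have "phull b (coords n) \<in> lists (X_set b)" by (rule hull_objs(2)) (rule coords_inner[OF assms])
  then show ?thesis by (intro rigid_obj) (simp_all add: rigid_eta eta_square)
qed

lemma hull_of_boundary: "inner_name b n \<Longrightarrow> boundary b (phull b (coords n))"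
  using coords_inner b_pos b_le by (intro hull_boundary) force+

text \<open>Equivariance of \<open>hull_in\<close> and \<open>hull_out\<close> lifts the hull
  sequence to the category with involution; its last term shows that \<open>shift_name\<close> names
  the shift.\<close>

lemma name_ses:
  assumes "inner_name b n"
  shows "(obj_of n, hull_in (length (coords n)), (phull b (coords n), eta_of n), hull_out (length (coords n)),
     obj_of (shift_name b n)) \<in> PS"
proof -
  note o = obj_of_in[OF assms] hull_of_in[OF assms] obj_of_in[OF inner_shift[OF assms]]
  have "hull_in (length (coords n)) \<in> Mor PC (obj_of n) (phull b (coords n), eta_of n)"
    using rigid_mor[OF o(1)[unfolded obj_of_eq] o(2) rigid_xi rigid_eta, of "hull_in (length (coords n))"]
      hull_in_equivariant[of n] by (simp add: obj_of_eq)
  moreover have "hull_out (length (coords n)) \<in> Mor PC (phull b (coords n), eta_of n) (obj_of (shift_name b n))"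
    using rigid_mor[OF o(2) o(3)[unfolded obj_of_eq] rigid_eta rigid_xi, of "hull_out (length (coords n))"]
      hull_out_equivariant[of n b] by (simp add: obj_of_eq)
  moreover have "(obj_list (coords n), hull_in (length (coords n)), phull b (coords n), hull_out (length (coords n)),
      cohull b (coords n)) \<in> S"
    by (rule hull_ses) (rule coords_inner[OF assms])
  ultimately show ?thesis using o by (simp add: Fpsi_exact_def obj_of_eq cohull_coords)
qed

subsection \<open>Splitting off named summands\<close>

lemma conj_dim [simp]: "dim_row (cj A B f) = length (fst B)" "dim_col (cj A B f) = length (fst A)"
  by (simp_all add: conj_mor_def)

text \<open>For an object \<open>(X, \<xi>)\<close> with a summand \<open>N\<close> of \<open>X\<close> in position \<open>k\<close>, the averages of the
  inclusion and of the projection of \<open>N\<close> give maps from and to \<open>SN\<close> or \<open>Z\<^sub>\<epsilon>\<close>; if \<open>\<psi>N\<close> is not isomorphic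
  to \<open>N\<close> their composite is unipotent modulo \<open>u\<close>, and otherwise it is \<open>2 (1 + \<epsilon> \<xi>\<^sub>k\<^sub>k)\<close>, which is
  a unit for one of the signs.\<close>

lemma averaged_composite:
  assumes A: "A \<in> Obj PC" and B: "B \<in> Obj PC"
    and f: "f \<in> carrier_mat (length (fst B)) (length (fst A))" and g: "g \<in> carrier_mat (length (fst A)) (length (fst B))"
  shows "tmul u (fst A) (fst B) (fst A) (g + cj B A g) (f + cj A B f) =
     (tmul u (fst A) (fst B) (fst A) g f + cj A A (tmul u (fst A) (fst B) (fst A) g f)) +
     (tmul u (fst A) (fst B) (fst A) g (cj A B f) + tmul u (fst A) (fst B) (fst A) (cj B A g) f)"
proof -
  have "tmul u (fst A) (fst B) (fst A) (g + cj B A g) (f + cj A B f) =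
    (tmul u (fst A) (fst B) (fst A) g f + tmul u (fst A) (fst B) (fst A) g (cj A B f)) +
    (tmul u (fst A) (fst B) (fst A) (cj B A g) f + tmul u (fst A) (fst B) (fst A) (cj B A g) (cj A B f))"
    using f g by (simp add: tmul_add_left[OF g conj_carrier] tmul_add_right[OF f conj_carrier])
  also have "tmul u (fst A) (fst B) (fst A) (cj B A g) (cj A B f) = cj A A (tmul u (fst A) (fst B) (fst A) g f)"
    by (rule conj_comp[OF A B A f g])
  finally show ?thesis
    by (auto intro!: eq_matI)
qed

lemma splits_off_regular:
  assumes X: "B \<in> Obj PC" and k: "k < length (fst B)" "fst B ! k = M_orb x y" and xy: "x \<noteq> y" "\<bar>x - y\<bar> < b"
  shows "\<exists>s \<in> Mor PC (obj_of (Regular x y)) B. \<exists>r \<in> Mor PC B (obj_of (Regular x y)).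
     tmul u (obj_list (coords (Regular x y))) (fst B) (obj_list (coords (Regular x y))) r s = 1\<^sub>m 2"
proof -
  define n where "n = Regular x y"
  define A :: "'r pobj" where "A = obj_of n"
  let ?X = "fst B" and ?\<xi> = "snd B" and ?A = "fst A"
  have inner: "inner_name b n" using xy by (simp add: n_def)
  have A: "A \<in> Obj PC" unfolding A_def by (rule obj_of_in[OF inner])
  note o = obj_list_in[OF A] obj_list_in[OF X]
  have fA: "?A = [M_orb x y, M_orb (x + pi) (y + pi)]" and sA: "snd A = swap2"
    by (simp_all add: A_def obj_of_eq n_def obj_list_def swap2_def)
  have lA: "length ?A = 2" by (simp add: fA)
  have Ain: "M_orb x y \<in> X_set b" "M_orb (x + pi) (y + pi) \<in> X_set b" using xy by (auto intro!: M_orb_in)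
  have pA: "psi ?A = [M_orb (x + pi) (y + pi), M_orb x y]"
    using psi_orb_psi_orb[OF Ain(1)] by (simp add: fA psi_def psi_orb_M)
  have rA: "rigid (psi ?A) ?A (snd A)" using rigid_xi[of n] by (simp add: A_def obj_of_eq)
  have rA': "rigid ?A (psi ?A) (snd A)"
    unfolding rigid_def using pA fA sA[unfolded swap2_def] same_coords_refl[OF Ain(1)] same_coords_refl[OF Ain(2)]
    by (auto simp: less_Suc_eq)
  have cA: "snd A \<in> carrier_mat 2 2" by (simp add: sA)
  define f where "f = mat (length ?X) 2 (\<lambda>(l, c). if l = k \<and> c = 0 then 1 else (0::'r))"
  define g where "g = mat 2 (length ?X) (\<lambda>(c, l). if l = k \<and> c = 0 then 1 else (0::'r))"
  define t where "t = ?\<xi> $$ (k, k)"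
  have fc: "f \<in> carrier_mat (length ?X) (length ?A)" and gc: "g \<in> carrier_mat (length ?A) (length ?X)"
    by (simp_all add: f_def g_def lA)
  have 1: "tmul u ?A (psi ?A) (psi ?X) f (snd A) = f * snd A"
    using tmul_rigid_right[OF o(1) psi_in[OF o(1)] psi_in[OF o(2)] b_le rA' _, of f] cA fc lA by simp
  have f1: "(f * snd A) $$ (l, c) = (if l = k \<and> c = 1 then 1 else 0)" if "l < length ?X" "c < 2" for l c
    using that swap2_right[of f "length ?X" l c] by (auto simp: f_def sA less_2_cases_iff)
  have cjf: "cj A B f $$ (l, c) = (if c = 1 then ?\<xi> $$ (l, k) else 0)" if lc: "l < length ?X" "c < 2" for l c
  proof -
    have "cj A B f $$ (l, c) = (\<Sum>m<length ?X. ?\<xi> $$ (l, m) * (f * snd A) $$ (m, c) * u ^ co (?A ! c) (psi ?X ! m) (?X ! l))"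
      unfolding conj_mor_def 1 using lc lA by (simp add: tmul_index)
    also have "\<dots> = (\<Sum>m<length ?X. ?\<xi> $$ (l, m) * (if m = k then 1 else 0) * (if c = 1 then u ^ co (?A ! c) (psi ?X ! m) (?X ! l) else 0))"
      using lc by (intro sum.cong) (auto simp: f1)
    also have "\<dots> = (if c = 1 then ?\<xi> $$ (l, k) else 0)"
      unfolding sum_select(2)[OF k(1)] using k by (auto simp: fA psi_nth psi_orb_M)
    finally show ?thesis .
  qed
  have 2: "tmul u ?X (psi ?A) ?A (snd A) h = snd A * h" if "h \<in> carrier_mat 2 (length ?X)" for h
    using tmul_rigid_left[OF o(2) psi_in[OF o(1)] o(1) b_le rA, of h u] cA that lA by simp
  have g1: "tmul u ?X (psi ?X) (psi ?A) g ?\<xi> $$ (c, l) = (if c = 0 then ?\<xi> $$ (k, l) else 0)"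
    if lc: "l < length ?X" "c < 2" for l c
  proof -
    have "tmul u ?X (psi ?X) (psi ?A) g ?\<xi> $$ (c, l) =
        (\<Sum>m<length ?X. (if m = k then 1 else 0) * ?\<xi> $$ (m, l) * (if c = 0 then u ^ co (?X ! l) (psi ?X ! m) (psi ?A ! c) else 0))"
      using lc lA by (simp add: tmul_index g_def) (intro sum.cong, auto)
    also have "\<dots> = (if c = 0 then ?\<xi> $$ (k, l) else 0)"
      unfolding sum_select(1)[OF k(1)] using k by (auto simp: pA psi_nth psi_orb_M)
    finally show ?thesis .
  qed
  have cjg: "cj B A g $$ (c, l) = (if c = 1 then ?\<xi> $$ (k, l) else 0)" if lc: "l < length ?X" "c < 2" for l c
  proof -
    have "cj B A g = snd A * tmul u ?X (psi ?X) (psi ?A) g ?\<xi>"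
      unfolding conj_mor_def using 2[of "tmul u ?X (psi ?X) (psi ?A) g ?\<xi>"] lA by simp
    then show ?thesis
      using lc lA g1 swap2_left[of "tmul u ?X (psi ?X) (psi ?A) g ?\<xi>" "length ?X" c l]
      by (auto simp: sA less_2_cases_iff)
  qed
  have gf: "tmul u ?A ?X ?A g f = mat 2 2 (\<lambda>(i, j). if i = 0 \<and> j = 0 then 1 else 0)"
  proof (rule eq_matI)
    fix i j assume "i < dim_row (mat 2 2 (\<lambda>(i, j). if i = 0 \<and> j = 0 then 1 else (0::'r)))"
      "j < dim_col (mat 2 2 (\<lambda>(i, j). if i = 0 \<and> j = 0 then 1 else (0::'r)))"
    then have ij: "i < 2" "j < 2" by auto
    have "tmul u ?A ?X ?A g f $$ (i, j) = (\<Sum>m<length ?X. (if m = k then 1 else 0) * (if i = 0 \<and> j = 0 then 1 else 0) * u ^ co (?A ! j) (?X ! m) (?A ! i))"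
      unfolding tmul_index[OF ij[folded lA]] by (intro sum.cong refl) (use ij in \<open>auto simp: g_def f_def\<close>)
    also have "\<dots> = (if i = 0 \<and> j = 0 then 1 else 0)"
      unfolding sum_select(1)[OF k(1)] using k by (auto simp: fA)
    finally show "tmul u ?A ?X ?A g f $$ (i, j) = mat 2 2 (\<lambda>(i, j). if i = 0 \<and> j = 0 then 1 else 0) $$ (i, j)"
      using ij by simp
  qed (simp_all add: lA)
  have cgf: "cj A A (tmul u ?A ?X ?A g f) = mat 2 2 (\<lambda>(i, j). if i = 1 \<and> j = 1 then 1 else 0)"
  proof -
    have "tmul u ?A (psi ?A) (psi ?A) h (snd A) = h * snd A" if "h \<in> carrier_mat 2 2" for h
      using tmul_rigid_right[OF o(1) psi_in[OF o(1)] psi_in[OF o(1)] b_le rA' _, of h u] that cA lA by simp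
    moreover have "tmul u ?A (psi ?A) ?A (snd A) h = snd A * h" if "h \<in> carrier_mat 2 2" for h
      using tmul_rigid_left[OF o(1) psi_in[OF o(1)] o(1) b_le rA, of h u] cA that lA by simp
    ultimately have "cj A A (tmul u ?A ?X ?A g f) = snd A * (mat 2 2 (\<lambda>(i, j). if i = 0 \<and> j = 0 then 1 else 0) * snd A)"
      unfolding conj_mor_def gf using cA by (simp add: mult_carrier_mat[of _ 2 2 _ 2])
    also have "\<dots> = mat 2 2 (\<lambda>(i, j). if i = 1 \<and> j = 1 then 1 else 0)"
      unfolding sA swap2_def
      by (rule mat_eqI4[where n = 2 and m = 2])
         (simp_all add: scalar_prod_def sum_two_four)
    finally show ?thesis .
  qed
  have gcf: "tmul u ?A ?X ?A g (cj A B f) = mat 2 2 (\<lambda>(i, j). if i = 0 \<and> j = 1 then t else 0)"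
  proof (rule eq_matI)
    fix i j assume "i < dim_row (mat 2 2 (\<lambda>(i, j). if i = 0 \<and> j = 1 then t else (0::'r)))"
      "j < dim_col (mat 2 2 (\<lambda>(i, j). if i = 0 \<and> j = 1 then t else (0::'r)))"
    then have ij: "i < 2" "j < 2" by auto
    have "tmul u ?A ?X ?A g (cj A B f) $$ (i, j) = (\<Sum>m<length ?X. (if m = k then 1 else 0) *
        (if j = 1 then ?\<xi> $$ (m, k) else 0) * (if i = 0 then u ^ co (?A ! j) (?X ! m) (?A ! i) else 0))"
      unfolding tmul_index[OF ij[folded lA]] by (intro sum.cong refl) (use ij in \<open>auto simp: g_def cjf\<close>)
    also have "\<dots> = (if i = 0 \<and> j = 1 then t else 0)"
      unfolding sum_select(1)[OF k(1)] using k by (auto simp: fA t_def)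
    finally show "tmul u ?A ?X ?A g (cj A B f) $$ (i, j) = mat 2 2 (\<lambda>(i, j). if i = 0 \<and> j = 1 then t else 0) $$ (i, j)"
      using ij by simp
  qed (simp_all add: lA)
  have cgf': "tmul u ?A ?X ?A (cj B A g) f = mat 2 2 (\<lambda>(i, j). if i = 1 \<and> j = 0 then t else 0)"
  proof (rule eq_matI)
    fix i j assume "i < dim_row (mat 2 2 (\<lambda>(i, j). if i = 1 \<and> j = 0 then t else (0::'r)))"
      "j < dim_col (mat 2 2 (\<lambda>(i, j). if i = 1 \<and> j = 0 then t else (0::'r)))"
    then have ij: "i < 2" "j < 2" by auto
    have "tmul u ?A ?X ?A (cj B A g) f $$ (i, j) = (\<Sum>m<length ?X. (if i = 1 then ?\<xi> $$ (k, m) else 0) *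
        (if m = k then 1 else 0) * (if j = 0 then u ^ co (?A ! j) (?X ! m) (?A ! i) else 0))"
      unfolding tmul_index[OF ij[folded lA]] by (intro sum.cong refl) (use ij in \<open>auto simp: f_def cjg\<close>)
    also have "\<dots> = (if i = 1 \<and> j = 0 then t else 0)"
      unfolding sum_select(2)[OF k(1)] using k by (auto simp: fA t_def)
    finally show "tmul u ?A ?X ?A (cj B A g) f $$ (i, j) = mat 2 2 (\<lambda>(i, j). if i = 1 \<and> j = 0 then t else 0) $$ (i, j)"
      using ij by simp
  qed (simp_all add: lA)
  \<comment> \<open>\<open>K\<close> is the adjugate of the composite, which has off-diagonal
    entries \<open>t\<close>. Their twisted product is \<open>1 - t * t * u ^ c\<close> times the
    identity, and the exponent \<open>c\<close> of the round trip from M to its rotation and back is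
    positive off the diagonal, so this scalar is a unit.\<close>
  define K where "K = mat 2 2 (\<lambda>(i, j). if i = j then 1 else - t)"
  have comp: "tmul u ?A ?X ?A (g + cj B A g) (f + cj A B f) = mat 2 2 (\<lambda>(i, j). if i = j then 1 else t)"
    unfolding averaged_composite[OF A X fc gc] gf cgf[unfolded gf] gcf cgf'
    by (rule eq_matI) (auto simp: less_2_cases_iff)
  define c where "c = co (M_orb x y) (M_orb (x + pi) (y + pi)) (M_orb x y)"
  have Api: "M_orb x y \<in> X_set pi" "M_orb (x + pi) (y + pi) \<in> X_set pi"
    using subsetD[OF X_set_mono[OF b_le]] Ain by blast+
  have "c \<noteq> 0"
    using co_back_forth[OF Api] psi_same_coords_imp_diagonal[of x y] xy(1) by (auto simp: c_def psi_orb_M)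
  have c': "co (M_orb (x + pi) (y + pi)) (M_orb x y) (M_orb (x + pi) (y + pi)) = c"
    using co_psi[OF Ain(1,2,1)] psi_orb_psi_orb[OF Ain(1)] by (simp add: psi_orb_M c_def)
  have "u dvd t * t * u ^ c" using \<open>c \<noteq> 0\<close> by (cases c) auto
  then have "\<not> u dvd 1 - t * t * u ^ c" using u_not_unit by (metis diff_add_cancel dvd_add)
  then obtain w where w: "(1 - t * t * u ^ c) * w = 1" using unit_iff by (metis dvdE)
  have KM: "K \<in> Mor PC A A"
  proof -
    have "K * snd A = snd A * K"
      unfolding sA swap2_def K_def
      by (rule mat_eqI4[where n = 2 and m = 2]) (simp_all add: mat_mult_entry sum_two_four del: index_mult_mat(1))
    then show ?thesis
      using rigid_mor[of ?A "snd A" ?A "snd A" K] A rA lA by (simp add: K_def)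
  qed
  have KK: "tmul u ?A ?A ?A K (mat 2 2 (\<lambda>(i, j). if i = j then 1 else t)) = (1 - t * t * u ^ c) \<cdot>\<^sub>m 1\<^sub>m 2"
    by (rule mat_eqI4[where n = 2 and m = 2])
       (simp_all add: lA tmul_index K_def sum_two_four fA c_def[symmetric] c')
  define r where "r = w \<cdot>\<^sub>m tmul u ?X ?A ?A K (g + cj B A g)"
  have rM: "r \<in> Mor PC B A"
    unfolding r_def using mor_smult[OF X A mor_comp[OF X A A average_mor[OF X A gc] KM]] .
  have sM: "f + cj A B f \<in> Mor PC A B" by (rule average_mor[OF A X fc])
  have "tmul u ?A ?X ?A r (f + cj A B f) = w \<cdot>\<^sub>m tmul u ?A ?A ?A K (tmul u ?A ?X ?A (g + cj B A g) (f + cj A B f))"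
    unfolding r_def by (simp add: tmul_smult_left tmul_assoc)
  also have "\<dots> = 1\<^sub>m 2"
    unfolding comp KK using w by (intro eq_matI) (auto simp: mult.commute)
  finally have "tmul u ?A ?X ?A r (f + cj A B f) = 1\<^sub>m 2" .
  then show ?thesis using rM sM unfolding A_def n_def obj_of_eq by auto
qed

lemma splits_off_singular:
  assumes X: "B \<in> Obj PC" and k: "k < length (fst B)" "fst B ! k = M_orb x x"
  shows "\<exists>e. \<exists>s \<in> Mor PC (obj_of (Singular e x)) B. \<exists>r \<in> Mor PC B (obj_of (Singular e x)).
     tmul u (obj_list (coords (Singular e x))) (fst B) (obj_list (coords (Singular e x))) r s = 1\<^sub>m 1"
proof -
  let ?X = "fst B" and ?\<xi> = "snd B"
  define t where "t = ?\<xi> $$ (k, k)"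
  \<comment> \<open>\<open>1 + t\<close> and \<open>1 - t\<close> add up to 2, so \<open>u\<close>
    cannot divide both.\<close>
  obtain e where e: "\<not> u dvd 1 + (if e then 1 else - 1) * t"
  proof -
    have "\<not> u dvd 1 + t \<or> \<not> u dvd 1 - t"
    proof (rule ccontr)
      assume "\<not> ?thesis"
      then have "u dvd (1 + t) + (1 - t)" using dvd_add by blast
      then show False using two by (simp add: dvd_principal)
    qed
    then show ?thesis using that[of True] that[of False] by auto
  qed
  define \<epsilon> where "\<epsilon> = (if e then 1 else - 1 :: 'r)"
  define n where "n = Singular e x"
  define A :: "'r pobj" where "A = obj_of n"
  let ?A = "fst A"
  have A: "A \<in> Obj PC" unfolding A_def by (rule obj_of_in) (simp add: n_def b_pos)
  note o = obj_list_in[OF A] obj_list_in[OF X]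
  have fA: "?A = [M_orb x x]" and sA: "snd A = mat 1 1 (\<lambda>_. \<epsilon>)"
    by (simp_all add: A_def obj_of_eq n_def obj_list_def \<epsilon>_def)
  have lA: "length ?A = 1" by (simp add: fA)
  have sc: "same_coords (psi_orb (M_orb x x)) (M_orb x x)" by (rule same_coords_psi_diagonal)
  have pA: "psi ?A = [psi_orb (M_orb x x)]" by (simp add: fA psi_def)
  have rA: "rigid (psi ?A) ?A (snd A)" using rigid_xi[of n] by (simp add: A_def obj_of_eq)
  have rA': "rigid ?A (psi ?A) (snd A)"
    unfolding rigid_def using pA fA same_coords_sym[OF sc] by auto
  have cA: "snd A \<in> carrier_mat 1 1" by (simp add: sA)
  have Api: "M_orb x x \<in> X_set pi" "psi_orb (M_orb x x) \<in> X_set pi"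
    by (auto intro!: M_orb_in psi_orb_in)
  have Xpi: "?X ! l \<in> X_set pi" if "l < length ?X" for l using X_nth[OF o(2) b_le that] .
  define f where "f = mat (length ?X) 1 (\<lambda>(l, c). if l = k then 1 else (0::'r))"
  define g where "g = mat 1 (length ?X) (\<lambda>(c, l). if l = k then 1 else (0::'r))"
  have fc: "f \<in> carrier_mat (length ?X) (length ?A)" and gc: "g \<in> carrier_mat (length ?A) (length ?X)"
    by (simp_all add: f_def g_def lA)
  have 1: "tmul u ?A (psi ?A) (psi ?X) f (snd A) = f * snd A"
    using tmul_rigid_right[OF o(1) psi_in[OF o(1)] psi_in[OF o(2)] b_le rA' _, of f] cA fc lA by simp
  have f1: "(f * snd A) $$ (l, 0) = (if l = k then \<epsilon> else 0)" if "l < length ?X" for l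
    using that by (simp add: f_def sA scalar_prod_def)
  have cjf: "cj A B f $$ (l, 0) = ?\<xi> $$ (l, k) * \<epsilon>" if lc: "l < length ?X" for l
  proof -
    have l0: "0 < length ?A" using lA by simp
    have "cj A B f $$ (l, 0) = (\<Sum>m<length ?X. ?\<xi> $$ (l, m) * (f * snd A) $$ (m, 0) * u ^ co (?A ! 0) (psi ?X ! m) (?X ! l))"
      unfolding conj_mor_def 1 tmul_index[OF lc l0] by simp
    also have "\<dots> = (\<Sum>m<length ?X. ?\<xi> $$ (l, m) * (if m = k then 1 else 0) * (\<epsilon> * u ^ co (?A ! 0) (psi ?X ! m) (?X ! l)))"
      using lc by (intro sum.cong) (auto simp: f1)
    also have "\<dots> = ?\<xi> $$ (l, k) * \<epsilon>"
      unfolding sum_select(2)[OF k(1)]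
      using k co_same_coords[OF Api(1,2) Xpi[OF lc]] same_coords_sym[OF sc] by (simp add: fA psi_nth)
    finally show ?thesis .
  qed
  have 2: "tmul u ?X (psi ?A) ?A (snd A) h = snd A * h" if "h \<in> carrier_mat 1 (length ?X)" for h
    using tmul_rigid_left[OF o(2) psi_in[OF o(1)] o(1) b_le rA, of h u] cA that lA by simp
  have g1: "tmul u ?X (psi ?X) (psi ?A) g ?\<xi> $$ (0, l) = ?\<xi> $$ (k, l)" if lc: "l < length ?X" for l
  proof -
    have l0: "0 < length (psi ?A)" using lA by simp
    have "tmul u ?X (psi ?X) (psi ?A) g ?\<xi> $$ (0, l) =
        (\<Sum>m<length ?X. (if m = k then 1 else 0) * ?\<xi> $$ (m, l) * u ^ co (?X ! l) (psi ?X ! m) (psi ?A ! 0))"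
      unfolding tmul_index[OF l0 lc] by (intro sum.cong) (auto simp: g_def)
    also have "\<dots> = ?\<xi> $$ (k, l)"
      unfolding sum_select(1)[OF k(1)] using k by (simp add: pA psi_nth)
    finally show ?thesis .
  qed
  have cjg: "cj B A g $$ (0, l) = \<epsilon> * ?\<xi> $$ (k, l)" if lc: "l < length ?X" for l
  proof -
    have "cj B A g = snd A * tmul u ?X (psi ?X) (psi ?A) g ?\<xi>"
      unfolding conj_mor_def using 2[of "tmul u ?X (psi ?X) (psi ?A) g ?\<xi>"] lA by simp
    then show ?thesis using lc lA g1 by (simp add: sA scalar_prod_def)
  qed
  have l0: "0 < length ?A" using lA by simp
  have gf: "tmul u ?A ?X ?A g f $$ (0, 0) = 1"
  proof -
    have "tmul u ?A ?X ?A g f $$ (0, 0) = (\<Sum>m<length ?X. (if m = k then 1 else 0) * 1 * u ^ co (?A ! 0) (?X ! m) (?A ! 0))"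
      unfolding tmul_index[OF l0 l0] by (intro sum.cong) (auto simp: g_def f_def)
    also have "\<dots> = 1" unfolding sum_select(1)[OF k(1)] using k by (simp add: fA)
    finally show ?thesis .
  qed
  then have gf1: "tmul u ?A ?X ?A g f = 1\<^sub>m (length ?A)" by (intro eq_matI) (auto simp: lA)
  have gcf: "tmul u ?A ?X ?A g (cj A B f) $$ (0, 0) = \<epsilon> * t"
  proof -
    have "tmul u ?A ?X ?A g (cj A B f) $$ (0, 0) =
        (\<Sum>m<length ?X. (if m = k then 1 else 0) * (?\<xi> $$ (m, k) * \<epsilon>) * u ^ co (?A ! 0) (?X ! m) (?A ! 0))"
      unfolding tmul_index[OF l0 l0] by (intro sum.cong) (auto simp: g_def cjf)
    also have "\<dots> = \<epsilon> * t" unfolding sum_select(1)[OF k(1)] using k by (simp add: fA t_def mult.commute)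
    finally show ?thesis .
  qed
  have cgf: "tmul u ?A ?X ?A (cj B A g) f $$ (0, 0) = \<epsilon> * t"
  proof -
    have "tmul u ?A ?X ?A (cj B A g) f $$ (0, 0) =
        (\<Sum>m<length ?X. (\<epsilon> * ?\<xi> $$ (k, m)) * (if m = k then 1 else 0) * u ^ co (?A ! 0) (?X ! m) (?A ! 0))"
      unfolding tmul_index[OF l0 l0] by (intro sum.cong) (auto simp: f_def cjg)
    also have "\<dots> = \<epsilon> * t" unfolding sum_select(2)[OF k(1)] using k by (simp add: fA t_def)
    finally show ?thesis .
  qed
  have comp: "tmul u ?A ?X ?A (g + cj B A g) (f + cj A B f) = (2 * (1 + \<epsilon> * t)) \<cdot>\<^sub>m 1\<^sub>m 1" (is "?L = _")
  proof (rule eq_matI)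
    have "?L = (1\<^sub>m (length ?A) + 1\<^sub>m (length ?A)) + (tmul u ?A ?X ?A g (cj A B f) + tmul u ?A ?X ?A (cj B A g) f)"
      by (simp only: averaged_composite[OF A X fc gc] gf1 conj_id[OF A])
    then have "?L $$ (0, 0) = (1 + 1) + (\<epsilon> * t + \<epsilon> * t)" using lA gcf cgf by simp
    also have "\<dots> = 2 * (1 + \<epsilon> * t)" by (simp only: one_add_one distrib_left mult_1_right mult_2[of "\<epsilon> * t"])
    finally have L00: "?L $$ (0, 0) = 2 * (1 + \<epsilon> * t)" .
    fix i j assume "i < dim_row ((2 * (1 + \<epsilon> * t)) \<cdot>\<^sub>m 1\<^sub>m 1)" "j < dim_col ((2 * (1 + \<epsilon> * t)) \<cdot>\<^sub>m 1\<^sub>m 1)"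
    then have "i = 0" "j = 0" by auto
    then show "?L $$ (i, j) = ((2 * (1 + \<epsilon> * t)) \<cdot>\<^sub>m 1\<^sub>m 1) $$ (i, j)" using L00 by simp
  qed (simp_all add: lA)
  have "\<not> u dvd 2 * (1 + \<epsilon> * t)" using e two unfolding u_dvd_mult \<epsilon>_def dvd_principal by blast
  then obtain w where w: "(2 * (1 + \<epsilon> * t)) * w = 1" using unit_iff by (metis dvdE)
  define r where "r = w \<cdot>\<^sub>m (g + cj B A g)"
  have rM: "r \<in> Mor PC B A" unfolding r_def using mor_smult[OF X A average_mor[OF X A gc]] .
  have sM: "f + cj A B f \<in> Mor PC A B" by (rule average_mor[OF A X fc])
  have "g + cj B A g \<in> carrier_mat (length ?A) (length ?X)" using gc by simp
  then have "tmul u ?A ?X ?A r (f + cj A B f) = w \<cdot>\<^sub>m tmul u ?A ?X ?A (g + cj B A g) (f + cj A B f)"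
    unfolding r_def by (rule tmul_smult_left)
  also have "\<dots> = 1\<^sub>m 1"
    unfolding comp using w by (intro eq_matI) (auto simp: mult.commute)
  finally have rs: "tmul u ?A ?X ?A r (f + cj A B f) = 1\<^sub>m 1" .
  have "?A = obj_list (coords n)" by (simp add: A_def obj_of_eq)
  then show ?thesis
    using rs sM rM unfolding A_def n_def by (intro exI[of _ e] bexI[of _ "f + cj A B f"] bexI[of _ r]) (simp_all add: A_def n_def)
qed

lemma splits_off:
  assumes X: "B \<in> Obj PC" and k: "k < length (fst B)" "nz b (fst B ! k) (fst B ! k)"
  obtains n s r where "proper_name b n" "s \<in> Mor PC (obj_of n) B" "r \<in> Mor PC B (obj_of n)"
    "tmul u (obj_list (coords n)) (fst B) (obj_list (coords n)) r s = 1\<^sub>m (length (coords n))"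
proof -
  have in_X: "fst B ! k \<in> X_set b" using X_nth[OF obj_list_in[OF X] order_refl k(1)] .
  then obtain x y where xy: "fst B ! k = M_orb x y" "\<bar>x - y\<bar> \<le> b" by (elim X_setE)
  have lt: "\<bar>x - y\<bar> < b" using nz_self_iff[OF in_X b_le, of x y True] k(2) xy M_orb_self by simp
  show ?thesis
  proof (cases "x = y")
    case True
    then obtain e s r where "s \<in> Mor PC (obj_of (Singular e x)) B" "r \<in> Mor PC B (obj_of (Singular e x))"
      "tmul u (obj_list (coords (Singular e x))) (fst B) (obj_list (coords (Singular e x))) r s = 1\<^sub>m 1"
      using splits_off_singular[OF X k(1)] xy by blast
    then show ?thesis using that[of "Singular e x" s r] b_pos by simp
  next
    case False
    then obtain s r where "s \<in> Mor PC (obj_of (Regular x y)) B" "r \<in> Mor PC B (obj_of (Regular x y))"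
      "tmul u (obj_list (coords (Regular x y))) (fst B) (obj_list (coords (Regular x y))) r s = 1\<^sub>m 2"
      using splits_off_regular[OF X k(1) xy(1) _ lt] by blast
    then show ?thesis using that[of "Regular x y" s r] lt False by (simp add: numeral_2_eq_2)
  qed
qed

lemma one_not_nul:
  assumes "inner_name b n"
  shows "\<not> nul u b (obj_list (coords n)) (obj_list (coords n)) (1\<^sub>m (length (coords n)))"
proof
  assume nul: "nul u b (obj_list (coords n)) (obj_list (coords n)) (1\<^sub>m (length (coords n)))"
  have 0: "0 < length (coords n)" by (cases n) auto
  obtain x y where xy: "coords n ! 0 = (x, y)" by (cases "coords n ! 0")
  then have "\<bar>x - y\<bar> < b" using coords_inner[OF assms] nth_mem[OF 0] by metis
  then have "nz b (M_orb x y) (M_orb x y)"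
    using nz_self_iff[OF M_orb_in b_le M_orb_self, of x y] by simp
  moreover have "obj_list (coords n) ! 0 = M_orb x y" using hull_nth(1)[OF 0] xy by simp
  ultimately have "u dvd (1\<^sub>m (length (coords n)) :: 'r mat) $$ (0, 0)"
    using nul 0 unfolding nul_def by (metis hull_length(1))
  then show False using u_not_unit 0 by simp
qed

text \<open>Otherwise a named object N splits off. By injectivity its inclusion extends to the hull
  of N, so the identity of N factors through a boundary object and is null, against
  \<open>one_not_nul\<close>.\<close>

lemma injective_boundary:
  assumes inj: "injective PC PS P"
  shows "boundary b (fst P)"
proof (rule ccontr)
  assume "\<not> boundary b (fst P)"
  then obtain k where k: "k < length (fst P)" "nz b (fst P ! k) (fst P ! k)"
    unfolding boundary_def by (metis in_set_conv_nth)
  have P: "P \<in> Obj PC" using inj by (simp add: injective_def)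
  obtain n s r where n: "proper_name b n" and s: "s \<in> Mor PC (obj_of n) P" and r: "r \<in> Mor PC P (obj_of n)"
    and rs: "tmul u (obj_list (coords n)) (fst P) (obj_list (coords n)) r s = 1\<^sub>m (length (coords n))"
    using splits_off[OF P k] .
  have inner: "inner_name b n" using proper_inner[OF n] .
  let ?H = "(phull b (coords n), eta_of n) :: 'r pobj" and ?j = "hull_in (length (coords n)) :: 'r mat"
  have ses: "(obj_of n, ?j, ?H, hull_out (length (coords n)), obj_of (shift_name b n)) \<in> PS" by (rule name_ses[OF inner])
  then have infl: "inflation PS (obj_of n) ?H ?j" unfolding inflation_def by blast
  then obtain t where t: "t \<in> Mor PC ?H P" "tmul u (obj_list (coords n)) (phull b (coords n)) (fst P) t ?j = s"
    using injectiveD[OF inj infl s] by (auto simp: obj_of_eq)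
  have o: "obj_list (coords n) \<in> lists (X_set b)" "phull b (coords n) \<in> lists (X_set b)" "fst P \<in> lists (X_set b)"
    using obj_list_in[OF obj_of_in[OF inner]] obj_list_in[OF hull_of_in[OF inner]] obj_list_in[OF P]
    by (simp_all add: obj_of_eq)
  have "nul u b (obj_list (coords n)) (phull b (coords n)) ?j"
    by (rule boundary_nul[OF o(1,2) b_le]) (simp add: hull_of_boundary[OF inner])
  then have "nul u b (obj_list (coords n)) (obj_list (coords n)) (tmul u (obj_list (coords n)) (fst P) (obj_list (coords n)) r s)"
    using nul_tmul[OF o(1,2,3) b_le, of u ?j t] nul_tmul[OF o(1,3,1) b_le, of u s r] t(2) by blast
  then show False using one_not_nul[OF inner] rs by simp
qed

subsection \<open>Stably trivial morphisms\<close>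

definition double_swap :: "nat \<Rightarrow> 'a::idom mat" where
  "double_swap n = mat (n + n) (n + n) (\<lambda>(i, j). if i = n + j \<or> j = n + i then 1 else 0)"

lemma double_obj:
  assumes "P \<in> lists (X_set b)"
  shows "(P @ psi P, double_swap (length P)) \<in> Obj PC"
proof (rule rigid_obj)
  let ?n = "length P"
  show "P @ psi P \<in> lists (X_set b)" using assms psi_in[OF assms] by simp
  show "double_swap ?n \<in> carrier_mat (length (P @ psi P)) (length (P @ psi P))" by (simp add: double_swap_def)
  have pp: "psi (P @ psi P) = psi P @ P" using psi_psi[OF assms] by (simp add: psi_def)
  show "rigid (psi (P @ psi P)) (P @ psi P) (double_swap ?n :: 'r mat)"
    unfolding rigid_def pp
  proof (intro allI impI)
    fix j i assume "j < length (P @ psi P)" "i < length (psi P @ P)" "(double_swap ?n :: 'r mat) $$ (j, i) \<noteq> 0"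
    then have ij: "j < ?n + ?n" "i < ?n + ?n" "j = ?n + i \<or> i = ?n + j"
      by (auto simp: double_swap_def split: if_splits)
    then have "(psi P @ P) ! i = (P @ psi P) ! j" by (auto simp: nth_append)
    moreover have "(P @ psi P) ! j \<in> X_set b" using assms psi_in[OF assms] ij(1)
      by (intro X_nth[of "P @ psi P" b]) auto
    ultimately show "same_coords ((psi P @ P) ! i) ((P @ psi P) ! j)" using same_coords_refl by simp
  qed
  show "double_swap ?n * double_swap ?n = (1\<^sub>m (length (P @ psi P)) :: 'r mat)"
  proof (rule eq_matI)
    fix i j assume "i < dim_row (1\<^sub>m (length (P @ psi P)) :: 'r mat)" "j < dim_col (1\<^sub>m (length (P @ psi P)) :: 'r mat)"
    then have ij: "i < ?n + ?n" "j < ?n + ?n" by auto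
    define l where "l = (if i < ?n then ?n + i else i - ?n)"
    have l: "l < ?n + ?n" using ij by (auto simp: l_def)
    have "(double_swap ?n * double_swap ?n) $$ (i, j) =
        (\<Sum>m<?n + ?n. double_swap ?n $$ (i, m) * (double_swap ?n $$ (m, j) :: 'r))"
      using ij by (simp add: scalar_prod_def double_swap_def lessThan_atLeast0)
    also have "\<dots> = (\<Sum>m<?n + ?n. (if m = l then 1 else 0) * double_swap ?n $$ (m, j) * 1)"
      using ij by (intro sum.cong) (auto simp: double_swap_def l_def)
    also have "\<dots> = double_swap ?n $$ (l, j)" unfolding sum_select(1)[OF l] by simp
    also have "\<dots> = 1\<^sub>m (length (P @ psi P)) $$ (i, j)" using ij l by (auto simp: double_swap_def l_def)
    finally show "(double_swap ?n * double_swap ?n) $$ (i, j) = (1\<^sub>m (length (P @ psi P)) :: 'r mat) $$ (i, j)" .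
  qed (simp_all add: double_swap_def)
qed

text \<open>The swap moves the first copy of \<open>P\<close> into the second, and the projection
  kills it. For this reason the mixed terms of the averaged factorisation below vanish.\<close>

lemma double_swap_off_diagonal:
  "tmul u (psi P) (P @ psi P) P (pr1 (length P) (length P))
     (tmul u (psi P) (psi (P @ psi P)) (P @ psi P) (double_swap (length P)) (in1 (length P) (length P))) =
   0\<^sub>m (length P) (length P)"
proof (rule eq_matI)
  let ?n = "length P"
  fix i j assume "i < dim_row (0\<^sub>m ?n ?n :: 'r mat)" "j < dim_col (0\<^sub>m ?n ?n :: 'r mat)"
  then have ij: "i < ?n" "j < ?n" by auto
  have "tmul u (psi P) (psi (P @ psi P)) (P @ psi P) (double_swap ?n) (in1 ?n ?n) $$ (i, j) = (0::'r)"
    using ij by (simp add: tmul_index, intro sum.neutral) (auto simp: double_swap_def in1_def)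
  then have "tmul u (psi P) (P @ psi P) P (pr1 ?n ?n)
     (tmul u (psi P) (psi (P @ psi P)) (P @ psi P) (double_swap ?n) (in1 ?n ?n)) $$ (i, j) = 0"
    using ij by (subst tmul_index; simp) (intro sum.neutral; auto simp: pr1_def)
  then show "tmul u (psi P) (P @ psi P) P (pr1 ?n ?n)
     (tmul u (psi P) (psi (P @ psi P)) (P @ psi P) (double_swap ?n) (in1 ?n ?n)) $$ (i, j) = 0\<^sub>m ?n ?n $$ (i, j)"
    using ij by simp
qed simp_all

lemma tmul_pr1_in1: "tmul u A (A @ B) A (pr1 (length A) (length B)) (in1 (length A) (length B)) = 1\<^sub>m (length A)"
  by (rule eq_matI) (auto simp: tmul_index sum_append in1_def pr1_def sum_select nth_append)

text \<open>A null morphism factors through the hull \<open>P\<close> in \<open>F\<^sub>b\<close>; averaging the two factors makes it factor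
  through \<open>P \<oplus> \<psi>P\<close> equivariantly.\<close>

lemma nul_factors_equivariantly:
  assumes A: "A \<in> Obj PC" and B: "B \<in> Obj PC" and f: "f \<in> Mor PC A B" "nul u b (fst A) (fst B) f"
  obtains Q p q where "Q \<in> Obj PC" "boundary b (fst Q)" "p \<in> Mor PC A Q" "q \<in> Mor PC Q B"
    "tmul u (fst A) (fst Q) (fst B) q p = f"
proof -
  note o = obj_list_in[OF A] obj_list_in[OF B]
  obtain xs where xs: "fst A = obj_list xs" "\<And>x y. (x, y) \<in> set xs \<Longrightarrow> \<bar>x - y\<bar> \<le> b"
    using obj_listE[OF o(1)] by metis
  let ?P = "phull b xs" let ?n = "length ?P"
  have P: "?P \<in> lists (X_set b)" using hull_obj(2)[of xs b] xs(2) b_pos by blast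
  have fc: "f \<in> carrier_mat (length (fst B)) (length (fst A))" using mor_carrier[OF A B f(1)] .
  obtain h where h: "h \<in> carrier_mat (length (fst B)) ?n" "tmul u (fst A) ?P (fst B) h (hull_in (length xs)) = f"
    using nul_factors_through_hull[where f = f and xs = xs and u = u, OF xs(2) b_le o(2)] fc f(2) xs(1)
    by (metis hull_length(1,2))
  define j where "j = (hull_in (length xs) :: 'r mat)"
  have jc: "j \<in> carrier_mat ?n (length (fst A))" by (simp add: j_def xs(1))
  define Q where "Q = (?P @ psi ?P, double_swap ?n :: 'r mat)"
  have Q: "Q \<in> Obj PC" unfolding Q_def by (rule double_obj[OF P])
  have fQ: "fst Q = ?P @ psi ?P" and sQ: "snd Q = double_swap ?n" by (simp_all add: Q_def)
  have lQ: "length (fst Q) = ?n + ?n" by (simp add: fQ)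
  have "boundary b ?P" using hull_boundary[OF xs(2) b_pos b_le] .
  then have bd: "boundary b (fst Q)"
    using nz_psi P unfolding boundary_def fQ psi_def by (auto simp: in_lists_conv_set)
  define p0 where "p0 = tmul u (fst A) ?P (fst Q) (in1 ?n ?n) j"
  define q0 where "q0 = tmul u (fst Q) ?P (fst B) h (pr1 ?n ?n)"
  have p0: "p0 \<in> carrier_mat (length (fst Q)) (length (fst A))" and q0: "q0 \<in> carrier_mat (length (fst B)) (length (fst Q))"
    by (simp_all add: p0_def q0_def)
  have pr_in: "tmul u ?P (fst Q) ?P (pr1 ?n ?n) (in1 ?n ?n) = 1\<^sub>m ?n"
    using tmul_pr1_in1[of ?P "psi ?P"] by (simp only: fQ psi_length)
  have q0p0: "tmul u (fst A) (fst Q) (fst B) q0 p0 = f"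
  proof -
    have "tmul u (fst A) (fst Q) (fst B) q0 p0 = tmul u (fst A) ?P (fst B) h (tmul u (fst A) ?P ?P (tmul u ?P (fst Q) ?P (pr1 ?n ?n) (in1 ?n ?n)) j)"
      by (simp add: p0_def q0_def tmul_assoc)
    then show ?thesis using pr_in h(2) tmul_one(1)[OF jc] by (simp add: j_def)
  qed
  have q0cp0: "tmul u (fst A) (fst Q) (fst B) q0 (cj A Q p0) = 0\<^sub>m (length (fst B)) (length (fst A))"
  proof -
    have p0': "tmul u (psi (fst A)) (psi ?P) (psi (fst Q)) (in1 ?n ?n) j = p0"
      using tmul_psi[OF o(1) P obj_list_in[OF Q]] by (simp add: p0_def)
    have "cj A Q p0 = tmul u (fst A) (psi (fst Q)) (fst Q) (double_swap ?n)
        (tmul u (fst A) (psi (fst A)) (psi (fst Q)) (tmul u (psi (fst A)) (psi ?P) (psi (fst Q)) (in1 ?n ?n) j) (snd A))"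
      unfolding conj_mor_def p0' sQ ..
    then have "tmul u (fst A) (fst Q) (fst B) q0 (cj A Q p0) = tmul u (fst A) (psi (fst A)) (fst B)
        (tmul u (psi (fst A)) (psi ?P) (fst B) (tmul u (psi ?P) ?P (fst B) h
          (tmul u (psi ?P) (fst Q) ?P (pr1 ?n ?n) (tmul u (psi ?P) (psi (fst Q)) (fst Q) (double_swap ?n) (in1 ?n ?n)))) j) (snd A)"
      by (simp add: q0_def tmul_assoc)
    also have "tmul u (psi ?P) (fst Q) ?P (pr1 ?n ?n) (tmul u (psi ?P) (psi (fst Q)) (fst Q) (double_swap ?n) (in1 ?n ?n)) = 0\<^sub>m ?n ?n"
      unfolding fQ by (rule double_swap_off_diagonal)
    finally show ?thesis by (auto intro!: eq_matI sum.neutral simp: tmul_index)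
  qed
  have cq0p0: "tmul u (fst A) (fst Q) (fst B) (cj Q B q0) p0 = 0\<^sub>m (length (fst B)) (length (fst A))"
  proof -
    have "tmul u (fst A) (fst Q) (fst B) (cj Q B q0) p0 = cj A B (tmul u (fst A) (fst Q) (fst B) q0 (cj A Q p0))"
      using conj_comp[OF A Q B conj_carrier q0, of p0] conj_conj[OF A Q p0] by simp
    then show ?thesis using q0cp0 mor_conj[OF A B mor_zero[OF A B]] by simp
  qed
  \<comment> \<open>Of the four products the two straight ones equal \<open>f\<close>, by choice and
    by conjugation, and the two mixed ones vanish.\<close>
  have "tmul u (fst A) (fst Q) (fst B) (q0 + cj Q B q0) (p0 + cj A Q p0) =
    (tmul u (fst A) (fst Q) (fst B) q0 p0 + tmul u (fst A) (fst Q) (fst B) q0 (cj A Q p0)) +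
    (tmul u (fst A) (fst Q) (fst B) (cj Q B q0) p0 + tmul u (fst A) (fst Q) (fst B) (cj Q B q0) (cj A Q p0))"
    using p0 q0 by (simp add: tmul_add_left[OF q0 conj_carrier] tmul_add_right[OF p0 conj_carrier])
  also have "tmul u (fst A) (fst Q) (fst B) (cj Q B q0) (cj A Q p0) = f"
    using conj_comp[OF A Q B p0 q0] q0p0 mor_conj[OF A B f(1)] by simp
  finally have sum: "tmul u (fst A) (fst Q) (fst B) (q0 + cj Q B q0) (p0 + cj A Q p0) = f + f"
    unfolding q0p0 q0cp0 cq0p0 using fc by simp
  obtain c where c: "2 * c = (1::'r)" by (rule half)
  show ?thesis
  proof (rule that[OF Q bd average_mor[OF A Q p0] mor_smult[OF Q B average_mor[OF Q B q0], of c]])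
    show "tmul u (fst A) (fst Q) (fst B) (c \<cdot>\<^sub>m (q0 + cj Q B q0)) (p0 + cj A Q p0) = f"
      using half_average[OF c fc] q0 by (simp add: tmul_smult_left sum)
  qed
qed

text \<open>The bridge from categories to matrices: projective-injective objects have only boundary
  summands, through which every matrix is null, and conversely a null morphism factors through a
  boundary object, which is both projective and injective.\<close>

lemma stably_null_iff:
  assumes A: "A \<in> Obj PC" and B: "B \<in> Obj PC"
  shows "f \<in> stably_null PC PS A B \<longleftrightarrow> f \<in> Mor PC A B \<and> nul u b (fst A) (fst B) f"
proof
  assume "f \<in> stably_null PC PS A B"
  then obtain P p q where f: "f = Comp PC A P B q p" and P: "injective PC PS P"
    and pq: "p \<in> Mor PC A P" "q \<in> Mor PC P B" unfolding stably_null_def by blast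
  have PO: "P \<in> Obj PC" using P by (simp add: injective_def)
  have "nul u b (fst A) (fst P) p"
    using boundary_nul[OF obj_list_in[OF A] obj_list_in[OF PO] b_le] injective_boundary[OF P] by blast
  then have "nul u b (fst A) (fst B) (tmul u (fst A) (fst P) (fst B) q p)"
    using nul_tmul[OF obj_list_in[OF A] obj_list_in[OF PO] obj_list_in[OF B] b_le] by blast
  then show "f \<in> Mor PC A B \<and> nul u b (fst A) (fst B) f" using mor_comp[OF A PO B pq] f by simp
next
  assume *: "f \<in> Mor PC A B \<and> nul u b (fst A) (fst B) f"
  obtain Q p q where "Q \<in> Obj PC" "boundary b (fst Q)" "p \<in> Mor PC A Q" "q \<in> Mor PC Q B"
    "tmul u (fst A) (fst Q) (fst B) q p = f"
    using nul_factors_equivariantly[OF A B] * by blast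
  then show "f \<in> stably_null PC PS A B"
    using boundary_projective boundary_injective unfolding stably_null_def Fpsi_simps by blast
qed

end

section \<open>The stable category\<close>

lemma tmul_diff_left:
  assumes "g \<in> carrier_mat (length Z) (length Y)" "h \<in> carrier_mat (length Z) (length Y)"
  shows "tmul u X Y Z (g - h) f = tmul u X Y Z g f - tmul u X Y Z h f"
  using assms by (auto intro!: eq_matI simp: tmul_index sum_subtractf[symmetric] algebra_simps)

lemma tmul_diff_right:
  assumes "g \<in> carrier_mat (length Y) (length X)" "h \<in> carrier_mat (length Y) (length X)"
  shows "tmul u X Y Z f (g - h) = tmul u X Y Z f g - tmul u X Y Z f h"
  using assms by (auto intro!: eq_matI simp: tmul_index sum_subtractf[symmetric] algebra_simps)

lemma nul_diff: "f \<in> carrier_mat (length Y) (length X) \<Longrightarrow> g \<in> carrier_mat (length Y) (length X) \<Longrightarrow>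
    nul u b X Y f \<Longrightarrow> nul u b X Y g \<Longrightarrow> nul u b X Y (f - g)"
  by (auto simp: nul_def)

lemma nul_diff_iff:
  assumes "f \<in> carrier_mat (length Y) (length X)" "g \<in> carrier_mat (length Y) (length X)" "nul u b X Y (f - g)"
  shows "nul u b X Y f \<longleftrightarrow> nul u b X Y g"
proof -
  have "u dvd f $$ (i, j) \<longleftrightarrow> u dvd g $$ (i, j)" if "i < length Y" "j < length X" "nz b (X ! j) (Y ! i)" for i j
  proof -
    have "u dvd (f - g) $$ (i, j)" using assms(3) that unfolding nul_def by blast
    then have "u dvd f $$ (i, j) - g $$ (i, j)" using assms(1,2) that by simp
    then show ?thesis using dvd_add_left_iff[of u "f $$ (i, j) - g $$ (i, j)" "g $$ (i, j)"] by simp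
  qed
  then show ?thesis unfolding nul_def by blast
qed

context F_structure
begin

abbreviation CC where "CC \<equiv> Cpsi_cat u b S"
abbreviation sc where "sc \<equiv> stable_class PC PS"
abbreviation nl where "nl A B \<equiv> nul u b (fst A) (fst B)"

lemma mor_diff: assumes "A \<in> Obj PC" "B \<in> Obj PC" "f \<in> Mor PC A B" "g \<in> Mor PC A B" shows "f - g \<in> Mor PC A B"
proof -
  have "f - g = f + (- g)"
    using mor_carrier[OF assms(1,2,3)] mor_carrier[OF assms(1,2,4)] by (intro eq_matI) auto
  then show ?thesis using mor_add[OF assms(1-3) mor_uminus[OF assms(1,2,4)]] by simp
qed

lemma sc_alt:
  assumes "A \<in> Obj PC" "B \<in> Obj PC" "f \<in> Mor PC A B"
  shows "sc A B f = {h \<in> Mor PC A B. nl A B (h - f)}"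
proof (intro equalityI subsetI)
  note fc = mor_carrier[OF assms]
  fix h assume "h \<in> sc A B f"
  then obtain n where n: "h = f + n" "n \<in> Mor PC A B" "nl A B n"
    unfolding stable_class_def using stably_null_iff[OF assms(1,2)] by auto
  have "h - f = n" using n(1) fc mor_carrier[OF assms(1,2) n(2)] by (intro eq_matI) auto
  then show "h \<in> {h \<in> Mor PC A B. nl A B (h - f)}" using n mor_add assms by auto
next
  note fc = mor_carrier[OF assms]
  fix h assume h: "h \<in> {h \<in> Mor PC A B. nl A B (h - f)}"
  have hf: "f + (h - f) = h" using h fc mor_carrier[OF assms(1,2), of h] by (intro eq_matI) auto
  have "h - f \<in> stably_null PC PS A B" using h mor_diff[OF assms(1,2) _ assms(3)] stably_null_iff[OF assms(1,2)] by simp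
  then show "h \<in> sc A B f" unfolding stable_class_def mem_Collect_eq Fpsi_simps using hf by metis
qed

lemma sc_self: assumes "A \<in> Obj PC" "B \<in> Obj PC" "f \<in> Mor PC A B" shows "f \<in> sc A B f"
proof -
  have "f - f = 0\<^sub>m (length (fst B)) (length (fst A))" using mor_carrier[OF assms] by (intro eq_matI) auto
  then show ?thesis using assms by (simp add: sc_alt nul_zero)
qed

lemma sc_eq_iff:
  assumes "A \<in> Obj PC" "B \<in> Obj PC" "f \<in> Mor PC A B" "g \<in> Mor PC A B"
  shows "sc A B f = sc A B g \<longleftrightarrow> nl A B (f - g)"
proof
  assume "sc A B f = sc A B g"
  then show "nl A B (f - g)" using sc_self[OF assms(1-3)] assms by (simp add: sc_alt)
next
  assume n: "nl A B (f - g)"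
  note c = mor_carrier[OF assms(1,2)]
  have "nl A B (h - f) \<longleftrightarrow> nl A B (h - g)" if "h \<in> Mor PC A B" for h
  proof (rule nul_diff_iff)
    have "(h - f) - (h - g) = - (f - g)"
      using c[OF that] c[OF assms(3)] c[OF assms(4)] by (intro eq_matI) auto
    moreover have "f - g \<in> carrier_mat (length (fst B)) (length (fst A))"
      using c[OF assms(4)] by (rule minus_carrier_mat)
    ultimately show "nl A B ((h - f) - (h - g))" using nul_uminus n by metis
  qed (use c[OF assms(3)] c[OF assms(4)] minus_carrier_mat in blast)+
  then show "sc A B f = sc A B g" using assms by (auto simp: sc_alt)
qed

lemma sc_zero_iff:
  assumes "A \<in> Obj PC" "B \<in> Obj PC" "f \<in> Mor PC A B"
  shows "sc A B f = sc A B (0\<^sub>m (length (fst B)) (length (fst A))) \<longleftrightarrow> nl A B f"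
proof -
  have "f - 0\<^sub>m (length (fst B)) (length (fst A)) = f" using mor_carrier[OF assms] by (intro eq_matI) auto
  then show ?thesis using sc_eq_iff[OF assms mor_zero[OF assms(1,2)]] by simp
qed

lemma sc_comp:
  assumes "A \<in> Obj PC" "B \<in> Obj PC" "C \<in> Obj PC" "f \<in> Mor PC A B" "g \<in> Mor PC B C"
  shows "Comp CC A B C (sc B C g) (sc A B f) = sc A C (tmul u (fst A) (fst B) (fst C) g f)"
proof -
  note o = obj_list_in[OF assms(1)] obj_list_in[OF assms(2)] obj_list_in[OF assms(3)]
  have "sc A C (tmul u (fst A) (fst B) (fst C) g' f') = sc A C (tmul u (fst A) (fst B) (fst C) g f)"
    if "g' \<in> sc B C g" "f' \<in> sc A B f" for g' f'
  proof -
    have g': "g' \<in> Mor PC B C" "nl B C (g' - g)" and f': "f' \<in> Mor PC A B" "nl A B (f' - f)"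
      using that assms by (auto simp: sc_alt)
    note c = mor_carrier[OF assms(1,2,4)] mor_carrier[OF assms(2,3,5)] mor_carrier[OF assms(1,2) f'(1)]
      mor_carrier[OF assms(2,3) g'(1)]
    have "tmul u (fst A) (fst B) (fst C) g' f' - tmul u (fst A) (fst B) (fst C) g f =
        tmul u (fst A) (fst B) (fst C) g' (f' - f) + tmul u (fst A) (fst B) (fst C) (g' - g) f"
      unfolding tmul_diff_left[OF c(4,2)] tmul_diff_right[OF c(3,1)] by (intro eq_matI) auto
    moreover have "nl A C (tmul u (fst A) (fst B) (fst C) g' (f' - f))" "nl A C (tmul u (fst A) (fst B) (fst C) (g' - g) f)"
      using nul_tmul[OF o b_le] g' f' by blast+
    ultimately have "nl A C (tmul u (fst A) (fst B) (fst C) g' f' - tmul u (fst A) (fst B) (fst C) g f)"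
      using nul_add by (metis tmul_carrier)
    then show ?thesis using sc_eq_iff[OF assms(1,3)] mor_comp assms f' g' by blast
  qed
  then have "(\<Union>g' \<in> sc B C g. \<Union>f' \<in> sc A B f. sc A C (tmul u (fst A) (fst B) (fst C) g' f')) =
      sc A C (tmul u (fst A) (fst B) (fst C) g f)"
    using sc_self[OF assms(1,2,4)] sc_self[OF assms(2,3,5)] by blast
  then show ?thesis by (simp add: Cpsi_cat_def stable_category_def)
qed

lemma CC_simps [simp]:
  "Obj CC = Obj PC" "Mor CC A B = sc A B ` Mor PC A B" "Idm CC A = sc A A (1\<^sub>m (length (fst A)))"
  "ZeroM CC A B = sc A B (0\<^sub>m (length (fst B)) (length (fst A)))"
  by (simp_all add: Cpsi_cat_def stable_category_def)

lemma sc_add: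
  assumes "A \<in> Obj PC" "B \<in> Obj PC" "f \<in> Mor PC A B" "g \<in> Mor PC A B"
  shows "AddM CC (sc A B f) (sc A B g) = sc A B (f + g)"
proof -
  note c = mor_carrier[OF assms(1,2)]
  have "AddM CC (sc A B f) (sc A B g) = {f' + g' | f' g'. f' \<in> sc A B f \<and> g' \<in> sc A B g}"
    by (simp add: Cpsi_cat_def stable_category_def)
  also have "\<dots> = sc A B (f + g)"
  proof (intro equalityI subsetI)
    fix h assume "h \<in> {f' + g' | f' g'. f' \<in> sc A B f \<and> g' \<in> sc A B g}"
    then obtain f' g' where h: "h = f' + g'" "f' \<in> Mor PC A B" "nl A B (f' - f)" "g' \<in> Mor PC A B" "nl A B (g' - g)"
      using assms by (auto simp: sc_alt)
    have "h - (f + g) = (f' - f) + (g' - g)"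
      using c[OF h(2)] c[OF h(4)] c[OF assms(3)] c[OF assms(4)] h(1) by (intro eq_matI) auto
    moreover have "nl A B ((f' - f) + (g' - g))"
      by (rule nul_add[OF minus_carrier_mat[OF c[OF assms(3)]] minus_carrier_mat[OF c[OF assms(4)]] h(3,5)])
    ultimately show "h \<in> sc A B (f + g)" using h mor_add assms by (auto simp: sc_alt)
  next
    fix h assume "h \<in> sc A B (f + g)"
    then have h: "h \<in> Mor PC A B" "nl A B (h - (f + g))" using sc_alt[OF assms(1,2) mor_add[OF assms]] by auto
    have hf: "h = f + (h - f)" using c[OF h(1)] c[OF assms(3)] by (intro eq_matI) simp_all
    have "(h - f) - g = h - (f + g)" using c[OF h(1)] c[OF assms(3)] c[OF assms(4)] by (intro eq_matI) simp_all
    then have "h - f \<in> sc A B g" using h mor_diff[OF assms(1,2) h(1) assms(3)] sc_alt[OF assms(1,2,4)] by simp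
    then have "h = f + (h - f) \<and> f \<in> sc A B f \<and> h - f \<in> sc A B g" using hf sc_self[OF assms(1-3)] by blast
    then show "h \<in> {f' + g' | f' g'. f' \<in> sc A B f \<and> g' \<in> sc A B g}" by blast
  qed
  finally show ?thesis .
qed

lemma CC_isomorphicI:
  assumes "A \<in> Obj PC" "B \<in> Obj PC" "f \<in> Mor PC A B" "g \<in> Mor PC B A"
    "sc A A (tmul u (fst A) (fst B) (fst A) g f) = sc A A (1\<^sub>m (length (fst A)))"
    "sc B B (tmul u (fst B) (fst A) (fst B) f g) = sc B B (1\<^sub>m (length (fst B)))"
  shows "isomorphic CC A B"
proof -
  have "isomorphism CC A B (sc A B f)"
    unfolding isomorphism_def CC_simps
  proof (intro conjI bexI)
    show "sc A B f \<in> sc A B ` Mor PC A B" "sc B A g \<in> sc B A ` Mor PC B A" using assms by blast+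
    show "Comp CC A B A (sc B A g) (sc A B f) = sc A A (1\<^sub>m (length (fst A)))"
      using sc_comp[OF assms(1,2,1,3,4)] assms(5) by simp
    show "Comp CC B A B (sc A B f) (sc B A g) = sc B B (1\<^sub>m (length (fst B)))"
      using sc_comp[OF assms(2,1,2,4,3)] assms(6) by simp
  qed
  then show ?thesis by (auto simp: isomorphic_def)
qed

lemma CC_isomorphicE:
  assumes "A \<in> Obj PC" "B \<in> Obj PC" "isomorphic CC A B"
  obtains f g where "f \<in> Mor PC A B" "g \<in> Mor PC B A"
    "sc A A (tmul u (fst A) (fst B) (fst A) g f) = sc A A (1\<^sub>m (length (fst A)))"
    "sc B B (tmul u (fst B) (fst A) (fst B) f g) = sc B B (1\<^sub>m (length (fst B)))"
proof -
  obtain f g where fg: "f \<in> Mor PC A B" "g \<in> Mor PC B A"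
    "Comp CC A B A (sc B A g) (sc A B f) = sc A A (1\<^sub>m (length (fst A)))"
    "Comp CC B A B (sc A B f) (sc B A g) = sc B B (1\<^sub>m (length (fst B)))"
    using assms(3) unfolding isomorphic_def isomorphism_def CC_simps by blast
  then show ?thesis using that sc_comp[OF assms(1,2,1) fg(1,2)] sc_comp[OF assms(2,1,2) fg(2,1)] by simp
qed

lemma CC_isomorphic_sym: assumes "A \<in> Obj PC" "B \<in> Obj PC" "isomorphic CC A B" shows "isomorphic CC B A"
proof -
  obtain f g where "f \<in> Mor PC A B" "g \<in> Mor PC B A"
    "sc A A (tmul u (fst A) (fst B) (fst A) g f) = sc A A (1\<^sub>m (length (fst A)))"
    "sc B B (tmul u (fst B) (fst A) (fst B) f g) = sc B B (1\<^sub>m (length (fst B)))"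
    using CC_isomorphicE[OF assms] .
  then show ?thesis using CC_isomorphicI[OF assms(2,1)] by blast
qed

lemma sc_cancel_middle:
  assumes "A \<in> Obj PC" "B \<in> Obj PC" "C \<in> Obj PC" "f \<in> Mor PC A B" "f' \<in> Mor PC B C" "g' \<in> Mor PC C B" "g \<in> Mor PC B A"
    and 1: "sc B B (tmul u (fst B) (fst C) (fst B) g' f') = sc B B (1\<^sub>m (length (fst B)))"
    and 2: "sc A A (tmul u (fst A) (fst B) (fst A) g f) = sc A A (1\<^sub>m (length (fst A)))"
  shows "sc A A (tmul u (fst A) (fst C) (fst A) (tmul u (fst C) (fst B) (fst A) g g') (tmul u (fst A) (fst B) (fst C) f' f)) =
    sc A A (1\<^sub>m (length (fst A)))"
proof -
  have m: "tmul u (fst B) (fst C) (fst B) g' f' \<in> Mor PC B B" using mor_comp assms by blast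
  have "tmul u (fst A) (fst C) (fst A) (tmul u (fst C) (fst B) (fst A) g g') (tmul u (fst A) (fst B) (fst C) f' f) =
    tmul u (fst A) (fst B) (fst A) g (tmul u (fst A) (fst B) (fst B) (tmul u (fst B) (fst C) (fst B) g' f') f)"
    by (simp add: tmul_assoc)
  also have "sc A A \<dots> = Comp CC A B A (sc B A g) (Comp CC A B B (sc B B (tmul u (fst B) (fst C) (fst B) g' f')) (sc A B f))"
    using assms(1-7) m mor_comp[OF assms(1,2,2,4) m] by (simp add: sc_comp)
  also have "\<dots> = sc A A (tmul u (fst A) (fst B) (fst A) g (tmul u (fst A) (fst B) (fst B) (1\<^sub>m (length (fst B))) f))"
    unfolding 1 using assms(1-7) mor_id[OF assms(2)] mor_comp[OF assms(1,2,2,4) mor_id[OF assms(2)]] by (simp add: sc_comp)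
  also have "\<dots> = sc A A (1\<^sub>m (length (fst A)))" using 2 mor_carrier[OF assms(1,2,4)] by simp
  finally show ?thesis .
qed

lemma CC_isomorphic_trans:
  assumes "A \<in> Obj PC" "B \<in> Obj PC" "C \<in> Obj PC" "isomorphic CC A B" "isomorphic CC B C"
  shows "isomorphic CC A C"
proof -
  obtain f g where fg: "f \<in> Mor PC A B" "g \<in> Mor PC B A"
    "sc A A (tmul u (fst A) (fst B) (fst A) g f) = sc A A (1\<^sub>m (length (fst A)))"
    "sc B B (tmul u (fst B) (fst A) (fst B) f g) = sc B B (1\<^sub>m (length (fst B)))"
    using CC_isomorphicE[OF assms(1,2,4)] .
  obtain f' g' where fg': "f' \<in> Mor PC B C" "g' \<in> Mor PC C B"
    "sc B B (tmul u (fst B) (fst C) (fst B) g' f') = sc B B (1\<^sub>m (length (fst B)))"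
    "sc C C (tmul u (fst C) (fst B) (fst C) f' g') = sc C C (1\<^sub>m (length (fst C)))"
    using CC_isomorphicE[OF assms(2,3,5)] .
  show ?thesis
    by (rule CC_isomorphicI[OF assms(1,3) mor_comp[OF assms(1-3) fg(1) fg'(1)] mor_comp[OF assms(3,2,1) fg'(2) fg(2)]])
       (rule sc_cancel_middle[OF assms(1-3) fg(1) fg'(1,2) fg(2) fg'(3) fg(3)]
             sc_cancel_middle[OF assms(3,2,1) fg'(2) fg(2,1) fg'(1) fg(4) fg'(4)])+
qed

section \<open>Idempotents and direct sums in the stable category\<close>

lemma CC_zero_iff: "zero_object CC A \<longleftrightarrow> A \<in> Obj PC \<and> nl A A (1\<^sub>m (length (fst A)))"
  using sc_zero_iff[of A A] mor_id[of A] by (auto simp: zero_object_def)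

lemma nl_comp:
  assumes "A \<in> Obj PC" "B \<in> Obj PC" "C \<in> Obj PC" "nl A B f \<or> nl B C g"
  shows "nl A C (tmul u (fst A) (fst B) (fst C) g f)"
  using nul_tmul[OF obj_list_in[OF assms(1)] obj_list_in[OF assms(2)] obj_list_in[OF assms(3)] b_le assms(4)] .

text \<open>If \<open>i p\<close> is null, so is the square of \<open>p i\<close>, which equals
  \<open>p (i p) i\<close>; but \<open>p i\<close> is the identity in the stable category.\<close>

lemma idempotent_zero:
  assumes "X \<in> Obj PC" "A \<in> Obj PC" "i \<in> Mor PC A X" "p \<in> Mor PC X A"
    and pi: "sc A A (tmul u (fst A) (fst X) (fst A) p i) = sc A A (1\<^sub>m (length (fst A)))"
    and nl: "nl X X (tmul u (fst X) (fst A) (fst X) i p)"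
  shows "zero_object CC A"
proof -
  let ?pi = "tmul u (fst A) (fst X) (fst A) p i"
  have m: "?pi \<in> Mor PC A A" using mor_comp assms by blast
  have "tmul u (fst A) (fst A) (fst A) ?pi ?pi = tmul u (fst A) (fst X) (fst A) (tmul u (fst X) (fst X) (fst A) p (tmul u (fst X) (fst A) (fst X) i p)) i"
    by (simp add: tmul_assoc)
  then have "nl A A (tmul u (fst A) (fst A) (fst A) ?pi ?pi)"
    using nl_comp[OF assms(1,1,2), of _ p] nl_comp[OF assms(2,1,2), of i] nl by metis
  then have "sc A A (0\<^sub>m (length (fst A)) (length (fst A))) = sc A A (tmul u (fst A) (fst A) (fst A) ?pi ?pi)"
    using sc_zero_iff[OF assms(2,2) mor_comp[OF assms(2,2,2) m m]] by simp
  also have "\<dots> = Comp CC A A A (sc A A ?pi) (sc A A ?pi)" using sc_comp[OF assms(2,2,2) m m] by simp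
  also have "\<dots> = sc A A (1\<^sub>m (length (fst A)))"
    unfolding pi using sc_comp[OF assms(2,2,2) mor_id[OF assms(2)] mor_id[OF assms(2)]] by simp
  finally have "nl A A (1\<^sub>m (length (fst A)))" using sc_zero_iff[OF assms(2,2) mor_id[OF assms(2)]] by simp
  then show ?thesis using CC_zero_iff assms by blast
qed

text \<open>A decomposition gives the idempotent \<open>i p\<close> with complement
  \<open>j q\<close>, and either of them being null kills a summand. What remains is a question
  about matrices that are idempotent modulo null ones.\<close>

lemma CC_indecomposableI:
  assumes X: "X \<in> Obj PC" "\<not> nl X X (1\<^sub>m (length (fst X)))"
    and idem: "\<And>e. e \<in> Mor PC X X \<Longrightarrow> nl X X (tmul u (fst X) (fst X) (fst X) e e - e) \<Longrightarrow>
       nl X X e \<or> nl X X (e - 1\<^sub>m (length (fst X)))"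
  shows "indecomposable CC X"
  unfolding indecomposable_def CC_simps
proof (intro conjI ballI impI)
  show "X \<in> Obj PC" "\<not> zero_object CC X" using X by (auto simp: CC_zero_iff)
  fix A B assume A: "A \<in> Obj PC" and B: "B \<in> Obj PC" and "direct_sum CC X A B"
  then obtain i j p q where m: "i \<in> Mor PC A X" "j \<in> Mor PC B X" "p \<in> Mor PC X A" "q \<in> Mor PC X B"
    and eq: "Comp CC A X A (sc X A p) (sc A X i) = sc A A (1\<^sub>m (length (fst A)))"
      "Comp CC B X B (sc X B q) (sc B X j) = sc B B (1\<^sub>m (length (fst B)))"
      "AddM CC (Comp CC X A X (sc A X i) (sc X A p)) (Comp CC X B X (sc B X j) (sc X B q)) = sc X X (1\<^sub>m (length (fst X)))"
    unfolding direct_sum_def CC_simps by blast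
  have pi: "sc A A (tmul u (fst A) (fst X) (fst A) p i) = sc A A (1\<^sub>m (length (fst A)))"
    and qj: "sc B B (tmul u (fst B) (fst X) (fst B) q j) = sc B B (1\<^sub>m (length (fst B)))"
    using eq(1,2) sc_comp[OF A X(1) A m(1,3)] sc_comp[OF B X(1) B m(2,4)] by simp_all
  let ?e = "tmul u (fst X) (fst A) (fst X) i p" and ?f = "tmul u (fst X) (fst B) (fst X) j q"
  have e: "?e \<in> Mor PC X X" and f: "?f \<in> Mor PC X X" using mor_comp A B X(1) m by blast+
  have ef: "sc X X (?e + ?f) = sc X X (1\<^sub>m (length (fst X)))"
    using eq(3) sc_comp[OF X(1) A X(1) m(3,1)] sc_comp[OF X(1) B X(1) m(4,2)] sc_add[OF X(1,1) e f] by simp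
  have "tmul u (fst X) (fst X) (fst X) ?e ?e = tmul u (fst X) (fst A) (fst X) i (tmul u (fst X) (fst A) (fst A) (tmul u (fst A) (fst X) (fst A) p i) p)"
    by (simp add: tmul_assoc)
  also have "sc X X \<dots> = Comp CC X A X (sc A X i) (Comp CC X A A (sc A A (tmul u (fst A) (fst X) (fst A) p i)) (sc X A p))"
    using sc_comp[OF X(1) A A m(3) mor_comp[OF A X(1) A m(1,3)]]
      sc_comp[OF X(1) A X(1) mor_comp[OF X(1) A A m(3) mor_comp[OF A X(1) A m(1,3)]] m(1)] by simp
  also have "\<dots> = sc X X ?e"
    unfolding pi using sc_comp[OF X(1) A A m(3) mor_id[OF A]] sc_comp[OF X(1) A X(1) m(3,1)] mor_carrier[OF X(1) A m(3)] by simp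
  finally have "nl X X (tmul u (fst X) (fst X) (fst X) ?e ?e - ?e)"
    using sc_eq_iff[OF X(1,1) mor_comp[OF X(1,1,1) e e] e] by simp
  then consider "nl X X ?e" | "nl X X (?e - 1\<^sub>m (length (fst X)))" using idem[OF e] by blast
  then show "zero_object CC A \<or> zero_object CC B"
  proof cases
    case 1
    then show ?thesis using idempotent_zero[OF X(1) A m(1,3) pi] by blast
  next
    case 2
    have "nl X X ((?e + ?f) - 1\<^sub>m (length (fst X)))"
      using ef sc_eq_iff[OF X(1,1) mor_add[OF X(1,1) e f] mor_id[OF X(1)]] by simp
    then have "nl X X (((?e + ?f) - 1\<^sub>m (length (fst X))) - (?e - 1\<^sub>m (length (fst X))))"
      by (rule nul_diff[rotated 2]) (use 2 in auto)
    moreover have "((?e + ?f) - 1\<^sub>m (length (fst X))) - (?e - 1\<^sub>m (length (fst X))) = ?f" by (intro eq_matI) auto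
    ultimately show ?thesis using idempotent_zero[OF X(1) B m(2,4) qj] by simp
  qed
qed

lemma CC_direct_sumI:
  assumes o: "X \<in> Obj PC" "A \<in> Obj PC" "B \<in> Obj PC"
    and m: "i \<in> Mor PC A X" "j \<in> Mor PC B X" "p \<in> Mor PC X A" "q \<in> Mor PC X B"
    and eq: "sc A A (tmul u (fst A) (fst X) (fst A) p i) = sc A A (1\<^sub>m (length (fst A)))"
      "sc B B (tmul u (fst B) (fst X) (fst B) q j) = sc B B (1\<^sub>m (length (fst B)))"
      "nl A B (tmul u (fst A) (fst X) (fst B) q i)" "nl B A (tmul u (fst B) (fst X) (fst A) p j)"
      "tmul u (fst X) (fst A) (fst X) i p + tmul u (fst X) (fst B) (fst X) j q = 1\<^sub>m (length (fst X))"
  shows "direct_sum CC X A B"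
  unfolding direct_sum_def CC_simps
proof (intro bexI conjI)
  show "sc A X i \<in> sc A X ` Mor PC A X" "sc B X j \<in> sc B X ` Mor PC B X" "sc X A p \<in> sc X A ` Mor PC X A"
    "sc X B q \<in> sc X B ` Mor PC X B" using m by blast+
  show "Comp CC A X A (sc X A p) (sc A X i) = sc A A (1\<^sub>m (length (fst A)))"
    "Comp CC B X B (sc X B q) (sc B X j) = sc B B (1\<^sub>m (length (fst B)))"
    "Comp CC A X B (sc X B q) (sc A X i) = sc A B (0\<^sub>m (length (fst B)) (length (fst A)))"
    "Comp CC B X A (sc X A p) (sc B X j) = sc B A (0\<^sub>m (length (fst A)) (length (fst B)))"
    using sc_comp[OF o(2,1,2) m(1,3)] sc_comp[OF o(3,1,3) m(2,4)] sc_comp[OF o(2,1,3) m(1,4)]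
      sc_comp[OF o(3,1,2) m(2,3)] eq sc_zero_iff[OF o(2,3) mor_comp[OF o(2,1,3) m(1,4)]]
      sc_zero_iff[OF o(3,2) mor_comp[OF o(3,1,2) m(2,3)]] by simp_all
  show "AddM CC (Comp CC X A X (sc A X i) (sc X A p)) (Comp CC X B X (sc B X j) (sc X B q)) = sc X X (1\<^sub>m (length (fst X)))"
    using sc_comp[OF o(1,2,1) m(3,1)] sc_comp[OF o(1,3,1) m(4,2)]
      sc_add[OF o(1,1) mor_comp[OF o(1,2,1) m(3,1)] mor_comp[OF o(1,3,1) m(4,2)]] eq(5) by simp
qed

subsection \<open>Vanishing of extensions\<close>

text \<open>\<open>shift\<close> chooses some cokernel of some hull. Maps between two hulls of
  \<open>B\<close> induce \<open>k'\<close> and \<open>h'\<close> on the cokernels, whose composite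
  is the identity up to a morphism through \<open>I\<close>. So \<open>t\<close> differs by a null
  morphism from \<open>h' k' t\<close>, and \<open>k' t\<close> is null by assumption.\<close>

lemma null_homs_of_cone:
  assumes 1: "(B, f, I, g, Z) \<in> PS" and I: "boundary b (fst I)" and 2: "(B, f', I', g', Z') \<in> PS" and I': "boundary b (fst I')"
    and A: "A \<in> Obj PC" and null: "\<And>t. t \<in> Mor PC A Z' \<Longrightarrow> nl A Z' t" and t: "t \<in> Mor PC A Z"
  shows "nl A Z t"
proof -
  note D = Fpsi_exactD[OF 1] and D' = Fpsi_exactD[OF 2]
  have infl: "inflation PS B I' f'" "inflation PS B I f" using 1 2 unfolding inflation_def by blast+
  then obtain h k where h: "h \<in> Mor PC I' I" "tmul u (fst B) (fst I') (fst I) h f' = f"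
    and k: "k \<in> Mor PC I I'" "tmul u (fst B) (fst I) (fst I') k f = f'"
    using injectiveD[OF boundary_injective[OF D(2) I] infl(1) D(4)]
      injectiveD[OF boundary_injective[OF D'(2) I'] infl(2) D'(4)]
    by auto
  note c = mor_carrier[OF D(1,2,4)] mor_carrier[OF D(2,3,5)] mor_carrier[OF D'(1,2,4)] mor_carrier[OF D'(2,3,5)]
    mor_carrier[OF D'(2) D(2) h(1)] mor_carrier[OF D(2) D'(2) k(1)]
  have coker: "is_cokernel (F_cat u b) (fst B) f (fst I) g (fst Z)" "is_cokernel (F_cat u b) (fst B) f' (fst I') g' (fst Z')"
    using F.ses_cokernel D(6) D'(6) by blast+
  have gf: "tmul u (fst B) (fst I) (fst Z) g f = 0\<^sub>m (length (fst Z)) (length (fst B))"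
    "tmul u (fst B) (fst I') (fst Z') g' f' = 0\<^sub>m (length (fst Z')) (length (fst B))"
    using coker by (auto simp: is_cokernel_def)
  have o: "fst Z \<in> lists (X_set b)" "fst Z' \<in> lists (X_set b)" "fst I \<in> lists (X_set b)"
    using obj_list_in[OF D(3)] obj_list_in[OF D'(3)] obj_list_in[OF D(2)] by auto
  have "tmul u (fst B) (fst I') (fst Z) (tmul u (fst I') (fst I) (fst Z) g h) f' = 0\<^sub>m (length (fst Z)) (length (fst B))"
    using h(2) gf(1) by (simp add: tmul_assoc[symmetric])
  then obtain h' where h': "h' \<in> carrier_mat (length (fst Z)) (length (fst Z'))"
    "tmul u (fst I') (fst Z') (fst Z) h' g' = tmul u (fst I') (fst I) (fst Z) g h"
    using F.cokernel_factor[OF coker(2), of "fst Z" "tmul u (fst I') (fst I) (fst Z) g h"] o by auto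
  have "tmul u (fst B) (fst I) (fst Z') (tmul u (fst I) (fst I') (fst Z') g' k) f = 0\<^sub>m (length (fst Z')) (length (fst B))"
    using k(2) gf(2) by (simp add: tmul_assoc[symmetric])
  then obtain k' where k': "k' \<in> carrier_mat (length (fst Z')) (length (fst Z))"
    "tmul u (fst I) (fst Z) (fst Z') k' g = tmul u (fst I) (fst I') (fst Z') g' k"
    using F.cokernel_factor[OF coker(1), of "fst Z'" "tmul u (fst I) (fst I') (fst Z') g' k"] o by auto
  \<comment> \<open>\<open>k'\<close> comes from the cokernel property in F_b; its conjugate
    satisfies the same equation, so uniqueness makes it equivariant.\<close>
  have "tmul u (fst I) (fst Z) (fst Z') (cj Z Z' k') g = tmul u (fst I) (fst I') (fst Z') g' k"
    using conj_comp[OF D(2,3) D'(3) c(2) k'(1)] mor_conj[OF D(2,3,5)] k'(2)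
      mor_conj[OF D(2) D'(3) mor_comp[OF D(2) D'(2,3) k(1) D'(5)]] by simp
  then have "cj Z Z' k' = k'"
    using F.cokernel_epi[OF coker(1), of "fst Z'" "cj Z Z' k'" k'] o k' by auto
  then have k'M: "k' \<in> Mor PC Z Z'" using k' D(3) D'(3) by (simp add: Fpsi_mor_iff)
  \<comment> \<open>\<open>h k\<close> and the identity agree after composition with
    \<open>f\<close>, so their difference \<open>d\<close> is \<open>m g\<close>. Cancelling the
    epimorphism \<open>g\<close> turns this into \<open>h' k' - 1 = g m\<close>, which passes
    through the boundary object \<open>I\<close>.\<close>
  define d where "d = tmul u (fst I) (fst I') (fst I) h k - 1\<^sub>m (length (fst I))"
  have dc: "d \<in> carrier_mat (length (fst I)) (length (fst I))" unfolding d_def by (rule minus_carrier_mat) simp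
  have hkf: "tmul u (fst B) (fst I) (fst I) (tmul u (fst I) (fst I') (fst I) h k) f = f"
    using k(2) h(2) by (simp add: tmul_assoc[symmetric])
  have df: "tmul u (fst B) (fst I) (fst I) d f = 0\<^sub>m (length (fst I)) (length (fst B))"
  proof -
    have "tmul u (fst B) (fst I) (fst I) d f = f - f"
      unfolding d_def using tmul_diff_left[of "tmul u (fst I) (fst I') (fst I) h k" "fst I" "fst I" "1\<^sub>m (length (fst I))"] hkf c(1) by simp
    then show ?thesis using c(1) by (intro eq_matI) auto
  qed
  then obtain m where m: "m \<in> carrier_mat (length (fst I)) (length (fst Z))" "tmul u (fst I) (fst Z) (fst I) m g = d"
    using F.cokernel_factor[OF coker(1), of "fst I" d] o dc by auto
  let ?hk = "tmul u (fst Z) (fst Z') (fst Z) h' k'"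
  have "tmul u (fst I) (fst Z) (fst Z) (?hk - 1\<^sub>m (length (fst Z))) g = tmul u (fst I) (fst Z) (fst Z) (tmul u (fst Z) (fst I) (fst Z) g m) g"
  proof -
    have "tmul u (fst I) (fst Z) (fst Z) ?hk g = tmul u (fst I) (fst Z') (fst Z) h' (tmul u (fst I) (fst I') (fst Z') g' k)"
      using k'(2) by (simp add: tmul_assoc[symmetric])
    also have "\<dots> = tmul u (fst I) (fst I) (fst Z) g (tmul u (fst I) (fst I') (fst I) h k)"
      using h'(2) by (simp add: tmul_assoc)
    finally have e1: "tmul u (fst I) (fst Z) (fst Z) ?hk g = tmul u (fst I) (fst I) (fst Z) g (tmul u (fst I) (fst I') (fst I) h k)" .
    have "tmul u (fst I) (fst Z) (fst Z) (?hk - 1\<^sub>m (length (fst Z))) g = tmul u (fst I) (fst Z) (fst Z) ?hk g - g"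
      using tmul_diff_left[of ?hk "fst Z" "fst Z" "1\<^sub>m (length (fst Z))"] c(2) by simp
    also have "\<dots> = tmul u (fst I) (fst I) (fst Z) g d"
      unfolding e1 d_def using tmul_diff_right[of "tmul u (fst I) (fst I') (fst I) h k" "fst I" "fst I" "1\<^sub>m (length (fst I))"] c(2) by simp
    also have "\<dots> = tmul u (fst I) (fst Z) (fst Z) (tmul u (fst Z) (fst I) (fst Z) g m) g"
      unfolding m(2)[symmetric] by (simp add: tmul_assoc)
    finally show ?thesis .
  qed
  moreover have "?hk - 1\<^sub>m (length (fst Z)) \<in> carrier_mat (length (fst Z)) (length (fst Z))"
    by (rule minus_carrier_mat) simp
  ultimately have hk1: "?hk - 1\<^sub>m (length (fst Z)) = tmul u (fst Z) (fst I) (fst Z) g m"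
    using F.cokernel_epi[OF coker(1), of "fst Z" "?hk - 1\<^sub>m (length (fst Z))" "tmul u (fst Z) (fst I) (fst Z) g m"] o by auto
  have tc: "t \<in> carrier_mat (length (fst Z)) (length (fst A))" using mor_carrier[OF A D(3) t] .
  have "nl A Z' (tmul u (fst A) (fst Z) (fst Z') k' t)" by (rule null) (rule mor_comp[OF A D(3) D'(3) t k'M])
  then have n1: "nl A Z (tmul u (fst A) (fst Z) (fst Z) ?hk t)"
    using nl_comp[OF A D'(3) D(3), of "tmul u (fst A) (fst Z) (fst Z') k' t" h'] by (simp add: tmul_assoc)
  have "nl Z Z (tmul u (fst Z) (fst I) (fst Z) g m)"
    using nl_comp[OF D(3,2,3)] boundary_nul[OF o(1,3) b_le] I by blast
  then have "nl A Z (tmul u (fst A) (fst Z) (fst Z) (?hk - 1\<^sub>m (length (fst Z))) t)"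
    unfolding hk1 using nl_comp[OF A D(3,3)] by blast
  moreover have "tmul u (fst A) (fst Z) (fst Z) (?hk - 1\<^sub>m (length (fst Z))) t = tmul u (fst A) (fst Z) (fst Z) ?hk t - t"
    using tmul_diff_left[of ?hk "fst Z" "fst Z" "1\<^sub>m (length (fst Z))"] tc by simp
  ultimately show ?thesis
    using nul_diff_iff[of "tmul u (fst A) (fst Z) (fst Z) ?hk t" "fst Z" "fst A" t] n1 tc by simp
qed

text \<open>By \<open>null_homs_of_cone\<close> the chosen \<open>shift\<close> may be replaced by
  the explicit cokernel of the hull.\<close>

lemma Ext1_zero_iff:
  assumes n: "inner_name b n" and A: "A \<in> Obj PC"
  shows "Ext1_zero PC PS A (obj_of n) \<longleftrightarrow> (\<forall>t \<in> Mor PC A (obj_of (shift_name b n)). nul u b (fst A) (obj_list (coords (shift_name b n))) t)"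
proof -
  let ?B = "obj_of n :: 'r pobj" and ?Z' = "obj_of (shift_name b n) :: 'r pobj" and ?I = "(phull b (coords n), eta_of n) :: 'r pobj"
  let ?Z = "shift PC PS ?B"
  have s': "(?B, hull_in (length (coords n)), ?I, hull_out (length (coords n)), ?Z') \<in> PS" by (rule name_ses[OF n])
  have bI: "boundary b (fst ?I)" using hull_of_boundary[OF n] by simp
  have I: "projective PC PS ?I" "injective PC PS ?I"
    using boundary_projective boundary_injective hull_of_in[OF n] bI by blast+
  have "\<exists>f I g. (?B, f, I, g, ?Z) \<in> PS \<and> projective PC PS I \<and> injective PC PS I"
    unfolding shift_def by (rule someI[of _ ?Z']) (use s' I in blast)
  then obtain f J g where s: "(?B, f, J, g, ?Z) \<in> PS" and J: "injective PC PS J" by blast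
  have bJ: "boundary b (fst J)" by (rule injective_boundary[OF J])
  have Z: "?Z \<in> Obj PC" using Fpsi_exactD[OF s] by blast
  have "Ext1_zero PC PS A ?B \<longleftrightarrow> sc A ?Z ` Mor PC A ?Z = {sc A ?Z (0\<^sub>m (length (fst ?Z)) (length (fst A)))}"
    by (simp add: Ext1_zero_def Ext1_def stable_category_def)
  also have "\<dots> \<longleftrightarrow> (\<forall>t \<in> Mor PC A ?Z. sc A ?Z t = sc A ?Z (0\<^sub>m (length (fst ?Z)) (length (fst A))))"
  proof -
    have "f ` M = {f x} \<longleftrightarrow> (\<forall>t \<in> M. f t = f x)" if "x \<in> M" for f :: "'r mat \<Rightarrow> 'r mat set" and M x
      using that by auto
    then show ?thesis using mor_zero[OF A Z] by blast
  qed
  also have "\<dots> \<longleftrightarrow> (\<forall>t \<in> Mor PC A ?Z. nl A ?Z t)"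
    by (intro ball_cong refl sc_zero_iff[OF A Z])
  also have "\<dots> \<longleftrightarrow> (\<forall>t \<in> Mor PC A ?Z'. nl A ?Z' t)"
  proof
    assume *: "\<forall>t \<in> Mor PC A ?Z. nl A ?Z t"
    show "\<forall>t \<in> Mor PC A ?Z'. nl A ?Z' t"
    proof
      fix t assume "t \<in> Mor PC A ?Z'"
      then show "nl A ?Z' t" by (rule null_homs_of_cone[OF s' bI s bJ A, rotated]) (use * in blast)
    qed
  next
    assume *: "\<forall>t \<in> Mor PC A ?Z'. nl A ?Z' t"
    show "\<forall>t \<in> Mor PC A ?Z. nl A ?Z t"
    proof
      fix t assume "t \<in> Mor PC A ?Z"
      then show "nl A ?Z t" by (rule null_homs_of_cone[OF s bJ s' bI A, rotated]) (use * in blast)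
    qed
  qed
  finally show ?thesis by (simp add: obj_of_eq)
qed

end

section \<open>Indecomposable objects of the stable category\<close>

context F_structure
begin

lemma mor_equivariant:
  assumes "A \<in> Obj PC" "B \<in> Obj PC" "f \<in> Mor PC A B"
  shows "tmul u (fst A) (fst B) (psi (fst B)) (snd B) f = tmul u (fst A) (psi (fst A)) (psi (fst B)) f (snd A)"
proof -
  note o = obj_list_in[OF assms(1)] obj_list_in[OF assms(2)]
  have "tmul u (psi (fst A)) (fst A) (fst B) f (snd A) = tmul u (psi (fst A)) (psi (fst B)) (fst B) (snd B) f"
    using assms(3) by (cases A; cases B) (simp add: Fpsi_cat_def Let_def psi_mor_def)
  then show ?thesis
    using tmul_psi[OF o(1) psi_in[OF o(1)] psi_in[OF o(2)], of u] tmul_psi[OF o(1,2) psi_in[OF o(2)], of u]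
      psi_psi[OF o(1)] psi_psi[OF o(2)] by simp
qed

text \<open>\<open>(Y, x)\<close> is not assumed to be an object. In \<open>split_complement\<close>
  the second conclusion, for the two maps into a pushout, shows that the induced \<open>x\<close> is
  an involution; then the first makes these maps equivariant.\<close>

lemma conj_eqI:
  assumes A: "A \<in> Obj PC" and Y: "Y \<in> lists (X_set b)" and f: "f \<in> carrier_mat (length Y) (length (fst A))"
    and x: "tmul u (fst A) Y (psi Y) x f = tmul u (fst A) (psi (fst A)) (psi Y) f (snd A)"
  shows "cj A (Y, x) f = f" "tmul u (fst A) Y Y (tmul u Y (psi Y) Y x x) f = f"
proof -
  note o = obj_list_in[OF A]
  let ?z = "tmul u (fst A) (psi (fst A)) (psi Y) f (snd A)"
  have "tmul u (psi (fst A)) (psi Y) Y x f = tmul u (psi (fst A)) (fst A) Y f (snd A)"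
    using x tmul_psi[OF o Y psi_in[OF Y], of u x f] tmul_psi[OF o psi_in[OF o] psi_in[OF Y], of u f "snd A"]
      psi_psi[OF o] psi_psi[OF Y] by simp
  then have z: "tmul u (fst A) (psi Y) Y x ?z = tmul u (fst A) (psi (fst A)) Y (tmul u (psi (fst A)) (fst A) Y f (snd A)) (snd A)"
    by (simp add: tmul_assoc)
  also have "\<dots> = f" by (rule cancel_involution(2)[OF A f])
  finally have z: "tmul u (fst A) (psi Y) Y x ?z = f" .
  show "cj A (Y, x) f = f" using z by (simp add: conj_mor_def)
  show "tmul u (fst A) Y Y (tmul u Y (psi Y) Y x x) f = f" using z x by (simp add: tmul_assoc[symmetric])
qed

text \<open>A split monomorphism \<open>s : N \<rightarrow> X\<close> has a complement in the stable category, namely the pushout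
  of \<open>X\<close> and the injective hull \<open>I\<close> of \<open>N\<close>.\<close>

lemma split_complement:
  assumes n: "inner_name b n" and X: "X \<in> Obj PC" and s: "s \<in> Mor PC (obj_of n) X" and r: "r \<in> Mor PC X (obj_of n)"
    and rs: "tmul u (obj_list (coords n)) (fst X) (obj_list (coords n)) r s = 1\<^sub>m (length (coords n))"
  obtains P j q where "P \<in> Obj PC" "direct_sum CC X (obj_of n) P" "j \<in> Mor PC P X" "q \<in> Mor PC X P"
    "tmul u (fst X) (fst P) (fst X) j q = 1\<^sub>m (length (fst X)) - tmul u (fst X) (obj_list (coords n)) (fst X) s r"
proof -
  define N :: "'r pobj" where "N = obj_of n"
  define I :: "'r pobj" where "I = (phull b (coords n), eta_of n)"
  have fN: "fst N = obj_list (coords n)" by (simp add: N_def obj_of_eq)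
  have lN: "length (fst N) = length (coords n)" by (simp add: fN obj_list_def)
  define i :: "'r mat" where "i = hull_in (length (coords n))"
  have bI: "boundary b (fst I)" using hull_of_boundary[OF n] by (simp add: I_def)
  note D = Fpsi_exactD[OF name_ses[OF n], folded N_def I_def i_def]
  note N = D(1) and I = D(2) and i = D(4)
  have "inflation S (fst N) (fst I) i" unfolding inflation_def using D(6) by blast
  moreover have "fst X \<in> lists (X_set b)" "s \<in> carrier_mat (length (fst X)) (length (fst N))"
    using obj_list_in[OF X] mor_carrier[OF N X s[folded N_def]] .
  ultimately obtain Y q c where Y: "Y \<in> lists (X_set b)" and po: "is_pushout (F_cat u b) (fst N) (fst I) (fst X) Y i q s c"
    using F.exact[unfolded exact_structure_def] unfolding F_cat_simps by meson
  note oN = obj_list_in[OF N] and oI = obj_list_in[OF I] and oX = obj_list_in[OF X]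
  have q: "q \<in> carrier_mat (length Y) (length (fst X))" and c: "c \<in> carrier_mat (length Y) (length (fst I))"
    and ci: "tmul u (fst N) (fst I) Y c i = tmul u (fst N) (fst X) Y q s"
    using po by (auto simp: is_pushout_def)
  have ex1: "\<exists>!k. k \<in> carrier_mat (length W) (length Y) \<and> tmul u (fst I) Y W k c = v \<and> tmul u (fst X) Y W k q = t"
    if "W \<in> lists (X_set b)" "v \<in> carrier_mat (length W) (length (fst I))" "t \<in> carrier_mat (length W) (length (fst X))"
      "tmul u (fst N) (fst I) W v i = tmul u (fst N) (fst X) W t s" for W v t
    using po that unfolding is_pushout_def F_cat_simps by blast
  have factor: "\<exists>k. k \<in> carrier_mat (length W) (length Y) \<and> tmul u (fst I) Y W k c = v \<and> tmul u (fst X) Y W k q = t"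
    if "W \<in> lists (X_set b)" "v \<in> carrier_mat (length W) (length (fst I))" "t \<in> carrier_mat (length W) (length (fst X))"
      "tmul u (fst N) (fst I) W v i = tmul u (fst N) (fst X) W t s" for W v t
    using ex1[OF that] by blast
  have unique: "k = k'"
    if W: "W \<in> lists (X_set b)" and k: "k \<in> carrier_mat (length W) (length Y)" "k' \<in> carrier_mat (length W) (length Y)"
      and e: "tmul u (fst I) Y W k c = tmul u (fst I) Y W k' c" "tmul u (fst X) Y W k q = tmul u (fst X) Y W k' q" for W k k'
  proof -
    have "tmul u (fst N) (fst I) W (tmul u (fst I) Y W k' c) i = tmul u (fst N) (fst X) W (tmul u (fst X) Y W k' q) s"
      using ci by (simp add: tmul_assoc[symmetric])
    from ex1[OF W tmul_carrier tmul_carrier this] show ?thesis using k e by blast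
  qed
  note sX = s[folded N_def] and rX = r[folded N_def]
  \<comment> \<open>The involutions of \<open>I\<close> and \<open>X\<close> agree on
    \<open>N\<close>, so the pushout property yields \<open>x\<close> on \<open>Y\<close> compatible
    with both.\<close>
  have "tmul u (fst N) (fst I) (psi Y) (tmul u (fst I) (psi (fst I)) (psi Y) c (snd I)) i
     = tmul u (fst N) (psi (fst N)) (psi Y) (tmul u (psi (fst N)) (psi (fst I)) (psi Y) c i) (snd N)"
    using mor_equivariant[OF N I i] by (simp add: tmul_assoc[symmetric])
  also have "\<dots> = tmul u (fst N) (psi (fst N)) (psi Y) (tmul u (psi (fst N)) (psi (fst X)) (psi Y) q s) (snd N)"
    using ci tmul_psi[OF oN oI Y, of u c i] tmul_psi[OF oN oX Y, of u q s] by simp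
  also have "\<dots> = tmul u (fst N) (fst X) (psi Y) (tmul u (fst X) (psi (fst X)) (psi Y) q (snd X)) s"
    using mor_equivariant[OF N X sX] by (simp add: tmul_assoc[symmetric])
  finally obtain x where x: "x \<in> carrier_mat (length Y) (length Y)"
    and xc: "tmul u (fst I) Y (psi Y) x c = tmul u (fst I) (psi (fst I)) (psi Y) c (snd I)"
    and xq: "tmul u (fst X) Y (psi Y) x q = tmul u (fst X) (psi (fst X)) (psi Y) q (snd X)"
    using factor[OF psi_in[OF Y], of "tmul u (fst I) (psi (fst I)) (psi Y) c (snd I)" "tmul u (fst X) (psi (fst X)) (psi Y) q (snd X)"]
    by auto
  define P where "P = (Y, x)"
  have fP: "fst P = Y" by (simp add: P_def)
  have "tmul u Y (psi Y) Y x x = 1\<^sub>m (length Y)"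
    by (rule unique[OF Y]) (use conj_eqI(2)[OF I Y c xc] conj_eqI(2)[OF X Y q xq] c q in auto)
  then have P: "P \<in> Obj PC" using Y x by (simp add: Fpsi_obj_iff P_def)
  have qM: "q \<in> Mor PC X P" using conj_eqI(1)[OF X Y q xq] q X P by (simp add: Fpsi_mor_iff P_def)
  have cM: "c \<in> Mor PC I P" using conj_eqI(1)[OF I Y c xc] c I P by (simp add: Fpsi_mor_iff P_def)
  have fac: "\<exists>k \<in> Mor PC P W. tmul u (fst I) Y (fst W) k c = v \<and> tmul u (fst X) Y (fst W) k q = t"
    if W: "W \<in> Obj PC" and v: "v \<in> Mor PC I W" and t: "t \<in> Mor PC X W"
      and e: "tmul u (fst N) (fst I) (fst W) v i = tmul u (fst N) (fst X) (fst W) t s" for W v t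
  proof -
    obtain k where k: "k \<in> carrier_mat (length (fst W)) (length Y)" "tmul u (fst I) Y (fst W) k c = v" "tmul u (fst X) Y (fst W) k q = t"
      using factor[OF obj_list_in[OF W] mor_carrier[OF I W v] mor_carrier[OF X W t] e] by blast
    have "tmul u (fst I) Y (fst W) (cj P W k) c = tmul u (fst I) Y (fst W) k c"
      using conj_comp[OF I P W, unfolded fP, OF c k(1)] mor_conj[OF I P cM] mor_conj[OF I W v] k(2) by simp
    moreover have "tmul u (fst X) Y (fst W) (cj P W k) q = tmul u (fst X) Y (fst W) k q"
      using conj_comp[OF X P W, unfolded fP, OF q k(1)] mor_conj[OF X P qM] mor_conj[OF X W t] k(3) by simp
    ultimately have "cj P W k = k"
      using conj_carrier[of P W k] by (intro unique[OF obj_list_in[OF W] _ k(1)]) (simp_all add: fP)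
    then have "k \<in> Mor PC P W" using k(1) P W by (simp add: Fpsi_mor_iff fP)
    then show ?thesis using k by blast
  qed
  let ?sr = "tmul u (fst X) (fst N) (fst X) s r"
  have srM: "?sr \<in> Mor PC X X" by (rule mor_comp[OF X N X rX sX])
  have cs: "s \<in> carrier_mat (length (fst X)) (length (fst N))" "r \<in> carrier_mat (length (fst N)) (length (fst X))"
    "i \<in> carrier_mat (length (fst I)) (length (fst N))"
    using mor_carrier[OF N X sX] mor_carrier[OF X N rX] mor_carrier[OF N I i] by auto
  have rs': "tmul u (fst N) (fst X) (fst N) r s = 1\<^sub>m (length (fst N))" using rs lN by (simp add: fN)
  have srs: "tmul u (fst N) (fst X) (fst X) ?sr s = s" using cs rs' by (simp add: tmul_assoc[symmetric])
  \<comment> \<open>\<open>j\<close> is to be 0 on \<open>I\<close> and \<open>1 - s r\<close> on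
    \<open>X\<close>; the two agree on \<open>N\<close> because \<open>s r s = s\<close>.\<close>
  have "tmul u (fst N) (fst I) (fst X) (0\<^sub>m (length (fst X)) (length (fst I))) i
      = tmul u (fst N) (fst X) (fst X) (1\<^sub>m (length (fst X)) - ?sr) s"
    using tmul_diff_left[of "1\<^sub>m (length (fst X))" "fst X" "fst X" ?sr u "fst N" s] srs cs
    by (intro eq_matI) (auto simp: tmul_index)
  then obtain j where j: "j \<in> Mor PC P X" "tmul u (fst I) Y (fst X) j c = 0\<^sub>m (length (fst X)) (length (fst I))"
    "tmul u (fst X) Y (fst X) j q = 1\<^sub>m (length (fst X)) - ?sr"
    using fac[OF X mor_zero[OF I X] mor_diff[OF X X mor_id[OF X] srM]] by auto
  \<comment> \<open>\<open>m\<close> is the identity on \<open>I\<close> and \<open>i r\<close> on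
    \<open>X\<close>. It measures the defect of the splitting: \<open>q j = 1 - c m\<close>, and
    \<open>c m\<close> passes through the boundary object \<open>I\<close>.\<close>
  have "tmul u (fst N) (fst I) (fst I) (1\<^sub>m (length (fst I))) i = tmul u (fst N) (fst X) (fst I) (tmul u (fst X) (fst N) (fst I) i r) s"
    using cs rs' by (simp add: tmul_assoc[symmetric])
  then obtain m where m: "m \<in> Mor PC P I" "tmul u (fst I) Y (fst I) m c = 1\<^sub>m (length (fst I))"
    "tmul u (fst X) Y (fst I) m q = tmul u (fst X) (fst N) (fst I) i r"
    using fac[OF I mor_id[OF I] mor_comp[OF X N I rX i]] by auto
  have jc: "j \<in> carrier_mat (length (fst X)) (length Y)" and mc: "m \<in> carrier_mat (length (fst I)) (length Y)"
    using mor_carrier[OF P X j(1)] mor_carrier[OF P I m(1)] by (simp_all add: fP)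
  have cm: "tmul u Y (fst X) Y q j = 1\<^sub>m (length Y) - tmul u Y (fst I) Y c m"
  proof (rule unique[OF Y])
    have cz: "tmul u (fst I) (fst X) Y q (0\<^sub>m (length (fst X)) (length (fst I))) = 0\<^sub>m (length Y) (length (fst I))"
      by (intro eq_matI) (auto simp: tmul_index)
    have "tmul u (fst I) Y Y (1\<^sub>m (length Y) - tmul u Y (fst I) Y c m) c = c - tmul u (fst I) (fst I) Y c (tmul u (fst I) Y (fst I) m c)"
      using tmul_diff_left[of "1\<^sub>m (length Y)" Y Y "tmul u Y (fst I) Y c m" u "fst I" c] c by (simp add: tmul_assoc)
    also have "\<dots> = 0\<^sub>m (length Y) (length (fst I))" using c m(2) by (intro eq_matI) auto
    also have "\<dots> = tmul u (fst I) Y Y (tmul u Y (fst X) Y q j) c" using j(2) cz by (simp add: tmul_assoc[symmetric])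
    finally show "tmul u (fst I) Y Y (tmul u Y (fst X) Y q j) c = tmul u (fst I) Y Y (1\<^sub>m (length Y) - tmul u Y (fst I) Y c m) c" ..
    have "tmul u (fst X) Y Y (tmul u Y (fst X) Y q j) q = tmul u (fst X) (fst X) Y q (1\<^sub>m (length (fst X)) - ?sr)"
      using j(3) by (simp add: tmul_assoc[symmetric])
    also have "\<dots> = q - tmul u (fst X) (fst X) Y q ?sr"
      using tmul_diff_right[of "1\<^sub>m (length (fst X))" "fst X" "fst X" ?sr u Y q] q by simp
    also have "tmul u (fst X) (fst X) Y q ?sr = tmul u (fst X) (fst I) Y c (tmul u (fst X) (fst N) (fst I) i r)"
      using ci by (simp add: tmul_assoc)
    also have "\<dots> = tmul u (fst X) Y Y (tmul u Y (fst I) Y c m) q" using m(3) by (simp add: tmul_assoc[symmetric])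
    also have "q - \<dots> = tmul u (fst X) Y Y (1\<^sub>m (length Y) - tmul u Y (fst I) Y c m) q"
      using tmul_diff_left[of "1\<^sub>m (length Y)" Y Y "tmul u Y (fst I) Y c m" u "fst X" q] q by simp
    finally show "tmul u (fst X) Y Y (tmul u Y (fst X) Y q j) q = tmul u (fst X) Y Y (1\<^sub>m (length Y) - tmul u Y (fst I) Y c m) q" .
  qed (auto intro!: minus_carrier_mat)
  have rj: "tmul u Y (fst X) (fst N) r j = 0\<^sub>m (length (fst N)) (length Y)"
  proof (rule unique[OF oN])
    show "tmul u (fst I) Y (fst N) (tmul u Y (fst X) (fst N) r j) c = tmul u (fst I) Y (fst N) (0\<^sub>m (length (fst N)) (length Y)) c"
      using j(2) by (simp add: tmul_assoc[symmetric]) (intro eq_matI, auto simp: tmul_index)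
    have "tmul u (fst X) Y (fst N) (tmul u Y (fst X) (fst N) r j) q = r - tmul u (fst X) (fst X) (fst N) r ?sr"
      using j(3) tmul_diff_right[of "1\<^sub>m (length (fst X))" "fst X" "fst X" ?sr u "fst N" r] cs by (simp add: tmul_assoc[symmetric])
    also have "tmul u (fst X) (fst X) (fst N) r ?sr = r" using rs' cs by (simp add: tmul_assoc)
    finally show "tmul u (fst X) Y (fst N) (tmul u Y (fst X) (fst N) r j) q = tmul u (fst X) Y (fst N) (0\<^sub>m (length (fst N)) (length Y)) q"
      using cs by (intro eq_matI) (auto simp: tmul_index)
  qed auto
  have "direct_sum CC X N P"
  proof (rule CC_direct_sumI[OF X N P sX j(1) rX qM])
    show "sc N N (tmul u (fst N) (fst X) (fst N) r s) = sc N N (1\<^sub>m (length (fst N)))" using rs' by simp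
    have "nl P P (tmul u Y (fst I) Y c m)" using nl_comp[OF P I P, of m c] boundary_nul[OF obj_list_in[OF P] oI b_le, of u m] bI by (simp add: fP)
    moreover have "tmul u Y (fst X) Y q j - 1\<^sub>m (length Y) = - tmul u Y (fst I) Y c m"
      unfolding cm by (intro eq_matI) auto
    ultimately have "nl P P (tmul u Y (fst X) Y q j - 1\<^sub>m (length Y))"
      using nul_uminus[of "tmul u Y (fst I) Y c m" Y Y u b] by (simp add: fP)
    then show "sc P P (tmul u (fst P) (fst X) (fst P) q j) = sc P P (1\<^sub>m (length (fst P)))"
      using sc_eq_iff[OF P P mor_comp[OF P X P j(1) qM] mor_id[OF P]] by (simp add: fP)
    show "nl N P (tmul u (fst N) (fst X) (fst P) q s)"
      using nl_comp[OF N I P, of i c] boundary_nul[OF oN oI b_le, of u i] bI ci by (simp add: fP)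
    show "nl P N (tmul u (fst P) (fst X) (fst N) r j)" using rj by (simp add: fP nul_def)
    show "?sr + tmul u (fst X) (fst P) (fst X) j q = 1\<^sub>m (length (fst X))" using j(3) by (intro eq_matI) (auto simp: fP)
  qed
  then show ?thesis using that[OF P _ j(1) qM] j(3) unfolding fP fN N_def[symmetric] by simp
qed

text \<open>\<open>X\<close> has a non-boundary summand, hence a split named summand N with a stable
  complement P. As N is non-zero, P is zero, so \<open>1 - s r = j q\<close> is null, and
  \<open>s\<close> and \<open>r\<close> are mutually inverse in the stable category.\<close>

lemma indecomposable_has_name:
  assumes "indecomposable CC X"
  obtains n where "proper_name b n" "isomorphic CC X (obj_of n)"
proof -
  have X: "X \<in> Obj PC" "\<not> zero_object CC X"
    and ind: "\<And>A B. A \<in> Obj PC \<Longrightarrow> B \<in> Obj PC \<Longrightarrow> direct_sum CC X A B \<Longrightarrow> zero_object CC A \<or> zero_object CC B"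
    using assms unfolding indecomposable_def CC_simps by blast+
  have "\<not> boundary b (fst X)"
    using boundary_nul[OF obj_list_in[OF X(1)] obj_list_in[OF X(1)] b_le] X by (auto simp: CC_zero_iff)
  then obtain k where "k < length (fst X)" "nz b (fst X ! k) (fst X ! k)"
    unfolding boundary_def by (metis in_set_conv_nth)
  then obtain n s r where n: "proper_name b n" and s: "s \<in> Mor PC (obj_of n) X" and r: "r \<in> Mor PC X (obj_of n)"
    and rs: "tmul u (obj_list (coords n)) (fst X) (obj_list (coords n)) r s = 1\<^sub>m (length (coords n))"
    using splits_off[OF X(1)] by metis
  note N = obj_of_in[OF proper_inner[OF n]]
  obtain P j q where P: "P \<in> Obj PC" "direct_sum CC X (obj_of n) P" "j \<in> Mor PC P X" "q \<in> Mor PC X P"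
    "tmul u (fst X) (fst P) (fst X) j q = 1\<^sub>m (length (fst X)) - tmul u (fst X) (obj_list (coords n)) (fst X) s r"
    using split_complement[OF proper_inner[OF n] X(1) s r rs] by metis
  have fN: "fst (obj_of n :: 'r pobj) = obj_list (coords n)" "length (obj_list (coords n)) = length (coords n)"
    by (simp_all add: obj_of_eq obj_list_def)
  have "\<not> zero_object CC (obj_of n)"
    using one_not_nul[OF proper_inner[OF n]] by (simp add: CC_zero_iff fN)
  then have "nl P P (1\<^sub>m (length (fst P)))" using ind[OF N P(1,2)] N by (auto simp: CC_zero_iff)
  then have "nl X P q" using nl_comp[OF X(1) P(1) P(1), of q "1\<^sub>m (length (fst P))"] mor_carrier[OF X(1) P(1,4)] by simp
  then have "nl X X (1\<^sub>m (length (fst X)) - tmul u (fst X) (obj_list (coords n)) (fst X) s r)"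
    using nl_comp[OF X(1) P(1) X(1), of q j] P(5) by simp
  then have "sc X X (tmul u (fst X) (fst (obj_of n :: 'r pobj)) (fst X) s r) = sc X X (1\<^sub>m (length (fst X)))"
    using sc_eq_iff[OF X(1) X(1) mor_id[OF X(1)] mor_comp[OF X(1) N X(1) r s]] by (simp add: fN)
  then have "isomorphic CC X (obj_of n)"
    using CC_isomorphicI[OF X(1) N r s] rs by (simp add: fN)
  then show ?thesis using n that by blast
qed

end

section \<open>Morphisms between objects with names\<close>

lemma obj_list_coords [simp]: "length (obj_list (coords n)) = length (coords n)"
  by (simp add: obj_list_def)

definition near2 :: "real \<Rightarrow> real \<Rightarrow> real \<Rightarrow> real \<Rightarrow> real \<Rightarrow> bool" where
  "near2 b x y x' y' \<longleftrightarrow> x \<le> x' \<and> x' < y + b \<and> y \<le> y' \<and> y' < x + b"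

lemma nz_M_orb: "nz b (M_orb x y) (M_orb x' y') \<longleftrightarrow>
  (\<exists>i::int. if even i then near2 b x y (x' + of_int i * pi) (y' + of_int i * pi)
            else near2 b x y (y' + of_int i * pi) (x' + of_int i * pi))"
  unfolding M_orb_def nz_orbit by (auto simp: sigma_pow_eq near_def near2_def)

lemma same_coords_M_orb_iff: "same_coords (M_orb x y) (M_orb x' y') \<longleftrightarrow>
  (\<exists>i::int. if even i then x = x' + of_int i * pi \<and> y = y' + of_int i * pi
            else x = y' + of_int i * pi \<and> y = x' + of_int i * pi)"
  unfolding same_coords_M_orb by (auto simp: sigma_pow_eq)

fun ends :: "name \<Rightarrow> real \<times> real" where
  "ends (Regular x y) = (x, y)"
| "ends (Singular e x) = (x, x)"

fun signs_agree :: "name \<Rightarrow> name \<Rightarrow> bool" where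
  "signs_agree (Singular e x) (Singular e' x') \<longleftrightarrow> e = e'"
| "signs_agree _ _ \<longleftrightarrow> True"

text \<open>\<open>sigma\<close> interchanges the coordinates at every odd step. A regular object
  contains an orbit together with its rotation, and a singular one is symmetric, so all combinations
  of a translation with an interchange occur and the parity of \<open>k\<close> drops out.\<close>

definition linked :: "real \<Rightarrow> real \<times> real \<Rightarrow> real \<times> real \<Rightarrow> bool" where
  "linked b p q \<longleftrightarrow> (\<exists>k::int. near2 b (fst p) (snd p) (fst q + of_int k * pi) (snd q + of_int k * pi) \<or>
     near2 b (fst p) (snd p) (snd q + of_int k * pi) (fst q + of_int k * pi))"

lemma near2_shift: "near2 b (x + a) (y + a) (x' + a) (y' + a) \<longleftrightarrow> near2 b x y x' y'"
  by (auto simp: near2_def)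

lemma linkedI:
  assumes "near2 b x y (x' + of_int k * pi) (y' + of_int k * pi) \<or> near2 b x y (y' + of_int k * pi) (x' + of_int k * pi)"
  shows "linked b (x, y) (x', y')"
  using assms unfolding linked_def by auto

lemma linked_turn: "linked b (x, y) (x' + pi, y' + pi) \<longleftrightarrow> linked b (x, y) (x', y')"
  "linked b (x + pi, y + pi) (x', y') \<longleftrightarrow> linked b (x, y) (x', y')"
proof -
  have 1: "linked b (x, y) (x', y') \<longleftrightarrow>
     (\<exists>k::int. near2 b x y (x' + of_int (k + m) * pi) (y' + of_int (k + m) * pi) \<or>
        near2 b x y (y' + of_int (k + m) * pi) (x' + of_int (k + m) * pi))" for m
    unfolding linked_def by (metis diff_add_cancel fst_conv snd_conv)
  show "linked b (x, y) (x' + pi, y' + pi) \<longleftrightarrow> linked b (x, y) (x', y')"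
    unfolding 1[of 1] by (simp add: linked_def algebra_simps)
  have "near2 b (x + pi) (y + pi) (p + of_int k * pi) (q + of_int k * pi) \<longleftrightarrow>
     near2 b x y (p + of_int (k + - 1) * pi) (q + of_int (k + - 1) * pi)" for p q and k :: int
    using near2_shift[of b x pi y "p + of_int (k + - 1) * pi" "q + of_int (k + - 1) * pi"] by (simp add: algebra_simps)
  then show "linked b (x + pi, y + pi) (x', y') \<longleftrightarrow> linked b (x, y) (x', y')"
    unfolding 1[of "- 1"] by (simp add: linked_def)
qed

lemma nz_imp_linked: "nz b (M_orb x y) (M_orb x' y') \<Longrightarrow> linked b (x, y) (x', y')"
  unfolding nz_M_orb by (metis linkedI)

lemma linked_imp_nz: "linked b (x, y) (x', y') \<Longrightarrow> nz b (M_orb x y) (M_orb x' y') \<or> nz b (M_orb x y) (M_orb (x' + pi) (y' + pi))"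
proof -
  assume "linked b (x, y) (x', y')"
  then obtain k :: int where k: "near2 b x y (x' + of_int k * pi) (y' + of_int k * pi) \<or>
     near2 b x y (y' + of_int k * pi) (x' + of_int k * pi)" by (auto simp: linked_def)
  let ?near = "\<lambda>x' y' i::int. if even i then near2 b x y (x' + of_int i * pi) (y' + of_int i * pi)
     else near2 b x y (y' + of_int i * pi) (x' + of_int i * pi)"
  have s: "x' + pi + of_int (k - 1) * pi = x' + of_int k * pi" "y' + pi + of_int (k - 1) * pi = y' + of_int k * pi"
    by (simp_all add: algebra_simps)
  have "?near x' y' k \<or> ?near (x' + pi) (y' + pi) (k - 1)"
    unfolding s using k by auto
  then show ?thesis unfolding nz_M_orb by blast
qed

lemma linked_iff_nz: "linked b (ends n) (ends m) \<longleftrightarrow>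
   (\<exists>A \<in> set (obj_list (coords n)). \<exists>B \<in> set (obj_list (coords m)). nz b A B)"
proof
  assume "\<exists>A \<in> set (obj_list (coords n)). \<exists>B \<in> set (obj_list (coords m)). nz b A B"
  then show "linked b (ends n) (ends m)"
    by (cases n; cases m) (auto simp: obj_list_def dest!: nz_imp_linked simp: linked_turn)
next
  assume l: "linked b (ends n) (ends m)"
  have *: "nz b (M_orb x y) (M_orb (z + pi) (z + pi)) \<Longrightarrow> nz b (M_orb x y) (M_orb z z)" for x y z
  proof -
    assume "nz b (M_orb x y) (M_orb (z + pi) (z + pi))"
    then obtain i :: int where "near2 b x y (z + pi + of_int i * pi) (z + pi + of_int i * pi)"
      unfolding nz_M_orb by (auto split: if_splits)
    then have "near2 b x y (z + of_int (i + 1) * pi) (z + of_int (i + 1) * pi)" by (simp add: algebra_simps)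
    then show ?thesis unfolding nz_M_orb by (intro exI[of _ "i + 1"]) simp
  qed
  show "\<exists>A \<in> set (obj_list (coords n)). \<exists>B \<in> set (obj_list (coords m)). nz b A B"
    using l by (cases n; cases m) (auto simp: obj_list_def dest!: linked_imp_nz dest: *)
qed

context F_structure
begin

lemma xi_dim [simp]: "dim_row (xi_of n) = length (coords n)" "dim_col (xi_of n) = length (coords n)"
  using carrier_matD[OF xi_carrier[of n]] by simp_all

lemma name_mor_iff:
  assumes "inner_name b n" "inner_name b m"
  shows "f \<in> Mor PC (obj_of n) (obj_of m) \<longleftrightarrow>
    f \<in> carrier_mat (length (coords m)) (length (coords n)) \<and> f * xi_of n = xi_of m * f"
  using rigid_mor[OF obj_of_in[OF assms(1), unfolded obj_of_eq] obj_of_in[OF assms(2), unfolded obj_of_eq] rigid_xi rigid_xi]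
  by (simp add: obj_of_eq)

text \<open>The matrix is \<open>e + \<eta> e \<xi>\<close> for an elementary matrix \<open>e\<close> and the involutions \<open>\<xi>\<close>, \<open>\<eta>\<close> of the two objects.\<close>

lemma orbit_sum_mor:
  assumes n: "inner_name b n" "inner_name b m" and i: "i < length (coords n)" and j: "j < length (coords m)"
  shows "mat (length (coords m)) (length (coords n)) (\<lambda>(l, c). (if l = j \<and> c = i then 1 else 0) +
     xi_of m $$ (l, j) * xi_of n $$ (i, c)) \<in> Mor PC (obj_of n) (obj_of m)" (is "?t \<in> _")
proof -
  let ?n = "length (coords n)" and ?m = "length (coords m)" and ?\<xi> = "xi_of n :: 'r mat" and ?\<eta> = "xi_of m :: 'r mat"
  have c: "?\<xi> \<in> carrier_mat ?n ?n" "?\<eta> \<in> carrier_mat ?m ?m" by simp_all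
  have sq: "(\<Sum>k<?n. ?\<xi> $$ (a, k) * ?\<xi> $$ (k, d)) = (if a = d then 1 else 0)" if "a < ?n" "d < ?n" for a d
  proof -
    have "(?\<xi> * ?\<xi>) $$ (a, d) = (\<Sum>k<?n. ?\<xi> $$ (a, k) * ?\<xi> $$ (k, d))"
      using that c(1) by (simp add: scalar_prod_def atLeast0LessThan)
    then show ?thesis using that by (simp add: xi_square)
  qed
  have sq': "(\<Sum>k<?m. ?\<eta> $$ (a, k) * ?\<eta> $$ (k, d)) = (if a = d then 1 else 0)" if "a < ?m" "d < ?m" for a d
  proof -
    have "(?\<eta> * ?\<eta>) $$ (a, d) = (\<Sum>k<?m. ?\<eta> $$ (a, k) * ?\<eta> $$ (k, d))"
      using that c(2) by (simp add: scalar_prod_def atLeast0LessThan)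
    then show ?thesis using that by (simp add: xi_square)
  qed
  have "?t * ?\<xi> = ?\<eta> * ?t"
  proof (rule eq_matI)
    fix l d assume "l < dim_row (?\<eta> * ?t)" "d < dim_col (?\<eta> * ?t)"
    then have ld: "l < ?m" "d < ?n" using c(2) by auto
    have "(?t * ?\<xi>) $$ (l, d) = (\<Sum>k<?n. ((if l = j \<and> k = i then 1 else 0) + ?\<eta> $$ (l, j) * ?\<xi> $$ (i, k)) * ?\<xi> $$ (k, d))"
      using ld c by (simp add: scalar_prod_def atLeast0LessThan)
    also have "\<dots> = (\<Sum>k<?n. if k = i then (if l = j then ?\<xi> $$ (k, d) else 0) else 0) + ?\<eta> $$ (l, j) * (\<Sum>k<?n. ?\<xi> $$ (i, k) * ?\<xi> $$ (k, d))"
      unfolding sum_distrib_left sum.distrib[symmetric] by (intro sum.cong) (auto simp: algebra_simps)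
    also have "\<dots> = (if l = j then ?\<xi> $$ (i, d) else 0) + (if i = d then ?\<eta> $$ (l, j) else 0)"
      using sq[OF i ld(2)] i by (simp add: sum.delta)
    finally have 1: "(?t * ?\<xi>) $$ (l, d) = (if l = j then ?\<xi> $$ (i, d) else 0) + (if i = d then ?\<eta> $$ (l, j) else 0)" .
    have "(?\<eta> * ?t) $$ (l, d) = (\<Sum>k<?m. ?\<eta> $$ (l, k) * ((if k = j \<and> d = i then 1 else 0) + ?\<eta> $$ (k, j) * ?\<xi> $$ (i, d)))"
      using ld c by (simp add: scalar_prod_def atLeast0LessThan)
    also have "\<dots> = (\<Sum>k<?m. if k = j then (if d = i then ?\<eta> $$ (l, k) else 0) else 0) + (\<Sum>k<?m. ?\<eta> $$ (l, k) * ?\<eta> $$ (k, j)) * ?\<xi> $$ (i, d)"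
      unfolding sum_distrib_right sum.distrib[symmetric] by (intro sum.cong) (auto simp: algebra_simps)
    also have "\<dots> = (if i = d then ?\<eta> $$ (l, j) else 0) + (if l = j then ?\<xi> $$ (i, d) else 0)"
      using sq'[OF ld(1) j] j by (auto simp: sum.delta)
    finally show "(?t * ?\<xi>) $$ (l, d) = (?\<eta> * ?t) $$ (l, d)" using 1 by (simp add: add.commute)
  qed (use c in auto)
  then show ?thesis using name_mor_iff[OF n] by simp
qed

text \<open>At a linked position the orbit sum of an elementary matrix has the entry 1, or 2 for two
  singular objects of equal sign, a unit in either case. For opposite signs equivariance forces
  \<open>t = - t\<close>, hence \<open>t = 0\<close>.\<close>

lemma all_null_iff:
  assumes n: "inner_name b n" "inner_name b m"
  shows "(\<forall>t \<in> Mor PC (obj_of n) (obj_of m). nul u b (obj_list (coords n)) (obj_list (coords m)) t) \<longleftrightarrow>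
    \<not> (linked b (ends n) (ends m) \<and> signs_agree n m)"
proof
  assume *: "\<forall>t \<in> Mor PC (obj_of n) (obj_of m). nul u b (obj_list (coords n)) (obj_list (coords m)) t"
  show "\<not> (linked b (ends n) (ends m) \<and> signs_agree n m)"
  proof
    assume l: "linked b (ends n) (ends m) \<and> signs_agree n m"
    then obtain i j where i: "i < length (coords n)" and j: "j < length (coords m)"
      and nz: "nz b (obj_list (coords n) ! i) (obj_list (coords m) ! j)"
      unfolding linked_iff_nz by (metis in_set_conv_nth obj_list_coords)
    have "u dvd mat (length (coords m)) (length (coords n)) (\<lambda>(l, c). (if l = j \<and> c = i then 1 else 0) +
        xi_of m $$ (l, j) * xi_of n $$ (i, c)) $$ (j, i)"
      using *[rule_format, OF orbit_sum_mor[OF n i j]] i j nz unfolding nul_def obj_list_coords by blast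
    then have "u dvd 1 + xi_of m $$ (j, j) * xi_of n $$ (i, i)" using i j by simp
    moreover have "1 + xi_of m $$ (j, j) * xi_of n $$ (i, i) \<in> {1, 2 :: 'r}"
      using i j l by (cases n; cases m) auto
    ultimately show False using u_not_unit two by (auto simp: dvd_principal)
  qed
next
  assume *: "\<not> (linked b (ends n) (ends m) \<and> signs_agree n m)"
  show "\<forall>t \<in> Mor PC (obj_of n) (obj_of m). nul u b (obj_list (coords n)) (obj_list (coords m)) t"
  proof
    fix t assume t: "t \<in> Mor PC (obj_of n) (obj_of m)"
    show "nul u b (obj_list (coords n)) (obj_list (coords m)) t"
    proof (cases "linked b (ends n) (ends m)")
      case False
      then show ?thesis unfolding linked_iff_nz nul_def by (auto simp: nth_mem)
    next
      case True
      then have "\<not> signs_agree n m" using * by simp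
      then obtain e z z' where nm: "n = Singular e z" "m = Singular (\<not> e) z'"
        by (cases n; cases m) auto
      have tc: "t \<in> carrier_mat 1 1" and te: "t * xi_of n = xi_of m * t" using t name_mor_iff[OF n] nm by auto
      have "(t * xi_of n) $$ (0, 0) = t $$ (0, 0) * (if e then 1 else - 1)"
        "(xi_of m * t) $$ (0, 0) = (if \<not> e then 1 else - 1) * t $$ (0, 0)"
        using tc by (auto simp: nm scalar_prod_def)
      then have "t $$ (0, 0) + t $$ (0, 0) = 0" using te by (cases e) (auto simp: eq_neg_iff_add_eq_0 minus_equation_iff)
      then have "2 * t $$ (0, 0) = 0" by simp
      moreover have "(2 :: 'r) \<noteq> 0" using two by (auto simp: dvd_principal)
      ultimately have "t $$ (0, 0) = 0" by simp
      then show ?thesis by (simp add: nul_def nm)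
    qed
  qed
qed

lemma Ext1_zero_names:
  assumes n: "inner_name b n" "inner_name b m"
  shows "Ext1_zero PC PS (obj_of n) (obj_of m) \<longleftrightarrow>
    \<not> (linked b (ends n) (ends (shift_name b m)) \<and> signs_agree n (shift_name b m))"
  using Ext1_zero_iff[OF n(2) obj_of_in[OF n(1)]] all_null_iff[OF n(1) inner_shift[OF n(2)]] by (simp add: obj_of_eq)

subsection \<open>Indecomposability and isomorphisms of the objects with names\<close>

text \<open>An endomorphism of a regular object has equal diagonal entries \<open>a\<close> and
  equal off-diagonal entries \<open>d\<close>, and the term with \<open>d * d\<close> carries a
  positive power of \<open>u\<close>. So idempotency makes \<open>a\<close> congruent to 0 or 1,
  whence \<open>2 * a - 1\<close> is a unit; the off-diagonal equation,
  \<open>d * (2 * a - 1)\<close> congruent to 0, then gives \<open>u dvd d\<close> wherever that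
  position is not null.\<close>

lemma name_indecomposable:
  assumes n: "proper_name b n"
  shows "indecomposable CC (obj_of n)"
proof (rule CC_indecomposableI)
  note inner = proper_inner[OF n]
  let ?A = "obj_of n :: 'r pobj" and ?X = "obj_list (coords n)"
  show A: "?A \<in> Obj PC" by (rule obj_of_in[OF inner])
  show "\<not> nl ?A ?A (1\<^sub>m (length (fst ?A)))" using one_not_nul[OF inner] by (simp add: obj_of_eq)
  fix f assume f: "f \<in> Mor PC ?A ?A" and "nl ?A ?A (tmul u (fst ?A) (fst ?A) (fst ?A) f f - f)"
  then have idem: "nul u b ?X ?X (tmul u ?X ?X ?X f f - f)" by (simp add: obj_of_eq)
  have fc: "f \<in> carrier_mat (length (coords n)) (length (coords n))" and fx: "f * xi_of n = xi_of n * f"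
    using f name_mor_iff[OF inner inner] by auto
  have entry: "u dvd (\<Sum>j<length (coords n). f $$ (k, j) * f $$ (j, i) * u ^ co (?X ! i) (?X ! j) (?X ! k)) - f $$ (k, i)"
    if "k < length (coords n)" "i < length (coords n)" "nz b (?X ! i) (?X ! k)" for k i
  proof -
    have "u dvd (tmul u ?X ?X ?X f f - f) $$ (k, i)" using idem that unfolding nul_def by simp
    then show ?thesis using that fc by (simp add: tmul_index)
  qed
  have dvd_idem: "u dvd a \<or> u dvd a - 1" if "u dvd a * a - a" for a
  proof -
    have "u dvd a * (a - 1)" using that by (simp add: algebra_simps)
    then show ?thesis by (simp add: u_dvd_mult)
  qed
  show "nl ?A ?A f \<or> nl ?A ?A (f - 1\<^sub>m (length (fst ?A)))"
  proof (cases n)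
    case (Singular e z)
    have "nz b (M_orb z z) (M_orb z z)"
      using nz_self_iff[OF M_orb_in b_le M_orb_self, of z z] b_pos by simp
    then have "u dvd f $$ (0, 0) * f $$ (0, 0) - f $$ (0, 0)" using entry[of 0 0] by (simp add: Singular obj_list_def)
    then have "u dvd f $$ (0, 0) \<or> u dvd f $$ (0, 0) - 1" by (rule dvd_idem)
    then show ?thesis using fc by (auto simp: nul_def Singular obj_of_eq)
  next
    case (Regular x y)
    then have xy: "x \<noteq> y" "\<bar>x - y\<bar> < b" using n by auto
    have X: "?X ! 0 = M_orb x y" "?X ! Suc 0 = M_orb (x + pi) (y + pi)" "length (coords n) = 2"
      by (simp_all add: Regular obj_list_def)
    define a where "a = f $$ (0, 0)"
    define d where "d = f $$ (0, 1)"
    have fc2: "f \<in> carrier_mat 2 2" using fc by (simp add: X)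
    have "f * swap2 = swap2 * f" using fx by (simp add: Regular swap2_def)
    then have "f $$ (i, 1 - j) = f $$ (1 - i, j)" if "i < 2" "j < 2" for i j
      using swap2_left[OF fc2 that] swap2_right[OF fc2 that] by simp
    from this[of 0 1] this[of 0 0] have f2: "f $$ (Suc 0, Suc 0) = a" "f $$ (Suc 0, 0) = d"
      by (simp_all add: a_def d_def)
    have in_b: "M_orb x y \<in> X_set b" "M_orb (x + pi) (y + pi) \<in> X_set b" using xy by (auto intro!: M_orb_in)
    have Api: "M_orb x y \<in> X_set pi" "M_orb (x + pi) (y + pi) \<in> X_set pi"
      using subsetD[OF X_set_mono[OF b_le]] in_b by blast+
    have c: "co (M_orb x y) (M_orb (x + pi) (y + pi)) (M_orb x y) \<noteq> 0"
      using co_back_forth[OF Api] psi_same_coords_imp_diagonal[of x y] xy(1) by (auto simp: psi_orb_M)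
    have "nz b (M_orb x y) (M_orb x y)" using nz_self_iff[OF in_b(1) b_le M_orb_self] xy by simp
    then have "u dvd a * a + d * d * u ^ co (M_orb x y) (M_orb (x + pi) (y + pi)) (M_orb x y) - a"
      using entry[of 0 0] f2 by (simp add: X sum_two_four a_def d_def)
    moreover have "u dvd d * d * u ^ co (M_orb x y) (M_orb (x + pi) (y + pi)) (M_orb x y)"
      using c by (cases "co (M_orb x y) (M_orb (x + pi) (y + pi)) (M_orb x y)") auto
    ultimately have "u dvd (a * a + d * d * u ^ co (M_orb x y) (M_orb (x + pi) (y + pi)) (M_orb x y) - a)
        - d * d * u ^ co (M_orb x y) (M_orb (x + pi) (y + pi)) (M_orb x y)" by (rule dvd_diff)
    then have "u dvd a * a - a" by simp
    then have a: "u dvd a \<or> u dvd a - 1" by (rule dvd_idem)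
    have unit: "\<not> u dvd 2 * a - 1"
    proof
      assume *: "u dvd 2 * a - 1"
      from a have "u dvd 1"
      proof
        assume "u dvd a"
        then have "u dvd 2 * a" by (rule dvd_mult)
        then have "u dvd 2 * a - (2 * a - 1)" using * by (rule dvd_diff)
        then show ?thesis by simp
      next
        assume "u dvd a - 1"
        then have "u dvd 2 * (a - 1)" by (rule dvd_mult)
        with * have "u dvd (2 * a - 1) - 2 * (a - 1)" by (rule dvd_diff)
        then show ?thesis by (simp add: algebra_simps)
      qed
      then show False using u_not_unit by simp
    qed
    have d: "u dvd d" if "nz b (M_orb (x + pi) (y + pi)) (M_orb x y) \<or> nz b (M_orb x y) (M_orb (x + pi) (y + pi))"
    proof -
      have "u dvd a * d + d * a - d"
        using that entry[of 0 "Suc 0"] entry[of "Suc 0" 0] f2 by (auto simp: X sum_two_four a_def d_def algebra_simps)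
      then have "u dvd d * (2 * a - 1)" by (simp add: algebra_simps)
      then show ?thesis using unit by (simp add: u_dvd_mult)
    qed
    from a show ?thesis
    proof
      assume "u dvd a"
      then have "nul u b ?X ?X f"
        using f2 d by (auto simp: nul_def X less_2_cases_iff a_def d_def)
      then show ?thesis by (simp add: obj_of_eq)
    next
      assume "u dvd a - 1"
      then have "nul u b ?X ?X (f - 1\<^sub>m 2)"
        using f2 d fc2 by (auto simp: nul_def X less_2_cases_iff a_def d_def)
      then show ?thesis by (simp add: obj_of_eq X)
    qed
  qed
qed

lemma rigid_isomorphic:
  fixes f g :: "'r mat"
  assumes n: "inner_name b n" "inner_name b m"
    and f: "f \<in> carrier_mat (length (coords m)) (length (coords n))" "g \<in> carrier_mat (length (coords n)) (length (coords m))"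
    and r: "rigid (obj_list (coords n)) (obj_list (coords m)) f" "rigid (obj_list (coords m)) (obj_list (coords n)) g"
    and eq: "f * xi_of n = xi_of m * f" "g * xi_of m = xi_of n * g" "g * f = 1\<^sub>m (length (coords n))" "f * g = 1\<^sub>m (length (coords m))"
  shows "isomorphic CC (obj_of n) (obj_of m)"
proof (rule CC_isomorphicI[OF obj_of_in[OF n(1)] obj_of_in[OF n(2)]])
  let ?X = "obj_list (coords n)" and ?Y = "obj_list (coords m)"
  have o: "?X \<in> lists (X_set b)" "?Y \<in> lists (X_set b)"
    using obj_list_in[OF obj_of_in[OF n(1)]] obj_list_in[OF obj_of_in[OF n(2)]] by (simp_all add: obj_of_eq)
  show "f \<in> Mor PC (obj_of n) (obj_of m)" "g \<in> Mor PC (obj_of m) (obj_of n)"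
    using name_mor_iff[OF n] name_mor_iff[OF n(2,1)] f eq by auto
  have "tmul u ?X ?Y ?X g f = g * f" using tmul_rigid_right[OF o(1,2,1) b_le r(1)] f by simp
  moreover have "tmul u ?Y ?X ?Y f g = f * g" using tmul_rigid_right[OF o(2,1,2) b_le r(2)] f by simp
  ultimately show "sc (obj_of n) (obj_of n) (tmul u (fst (obj_of n :: 'r pobj)) (fst (obj_of m :: 'r pobj)) (fst (obj_of n :: 'r pobj)) g f) =
      sc (obj_of n) (obj_of n) (1\<^sub>m (length (fst (obj_of n :: 'r pobj))))"
    "sc (obj_of m) (obj_of m) (tmul u (fst (obj_of m :: 'r pobj)) (fst (obj_of n :: 'r pobj)) (fst (obj_of m :: 'r pobj)) f g) =
      sc (obj_of m) (obj_of m) (1\<^sub>m (length (fst (obj_of m :: 'r pobj))))"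
    using eq by (simp_all add: obj_of_eq)
qed

text \<open>The entry of \<open>g f\<close> at (0, 0) is 1 modulo \<open>u\<close>, so some summand
  of the middle object contributes with exponent 0, and \<open>co_back_forth\<close> applies.
  Opposite signs would make all morphisms null.\<close>

lemma isomorphic_same_coords:
  assumes n: "proper_name b n" "proper_name b m" and iso: "isomorphic CC (obj_of n) (obj_of m)"
  shows "(\<exists>B \<in> set (obj_list (coords m)). same_coords (obj_list (coords n) ! 0) B) \<and> signs_agree n m"
proof -
  note i = proper_inner[OF n(1)] proper_inner[OF n(2)]
  let ?X = "obj_list (coords n)" and ?Y = "obj_list (coords m)"
  note o = obj_of_in[OF i(1)] obj_of_in[OF i(2)]
  obtain f g where f: "f \<in> Mor PC (obj_of n) (obj_of m)" and g: "g \<in> Mor PC (obj_of m) (obj_of n)"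
    and gf: "sc (obj_of n) (obj_of n) (tmul u (fst (obj_of n :: 'r pobj)) (fst (obj_of m :: 'r pobj)) (fst (obj_of n :: 'r pobj)) g f) =
      sc (obj_of n) (obj_of n) (1\<^sub>m (length (fst (obj_of n :: 'r pobj))))"
    using CC_isomorphicE[OF o iso] by metis
  have nl: "nul u b ?X ?X (tmul u ?X ?Y ?X g f - 1\<^sub>m (length ?X))"
    using gf sc_eq_iff[OF o(1,1) mor_comp[OF o(1,2,1) f g] mor_id[OF o(1)]] by (simp add: obj_of_eq)
  have l: "0 < length (coords n)" by (cases n) simp_all
  have X0: "?X ! 0 = M_orb (fst (ends n)) (snd (ends n))" by (cases n) (simp_all add: obj_list_def)
  have lt: "\<bar>fst (ends n) - snd (ends n)\<bar> < b" using n(1) by (cases n) auto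
  have in0: "?X ! 0 \<in> X_set b" unfolding X0 using lt by (intro M_orb_in) simp
  have "nz b (?X ! 0) (?X ! 0)"
    using nz_self_iff[OF in0 b_le, of "fst (ends n)" "snd (ends n)" True] lt M_orb_self X0 by simp
  then have "u dvd (tmul u ?X ?Y ?X g f - 1\<^sub>m (length ?X)) $$ (0, 0)"
    using nl l unfolding nul_def obj_list_coords by blast
  then have s1: "u dvd (\<Sum>k<length (coords m). g $$ (0, k) * f $$ (k, 0) * u ^ co (?X ! 0) (?Y ! k) (?X ! 0)) - 1"
    using l by (simp add: tmul_index)
  have "\<not> u dvd (\<Sum>k<length (coords m). g $$ (0, k) * f $$ (k, 0) * u ^ co (?X ! 0) (?Y ! k) (?X ! 0))"
    (is "\<not> u dvd ?s")
  proof
    assume "u dvd ?s"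
    then have "u dvd ?s - (?s - 1)" using s1 by (rule dvd_diff)
    then show False using u_not_unit by simp
  qed
  then obtain k where k: "k < length (coords m)" "\<not> u dvd g $$ (0, k) * f $$ (k, 0) * u ^ co (?X ! 0) (?Y ! k) (?X ! 0)"
    by (meson dvd_sum lessThan_iff)
  have "co (?X ! 0) (?Y ! k) (?X ! 0) = 0"
    using k(2) by (cases "co (?X ! 0) (?Y ! k) (?X ! 0)") auto
  moreover have "?Y ! k \<in> X_set pi" using X_nth[OF obj_list_in[OF o(2)] b_le, of k] k(1) by (simp add: obj_of_eq)
  moreover have "?X ! 0 \<in> X_set pi" using in0 X_set_mono[OF b_le] by blast
  ultimately have "same_coords (?X ! 0) (?Y ! k)" using co_back_forth by blast
  moreover have "signs_agree n m"
  proof (rule ccontr)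
    assume "\<not> signs_agree n m"
    then have "nul u b ?X ?Y f" "nul u b ?Y ?X g"
      using all_null_iff[OF i] all_null_iff[OF i(2,1)] f g by (cases n; cases m; auto)+
    then have "nul u b ?X ?X (tmul u ?X ?Y ?X g f)"
      using nl_comp[OF o(1,2,1), of f g] by (simp add: obj_of_eq)
    then have "nul u b ?X ?X (1\<^sub>m (length ?X))" using nl nul_diff_iff[of "tmul u ?X ?Y ?X g f" ?X ?X "1\<^sub>m (length ?X)" u b] by simp
    then show False using one_not_nul[OF i(1)] by simp
  qed
  ultimately show ?thesis using k(1) nth_mem[of k ?Y] by auto
qed

end

section \<open>Exchange in a locally finite system of arcs\<close>

definition cross :: "real \<Rightarrow> real \<Rightarrow> real \<Rightarrow> real \<Rightarrow> bool" where
  "cross x y x' y' \<longleftrightarrow> (x < x' \<and> x' < y \<and> y < y') \<or> (x' < x \<and> x < y' \<and> y' < y)"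

text \<open>Intervals of length \<open>pi\<close> are loops round the puncture, and the tag makes
  them behave like tagged spokes ending at it: overlapping loops with different base points cross
  iff their tags differ, and the two loops at one point never cross.\<close>

definition tagged_cross :: "point \<Rightarrow> point \<Rightarrow> bool" where
  "tagged_cross = (\<lambda>(x, y, e) (x', y', e'). cross x y x' y' \<and>
     (y = x + pi \<longrightarrow> y' = x' + pi \<longrightarrow> e \<noteq> e'))"

definition same_arc :: "point \<Rightarrow> point \<Rightarrow> bool" where
  "same_arc = (\<lambda>(x, y, e) (x', y', e'). \<exists>k::int. x' = x + of_int k * pi \<and> y' = y + of_int k * pi \<and>
     (y = x + pi \<longrightarrow> e = e'))"

lemma cross_commute: "cross x y x' y' \<longleftrightarrow> cross x' y' x y"
  by (auto simp: cross_def)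

lemma tagged_cross_commute: "tagged_cross p q \<longleftrightarrow> tagged_cross q p"
  by (cases p; cases q) (auto simp: tagged_cross_def cross_commute)

lemma cross_shift [simp]: "cross (x + a) (y + a) (x' + a) (y' + a) \<longleftrightarrow> cross x y x' y'"
  by (auto simp: cross_def)

lemma same_arc_shift: "same_arc (x, y, e) (x + of_int k * pi, y + of_int k * pi, e)"
  by (auto simp: same_arc_def)

lemma same_arc_refl: "same_arc p p"
  by (cases p) (auto simp: same_arc_def intro: exI[of _ 0])

lemma same_arc_sym: "same_arc p q \<Longrightarrow> same_arc q p"
proof (cases p; cases q)
  fix x y x' y' :: real and e e'
  assume "p = (x, y, e)" "q = (x', y', e')" "same_arc p q"
  then obtain k :: int where "x' = x + of_int k * pi" "y' = y + of_int k * pi" "y = x + pi \<longrightarrow> e = e'"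
    by (auto simp: same_arc_def)
  then show "same_arc q p" using \<open>p = _\<close> \<open>q = _\<close>
    by (auto simp: same_arc_def intro!: exI[of _ "- k"])
qed

lemma same_arc_trans: "same_arc p q \<Longrightarrow> same_arc q r \<Longrightarrow> same_arc p r"
proof (cases p; cases q; cases r)
  fix x y x' y' x'' y'' :: real and e e' e''
  assume eq: "p = (x, y, e)" "q = (x', y', e')" "r = (x'', y'', e'')" and "same_arc p q" "same_arc q r"
  then obtain k l :: int where "x' = x + of_int k * pi" "y' = y + of_int k * pi" "y = x + pi \<longrightarrow> e = e'"
    "x'' = x' + of_int l * pi" "y'' = y' + of_int l * pi" "y' = x' + pi \<longrightarrow> e' = e''"
    by (auto simp: same_arc_def)
  then show "same_arc p r" using eq
    by (auto simp: same_arc_def algebra_simps intro!: exI[of _ "k + l"])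
qed

lemma shift_into:
  fixes x a :: real
  obtains k :: int where "a \<le> x + of_int k * pi" "x + of_int k * pi < a + pi"
proof -
  define k where "k = \<lceil>(a - x) / pi\<rceil>"
  have "(a - x) / pi \<le> of_int k" "of_int k < (a - x) / pi + 1" unfolding k_def by linarith+
  then have "a - x \<le> of_int k * pi" "of_int k * pi < a - x + pi"
    by (simp_all add: field_simps)
  then show ?thesis using that[of k] by linarith
qed

lemma bounded_shifts: "finite {k::int. \<bar>x + of_int k * pi\<bar> \<le> N}"
proof (rule finite_subset)
  show "{k::int. \<bar>x + of_int k * pi\<bar> \<le> N} \<subseteq> {- \<lceil>(N + \<bar>x\<bar>) / pi\<rceil> .. \<lceil>(N + \<bar>x\<bar>) / pi\<rceil>}"
  proof
    fix k :: int
    assume "k \<in> {k::int. \<bar>x + of_int k * pi\<bar> \<le> N}"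
    then have "of_int k * pi \<le> N + \<bar>x\<bar>" "- of_int k * pi \<le> N + \<bar>x\<bar>" by auto
    then have "of_int k \<le> (N + \<bar>x\<bar>) / pi" "- of_int k \<le> (N + \<bar>x\<bar>) / pi"
      by (simp_all add: field_simps)
    then show "k \<in> {- \<lceil>(N + \<bar>x\<bar>) / pi\<rceil> .. \<lceil>(N + \<bar>x\<bar>) / pi\<rceil>}" by simp linarith
  qed
qed simp

lemma crossI: "x < x' \<Longrightarrow> x' < y \<Longrightarrow> y < y' \<Longrightarrow> cross x y x' y'" "x' < x \<Longrightarrow> x < y' \<Longrightarrow> y' < y \<Longrightarrow> cross x y x' y'"
  by (auto simp: cross_def)

text \<open>The arc is forced to be the other diagonal: an end \<open>x\<close> different from
  \<open>a\<close>, or \<open>y\<close> different from \<open>d\<close>, would produce a crossing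
  with one of the two sides at that corner.\<close>

lemma cross_quadrilateral_left:
  assumes "a < c" "c < d" "d < b" "x < y" "\<not> cross x y a c" "\<not> cross x y c d" "\<not> cross x y d b"
    "\<not> cross x y a b" "cross x y c b"
  shows "x = a \<and> y = d"
proof -
  have not: "\<not> (c < x \<and> x < b \<and> b < y)" using crossI(2)[of a x b y] assms by linarith
  have *: "x < c \<and> c < y \<and> y < b" using assms(9) not unfolding cross_def by auto
  have "\<not> x < a" using crossI(1)[of x a y b] * assms by linarith
  moreover have "\<not> a < x" using crossI(2)[of a x c y] * assms by linarith
  moreover have "\<not> y < d" using crossI(1)[of x c y d] * assms by linarith
  moreover have "\<not> d < y" using crossI(1)[of x d y b] * assms by linarith
  ultimately show ?thesis by linarith
qed

lemma cross_quadrilateral_right: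
  assumes "a < c" "c < d" "d < b" "x < y" "\<not> cross x y a c" "\<not> cross x y c d" "\<not> cross x y d b"
    "\<not> cross x y a b" "cross x y a d"
  shows "x = c \<and> y = b"
proof -
  have not: "\<not> (x < a \<and> a < y \<and> y < d)" using crossI(1)[of x a y b] assms by linarith
  have *: "a < x \<and> x < d \<and> d < y" using assms(9) not unfolding cross_def by auto
  have "\<not> x < c" using crossI(2)[of a x c y] * assms by linarith
  moreover have "\<not> c < x" using crossI(2)[of c x d y] * assms by linarith
  moreover have "\<not> b < y" using crossI(2)[of a x b y] * assms by linarith
  moreover have "\<not> y < b" using crossI(1)[of x d y b] * assms by linarith
  ultimately show ?thesis by linarith
qed

text \<open>All lifts to the real line of the arcs of a discrete lamination. An arc shorter than
  \<open>pi\<close> has no tag and is entered with both, so that one type serves for all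
  arcs.\<close>

locale arc_system =
  fixes D :: "point set"
  assumes range: "(x, y, e) \<in> D \<Longrightarrow> x < y \<and> y \<le> x + pi"
    and shift: "(x, y, e) \<in> D \<Longrightarrow> (x + of_int k * pi, y + of_int k * pi, e) \<in> D"
    and flip: "(x, y, e) \<in> D \<Longrightarrow> y < x + pi \<Longrightarrow> (x, y, e') \<in> D"
    and noncrossing: "p \<in> D \<Longrightarrow> q \<in> D \<Longrightarrow> \<not> tagged_cross p q"
    and maximal: "x < y \<Longrightarrow> y \<le> x + pi \<Longrightarrow> (\<And>q. q \<in> D \<Longrightarrow> \<not> tagged_cross (x, y, e) q) \<Longrightarrow> (x, y, e) \<in> D"
    and locally_finite: "0 < \<delta> \<Longrightarrow> finite {(x, y, e) \<in> D. \<bar>x\<bar> \<le> N \<and> \<delta> \<le> y - x}"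
begin

text \<open>A loop present with both tags bounds a region just as an ordinary arc does: whatever
  crosses it crosses one of its tagged copies. So both kinds can serve as sides of
  triangles.\<close>

definition both :: "real \<Rightarrow> real \<Rightarrow> bool" where
  "both x y \<longleftrightarrow> (\<forall>e. (x, y, e) \<in> D)"

lemma bothI: "(x, y, e) \<in> D \<Longrightarrow> y < x + pi \<Longrightarrow> both x y"
  using flip by (auto simp: both_def)

lemma both_range: "both x y \<Longrightarrow> x < y \<and> y \<le> x + pi"
  using range unfolding both_def by blast

lemma both_shift: "both x y \<Longrightarrow> both (x + of_int k * pi) (y + of_int k * pi)"
  using shift unfolding both_def by blast

lemma both_noncrossing: "both x y \<Longrightarrow> (a, b, e) \<in> D \<Longrightarrow> \<not> cross x y a b"
  using noncrossing[of "(x, y, \<not> e)" "(a, b, e)"] unfolding both_def tagged_cross_def by auto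

lemma both_maximal:
  "x < y \<Longrightarrow> y < x + pi \<Longrightarrow> (\<And>a b e. (a, b, e) \<in> D \<Longrightarrow> \<not> cross x y a b) \<Longrightarrow> both x y"
  unfolding both_def by (intro allI maximal) (auto simp: tagged_cross_def)

lemma finite_longer:
  assumes "0 < \<delta>" shows "finite {(a, b). \<bar>a\<bar> \<le> N \<and> \<delta> \<le> b - a \<and> (\<exists>e. (a, b, e) \<in> D)}"
proof -
  have "{(a, b). \<bar>a\<bar> \<le> N \<and> \<delta> \<le> b - a \<and> (\<exists>e. (a, b, e) \<in> D)}
      = (\<lambda>(a, b, e). (a, b)) ` {(a, b, e) \<in> D. \<bar>a\<bar> \<le> N \<and> \<delta> \<le> b - a}"
    by (auto simp: image_def split: prod.splits)
  then show ?thesis using locally_finite[OF assms, of N] by simp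
qed

text \<open>Only arcs at least as long as the given one compete, so its length is a \<delta> for
  which local finiteness leaves finitely many candidates.\<close>

lemma longest_inside:
  assumes "(a\<^sub>0, b\<^sub>0, e\<^sub>0) \<in> D" "P a\<^sub>0 b\<^sub>0" and bd: "\<And>a b. P a b \<Longrightarrow> \<bar>a\<bar> \<le> N"
  obtains a b e where "(a, b, e) \<in> D" "P a b"
    "\<And>a' b' e'. (a', b', e') \<in> D \<Longrightarrow> P a' b' \<Longrightarrow> b' - a' \<le> b - a"
proof -
  define F where "F = {(a, b). (\<exists>e. (a, b, e) \<in> D) \<and> P a b \<and> b\<^sub>0 - a\<^sub>0 \<le> b - a}"
  have "F \<subseteq> {(a, b). \<bar>a\<bar> \<le> N \<and> b\<^sub>0 - a\<^sub>0 \<le> b - a \<and> (\<exists>e. (a, b, e) \<in> D)}"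
    using bd by (auto simp: F_def)
  moreover have "0 < b\<^sub>0 - a\<^sub>0" using range[OF assms(1)] by simp
  ultimately have fin: "finite F" using finite_longer finite_subset by blast
  have ne: "F \<noteq> {}" using assms by (auto simp: F_def)
  define m where "m = Max ((\<lambda>(a, b). b - a) ` F)"
  have "m \<in> (\<lambda>(a, b). b - a) ` F" unfolding m_def using fin ne by (intro Max_in) auto
  then obtain a b where ab: "(a, b) \<in> F" "m = b - a" by auto
  have le: "b' - a' \<le> m" if "(a', b') \<in> F" for a' b'
    unfolding m_def using fin that by (intro Max_ge) auto
  have "(a\<^sub>0, b\<^sub>0) \<in> F" using assms by (auto simp: F_def)
  then have m0: "b\<^sub>0 - a\<^sub>0 \<le> m" by (rule le)
  obtain e where "(a, b, e) \<in> D" "P a b" using ab by (auto simp: F_def)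
  then show ?thesis
  proof (rule that)
    fix a' b' e' assume *: "(a', b', e') \<in> D" "P a' b'"
    show "b' - a' \<le> b - a"
    proof (cases "b\<^sub>0 - a\<^sub>0 \<le> b' - a'")
      case True
      then show ?thesis using * le[of a' b'] ab by (auto simp: F_def)
    qed (use m0 ab in linarith)
  qed
qed

lemma shortest_inside:
  assumes "(a\<^sub>0, b\<^sub>0, e\<^sub>0) \<in> D" "P a\<^sub>0 b\<^sub>0" and bd: "\<And>a b. P a b \<Longrightarrow> \<bar>a\<bar> \<le> N \<and> \<delta> \<le> b - a" and "0 < \<delta>"
  obtains a b e where "(a, b, e) \<in> D" "P a b"
    "\<And>a' b' e'. (a', b', e') \<in> D \<Longrightarrow> P a' b' \<Longrightarrow> b - a \<le> b' - a'"
proof -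
  define F where "F = {(a, b). (\<exists>e. (a, b, e) \<in> D) \<and> P a b}"
  have "F \<subseteq> {(a, b). \<bar>a\<bar> \<le> N \<and> \<delta> \<le> b - a \<and> (\<exists>e. (a, b, e) \<in> D)}"
    using bd by (auto simp: F_def)
  then have fin: "finite F" using finite_longer[OF \<open>0 < \<delta>\<close>] finite_subset by blast
  have ne: "F \<noteq> {}" using assms by (auto simp: F_def)
  define m where "m = Min ((\<lambda>(a, b). b - a) ` F)"
  have "m \<in> (\<lambda>(a, b). b - a) ` F" unfolding m_def using fin ne by (intro Min_in) auto
  then obtain a b where ab: "(a, b) \<in> F" "m = b - a" by auto
  have le: "m \<le> b' - a'" if "(a', b') \<in> F" for a' b'
    unfolding m_def using fin that by (intro Min_le) auto
  obtain e where "(a, b, e) \<in> D" "P a b" using ab by (auto simp: F_def)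
  then show ?thesis
  proof (rule that)
    fix a' b' e' assume *: "(a', b', e') \<in> D" "P a' b'"
    then show "b - a \<le> b' - a'" using le[of a' b'] ab by (auto simp: F_def)
  qed
qed

text \<open>The apex is an endpoint of a longest arc strictly inside \<open>[x, y]\<close>.\<close>

lemma apex:
  assumes "both x y"
  obtains c where "x < c" "c < y" "both x c" "both c y"
proof -
  have xy: "x < y" "y \<le> x + pi" using both_range[OF assms] by auto
  define P where "P = (\<lambda>a b. x \<le> a \<and> b \<le> y \<and> (a, b) \<noteq> (x, y) \<and> a < b)"
  have reg: "both a b" if "(a, b, e) \<in> D" "P a b" for a b e
    using that xy by (intro bothI) (auto simp: P_def)
  have add: "both a b" if "P a b"
    "\<And>a' b' e'. (a', b', e') \<in> D \<Longrightarrow> P a' b' \<Longrightarrow> \<not> cross a b a' b'" for a b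
  proof (rule both_maximal)
    show "a < b" "b < a + pi" using that(1) xy by (auto simp: P_def)
    fix a' b' e' assume D: "(a', b', e') \<in> D"
    show "\<not> cross a b a' b'"
    proof (cases "P a' b'")
      case True then show ?thesis using that D by blast
    next
      case False
      have "\<not> cross x y a' b'" using both_noncrossing assms D by blast
      then show ?thesis using False range[OF D] that(1)
        unfolding P_def cross_def by auto
    qed
  qed
  have "\<exists>a b e. (a, b, e) \<in> D \<and> P a b"
  proof (rule ccontr)
    assume none: "\<not> ?thesis"
    \<comment> \<open>Were there no arc strictly inside, the arc from \<open>x\<close> to the
      midpoint would cross nothing, and maximality would put it into \<open>D\<close>.\<close>
    have "P x ((x + y) / 2)" using xy by (auto simp: P_def)
    then have "both x ((x + y) / 2)" using none by (intro add) blast+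
    then show False using none \<open>P x ((x + y) / 2)\<close> unfolding both_def by blast
  qed
  then obtain a\<^sub>0 b\<^sub>0 e\<^sub>0 where "(a\<^sub>0, b\<^sub>0, e\<^sub>0) \<in> D" "P a\<^sub>0 b\<^sub>0" by blast
  then obtain a b e where ab: "(a, b, e) \<in> D" "P a b"
    and long: "\<And>a' b' e'. (a', b', e') \<in> D \<Longrightarrow> P a' b' \<Longrightarrow> b' - a' \<le> b - a"
    by (rule longest_inside[of a\<^sub>0 b\<^sub>0 e\<^sub>0 P "\<bar>x\<bar> + \<bar>y\<bar>"]) (auto simp: P_def)
  have nc: "\<not> cross a b a' b'" if "(a', b', e') \<in> D" for a' b' e'
    using both_noncrossing reg ab that by blast
  have Pab: "x \<le> a" "b \<le> y" "(a, b) \<noteq> (x, y)" "a < b" using ab(2) by (auto simp: P_def)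
  have left: "both x b" if "x < a" "b < y"
  proof (rule add)
    show "P x b" using Pab that by (auto simp: P_def)
    fix a' b' e' assume D': "(a', b', e') \<in> D" "P a' b'"
    then show "\<not> cross x b a' b'"
      using long[OF D'] nc[OF D'(1)] that unfolding cross_def P_def by auto
  qed
  \<comment> \<open>A longest arc touches an end of \<open>[x, y]\<close>: otherwise
    \<open>(x, b)\<close> crosses nothing, belongs to \<open>D\<close> and is longer.\<close>
  have no: "\<not> (x < a \<and> b < y)"
  proof
    assume *: "x < a \<and> b < y"
    then have "(x, b, True) \<in> D" using left by (auto simp: both_def)
    moreover have "P x b" using Pab * by (auto simp: P_def)
    ultimately show False using long[of x b True] * by linarith
  qed
  show ?thesis
  proof (cases "x < a")
    case True
    then have b: "b = y" using no Pab by auto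
    have "both x a"
    proof (rule add)
      show "P x a" using Pab True by (auto simp: P_def)
      fix a' b' e' assume D': "(a', b', e') \<in> D" "P a' b'"
      then show "\<not> cross x a a' b'"
        using long[OF D'] nc[OF D'(1)] True b unfolding cross_def P_def by auto
    qed
    then show ?thesis using that[of a] True Pab reg[OF ab] b by auto
  next
    case False
    then have a: "a = x" "b < y" using Pab by auto
    have "both b y"
    proof (rule add)
      show "P b y" using Pab a by (auto simp: P_def)
      fix a' b' e' assume D': "(a', b', e') \<in> D" "P a' b'"
      then show "\<not> cross b y a' b'"
        using long[OF D'] nc[OF D'(1)] a unfolding cross_def P_def by auto
    qed
    then show ?thesis using that[of b] a Pab reg[OF ab] by auto
  qed
qed

text \<open>The flip on the level of lifts: taking one object out of a lamination removes all
  translates of \<open>t\<close>, hence \<open>same_arc\<close> instead of equality, both for what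
  is removed and for the uniqueness of \<open>s\<close>.\<close>

definition exchange :: "point \<Rightarrow> point \<Rightarrow> bool" where
  "exchange t s \<longleftrightarrow> fst s < fst (snd s) \<and> fst (snd s) \<le> fst s + pi \<and> s \<notin> D \<and>
     (\<forall>q \<in> D. \<not> same_arc t q \<longrightarrow> \<not> tagged_cross s q) \<and>
     (\<forall>p. fst p < fst (snd p) \<longrightarrow> fst (snd p) \<le> fst p + pi \<longrightarrow> p \<notin> D \<longrightarrow>
        (\<forall>q \<in> D. \<not> same_arc t q \<longrightarrow> \<not> tagged_cross p q) \<longrightarrow> same_arc p s)"

lemma compatible_shift:
  assumes compat: "\<And>q. q \<in> D \<Longrightarrow> \<not> same_arc t q \<Longrightarrow> \<not> tagged_cross (x, y, f) q"
    and r: "r \<in> D" "\<not> same_arc t r"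
  shows "\<not> tagged_cross (x + of_int l * pi, y + of_int l * pi, f) r"
proof -
  obtain rx ry re where r_eq: "r = (rx, ry, re)" by (cases r)
  let ?r = "(rx + of_int (- l) * pi, ry + of_int (- l) * pi, re)"
  have "same_arc ?r r"
    unfolding r_eq by (rule same_arc_sym) (rule same_arc_shift)
  then have "\<not> same_arc t ?r" using r(2) same_arc_trans by blast
  then have "\<not> tagged_cross (x, y, f) ?r"
    using compat shift[of rx ry re "- l"] r(1) r_eq by blast
  moreover have "cross (x + of_int l * pi) (y + of_int l * pi) rx ry
      \<longleftrightarrow> cross x y (rx + of_int (- l) * pi) (ry + of_int (- l) * pi)"
    using cross_shift[of x "of_int l * pi" y "rx + of_int (- l) * pi" "ry + of_int (- l) * pi"] by simp
  moreover have "y + of_int l * pi = x + of_int l * pi + pi \<longleftrightarrow> y = x + pi"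
    "ry + of_int (- l) * pi = rx + of_int (- l) * pi + pi \<longleftrightarrow> ry = rx + pi"
    by linarith+
  ultimately show ?thesis unfolding r_eq tagged_cross_def prod.case by blast
qed

text \<open>Since the family is invariant under translation, it suffices to control the arcs that
  cross \<open>t\<close> itself, rather than one of its translates.\<close>

lemma exchangeI:
  assumes t: "t \<in> D" and s: "a < b" "b \<le> a + pi" "tagged_cross (a, b, e) t"
    and compat: "\<And>x y f. (x, y, f) \<in> D \<Longrightarrow> tagged_cross (a, b, e) (x, y, f) \<Longrightarrow> same_arc t (x, y, f)"
    and unique: "\<And>x y f. x < y \<Longrightarrow> y \<le> x + pi \<Longrightarrow> tagged_cross (x, y, f) t \<Longrightarrow>
       (\<And>q. q \<in> D \<Longrightarrow> \<not> same_arc t q \<Longrightarrow> \<not> tagged_cross (x, y, f) q) \<Longrightarrow> same_arc (x, y, f) (a, b, e)"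
  shows "exchange t (a, b, e)"
proof -
  have "same_arc p (a, b, e)" if p: "fst p < fst (snd p)" "fst (snd p) \<le> fst p + pi" "p \<notin> D"
    "\<forall>q \<in> D. \<not> same_arc t q \<longrightarrow> \<not> tagged_cross p q" for p
  proof -
    obtain x y f where p_eq: "p = (x, y, f)" by (cases p)
    have xy: "x < y" "y \<le> x + pi" using p p_eq by auto
    obtain q where q: "q \<in> D" "tagged_cross p q"
      using maximal[OF xy, of f] p p_eq by blast
    then have "same_arc t q" using p by blast
    obtain tx ty te where t_eq: "t = (tx, ty, te)" by (cases t)
    obtain qx qy qe where q_eq: "q = (qx, qy, qe)" by (cases q)
    obtain k :: int where k: "qx = tx + of_int k * pi" "qy = ty + of_int k * pi" "ty = tx + pi \<longrightarrow> te = qe"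
      using \<open>same_arc t q\<close> t_eq q_eq by (auto simp: same_arc_def)
    define l where "l = - k"
    let ?p = "(x + of_int l * pi, y + of_int l * pi, f)"
    have "same_arc ?p (a, b, e)"
    proof (rule unique)
      have "cross (x + of_int l * pi) (y + of_int l * pi) tx ty \<longleftrightarrow> cross x y qx qy"
        using cross_shift[of x "of_int l * pi" y qx qy] k by (simp add: l_def)
      then show "tagged_cross ?p t"
        using q k p_eq t_eq q_eq by (auto simp: tagged_cross_def)
    next
      fix r assume r: "r \<in> D" "\<not> same_arc t r"
      show "\<not> tagged_cross ?p r"
        by (rule compatible_shift[OF _ r]) (use p p_eq in auto)
    qed (use xy in auto)
    then show ?thesis using same_arc_trans same_arc_shift p_eq by blast
  qed
  moreover have "(a, b, e) \<notin> D" using noncrossing t s(3) by blast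
  moreover have "\<forall>q \<in> D. \<not> same_arc t q \<longrightarrow> \<not> tagged_cross (a, b, e) q" using compat by auto
  ultimately show ?thesis unfolding exchange_def using s by auto
qed

lemma both_not_tagged_cross: "both x y \<Longrightarrow> \<not> same_arc t (x, y, True) \<Longrightarrow> \<not> same_arc t (x, y, False) \<Longrightarrow>
   (\<And>q. q \<in> D \<Longrightarrow> \<not> same_arc t q \<Longrightarrow> \<not> tagged_cross (a, b, f) q) \<Longrightarrow> \<not> cross a b x y"
proof -
  assume *: "both x y" "\<not> same_arc t (x, y, True)" "\<not> same_arc t (x, y, False)"
    "\<And>q. q \<in> D \<Longrightarrow> \<not> same_arc t q \<Longrightarrow> \<not> tagged_cross (a, b, f) q"
  have "\<not> same_arc t (x, y, \<not> f)" using *(2,3) by (cases f) auto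
  then have "\<not> tagged_cross (a, b, f) (x, y, \<not> f)" using * by (auto simp: both_def)
  then show ?thesis by (auto simp: tagged_cross_def)
qed

section \<open>The explicit flips, configuration by configuration\<close>

lemma not_same_arc: "y - x \<noteq> b - a \<Longrightarrow> \<not> same_arc (x, y, e) (a, b, f)"
  by (auto simp: same_arc_def)

lemma not_same_arc': "\<bar>a - x\<bar> < pi \<Longrightarrow> a \<noteq> x \<Longrightarrow> \<not> same_arc (x, y, e) (a, b, f)"
proof
  assume *: "\<bar>a - x\<bar> < pi" "a \<noteq> x" "same_arc (x, y, e) (a, b, f)"
  then obtain k :: int where k: "a = x + of_int k * pi" by (auto simp: same_arc_def)
  then have "\<bar>of_int k\<bar> * pi < 1 * pi" using * by (simp add: abs_mult)
  then have "k = 0" by (simp add: mult_less_cancel_right)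
  then show False using k * by simp
qed

text \<open>The flip in a quadrilateral \<open>a < c < d < b\<close> whose last side may be the loop at \<open>a\<close>.\<close>

lemma exchange_quadrilateral_left:
  assumes "(a, d, e) \<in> D" "a < c" "c < d" "d < b" "both a c" "both c d" "both d b" "both a b"
  shows "exchange (a, d, e) (c, b, True)"
proof (rule exchangeI)
  have rg: "b \<le> a + pi" using both_range assms by blast
  show "(a, d, e) \<in> D" "c < b" "b \<le> c + pi" using assms rg by auto
  show "tagged_cross (c, b, True) (a, d, e)" using assms rg by (auto simp: tagged_cross_def cross_def)
  fix x y f assume q: "(x, y, f) \<in> D" "tagged_cross (c, b, True) (x, y, f)"
  have "\<not> cross x y a c" "\<not> cross x y c d" "\<not> cross x y d b" "\<not> cross x y a b" "x < y"
    using assms both_noncrossing q range cross_commute by blast+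
  moreover have "cross x y c b" using q by (auto simp: tagged_cross_def cross_commute)
  ultimately have "x = a" "y = d" using cross_quadrilateral_left assms(2-4) by blast+
  then show "same_arc (a, d, e) (x, y, f)" using rg assms by (auto simp: same_arc_def intro: exI[of _ 0])
next
  have rg: "b \<le> a + pi" using both_range assms by blast
  fix x y f assume *: "x < y" "y \<le> x + pi" "tagged_cross (x, y, f) (a, d, e)"
    "\<And>q. q \<in> D \<Longrightarrow> \<not> same_arc (a, d, e) q \<Longrightarrow> \<not> tagged_cross (x, y, f) q"
  have "\<not> cross x y a c" "\<not> cross x y a b"
    by (rule both_not_tagged_cross[OF assms(5) _ _ *(4)] both_not_tagged_cross[OF assms(8) _ _ *(4)];
        use not_same_arc assms in auto)+
  moreover have "\<not> cross x y c d" "\<not> cross x y d b"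
    by (rule both_not_tagged_cross[OF assms(6) _ _ *(4)] both_not_tagged_cross[OF assms(7) _ _ *(4)];
        use not_same_arc' assms rg in auto)+
  moreover have "cross x y a d" using * by (auto simp: tagged_cross_def)
  ultimately have "x = c" "y = b" using cross_quadrilateral_right assms(2-4) *(1) by blast+
  then show "same_arc (x, y, f) (c, b, True)" using rg assms by (auto simp: same_arc_def intro: exI[of _ 0])
qed

lemma exchange_quadrilateral_right:
  assumes "(d, b, e) \<in> D" "a < d" "d < c" "c < b" "both a d" "both d c" "both c b" "both a b"
  shows "exchange (d, b, e) (a, c, True)"
proof (rule exchangeI)
  have rg: "b \<le> a + pi" using both_range assms by blast
  show "(d, b, e) \<in> D" "a < c" "c \<le> a + pi" using assms rg by auto
  show "tagged_cross (a, c, True) (d, b, e)" using assms rg by (auto simp: tagged_cross_def cross_def)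
  fix x y f assume q: "(x, y, f) \<in> D" "tagged_cross (a, c, True) (x, y, f)"
  have "\<not> cross x y a d" "\<not> cross x y d c" "\<not> cross x y c b" "\<not> cross x y a b" "x < y"
    using assms both_noncrossing q range cross_commute by blast+
  moreover have "cross x y a c" using q by (auto simp: tagged_cross_def cross_commute)
  ultimately have "x = d" "y = b" using cross_quadrilateral_right[of a d c b x y] assms(2-4) by blast+
  then show "same_arc (d, b, e) (x, y, f)" using rg assms by (auto simp: same_arc_def intro: exI[of _ 0])
next
  have rg: "b \<le> a + pi" using both_range assms by blast
  fix x y f assume *: "x < y" "y \<le> x + pi" "tagged_cross (x, y, f) (d, b, e)"
    "\<And>q. q \<in> D \<Longrightarrow> \<not> same_arc (d, b, e) q \<Longrightarrow> \<not> tagged_cross (x, y, f) q"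
  have "\<not> cross x y a d" "\<not> cross x y a b" "\<not> cross x y c b"
    by (rule both_not_tagged_cross[OF assms(5) _ _ *(4)] both_not_tagged_cross[OF assms(8) _ _ *(4)]
             both_not_tagged_cross[OF assms(7) _ _ *(4)];
        use not_same_arc' assms rg in auto)+
  moreover have "\<not> cross x y d c"
    by (rule both_not_tagged_cross[OF assms(6) _ _ *(4)]; use not_same_arc assms in auto)+
  moreover have "cross x y d b" using * by (auto simp: tagged_cross_def)
  ultimately have "x = a" "y = c" using cross_quadrilateral_left[of a d c b x y] assms(2-4) *(1) by blast+
  then show "same_arc (x, y, f) (a, c, True)" using rg assms by (auto simp: same_arc_def intro: exI[of _ 0])
qed

text \<open>An arc crosses the loop at \<open>w\<close> by passing over \<open>w\<close> or over
  \<open>w + pi\<close>; translation by \<open>- pi\<close> reduces the second case to the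
  first.\<close>

lemma tagged_cross_loop_cases:
  assumes "tagged_cross (w, w + pi, e) (u, v, f)" "u < v" "v \<le> u + pi"
  obtains "u < w" "w < v" "v < w + pi" | "u - pi < w" "w < v - pi" "v - pi < w + pi"
proof -
  have "w < u \<and> u < w + pi \<and> w + pi < v \<or> u < w \<and> w < v \<and> v < w + pi"
    using assms(1) by (simp add: tagged_cross_def cross_def)
  then show thesis using that assms(2,3) by (elim disjE) linarith+
qed

text \<open>\<open>exchangeI\<close> for a new loop, with the translation by \<open>- pi\<close>
  already applied: only arcs passing over the base point \<open>c\<close> itself have to be
  examined.\<close>

lemma exchangeI_loop:
  assumes t: "t \<in> D" and s: "tagged_cross (c, c + pi, e) t"
    and compat: "\<And>u v f. (u, v, f) \<in> D \<Longrightarrow> u < c \<Longrightarrow> c < v \<Longrightarrow> v < c + pi \<Longrightarrow> (v = u + pi \<Longrightarrow> f \<noteq> e)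
       \<Longrightarrow> same_arc t (u, v, f)"
    and unique: "\<And>x y f. x < y \<Longrightarrow> y \<le> x + pi \<Longrightarrow> tagged_cross (x, y, f) t \<Longrightarrow>
       (\<And>q. q \<in> D \<Longrightarrow> \<not> same_arc t q \<Longrightarrow> \<not> tagged_cross (x, y, f) q) \<Longrightarrow> same_arc (x, y, f) (c, c + pi, e)"
  shows "exchange t (c, c + pi, e)"
proof (rule exchangeI)
  fix u v f assume q: "(u, v, f) \<in> D" "tagged_cross (c, c + pi, e) (u, v, f)"
  then have sgn: "v = u + pi \<Longrightarrow> f \<noteq> e" by (auto simp: tagged_cross_def)
  have "(u - pi, v - pi, f) \<in> D" using shift[OF q(1), of "- 1"] by simp
  moreover have "same_arc (u - pi, v - pi, f) (u, v, f)"
    using same_arc_shift[of "u - pi" "v - pi" f 1] by simp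
  ultimately show "same_arc t (u, v, f)"
    using q(2) range[OF q(1)] compat[of u v f] compat[of "u - pi" "v - pi" f] q(1) sgn
    by (elim tagged_cross_loop_cases) (auto intro: same_arc_trans)
qed (use t s unique in auto)

lemma uniqueI_loop:
  assumes p: "x < y" "y \<le> x + pi" "tagged_cross (x, y, f) (z, z + pi, e)"
    and compat: "\<And>q. q \<in> D \<Longrightarrow> \<not> same_arc (z, z + pi, e) q \<Longrightarrow> \<not> tagged_cross (x, y, f) q"
    and unique: "\<And>x y. x < z \<Longrightarrow> z < y \<Longrightarrow> y < z + pi \<Longrightarrow> y \<le> x + pi \<Longrightarrow> (y = x + pi \<Longrightarrow> f \<noteq> e) \<Longrightarrow>
      (\<And>q. q \<in> D \<Longrightarrow> \<not> same_arc (z, z + pi, e) q \<Longrightarrow> \<not> tagged_cross (x, y, f) q) \<Longrightarrow> same_arc (x, y, f) s"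
  shows "same_arc (x, y, f) s"
proof -
  have sgn: "y = x + pi \<Longrightarrow> f \<noteq> e" using p by (auto simp: tagged_cross_def)
  have "same_arc (x, y, f) (x - pi, y - pi, f)"
    using same_arc_shift[of x y f "- 1"] by simp
  moreover have "\<not> tagged_cross (x - pi, y - pi, f) q" if "q \<in> D" "\<not> same_arc (z, z + pi, e) q" for q
    using compatible_shift[OF compat that, of "- 1"] by simp
  ultimately show ?thesis
    using p(3)[unfolded tagged_cross_commute[of "(x, y, f)"]] p(1,2) unique[of x y] unique[of "x - pi" "y - pi"] sgn compat
    by (elim tagged_cross_loop_cases) (auto intro: same_arc_trans)
qed

lemma loop_not_same_arc: "both x y \<Longrightarrow> y < x + pi \<Longrightarrow>
   (\<And>q. q \<in> D \<Longrightarrow> \<not> same_arc (z, z + pi, e) q \<Longrightarrow> \<not> tagged_cross (a, b, f) q) \<Longrightarrow> \<not> cross a b x y"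
  by (rule both_not_tagged_cross[where t = "(z, z + pi, e)"]) (assumption | rule not_same_arc, simp)+

text \<open>The arcs \<open>(z, c)\<close> and \<open>(c, z + pi)\<close> bound a digon round the
  puncture, filled by the two tagged loops at \<open>z\<close>. Once the tag \<open>s\<close> is
  removed there, the digon can only be completed by the loop at \<open>c\<close>, whose tag must
  agree with the remaining one.\<close>

lemma exchange_double:
  assumes "both z (z + pi)" "z < c" "c < z + pi" "both z c" "both c (z + pi)"
  shows "exchange (z, z + pi, s) (c, c + pi, \<not> s)"
proof (rule exchangeI_loop)
  show "(z, z + pi, s) \<in> D" using assms by (simp add: both_def)
  show "tagged_cross (c, c + pi, \<not> s) (z, z + pi, s)"
    using assms by (auto simp: tagged_cross_def cross_def)
  fix u v f assume q: "(u, v, f) \<in> D" "u < c" "c < v" "v < c + pi" "v = u + pi \<Longrightarrow> f \<noteq> (\<not> s)"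
  have "\<not> cross z c u v" "\<not> cross c (z + pi) u v" using assms q both_noncrossing by auto
  then have "u \<le> z" "z + pi \<le> v" using q(2,3) unfolding cross_def by linarith+
  then have "u = z" "v = z + pi" using range[OF q(1)] by auto
  then show "same_arc (z, z + pi, s) (u, v, f)" using q by (auto simp: same_arc_def)
next
  fix x y f assume p: "x < y" "y \<le> x + pi" "tagged_cross (x, y, f) (z, z + pi, s)"
    "\<And>q. q \<in> D \<Longrightarrow> \<not> same_arc (z, z + pi, s) q \<Longrightarrow> \<not> tagged_cross (x, y, f) q"
  then show "same_arc (x, y, f) (c, c + pi, \<not> s)"
  proof (rule uniqueI_loop)
    fix x y assume p: "x < z" "z < y" "y < z + pi" "y \<le> x + pi" "y = x + pi \<Longrightarrow> f \<noteq> s"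
      and compat: "\<And>q. q \<in> D \<Longrightarrow> \<not> same_arc (z, z + pi, s) q \<Longrightarrow> \<not> tagged_cross (x, y, f) q"
    have "\<not> cross x y z c" "\<not> cross x y c (z + pi)"
      using loop_not_same_arc[OF _ _ compat] assms by auto
    then have y: "y = c" using p assms unfolding cross_def by linarith
    have "\<not> tagged_cross (x, y, f) (z, z + pi, \<not> s)"
      using compat assms(1) by (auto simp: both_def same_arc_def)
    then have "y = x + pi" using p unfolding tagged_cross_def cross_def by auto
    then show "same_arc (x, y, f) (c, c + pi, \<not> s)"
      using y p by (auto simp: same_arc_def intro!: exI[of _ 1])
  qed
qed

text \<open>Beyond \<open>(x, y)\<close> lies the triangle formed with the spokes at
  \<open>x\<close> and \<open>y\<close>. The quadrilateral thus has the puncture as a corner, and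
  its other diagonal is the spoke at \<open>c\<close>.\<close>

lemma exchange_ear:
  assumes "(x, y, e) \<in> D" "y < x + pi" "x < c" "c < y" "both x c" "both c y"
    and spokes: "(x, x + pi, s) \<in> D" "(y, y + pi, s) \<in> D"
  shows "exchange (x, y, e) (c, c + pi, s)"
proof (rule exchangeI_loop)
  show "(x, y, e) \<in> D" by fact
  show "tagged_cross (c, c + pi, s) (x, y, e)"
    using assms by (auto simp: tagged_cross_def cross_def)
  fix u v f assume q: "(u, v, f) \<in> D" "u < c" "c < v" "v < c + pi" "v = u + pi \<Longrightarrow> f \<noteq> s"
  have "\<not> cross x c u v" "\<not> cross c y u v" using assms q both_noncrossing by auto
  then have le: "u \<le> x" "y \<le> v" using q(2,3) unfolding cross_def by linarith+
  have "\<not> tagged_cross (x, x + pi, s) (u, v, f)" "\<not> tagged_cross (y, y + pi, s) (u, v, f)"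
    using noncrossing spokes q(1) by blast+
  then have "u = x" "v = y" using le q range[OF q(1)] assms(2-4)
    unfolding tagged_cross_def cross_def by auto
  then show "same_arc (x, y, e) (u, v, f)" using assms(2) by (auto simp: same_arc_def intro: exI[of _ 0])
next
  fix u v f assume p: "u < v" "v \<le> u + pi" "tagged_cross (u, v, f) (x, y, e)"
    and compat: "\<And>q. q \<in> D \<Longrightarrow> \<not> same_arc (x, y, e) q \<Longrightarrow> \<not> tagged_cross (u, v, f) q"
  have "\<not> cross u v x c"
    by (rule both_not_tagged_cross[OF assms(5) _ _ compat]; use not_same_arc assms in auto)+
  moreover have "\<not> cross u v c y"
    by (rule both_not_tagged_cross[OF assms(6) _ _ compat]; use not_same_arc assms in auto)+
  moreover have "cross u v x y" using p by (simp add: tagged_cross_def)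
  ultimately have cases: "u < x \<and> v = c \<or> u = c \<and> y < v"
    using assms(3,4) unfolding cross_def by linarith
  have "\<not> tagged_cross (u, v, f) (x, x + pi, s)" "\<not> tagged_cross (u, v, f) (y, y + pi, s)"
    using compat spokes not_same_arc assms by auto
  then have "v = u + pi \<and> f = s" using cases p(1,2) assms(2-4)
    unfolding tagged_cross_def cross_def by auto
  then show "same_arc (u, v, f) (c, c + pi, s)"
    using cases by (auto simp: same_arc_def intro: exI[of _ 0] exI[of _ 1])
qed

text \<open>The reverse of \<open>exchange_ear\<close>: between the neighbouring spokes at
  \<open>z\<^sub>1\<close> and \<open>z\<^sub>2\<close>, the spoke at \<open>z\<close> is the
  diagonal of a quadrilateral that has a corner at the puncture.\<close>

lemma exchange_spoke:
  assumes "(z, z + pi, s) \<in> D" "z\<^sub>1 < z" "z < z\<^sub>2" "z\<^sub>2 < z\<^sub>1 + pi" "both z\<^sub>1 z" "both z z\<^sub>2"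
    and spokes: "(z\<^sub>1, z\<^sub>1 + pi, s) \<in> D" "(z\<^sub>2, z\<^sub>2 + pi, s) \<in> D"
  shows "exchange (z, z + pi, s) (z\<^sub>1, z\<^sub>2, True)"
proof (rule exchangeI)
  show "(z, z + pi, s) \<in> D" "z\<^sub>1 < z\<^sub>2" "z\<^sub>2 \<le> z\<^sub>1 + pi" using assms by auto
  show "tagged_cross (z\<^sub>1, z\<^sub>2, True) (z, z + pi, s)"
    using assms by (auto simp: tagged_cross_def cross_def)
  fix u v f assume q: "(u, v, f) \<in> D" "tagged_cross (z\<^sub>1, z\<^sub>2, True) (u, v, f)"
  have "\<not> cross z\<^sub>1 z u v" "\<not> cross z z\<^sub>2 u v" using assms q both_noncrossing by auto
  moreover have "cross z\<^sub>1 z\<^sub>2 u v" using q by (simp add: tagged_cross_def)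
  ultimately have cases: "u = z \<and> z\<^sub>2 < v \<or> u < z\<^sub>1 \<and> v = z"
    using assms(2,3) unfolding cross_def by linarith
  have "\<not> tagged_cross (z\<^sub>1, z\<^sub>1 + pi, s) (u, v, f)" "\<not> tagged_cross (z\<^sub>2, z\<^sub>2 + pi, s) (u, v, f)"
    using noncrossing spokes q(1) by blast+
  then have "v = u + pi \<and> f = s" using cases range[OF q(1)] assms(2-4)
    unfolding tagged_cross_def cross_def by auto
  then show "same_arc (z, z + pi, s) (u, v, f)"
    using cases by (auto simp: same_arc_def intro: exI[of _ 0] exI[of _ "- 1"])
next
  fix x y f assume p: "x < y" "y \<le> x + pi" "tagged_cross (x, y, f) (z, z + pi, s)"
    "\<And>q. q \<in> D \<Longrightarrow> \<not> same_arc (z, z + pi, s) q \<Longrightarrow> \<not> tagged_cross (x, y, f) q"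
  then show "same_arc (x, y, f) (z\<^sub>1, z\<^sub>2, True)"
  proof (rule uniqueI_loop)
    fix x y assume p: "x < z" "z < y" "y < z + pi" "y \<le> x + pi" "y = x + pi \<Longrightarrow> f \<noteq> s"
      and compat: "\<And>q. q \<in> D \<Longrightarrow> \<not> same_arc (z, z + pi, s) q \<Longrightarrow> \<not> tagged_cross (x, y, f) q"
    have "\<not> cross x y z\<^sub>1 z" "\<not> cross x y z z\<^sub>2"
      using loop_not_same_arc[OF _ _ compat] assms by auto
    then have le: "x \<le> z\<^sub>1" "z\<^sub>2 \<le> y" using p unfolding cross_def by linarith+
    have "\<not> tagged_cross (x, y, f) (z\<^sub>1, z\<^sub>1 + pi, s)" "\<not> tagged_cross (x, y, f) (z\<^sub>2, z\<^sub>2 + pi, s)"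
      using compat spokes not_same_arc' assms(2-4) by auto
    then have "x = z\<^sub>1" "y = z\<^sub>2" using p le assms(2-4)
      unfolding tagged_cross_def cross_def by auto
    then show "same_arc (x, y, f) (z\<^sub>1, z\<^sub>2, True)"
      using assms(4) by (auto simp: same_arc_def intro: exI[of _ 0])
  qed
qed

text \<open>The reverse of \<open>exchange_double\<close>, and the degenerate case
  \<open>z\<^sub>2 = z\<^sub>1 + pi\<close> of \<open>exchange_spoke\<close>: with a single other
  spoke the quadrilateral closes up to a digon, and the new arc is the second tag at
  \<open>z\<^sub>1\<close>.\<close>

lemma exchange_two_spokes:
  assumes "(z, z + pi, s) \<in> D" "z\<^sub>1 < z" "z < z\<^sub>1 + pi" "both z\<^sub>1 z" "both z (z\<^sub>1 + pi)"
    and spoke: "(z\<^sub>1, z\<^sub>1 + pi, s) \<in> D"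
  shows "exchange (z, z + pi, s) (z\<^sub>1, z\<^sub>1 + pi, \<not> s)"
proof (rule exchangeI_loop)
  show "(z, z + pi, s) \<in> D" by fact
  show "tagged_cross (z\<^sub>1, z\<^sub>1 + pi, \<not> s) (z, z + pi, s)"
    using assms by (auto simp: tagged_cross_def cross_def)
  fix u v f assume q: "(u, v, f) \<in> D" "u < z\<^sub>1" "z\<^sub>1 < v" "v < z\<^sub>1 + pi" "v = u + pi \<Longrightarrow> f \<noteq> (\<not> s)"
  have "\<not> cross z\<^sub>1 z u v" "\<not> cross z (z\<^sub>1 + pi) u v" using assms q both_noncrossing by auto
  then have v: "v = z" using q assms(2,3) range[OF q(1)] unfolding cross_def by linarith
  have "\<not> tagged_cross (z\<^sub>1, z\<^sub>1 + pi, s) (u, v, f)" using noncrossing spoke q(1) by blast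
  then have "v = u + pi \<and> f = s" using q unfolding tagged_cross_def cross_def by auto
  then show "same_arc (z, z + pi, s) (u, v, f)"
    using v by (auto simp: same_arc_def intro: exI[of _ "- 1"])
next
  fix x y f assume p: "x < y" "y \<le> x + pi" "tagged_cross (x, y, f) (z, z + pi, s)"
    "\<And>q. q \<in> D \<Longrightarrow> \<not> same_arc (z, z + pi, s) q \<Longrightarrow> \<not> tagged_cross (x, y, f) q"
  then show "same_arc (x, y, f) (z\<^sub>1, z\<^sub>1 + pi, \<not> s)"
  proof (rule uniqueI_loop)
    fix x y assume p: "x < z" "z < y" "y < z + pi" "y \<le> x + pi" "y = x + pi \<Longrightarrow> f \<noteq> s"
      and compat: "\<And>q. q \<in> D \<Longrightarrow> \<not> same_arc (z, z + pi, s) q \<Longrightarrow> \<not> tagged_cross (x, y, f) q"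
    have "\<not> cross x y z\<^sub>1 z" "\<not> cross x y z (z\<^sub>1 + pi)"
      using loop_not_same_arc[OF _ _ compat] assms by auto
    then have "x = z\<^sub>1" "y = z\<^sub>1 + pi" using p unfolding cross_def by linarith+
    then show "same_arc (x, y, f) (z\<^sub>1, z\<^sub>1 + pi, \<not> s)"
      using p by (auto simp: same_arc_def intro: exI[of _ 0])
  qed
qed

text \<open>A translate of the second loop overlaps the first, and overlapping loops with different
  tags cross unless they have the same base point.\<close>

lemma one_sign:
  assumes "(a, a + pi, e) \<in> D" "(b, b + pi, f) \<in> D" "e \<noteq> f"
  shows "both a (a + pi)"
proof -
  obtain k :: int where k: "a \<le> b + of_int k * pi" "b + of_int k * pi < a + pi"
    by (rule shift_into)
  define b' where "b' = b + of_int k * pi"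
  have b': "(b', b' + pi, f) \<in> D"
    using shift[OF assms(2), of k] by (simp add: b'_def algebra_simps)
  have "\<not> tagged_cross (a, a + pi, e) (b', b' + pi, f)" using noncrossing assms(1) b' by blast
  then have "b' = a" using k assms(3) unfolding b'_def[symmetric] tagged_cross_def cross_def by auto
  then show ?thesis using assms b' unfolding both_def all_bool_eq by (cases e; cases f) auto
qed

text \<open>An arc crossing the tagged loop at \<open>w\<close> is either a short arc with a
  translate passing over \<open>w\<close>, or a loop with the other tag. Both are excluded, so
  maximality applies.\<close>

lemma spokeI:
  assumes reg: "\<And>a b f. (a, b, f) \<in> D \<Longrightarrow> b < a + pi \<Longrightarrow> \<not> (a < w \<and> w < b)"
    and sgn: "\<And>a f. (a, a + pi, f) \<in> D \<Longrightarrow> f = s"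
  shows "(w, w + pi, s) \<in> D"
proof (rule maximal)
  fix q assume "q \<in> D"
  obtain u v f where q: "q = (u, v, f)" by (cases q)
  have uv: "(u, v, f) \<in> D" "u < v" "v \<le> u + pi" using \<open>q \<in> D\<close> q range by auto
  have shifted: "(u - pi, v - pi, f) \<in> D" using shift[OF uv(1), of "- 1"] by simp
  show "\<not> tagged_cross (w, w + pi, s) q"
  proof
    assume t: "tagged_cross (w, w + pi, s) q"
    then have "v \<noteq> u + pi" using sgn uv q by (auto simp: tagged_cross_def)
    then show False
      using t[unfolded q] uv reg[OF uv(1)] reg[OF shifted]
      by (elim tagged_cross_loop_cases) auto
  qed
qed auto

text \<open>An arc with one end strictly between \<open>w\<close> and \<open>z\<close> and the other
  outside crosses one of the two spokes, unless it is itself a spoke based between them.\<close>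

lemma both_between:
  assumes "(w, w + pi, s) \<in> D" "(z, z + pi, s) \<in> D" "w < z" "z < w + pi"
    and none: "\<And>a f. (a, a + pi, f) \<in> D \<Longrightarrow> w < a \<Longrightarrow> a < z \<Longrightarrow> False"
  shows "both w z"
proof (rule both_maximal)
  fix a b e assume ab: "(a, b, e) \<in> D"
  have rg: "a < b" "b \<le> a + pi" using range[OF ab] by auto
  have nt: "\<not> tagged_cross (w, w + pi, s) (a, b, e)" "\<not> tagged_cross (z, z + pi, s) (a, b, e)"
    using noncrossing assms(1,2) ab by blast+
  show "\<not> cross w z a b"
  proof
    assume "cross w z a b"
    then consider "w < a" "a < z" "z < b" | "a < w" "w < b" "b < z" by (auto simp: cross_def)
    then show False
    proof cases
      case 1
      then have "b = a + pi" using nt(2) rg by (auto simp: tagged_cross_def cross_def)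
      then show False using none 1 ab by auto
    next
      case 2
      then have "b = a + pi" using nt(1) rg assms(4) by (auto simp: tagged_cross_def cross_def)
      then have "(b, b + pi, e) \<in> D" using shift[OF ab, of 1] by simp
      then show False using none 2 by auto
    qed
  qed
qed (use assms in auto)

text \<open>The triangle inside \<open>(x, y)\<close> is given by its apex. The outer one belongs to
  the shortest side enclosing \<open>(x, y)\<close>, if there is any; otherwise nothing separates
  \<open>(x, y)\<close> from the puncture, and the spokes at its two ends complete the
  triangle.\<close>

lemma exchange_regular:
  assumes t: "(x, y, e) \<in> D" and reg: "y < x + pi"
  shows "\<exists>s. exchange (x, y, e) s"
proof -
  have xy: "x < y" "both x y" using range[OF t] bothI[OF t reg] by auto
  obtain c where c: "x < c" "c < y" "both x c" "both c y" using apex[OF xy(2)] by blast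
  define P where "P = (\<lambda>a b. a \<le> x \<and> y \<le> b \<and> (a, b) \<noteq> (x, y) \<and> b \<le> a + pi \<and> both a b)"
  show ?thesis
  proof (cases "\<exists>a b. P a b")
    case True
    then obtain a\<^sub>0 b\<^sub>0 where ab0: "P a\<^sub>0 b\<^sub>0" by blast
    have "(a\<^sub>0, b\<^sub>0, True) \<in> D" using ab0 by (auto simp: P_def both_def)
    have "\<bar>a\<bar> \<le> \<bar>x\<bar> + \<bar>y\<bar> + pi \<and> y - x \<le> b - a" if "P a b" for a b
      using that xy(1) unfolding P_def by linarith
    then obtain a b where "P a b" and short: "\<And>a' b' e'. (a', b', e') \<in> D \<Longrightarrow> P a' b' \<Longrightarrow> b - a \<le> b' - a'"
      using shortest_inside[of a\<^sub>0 b\<^sub>0 True P, OF \<open>(a\<^sub>0, b\<^sub>0, True) \<in> D\<close> ab0] xy(1) by (metis diff_gt_0_iff_gt)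
    then have ab: "a \<le> x" "y \<le> b" "(a, b) \<noteq> (x, y)" "b \<le> a + pi" "both a b" by (auto simp: P_def)
    obtain d where d: "a < d" "d < b" "both a d" "both d b" using apex[OF ab(5)] by blast
    \<comment> \<open>By minimality neither side at the apex \<open>d\<close> of
      \<open>(a, b)\<close> properly encloses \<open>(x, y)\<close>; as they do not cross it either,
      one of them is \<open>(x, y)\<close> itself.\<close>
    have "\<not> P a d" "\<not> P d b"
      using short[of a d True] short[of d b True] d by (auto simp: both_def)
    moreover have "\<not> cross x y a d" "\<not> cross x y d b"
      using d both_noncrossing[OF xy(2)] unfolding both_def by blast+
    ultimately have "x = a \<and> y = d \<or> x = d \<and> y = b"
      using ab d xy(1) unfolding P_def cross_def by auto
    then show ?thesis
      using exchange_quadrilateral_left[of a d e c b] exchange_quadrilateral_right[of d b e a c] t c d ab by auto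
  next
    case False
    \<comment> \<open>A doubly tagged loop, translated so that its base point lies in
      \<open>(x - pi, x]\<close>, would enclose \<open>(x, y)\<close>.\<close>
    have nodouble: "\<not> both z (z + pi)" for z
    proof
      assume z: "both z (z + pi)"
      obtain k :: int where k: "- x \<le> - z + of_int k * pi" "- z + of_int k * pi < - x + pi"
        by (rule shift_into)
      define z' where "z' = z - of_int k * pi"
      have z': "both z' (z' + pi)" using both_shift[OF z, of "- k"] by (simp add: z'_def algebra_simps)
      have "\<not> cross z' (z' + pi) x y" by (rule both_noncrossing[OF z' t])
      moreover have "z' \<le> x" "x < z' + pi" using k by (auto simp: z'_def)
      ultimately have "P z' (z' + pi)" using z' reg unfolding P_def cross_def by auto
      then show False using False by blast
    qed
    have "\<exists>s. \<forall>a f. (a, a + pi, f) \<in> D \<longrightarrow> f = s"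
      using one_sign nodouble by metis
    then obtain s where s: "\<And>a f. (a, a + pi, f) \<in> D \<Longrightarrow> f = s" by blast
    have cover: "\<not> (a < x \<and> x < b)" "\<not> (a < y \<and> y < b)" if "(a, b, f) \<in> D" "b < a + pi" for a b f
    proof -
      have "\<not> P a b" using False by blast
      moreover have "both a b" "\<not> cross x y a b"
        using bothI[OF that] both_noncrossing[OF xy(2) that(1)] by auto
      ultimately show "\<not> (a < x \<and> x < b)" "\<not> (a < y \<and> y < b)"
        using xy(1) that unfolding P_def cross_def by auto
    qed
    have "(x, x + pi, s) \<in> D" "(y, y + pi, s) \<in> D" using cover s by (intro spokeI; blast)+
    then show ?thesis using exchange_ear[OF t reg] c by blast
  qed
qed

text \<open>If both tags are present at \<open>z\<close>, the apex gives the digon of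
  \<open>exchange_double\<close>. Otherwise all loops carry the same tag, and the nearest ones on
  either side of \<open>z\<close> decide between the two spoke configurations.\<close>

lemma exchange_singular:
  assumes t: "(z, z + pi, s) \<in> D"
  shows "\<exists>s'. exchange (z, z + pi, s) s'"
proof (cases "both z (z + pi)")
  case True
  then show ?thesis using apex[OF True] exchange_double by metis
next
  case False
  then have sgn: "f = s" if "(a, a + pi, f) \<in> D" for a f
    using one_sign[OF t that] by blast
  \<comment> \<open>The other spokes, one base point from each translation class, in the window
    \<open>(z - pi, z)\<close>. The maximum is the left neighbour of \<open>z\<close>, the minimum
    plus \<open>pi\<close> the right one.\<close>
  define F where "F = {a. z - pi < a \<and> a < z \<and> (a, a + pi, s) \<in> D}"
  have "finite ((\<lambda>(a, b). a) ` {(a, b). \<bar>a\<bar> \<le> \<bar>z\<bar> + pi \<and> pi \<le> b - a \<and> (\<exists>e. (a, b, e) \<in> D)})"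
    by (intro finite_imageI finite_longer) simp
  moreover have "F \<subseteq> (\<lambda>(a, b). a) ` {(a, b). \<bar>a\<bar> \<le> \<bar>z\<bar> + pi \<and> pi \<le> b - a \<and> (\<exists>e. (a, b, e) \<in> D)}"
  proof
    fix a assume "a \<in> F"
    then have "(a, a + pi) \<in> {(a, b). \<bar>a\<bar> \<le> \<bar>z\<bar> + pi \<and> pi \<le> b - a \<and> (\<exists>e. (a, b, e) \<in> D)}"
      by (auto simp: F_def)
    then show "a \<in> (\<lambda>(a, b). a) ` {(a, b). \<bar>a\<bar> \<le> \<bar>z\<bar> + pi \<and> pi \<le> b - a \<and> (\<exists>e. (a, b, e) \<in> D)}"
      by force
  qed
  ultimately have fin: "finite F" by (rule finite_subset[rotated])
  \<comment> \<open>The loop at \<open>z\<close> with the other tag is missing, so some arc crosses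
    it without crossing the loop with tag \<open>s\<close>; only a loop with another base point can
    do that.\<close>
  have ne: "F \<noteq> {}"
  proof -
    have "(z, z + pi, \<not> s) \<notin> D" using sgn[of z "\<not> s"] by auto
    then obtain q where q: "q \<in> D" "tagged_cross (z, z + pi, \<not> s) q"
      using maximal[of z "z + pi" "\<not> s"] by auto
    obtain u v f where q_eq: "q = (u, v, f)" by (cases q)
    have uv: "(u, v, f) \<in> D" "u < v" "v \<le> u + pi" using q q_eq range by auto
    have "\<not> tagged_cross (z, z + pi, s) q" using noncrossing t q by blast
    then have v: "v = u + pi" using q q_eq by (auto simp: tagged_cross_def)
    then have "f = s" using sgn uv by blast
    have "(u - pi, u, f) \<in> D" using shift[OF uv(1), of "- 1"] v by simp
    then have "u \<in> F \<or> u - pi \<in> F" using q(2)[unfolded q_eq] uv v \<open>f = s\<close>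
      by (elim tagged_cross_loop_cases) (auto simp: F_def)
    then show ?thesis by blast
  qed
  define z\<^sub>1 where "z\<^sub>1 = Max F"
  define z\<^sub>2 where "z\<^sub>2 = Min F + pi"
  have "z\<^sub>1 \<in> F" "z\<^sub>2 - pi \<in> F" using fin ne by (auto simp: z\<^sub>1_def z\<^sub>2_def)
  then have z: "z - pi < z\<^sub>1" "z\<^sub>1 < z" "z < z\<^sub>2" "z\<^sub>2 < z + pi" "(z\<^sub>1, z\<^sub>1 + pi, s) \<in> D" "(z\<^sub>2 - pi, z\<^sub>2, s) \<in> D"
    by (auto simp: F_def)
  have z2: "(z\<^sub>2, z\<^sub>2 + pi, s) \<in> D" using shift[OF z(6), of 1] by simp
  have mono: "z\<^sub>2 - pi \<le> a" "a \<le> z\<^sub>1" if "a \<in> F" for a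
    using that fin by (auto simp: z\<^sub>1_def z\<^sub>2_def)
  have "both z\<^sub>1 z"
  proof (rule both_between)
    fix a f assume "(a, a + pi, f) \<in> D" "z\<^sub>1 < a" "a < z"
    then have "a \<in> F" using sgn z by (auto simp: F_def)
    then show False using mono \<open>z\<^sub>1 < a\<close> by force
  qed (use z t in auto)
  moreover have "both z z\<^sub>2"
  proof (rule both_between)
    fix a f assume *: "(a, a + pi, f) \<in> D" "z < a" "a < z\<^sub>2"
    then have "(a - pi, a, f) \<in> D" using shift[OF *(1), of "- 1"] by simp
    then have "a - pi \<in> F" using sgn[OF *(1)] * z by (auto simp: F_def)
    then show False using mono *(3) by force
  qed (use z z2 t in auto)
  moreover have "z\<^sub>2 \<le> z\<^sub>1 + pi" using mono[OF \<open>z\<^sub>1 \<in> F\<close>] by simp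
  ultimately show ?thesis
    using exchange_spoke[OF t z(2,3) _ _ _ z(5) z2] exchange_two_spokes[OF t z(2) _ _ _ z(5)] z(3)
    by (cases "z\<^sub>2 = z\<^sub>1 + pi") auto
qed

theorem exchange_exists: "t \<in> D \<Longrightarrow> \<exists>s. exchange t s"
proof (cases t)
  fix x y e assume "t \<in> D" "t = (x, y, e)"
  then show ?thesis
    using exchange_regular[of x y e] exchange_singular[of x e] range[of x y e]
    by (cases "y < x + pi") auto
qed

end

section \<open>Arcs of names\<close>

text \<open>\<open>M(x, y)\<close> is \<open>E(x, y + pi)\<close>, which \<open>h\<close> sends to
  \<open>[x, y + pi]\<close> if \<open>y < x\<close>, and to \<open>[y + pi, x + 2 pi]\<close>, a
  translate of \<open>[y, x + pi]\<close>, if \<open>x < y\<close>. Maximum and minimum cover both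
  cases.\<close>

fun arc :: "name \<Rightarrow> point" where
  "arc (Regular x y) = (max x y, min x y + pi, True)"
| "arc (Singular e x) = (x, x + pi, e)"

fun shift_point :: "int \<Rightarrow> point \<Rightarrow> point" where
  "shift_point k (x, y, e) = (x + of_int k * pi, y + of_int k * pi, e)"

definition arcs_cross :: "point \<Rightarrow> point \<Rightarrow> bool" where
  "arcs_cross p q \<longleftrightarrow> (\<exists>k. tagged_cross p (shift_point k q))"

lemma shift_point_add: "shift_point k (shift_point l p) = shift_point (k + l) p"
  by (cases p) (simp add: algebra_simps)

lemma shift_point_0 [simp]: "shift_point 0 p = p"
  by (cases p) simp

lemma tagged_cross_shift: "tagged_cross (shift_point k p) (shift_point k q) \<longleftrightarrow> tagged_cross p q"
  by (cases p; cases q) (auto simp: tagged_cross_def)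

lemma arcs_cross_commute: "arcs_cross p q \<longleftrightarrow> arcs_cross q p"
proof -
  have "arcs_cross q p" if pq: "arcs_cross p q" for p q
  proof -
    obtain k where "tagged_cross p (shift_point k q)" using pq unfolding arcs_cross_def by blast
    then have "tagged_cross (shift_point (- k) p) (shift_point (- k) (shift_point k q))" unfolding tagged_cross_shift .
    then have "tagged_cross q (shift_point (- k) p)" by (simp add: shift_point_add tagged_cross_commute)
    then show ?thesis unfolding arcs_cross_def by blast
  qed
  then show ?thesis by blast
qed

lemma same_arc_regular:
  "same_arc (arc (Regular x y)) (arc (Regular x' y')) \<longleftrightarrow>
    (\<exists>k::int. (x' = x + of_int k * pi \<and> y' = y + of_int k * pi) \<or> (x' = y + of_int k * pi \<and> y' = x + of_int k * pi))"
proof -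
  have "(max x' y' = max x y + c \<and> min x' y' + pi = min x y + pi + c) \<longleftrightarrow>
    (x' = x + c \<and> y' = y + c) \<or> (x' = y + c \<and> y' = x + c)" for c :: real
    by (auto simp: max_def min_def)
  then show ?thesis by (simp add: same_arc_def)
qed

lemma arc_range: "is_name n \<Longrightarrow> arc n = (x, y, e) \<Longrightarrow> x < y \<and> y \<le> x + pi"
  by (cases n) (auto simp: max_def min_def split: if_splits)

lemma arc_surj: 
  assumes "x < y" "y \<le> x + pi"
  obtains n where "is_name n" "same_arc (arc n) (x, y, e)"
proof (cases "y = x + pi")
  case True
  then show ?thesis using that[of "Singular e x"] by (simp add: same_arc_refl)
next
  case False
  have "same_arc (arc (Regular x (y - pi))) (x, y, e)"
    using assms False by (auto simp: same_arc_def intro!: exI[of _ 0])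
  then show ?thesis using that[of "Regular x (y - pi)"] assms False by auto
qed

subsection \<open>Isomorphism and arcs\<close>

lemma proper_name_pi: "proper_name pi n \<longleftrightarrow> is_name n"
  by (cases n) auto

context F_structure
begin

text \<open>A translation by \<open>k\<close> times \<open>pi\<close> is a power of
  \<open>sigma\<close> up to interchanging coordinates. Depending on whether the parity of
  \<open>k\<close> matches the interchange, the summands correspond in order or crosswise, so the
  isomorphism is the identity matrix or \<open>swap2\<close>.\<close>

lemma same_arc_isomorphic:
  assumes n: "proper_name b n" "proper_name b m" and arc: "same_arc (arc n) (arc m)"
  shows "isomorphic CC (obj_of n) (obj_of m)"
proof -
  note i = proper_inner[OF n(1)] proper_inner[OF n(2)]
  show ?thesis
  proof (cases n; cases m)
    fix x y x' y' assume nm: "n = Regular x y" "m = Regular x' y'"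
    let ?X = "[M_orb x y, M_orb (x + pi) (y + pi)]" and ?Y = "[M_orb x' y', M_orb (x' + pi) (y' + pi)]"
    obtain k :: int where "(x' = x + of_int k * pi \<and> y' = y + of_int k * pi) \<or> (x' = y + of_int k * pi \<and> y' = x + of_int k * pi)"
      using arc unfolding nm same_arc_regular by blast
    then have "(same_coords (M_orb x' y') (M_orb x y) \<and> same_coords (M_orb (x' + pi) (y' + pi)) (M_orb (x + pi) (y + pi))) \<or>
       (same_coords (M_orb x' y') (M_orb (x + pi) (y + pi)) \<and> same_coords (M_orb (x' + pi) (y' + pi)) (M_orb x y))"
    proof -
      assume *: "(x' = x + of_int k * pi \<and> y' = y + of_int k * pi) \<or> (x' = y + of_int k * pi \<and> y' = x + of_int k * pi)"
      have "same_coords (M_orb x' y') (M_orb x y) \<and> same_coords (M_orb (x' + pi) (y' + pi)) (M_orb (x + pi) (y + pi))"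
        if "(x' = x + of_int k * pi \<and> y' = y + of_int k * pi) \<longleftrightarrow> even k"
        unfolding same_coords_M_orb_iff using * that by (intro conjI exI[of _ k]) auto
      moreover have "same_coords (M_orb x' y') (M_orb (x + pi) (y + pi)) \<and> same_coords (M_orb (x' + pi) (y' + pi)) (M_orb x y)"
        if "(x' = x + of_int k * pi \<and> y' = y + of_int k * pi) \<longleftrightarrow> odd k"
        unfolding same_coords_M_orb_iff
      proof (intro conjI)
        show "\<exists>i::int. if even i then x' = x + pi + of_int i * pi \<and> y' = y + pi + of_int i * pi
           else x' = y + pi + of_int i * pi \<and> y' = x + pi + of_int i * pi"
          using * that by (intro exI[of _ "k - 1"]) (auto simp: algebra_simps)
        show "\<exists>i::int. if even i then x' + pi = x + of_int i * pi \<and> y' + pi = y + of_int i * pi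
           else x' + pi = y + of_int i * pi \<and> y' + pi = x + of_int i * pi"
          using * that by (intro exI[of _ "k + 1"]) (auto simp: algebra_simps)
      qed
      ultimately show ?thesis by blast
    qed
    then show ?thesis
    proof
      assume "same_coords (M_orb x' y') (M_orb x y) \<and> same_coords (M_orb (x' + pi) (y' + pi)) (M_orb (x + pi) (y + pi))"
      then have "rigid ?X ?Y (1\<^sub>m 2 :: 'r mat)" "rigid ?Y ?X (1\<^sub>m 2 :: 'r mat)"
        by (auto simp: rigid_def less_Suc_eq dest: same_coords_sym)
      then show ?thesis
        by (intro rigid_isomorphic[OF i, where f = "1\<^sub>m 2" and g = "1\<^sub>m 2"]) (simp_all add: nm obj_list_def numeral_2_eq_2)
    next
      assume "same_coords (M_orb x' y') (M_orb (x + pi) (y + pi)) \<and> same_coords (M_orb (x' + pi) (y' + pi)) (M_orb x y)"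
      then have "rigid ?X ?Y (swap2 :: 'r mat)" "rigid ?Y ?X (swap2 :: 'r mat)"
        by (auto simp: rigid_def less_Suc_eq swap2_def dest: same_coords_sym)
      moreover have "swap2 * swap2 = (1\<^sub>m 2 :: 'r mat)" using xi_square[of n] by (simp add: nm swap2_def numeral_2_eq_2)
      ultimately show ?thesis
        by (intro rigid_isomorphic[OF i, where f = swap2 and g = swap2])
           (simp_all add: nm obj_list_def numeral_2_eq_2, simp_all add: swap2_def numeral_2_eq_2)
    qed
  next
    fix e x e' x' assume nm: "n = Singular e x" "m = Singular e' x'"
    then obtain k :: int where k: "x' = x + of_int k * pi" "e = e'" using arc by (auto simp: same_arc_def)
    then have "same_coords (M_orb x' x') (M_orb x x)"
      unfolding same_coords_M_orb_iff by (intro exI[of _ k]) auto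
    then have "rigid [M_orb x x] [M_orb x' x'] (1\<^sub>m 1 :: 'r mat)" "rigid [M_orb x' x'] [M_orb x x] (1\<^sub>m 1 :: 'r mat)"
      by (auto simp: rigid_def dest: same_coords_sym)
    then show ?thesis
      using k by (intro rigid_isomorphic[OF i, where f = "1\<^sub>m 1" and g = "1\<^sub>m 1"]) (simp_all add: nm obj_list_def)
  qed (use arc n in \<open>auto simp: same_arc_def max_def min_def split: if_splits\<close>)
qed

lemma isomorphic_same_arc:
  assumes n: "proper_name b n" "proper_name b m" and iso: "isomorphic CC (obj_of n) (obj_of m)"
  shows "same_arc (arc n) (arc m)"
proof -
  obtain B where B: "B \<in> set (obj_list (coords m))" "same_coords (obj_list (coords n) ! 0) B" and s: "signs_agree n m"
    using isomorphic_same_coords[OF n iso] by blast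
  have same: "\<exists>k::int. (x' = x + of_int k * pi \<and> y' = y + of_int k * pi) \<or> (x' = y + of_int k * pi \<and> y' = x + of_int k * pi)"
    if sc: "same_coords (M_orb x y) (M_orb x' y')" for x y x' y'
  proof -
    obtain i :: int where "if even i then x = x' + of_int i * pi \<and> y = y' + of_int i * pi
            else x = y' + of_int i * pi \<and> y = x' + of_int i * pi" using sc unfolding same_coords_M_orb_iff by blast
    then show ?thesis by (intro exI[of _ "- i"]) (auto split: if_splits)
  qed
  have same': "\<exists>k::int. (x' = x + of_int k * pi \<and> y' = y + of_int k * pi) \<or> (x' = y + of_int k * pi \<and> y' = x + of_int k * pi)"
    if sc: "same_coords (M_orb x y) (M_orb (x' + pi) (y' + pi))" for x y x' y'
  proof -
    obtain k :: int where "(x' + pi = x + of_int k * pi \<and> y' + pi = y + of_int k * pi) \<or> (x' + pi = y + of_int k * pi \<and> y' + pi = x + of_int k * pi)"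
      using same[OF sc] by blast
    then show ?thesis by (intro exI[of _ "k - 1"]) (auto simp: algebra_simps)
  qed
  show ?thesis
  proof (cases n; cases m)
    fix x y x' y' assume nm: "n = Regular x y" "m = Regular x' y'"
    then have "same_coords (M_orb x y) (M_orb x' y') \<or> same_coords (M_orb x y) (M_orb (x' + pi) (y' + pi))"
      using B by (auto simp: obj_list_def)
    then show ?thesis unfolding nm same_arc_regular using same same' by blast
  next
    fix x y e z assume nm: "n = Regular x y" "m = Singular e z"
    then show ?thesis using B n same[of x y z z] by (auto simp: obj_list_def)
  next
    fix x y e z assume nm: "n = Singular e z" "m = Regular x y"
    then show ?thesis using B n same[of z z x y] same'[of z z x y] by (auto simp: obj_list_def)
  next
    fix e z e' z' assume nm: "n = Singular e z" "m = Singular e' z'"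
    then show ?thesis using B n s same[of z z z' z'] by (auto simp: obj_list_def same_arc_def)
  qed
qed

end

subsection \<open>Extensions and crossings\<close>

lemma ends_shift: "ends (shift_name b n) = (snd (ends n) + b, fst (ends n) + b)"
  by (cases n) simp_all

text \<open>The limit of the condition \<^term>\<open>linked b (x, y) (y' + b, x' + b)\<close> for \<open>b \<rightarrow> \<pi>\<close>, up to translation.\<close>

definition interlaced :: "real \<Rightarrow> real \<Rightarrow> real \<Rightarrow> real \<Rightarrow> bool" where
  "interlaced x y x' y' \<longleftrightarrow> (x - pi < y' \<and> y' < y \<and> y - pi < x' \<and> x' < x) \<or> (x - pi < x' \<and> x' < y \<and> y - pi < y' \<and> y' < x)"

lemma interlaced_cross:
  assumes "\<bar>x - y\<bar> < pi" "\<bar>x' - y'\<bar> < pi"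
  shows "interlaced x y x' y' \<Longrightarrow> cross (max x y) (min x y + pi) (max x' y') (min x' y' + pi) \<or>
      cross (max x y) (min x y + pi) (max x' y' + pi) (min x' y' + pi + pi)"
    and "cross (max x y) (min x y + pi) (max x' y') (min x' y' + pi) \<Longrightarrow> interlaced x y x' y' \<or> interlaced x y (x' - pi) (y' - pi)"
  using assms unfolding interlaced_def cross_def max_def min_def by (smt (verit) pi_gt_zero)+

lemma interlaced_iff_cross:
  assumes "\<bar>x - y\<bar> < pi" "\<bar>x' - y'\<bar> < pi"
  shows "(\<exists>k::int. interlaced x y (x' + of_int k * pi) (y' + of_int k * pi)) \<longleftrightarrow>
    (\<exists>k::int. cross (max x y) (min x y + pi) (max x' y' + of_int k * pi) (min x' y' + pi + of_int k * pi))"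
proof -
  have mm: "max (x' + c) (y' + c) = max x' y' + c" "min (x' + c) (y' + c) = min x' y' + c" for c
    by (auto simp: max_def min_def)
  have a: "\<bar>(x' + c) - (y' + c)\<bar> < pi" for c using assms(2) by simp
  show ?thesis
  proof (intro iffI; elim exE)
    fix k :: int assume "interlaced x y (x' + of_int k * pi) (y' + of_int k * pi)"
    from interlaced_cross(1)[OF assms(1) a this] consider
      "cross (max x y) (min x y + pi) (max x' y' + of_int k * pi) (min x' y' + pi + of_int k * pi)"
      | "cross (max x y) (min x y + pi) (max x' y' + of_int (k + 1) * pi) (min x' y' + pi + of_int (k + 1) * pi)"
      by (auto simp: mm algebra_simps)
    then show "\<exists>k::int. cross (max x y) (min x y + pi) (max x' y' + of_int k * pi) (min x' y' + pi + of_int k * pi)"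
      by cases blast+
  next
    fix k :: int assume "cross (max x y) (min x y + pi) (max x' y' + of_int k * pi) (min x' y' + pi + of_int k * pi)"
    then have "cross (max x y) (min x y + pi) (max (x' + of_int k * pi) (y' + of_int k * pi)) (min (x' + of_int k * pi) (y' + of_int k * pi) + pi)"
      by (simp add: mm algebra_simps)
    from interlaced_cross(2)[OF assms(1) a this] consider
      "interlaced x y (x' + of_int k * pi) (y' + of_int k * pi)" | "interlaced x y (x' + of_int (k - 1) * pi) (y' + of_int (k - 1) * pi)"
      by (auto simp: algebra_simps)
    then show "\<exists>k::int. interlaced x y (x' + of_int k * pi) (y' + of_int k * pi)" by cases blast+
  qed
qed

lemma linked_shift:
  assumes "b < pi" "linked b (x, y) (y' + b, x' + b)"
  shows "\<exists>k::int. interlaced x y (x' + of_int k * pi) (y' + of_int k * pi)"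
proof -
  obtain k :: int where "near2 b x y (y' + b + of_int k * pi) (x' + b + of_int k * pi) \<or> near2 b x y (x' + b + of_int k * pi) (y' + b + of_int k * pi)"
    using assms(2) by (auto simp: linked_def)
  then have "interlaced x y (x' + of_int k * pi) (y' + of_int k * pi)"
    using assms(1) unfolding near2_def interlaced_def by linarith
  then show ?thesis ..
qed

text \<open>Of the inequalities in \<open>interlaced\<close> only the lower bounds contain
  \<open>pi\<close>; being strict, they survive when \<open>pi\<close> is replaced by a nearby
  \<open>b\<close>.\<close>

lemma eventually_linked:
  assumes "interlaced x y (x' + of_int k * pi) (y' + of_int k * pi)"
  shows "\<forall>\<^sub>F b in at_left pi. linked b (x, y) (y' + b, x' + b)"
proof -
  define p where "p = x' + of_int k * pi"
  define q where "q = y' + of_int k * pi"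
  have near: "\<exists>b0 < pi. \<forall>b > b0. x - b \<le> p \<and> y - b \<le> q" if "x - pi < p" "y - pi < q" for p q
    by (rule exI[of _ "max (x - p) (y - q)"]) (use that in auto)
  have "\<exists>b0 < pi. \<forall>b > b0. linked b (x, y) (y' + b, x' + b)"
  proof (cases "x - pi < q \<and> q < y \<and> y - pi < p \<and> p < x")
    case True
    then obtain b0 where "b0 < pi" "\<And>b. b > b0 \<Longrightarrow> x - b \<le> q \<and> y - b \<le> p" using near[of q p] by auto
    then show ?thesis
      using True by (intro exI[of _ b0]) (auto intro!: linkedI[of _ _ _ _ k] simp: near2_def p_def q_def algebra_simps)
  next
    case False
    then have *: "x - pi < p \<and> p < y \<and> y - pi < q \<and> q < x" using assms by (auto simp: interlaced_def p_def q_def)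
    then obtain b0 where "b0 < pi" "\<And>b. b > b0 \<Longrightarrow> x - b \<le> p \<and> y - b \<le> q" using near[of p q] by auto
    then show ?thesis
      using * by (intro exI[of _ b0]) (auto intro!: linkedI[of _ _ _ _ k] simp: near2_def p_def q_def algebra_simps)
  qed
  then show ?thesis unfolding eventually_at_left_field by auto
qed

text \<open>The shift reverses the sign of a singular name, so agreement of signs after the shift is
  the difference of tags demanded by \<open>tagged_cross\<close>.\<close>

lemma arcs_cross_names:
  assumes "is_name n" "is_name m"
  shows "arcs_cross (arc n) (arc m) \<longleftrightarrow>
    (\<exists>k::int. interlaced (fst (ends n)) (snd (ends n)) (fst (ends m) + of_int k * pi) (snd (ends m) + of_int k * pi)) \<and>
    signs_agree n (shift_name b m)"
proof -
  have lt: "\<bar>fst (ends n) - snd (ends n)\<bar> < pi" "\<bar>fst (ends m) - snd (ends m)\<bar> < pi"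
    using assms by (cases n; cases m; simp)+
  have "tagged_cross (arc n) (shift_point k (arc m)) \<longleftrightarrow>
      cross (max (fst (ends n)) (snd (ends n))) (min (fst (ends n)) (snd (ends n)) + pi)
        (max (fst (ends m)) (snd (ends m)) + of_int k * pi) (min (fst (ends m)) (snd (ends m)) + pi + of_int k * pi) \<and>
      signs_agree n (shift_name b m)" for k
    using assms by (cases n; cases m) (auto simp: tagged_cross_def max_def min_def)
  then show ?thesis unfolding arcs_cross_def interlaced_iff_cross[OF lt] by auto
qed

lemma is_name_inner: assumes "is_name n" shows "\<forall>\<^sub>F b in at_left pi. inner_name b n"
proof -
  obtain a where "a < pi" "\<And>b. b > a \<Longrightarrow> inner_name b n"
    using assms by (cases n) (auto simp: dense intro: that pi_gt_zero)
  then show ?thesis unfolding eventually_at_left_field by auto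
qed

locale F_family = dvr u for u :: "'r::idom" +
  fixes E :: "'r exacts"
  assumes exact_family: "0 < b \<Longrightarrow> b \<le> pi \<Longrightarrow> F_exact_structure u b (E b)"
begin

lemma F_structure_at: "0 < b \<Longrightarrow> b \<le> pi \<Longrightarrow> F_structure u b (E b)"
  by unfold_locales (use exact_family in auto)

text \<open>Linked objects interlace for every \<open>b < pi\<close>, and interlaced ones are linked
  for \<open>b\<close> near \<open>pi\<close>. So names with non-crossing arcs are compatible at all
  \<open>b\<close> at which both are inner, and those with crossing arcs are incompatible for all
  \<open>b\<close> near \<open>pi\<close>.\<close>

lemma compatible_names:
  assumes n: "is_name n" "is_name m"
  shows "(\<forall>\<^sub>F b in at_left pi. compatible_below u E b (obj_of n) (obj_of m)) \<longleftrightarrow> \<not> arcs_cross (arc n) (arc m)"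
proof -
  let ?linked = "\<lambda>b n m. linked b (ends n) (snd (ends m) + b, fst (ends m) + b)"
  have good: "\<forall>\<^sub>F b in at_left pi. 0 < b \<and> b < pi \<and> inner_name b n \<and> inner_name b m"
    using is_name_inner[OF n(1)] is_name_inner[OF n(2)] eventually_at_left_real[OF pi_gt_zero]
    by eventually_elim auto
  have iff: "compatible_below u E b (obj_of n) (obj_of m) \<longleftrightarrow>
      \<not> (?linked b n m \<and> signs_agree n (shift_name pi m)) \<and> \<not> (?linked b m n \<and> signs_agree m (shift_name pi n))"
    if b: "0 < b \<and> b < pi \<and> inner_name b n \<and> inner_name b m" for b
  proof -
    interpret F_structure u b "E b" using F_structure_at b by simp
    have "signs_agree n (shift_name b m) = signs_agree n (shift_name pi m)" "signs_agree m (shift_name b n) = signs_agree m (shift_name pi n)"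
      by (cases n; cases m; simp)+
    then show ?thesis
      using Ext1_zero_names[of n m] Ext1_zero_names[of m n] b by (simp add: compatible_below_def ends_shift)
  qed
  show ?thesis
  proof
    assume c: "\<forall>\<^sub>F b in at_left pi. compatible_below u E b (obj_of n) (obj_of m)"
    show "\<not> arcs_cross (arc n) (arc m)"
    proof
      assume "arcs_cross (arc n) (arc m)"
      then obtain k :: int where "interlaced (fst (ends n)) (snd (ends n)) (fst (ends m) + of_int k * pi) (snd (ends m) + of_int k * pi)"
        and s: "signs_agree n (shift_name pi m)" using arcs_cross_names[OF n] by blast
      then have "\<forall>\<^sub>F b in at_left pi. ?linked b n m" using eventually_linked by fastforce
      with c good have "\<forall>\<^sub>F b in at_left (pi::real). False"
        by eventually_elim (use iff s in blast)
      then show False by (simp add: trivial_limit_at_left_real)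
    qed
  next
    assume nc: "\<not> arcs_cross (arc n) (arc m)"
    have "compatible_below u E b (obj_of n) (obj_of m)" if b: "0 < b \<and> b < pi \<and> inner_name b n \<and> inner_name b m" for b
    proof -
      have l: "b < pi \<Longrightarrow> ?linked b n m \<Longrightarrow> \<exists>k::int. interlaced (fst (ends n)) (snd (ends n)) (fst (ends m) + of_int k * pi) (snd (ends m) + of_int k * pi)" for n m
        using linked_shift[of b "fst (ends n)" "snd (ends n)" "snd (ends m)" "fst (ends m)"] by simp
      show ?thesis
        unfolding iff[OF b] using l[of n m] l[of m n] nc arcs_cross_names[OF n] arcs_cross_names[OF n(2,1)] arcs_cross_commute b by blast
    qed
    then show "\<forall>\<^sub>F b in at_left pi. compatible_below u E b (obj_of n) (obj_of m)"
      using good by (rule eventually_mono[rotated])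
  qed
qed

end

section \<open>The space of arcs\<close>

lemma same_arc_shift_point:
  assumes "same_arc p q"
  obtains k e where "q = (fst (shift_point k p), fst (snd (shift_point k p)), e)" "fst (snd p) = fst p + pi \<Longrightarrow> e = snd (snd p)"
  using assms that by (cases p; cases q) (fastforce simp: same_arc_def)

lemma H_gen_imp_same_arc: "H_gen p q \<Longrightarrow> same_arc p q"
  by (erule H_gen.cases) (auto simp: same_arc_def intro: exI[of _ 0] exI[of _ 1])

lemma equivclp_shift:
  assumes "x < y" "y \<le> x + pi"
  shows "equivclp H_gen (x, y, e) (x + of_int k * pi, y + of_int k * pi, e)"
proof -
  have up: "equivclp H_gen (x, y, e) (x + of_nat n * pi, y + of_nat n * pi, e)" if "x < y" "y \<le> x + pi" for n x y
  proof (induction n)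
    case (Suc n)
    have "H_gen (x + of_nat n * pi, y + of_nat n * pi, e) (x + of_nat n * pi + pi, y + of_nat n * pi + pi, e)"
      by (rule H_gen.translate) (use that in auto)
    then show ?case
      using Suc equivclp_trans[OF Suc r_into_equivclp] by (simp add: algebra_simps)
  qed simp
  show ?thesis
  proof (cases "0 \<le> k")
    case True
    then show ?thesis using up[OF assms, of "nat k"] by simp
  next
    case False
    then show ?thesis
      using up[of "x + of_int k * pi" "y + of_int k * pi" "nat (- k)"] assms by (simp add: algebra_simps equivclp_sym)
  qed
qed

lemma equivclp_H_gen:
  assumes "p \<in> H_tilde"
  shows "equivclp H_gen p q \<longleftrightarrow> same_arc p q"
proof
  assume "equivclp H_gen p q"
  then show "same_arc p q"
    by induction (use same_arc_refl same_arc_trans same_arc_sym H_gen_imp_same_arc in blast)+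
next
  assume s: "same_arc p q"
  obtain x y e where p: "p = (x, y, e)" "x < y" "y \<le> x + pi" using assms by (cases p) (auto simp: H_tilde_def)
  obtain k :: int and e' where q: "q = (x + of_int k * pi, y + of_int k * pi, e')" "y = x + pi \<longrightarrow> e = e'"
    using s unfolding p by (cases q) (auto simp: same_arc_def)
  have flip: "equivclp H_gen (x, y, e) (x, y, e')"
  proof (cases "e = e'")
    case False
    then have lt: "y < x + pi" using q(2) p(3) by fastforce
    have "H_gen (x, y, True) (x, y, False)" by (rule H_gen.sign[OF p(2) lt])
    then show ?thesis using False by (cases e; cases e') (auto intro: r_into_equivclp equivclp_sym)
  qed simp
  show "equivclp H_gen p q" unfolding p(1) q(1)
    by (rule equivclp_trans[OF flip equivclp_shift[OF p(2,3)]])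
qed

lemma H_class_eq_same_arc: "p \<in> H_tilde \<Longrightarrow> H_class p = {q. same_arc p q}"
  unfolding H_class_def using equivclp_H_gen by blast

lemma H_class_eq_iff: "p \<in> H_tilde \<Longrightarrow> q \<in> H_tilde \<Longrightarrow> H_class p = H_class q \<longleftrightarrow> same_arc p q"
  unfolding H_class_eq_same_arc using same_arc_refl same_arc_sym same_arc_trans by blast

lemma arc_in_H_tilde: "is_name n \<Longrightarrow> arc n \<in> H_tilde"
  using arc_range[of n] by (cases "arc n") (auto simp: H_tilde_def)

lemma h_name_eq: assumes "is_name n" shows "h_name n = H_class (arc n)"
proof (cases n)
  case (Regular x y)
  show ?thesis
  proof (cases "y < x")
    case True
    then show ?thesis using assms Regular by (auto simp: h_SE_def max_def min_def)
  next
    case False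
    then have lt: "x < y" "y < x + pi" using assms Regular by auto
    have "same_arc (y, x + pi, True) (y + pi, x + 2 * pi, True)"
      by (auto simp: same_arc_def intro: exI[of _ 1])
    then have "H_class (y, x + pi, True) = H_class (y + pi, x + 2 * pi, True)"
      using lt by (subst H_class_eq_iff) (auto simp: H_tilde_def)
    then show ?thesis using lt Regular by (simp add: h_SE_def)
  qed
qed simp

lemma H_tilde_iff: "p \<in> H_tilde \<longleftrightarrow> fst p < fst (snd p) \<and> fst (snd p) \<le> fst p + pi"
  by (cases p) (simp add: H_tilde_def)

lemma same_arc_H_tilde: "same_arc p q \<Longrightarrow> p \<in> H_tilde \<Longrightarrow> q \<in> H_tilde"
  by (auto simp: same_arc_def H_tilde_def)

lemma same_arc_not_cross: "p \<in> H_tilde \<Longrightarrow> same_arc p q \<Longrightarrow> \<not> tagged_cross p q"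
proof
  assume "p \<in> H_tilde" "same_arc p q" "tagged_cross p q"
  then obtain x y k where xy: "x < y" "y \<le> x + pi" and c: "cross x y (x + of_int k * pi) (y + of_int k * pi)"
    by (cases p; cases q) (auto simp: H_tilde_def same_arc_def tagged_cross_def)
  have "\<bar>a\<bar> < pi \<and> a \<noteq> 0" if "cross x y (x + a) (y + a)" for a
    using that xy by (auto simp: cross_def)
  from this[OF c] have "\<bar>of_int k * pi\<bar> < pi" "of_int k * pi \<noteq> 0" by blast+
  then have "\<bar>of_int k\<bar> < (1::real)" "k \<noteq> 0" by (auto simp: abs_mult)
  then show False by linarith
qed

lemma tagged_cross_same_arc:
  assumes "tagged_cross p q" "same_arc p' p" "same_arc q' q"
  shows "arcs_cross p' q'"
proof -
  obtain k e l f where p: "p = (fst (shift_point k p'), fst (snd (shift_point k p')), e)" "fst (snd p') = fst p' + pi \<Longrightarrow> e = snd (snd p')"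
    and q: "q = (fst (shift_point l q'), fst (snd (shift_point l q')), f)" "fst (snd q') = fst q' + pi \<Longrightarrow> f = snd (snd q')"
    using same_arc_shift_point assms(2,3) by metis
  have "tagged_cross (shift_point k p') (shift_point l q')"
    using assms(1) p q by (cases p'; cases q') (auto simp: tagged_cross_def)
  then have "tagged_cross (shift_point (- k) (shift_point k p')) (shift_point (- k) (shift_point l q'))"
    unfolding tagged_cross_shift .
  then show ?thesis unfolding arcs_cross_def shift_point_add by auto
qed

lemma arcs_cross_same_arc: "arcs_cross p q \<Longrightarrow> same_arc p p' \<Longrightarrow> same_arc q q' \<Longrightarrow> arcs_cross p' q'"
proof -
  assume "arcs_cross p q" and s: "same_arc p p'" "same_arc q q'"
  then obtain k where "tagged_cross p (shift_point k q)" unfolding arcs_cross_def by blast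
  moreover have "same_arc q (shift_point k q)" by (cases q) (simp add: same_arc_shift)
  ultimately show ?thesis using tagged_cross_same_arc s same_arc_sym same_arc_trans by blast
qed

subsection \<open>Discreteness and local finiteness\<close>

text \<open>The inequalities of a crossing are strict and hence open. \<open>?V\<close> fixes the
  tag near a loop and keeps away from loops otherwise, so that the condition on tags persists as
  well.\<close>

lemma open_near_cross:
  assumes "tagged_cross l q" "l \<in> H_tilde"
  obtains U where "open U" "l \<in> U" "\<And>p. p \<in> U \<Longrightarrow> tagged_cross p q"
proof -
  obtain x' y' e' where q: "q = (x', y', e')" by (cases q)
  let ?C = "{p :: point. (fst p < x' \<and> x' < fst (snd p) \<and> fst (snd p) < y') \<or> (x' < fst p \<and> fst p < y' \<and> y' < fst (snd p))}"
  let ?V = "if fst (snd l) = fst l + pi then {p. snd (snd p) = snd (snd l)} else {p. fst (snd p) < fst p + pi}"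
  have "open ?C"
    by (intro open_Collect_disj open_Collect_conj open_Collect_less continuous_intros)
  moreover have "open {p :: point. snd (snd p) = snd (snd l)}"
  proof -
    have "open ((\<lambda>p :: point. snd (snd p)) -` {snd (snd l)})"
      by (rule open_vimage[OF open_discrete]) (intro continuous_intros)
    then show ?thesis by (simp add: vimage_def)
  qed
  moreover have "open {p :: point. fst (snd p) < fst p + pi}"
    by (intro open_Collect_less continuous_intros)
  ultimately have "open (?C \<inter> ?V)" by (auto intro: open_Int)
  moreover have "l \<in> ?C \<inter> ?V" using assms by (cases l) (auto simp: q tagged_cross_def cross_def H_tilde_def)
  moreover have "tagged_cross p q" if "p \<in> ?C \<inter> ?V" for p
    using that assms by (cases l; cases p) (auto simp: q tagged_cross_def cross_def split: if_splits)
  ultimately show ?thesis using that by blast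
qed

definition locally_finite_arcs :: "point set \<Rightarrow> bool" where
  "locally_finite_arcs D \<longleftrightarrow> (\<forall>\<delta> > 0. \<forall>N. finite {(x, y, e) \<in> D. \<bar>x\<bar> \<le> N \<and> \<delta> \<le> y - x})"

lemma same_arc_bounded_finite: "finite {q. same_arc p q \<and> \<bar>fst q\<bar> \<le> N}"
proof (rule finite_subset)
  show "{q. same_arc p q \<and> \<bar>fst q\<bar> \<le> N} \<subseteq>
     (\<lambda>(k, e). (fst p + of_int k * pi, fst (snd p) + of_int k * pi, e)) ` ({k. \<bar>fst p + of_int k * pi\<bar> \<le> N} \<times> UNIV)"
    by (cases p) (fastforce simp: same_arc_def)
  show "finite ((\<lambda>(k, e). (fst p + of_int k * pi, fst (snd p) + of_int k * pi, e :: bool)) ` ({k. \<bar>fst p + of_int k * pi\<bar> \<le> N} \<times> UNIV))"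
    by (intro finite_imageI finite_cartesian_product bounded_shifts) simp
qed

lemma compact_strip: "compact ((\<lambda>p :: point. (fst p, fst p + fst (snd p), snd (snd p))) ` ({- N..N} \<times> ({\<delta>..pi} \<times> UNIV)))"
  by (intro compact_continuous_image compact_Times compact_Icc finite_imp_compact continuous_intros) simp

text \<open>Infinitely many arcs in a compact strip accumulate at some \<open>l\<close> whose length
  is still at least \<delta>, so that \<open>l\<close> lies in \<open>H_tilde\<close>. Closedness
  puts \<open>l\<close> into \<open>D\<close>, and discreteness leaves near it only representatives
  of its own class, finitely many in a bounded region.\<close>

lemma discrete_imp_locally_finite:
  assumes D: "D \<subseteq> H_tilde" and closed: "\<And>l. l \<in> H_tilde \<Longrightarrow> l islimpt D \<Longrightarrow> l \<in> D"
    and discrete: "\<And>l. l \<in> D \<Longrightarrow> \<exists>U. open U \<and> l \<in> U \<and> (\<forall>p \<in> U \<inter> D. same_arc l p)"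
  shows "locally_finite_arcs D"
  unfolding locally_finite_arcs_def
proof (intro allI impI)
  fix \<delta> N :: real assume "0 < \<delta>"
  let ?K = "{(x, y, e) \<in> D. \<bar>x\<bar> \<le> N \<and> \<delta> \<le> y - x}"
  let ?C = "(\<lambda>p :: point. (fst p, fst p + fst (snd p), snd (snd p))) ` ({- N..N} \<times> ({\<delta>..pi} \<times> UNIV))"
  show "finite ?K"
  proof (rule ccontr)
    assume inf: "infinite ?K"
    have sub: "?K \<subseteq> ?C"
    proof
      fix p assume p: "p \<in> ?K"
      then obtain x y e where "p = (x, y, e)" "(x, y, e) \<in> D" "\<bar>x\<bar> \<le> N" "\<delta> \<le> y - x" by auto
      then show "p \<in> ?C" using D by (intro image_eqI[of _ _ "(x, y - x, e)"]) (auto simp: H_tilde_def)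
    qed
    obtain l where l: "l \<in> ?C" "l islimpt ?K" using Heine_Borel_imp_Bolzano_Weierstrass[OF compact_strip inf sub] by (rule bexE)
    have H: "l \<in> H_tilde" using l(1) \<open>0 < \<delta>\<close> by (auto simp: H_tilde_def)
    have "l islimpt D" by (rule islimpt_subset[OF l(2)]) auto
    then have "l \<in> D" by (rule closed[OF H])
    then obtain U where U: "open U" "l \<in> U" "\<forall>p \<in> U \<inter> D. same_arc l p" using discrete by blast
    then have "U \<inter> ?K \<subseteq> {q. same_arc l q \<and> \<bar>fst q\<bar> \<le> N}" by auto
    then have "finite (U \<inter> ?K)" using same_arc_bounded_finite finite_subset by blast
    moreover have "infinite (U \<inter> ?K)" using l(2) U unfolding islimpt_eq_acc_point by blast
    ultimately show False by blast
  qed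
qed

text \<open>Half the length of \<open>l\<close> and a bound for its left end serve as \<delta> and
  \<open>N\<close>, so a neighbourhood of \<open>l\<close> contains only finitely many points of
  \<open>A\<close>, which can be removed.\<close>

lemma locally_finite_closed:
  assumes D: "locally_finite_arcs D" and A: "A \<subseteq> D"
  shows "openin (top_of_set H_tilde) (H_tilde - A)"
proof (subst openin_subopen, intro ballI)
  fix l assume l: "l \<in> H_tilde - A"
  define \<delta> where "\<delta> = (fst (snd l) - fst l) / 2"
  define N where "N = \<bar>fst l\<bar> + 1"
  have pos: "0 < \<delta>" using l by (auto simp: \<delta>_def H_tilde_def)
  let ?U = "{p :: point. \<bar>fst p\<bar> < N \<and> \<delta> < fst (snd p) - fst p}"
  have "finite {(x, y, e) \<in> D. \<bar>x\<bar> \<le> N \<and> \<delta> \<le> y - x}" using D pos by (simp add: locally_finite_arcs_def)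
  then have fin: "finite (?U \<inter> A)" by (rule finite_subset[rotated]) (use A in auto)
  have "open ?U" by (intro open_Collect_conj open_Collect_less continuous_intros)
  then have "open (?U - (?U \<inter> A))" using fin by (intro open_Diff finite_imp_closed)
  then have "openin (top_of_set H_tilde) (H_tilde \<inter> (?U - (?U \<inter> A)))" by (rule openin_open_Int)
  moreover have "l \<in> H_tilde \<inter> (?U - (?U \<inter> A))" using l pos by (auto simp: \<delta>_def N_def field_simps)
  moreover have "H_tilde \<inter> (?U - (?U \<inter> A)) \<subseteq> H_tilde - A" by blast
  ultimately show "\<exists>T. openin (top_of_set H_tilde) T \<and> l \<in> T \<and> T \<subseteq> H_tilde - A" by blast
qed

section \<open>Laminations\<close>

context F_family
begin

abbreviation nm where "nm \<equiv> name_of u E"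
abbreviation indec where "indec \<equiv> indecomposable (Cpi u E)"
abbreviation iso where "iso \<equiv> isomorphic (Cpi u E)"

definition arc_of :: "'r pobj \<Rightarrow> point" where
  "arc_of X = arc (nm X)"

text \<open>For a set of indecomposable objects this is the preimage in \<open>H_tilde\<close> of
  its image under \<open>h\<close>: all translates, and short arcs with both tags.\<close>

definition arcs :: "'r pobj set \<Rightarrow> point set" where
  "arcs L = {p. \<exists>X \<in> L. same_arc (arc_of X) p}"

sublocale pi: F_structure u pi "E pi"
  by (rule F_structure_at) simp_all

lemma name_of: assumes "indec X" shows "is_name (nm X)" "iso X (obj_of (nm X))"
proof -
  have "\<exists>n. is_name n \<and> iso X (obj_of n)"
    using pi.indecomposable_has_name[OF assms] proper_name_pi by metis
  then show "is_name (nm X)" "iso X (obj_of (nm X))" unfolding name_of_def by (rule someI2_ex, blast)+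
qed

lemma indec_obj: "indec X \<Longrightarrow> X \<in> Obj pi.PC"
  by (simp add: indecomposable_def)

lemma name_obj: "is_name n \<Longrightarrow> obj_of n \<in> Obj pi.PC" "is_name n \<Longrightarrow> indec (obj_of n)"
  using pi.obj_of_in[OF proper_inner] pi.name_indecomposable proper_name_pi by blast+

lemma iso_iff: assumes "indec X" "indec Y" shows "iso X Y \<longleftrightarrow> same_arc (arc_of X) (arc_of Y)"
proof -
  note X = name_of[OF assms(1)] and Y = name_of[OF assms(2)]
  note o = indec_obj[OF assms(1)] indec_obj[OF assms(2)] name_obj(1)[OF X(1)] name_obj(1)[OF Y(1)]
  have "iso X Y \<longleftrightarrow> iso (obj_of (nm X)) (obj_of (nm Y))"
    using pi.CC_isomorphic_trans[OF o(3,1,2)] pi.CC_isomorphic_trans[OF o(3,2,4)] pi.CC_isomorphic_trans[OF o(1,3,4)]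
      pi.CC_isomorphic_trans[OF o(1,4,2)] pi.CC_isomorphic_sym o X(2) Y(2) by blast
  also have "\<dots> \<longleftrightarrow> same_arc (arc_of X) (arc_of Y)"
    using pi.same_arc_isomorphic pi.isomorphic_same_arc X(1) Y(1) proper_name_pi unfolding arc_of_def by blast
  finally show ?thesis .
qed

lemma compatible_iff: "indec X \<Longrightarrow> indec Y \<Longrightarrow> compatible u E X Y \<longleftrightarrow> \<not> arcs_cross (arc_of X) (arc_of Y)"
  unfolding compatible_def arc_of_def using compatible_names name_of by blast

lemma arc_of_obj: assumes "is_name n" shows "same_arc (arc_of (obj_of n)) (arc n)"
proof -
  note X = name_of[OF name_obj(2)[OF assms]]
  show ?thesis
    using pi.isomorphic_same_arc[of n "nm (obj_of n)"] X proper_name_pi assms same_arc_sym unfolding arc_of_def by blast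
qed

lemma arc_of_H_tilde: "indec X \<Longrightarrow> arc_of X \<in> H_tilde"
  unfolding arc_of_def using arc_in_H_tilde name_of by blast

lemma h_map_eq: "indec X \<Longrightarrow> h_map u E X = H_class (arc_of X)"
  unfolding h_map_def arc_of_def using h_name_eq name_of by blast

lemma arc_object:
  assumes "p \<in> H_tilde" obtains X where "indec X" "same_arc (arc_of X) p"
proof -
  obtain x y e where p: "p = (x, y, e)" "x < y" "y \<le> x + pi" using assms by (cases p) (auto simp: H_tilde_def)
  obtain n where n: "is_name n" "same_arc (arc n) p" using arc_surj[OF p(2,3)] p(1) by metis
  then show ?thesis using that[of "obj_of n"] name_obj(2) arc_of_obj same_arc_trans by blast
qed

lemma compatible_set_indec: "compatible_set u E L \<Longrightarrow> X \<in> L \<Longrightarrow> indec X"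
  by (simp add: compatible_set_def)

lemma compatible_setD:
  assumes "compatible_set u E L" "X \<in> L" "Y \<in> L" "X \<noteq> Y"
  shows "\<not> same_arc (arc_of X) (arc_of Y)" "\<not> arcs_cross (arc_of X) (arc_of Y)"
proof -
  have "indec X" "indec Y" "\<not> iso X Y" "compatible u E X Y"
    using assms unfolding compatible_set_def pairwise_def by blast+
  then show "\<not> same_arc (arc_of X) (arc_of Y)" "\<not> arcs_cross (arc_of X) (arc_of Y)"
    using iso_iff compatible_iff by blast+
qed

lemma compatible_set_subset: "compatible_set u E L \<Longrightarrow> L' \<subseteq> L \<Longrightarrow> compatible_set u E L'"
  unfolding compatible_set_def using pairwise_subset[of _ L L'] by blast

lemma compatible_set_insert:
  assumes L: "compatible_set u E L" and X: "indec X" and p: "same_arc (arc_of X) p"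
    and cross: "\<And>q. q \<in> arcs L \<Longrightarrow> \<not> tagged_cross p q" and new: "p \<notin> arcs L"
  shows "compatible_set u E (insert X L)"
proof -
  have *: "\<not> iso X Y \<and> compatible u E X Y \<and> \<not> iso Y X \<and> compatible u E Y X" if Y: "Y \<in> L" for Y
  proof -
    note iY = compatible_set_indec[OF L Y]
    have "\<not> same_arc (arc_of Y) p" using new Y by (auto simp: arcs_def)
    then have 1: "\<not> same_arc (arc_of X) (arc_of Y)" using p same_arc_sym same_arc_trans by blast
    have "\<not> arcs_cross p (arc_of Y)"
    proof
      assume "arcs_cross p (arc_of Y)"
      then obtain k where "tagged_cross p (shift_point k (arc_of Y))" unfolding arcs_cross_def by blast
      moreover have "same_arc (arc_of Y) (shift_point k (arc_of Y))" by (cases "arc_of Y") (simp add: same_arc_shift)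
      ultimately show False using cross Y unfolding arcs_def by blast
    qed
    then have "\<not> arcs_cross (arc_of X) (arc_of Y)" using p arcs_cross_same_arc same_arc_refl by blast
    then show ?thesis using 1 iso_iff compatible_iff X iY arcs_cross_commute same_arc_sym by blast
  qed
  show ?thesis
    using L X * unfolding compatible_set_def pairwise_insert by blast
qed

lemma arcs_noncrossing:
  assumes "compatible_set u E L" "p \<in> arcs L" "q \<in> arcs L"
  shows "\<not> tagged_cross p q"
proof -
  obtain X Y where X: "X \<in> L" "same_arc (arc_of X) p" and Y: "Y \<in> L" "same_arc (arc_of Y) q"
    using assms(2,3) by (auto simp: arcs_def)
  show ?thesis
  proof (cases "X = Y")
    case True
    have "p \<in> H_tilde" using same_arc_H_tilde[OF X(2)] arc_of_H_tilde compatible_set_indec[OF assms(1) X(1)] by blast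
    moreover have "same_arc p q" using True X Y same_arc_sym same_arc_trans by blast
    ultimately show ?thesis by (rule same_arc_not_cross)
  next
    case False
    then show ?thesis using compatible_setD[OF assms(1) X(1) Y(1)] tagged_cross_same_arc X(2) Y(2) by blast
  qed
qed

lemma arcs_same_arc: "p \<in> arcs L \<Longrightarrow> same_arc p q \<Longrightarrow> q \<in> arcs L"
  unfolding arcs_def using same_arc_trans by blast

lemma arcs_H_tilde: "compatible_set u E L \<Longrightarrow> arcs L \<subseteq> H_tilde"
  unfolding arcs_def using same_arc_H_tilde arc_of_H_tilde compatible_set_indec by blast

lemma lamination_maximal:
  assumes L: "lamination u E L" and p: "p \<in> H_tilde" "\<And>q. q \<in> arcs L \<Longrightarrow> \<not> tagged_cross p q"
  shows "p \<in> arcs L"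
proof (rule ccontr)
  assume new: "p \<notin> arcs L"
  obtain X where X: "indec X" "same_arc (arc_of X) p" using arc_object[OF p(1)] .
  have "compatible_set u E (insert X L)"
    using compatible_set_insert[OF _ X p(2) new] L by (simp add: lamination_def)
  then have "X \<in> L" using L unfolding lamination_def by blast
  then show False using new X(2) by (auto simp: arcs_def)
qed

lemma discrete_at:
  assumes L: "discrete_lamination u E L" and l: "l \<in> arcs L"
  shows "\<exists>U. open U \<and> l \<in> U \<and> (\<forall>p \<in> U \<inter> arcs L. same_arc l p)"
proof -
  have c: "compatible_set u E L" using L by (simp add: discrete_lamination_def lamination_def)
  obtain X where X: "X \<in> L" "same_arc (arc_of X) l" using l by (auto simp: arcs_def)
  note H = arc_of_H_tilde[OF compatible_set_indec[OF c]]
  have "openin (subtopology H_space (h_map u E ` L)) {h_map u E X}"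
    using L X(1) unfolding discrete_lamination_def by simp
  then obtain U where U: "openin H_space U" "{h_map u E X} = U \<inter> h_map u E ` L"
    by (auto simp: openin_subtopology)
  obtain T where T: "open T" "{p \<in> H_tilde. H_class p \<in> U} = H_tilde \<inter> T"
    using U(1) unfolding openin_H_space openin_open by blast
  have "l \<in> H_tilde" using l arcs_H_tilde[OF c] by blast
  moreover have cl: "H_class l = h_map u E X"
    using H_class_eq_iff[OF H[OF X(1)] \<open>l \<in> H_tilde\<close>] X h_map_eq[OF compatible_set_indec[OF c X(1)]] by simp
  ultimately have "l \<in> T" using U(2) T(2) by blast
  moreover have "same_arc l p" if pT: "p \<in> T \<inter> arcs L" for p
  proof -
    obtain Y where Y: "Y \<in> L" "same_arc (arc_of Y) p" using pT by (auto simp: arcs_def)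
    have pH: "p \<in> H_tilde" using pT arcs_H_tilde[OF c] by blast
    have "H_class p = h_map u E Y"
      using H_class_eq_iff[OF H[OF Y(1)] pH] Y h_map_eq[OF compatible_set_indec[OF c Y(1)]] by simp
    moreover have "H_class p \<in> U" using pT pH T(2) by blast
    ultimately have "H_class p = H_class l" using U(2) Y(1) cl by blast
    then show ?thesis using H_class_eq_iff[OF \<open>l \<in> H_tilde\<close> pH] by simp
  qed
  ultimately show ?thesis using T(1) by blast
qed

text \<open>If a limit of arcs of \<open>L\<close> crossed an arc of \<open>L\<close>, so would the
  arcs near it, by \<open>open_near_cross\<close>. Hence the limit crosses none of them and belongs
  to \<open>arcs L\<close> by maximality; this is the closedness that discreteness alone does not
  give.\<close>

lemma lamination_arcs_locally_finite:
  assumes L: "discrete_lamination u E L"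
  shows "locally_finite_arcs (arcs L)"
proof (rule discrete_imp_locally_finite)
  have lam: "lamination u E L" and c: "compatible_set u E L"
    using L by (simp_all add: discrete_lamination_def lamination_def)
  show "arcs L \<subseteq> H_tilde" by (rule arcs_H_tilde[OF c])
  fix l assume l: "l \<in> H_tilde" "l islimpt arcs L"
  show "l \<in> arcs L"
  proof (rule lamination_maximal[OF lam l(1)])
    fix q assume q: "q \<in> arcs L"
    show "\<not> tagged_cross l q"
    proof
      assume "tagged_cross l q"
      then obtain U where "open U" "l \<in> U" "\<And>p. p \<in> U \<Longrightarrow> tagged_cross p q" using open_near_cross l(1) by metis
      then show False using l(2) arcs_noncrossing[OF c _ q] unfolding islimpt_def by blast
    qed
  qed
qed (rule discrete_at[OF L])

lemma discrete_laminationI: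
  assumes L: "lamination u E L" and fin: "locally_finite_arcs (arcs L)"
  shows "discrete_lamination u E L"
proof -
  have c: "compatible_set u E L" using L by (simp add: lamination_def)
  have hc: "h_map u E X = H_class (arc_of X)" "arc_of X \<in> H_tilde" if "X \<in> L" for X
    using h_map_eq arc_of_H_tilde compatible_set_indec[OF c that] by blast+
  let ?h = "h_map u E ` L"
  have sub: "?h \<subseteq> topspace H_space" unfolding topspace_H_space using hc by auto
  have "openin (subtopology H_space ?h) {h_map u E X}" if X: "X \<in> L" for X
  proof -
    let ?A = "{p \<in> arcs L. \<not> same_arc (arc_of X) p}"
    \<comment> \<open>\<open>?U\<close> omits the other points of the image. Its preimage is
      \<open>H_tilde\<close> minus a part of \<open>arcs L\<close>, which is open by local
      finiteness.\<close>
    let ?U = "H_class ` H_tilde - (?h - {h_map u E X})"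
    have "{p \<in> H_tilde. H_class p \<in> ?U} = H_tilde - ?A"
    proof (intro equalityI subsetI)
      fix p assume p: "p \<in> {p \<in> H_tilde. H_class p \<in> ?U}"
      have "same_arc (arc_of X) p" if pL: "p \<in> arcs L"
      proof -
        obtain Y where Y: "Y \<in> L" "same_arc (arc_of Y) p" using pL by (auto simp: arcs_def)
        then have "H_class p = h_map u E Y" using hc[OF Y(1)] H_class_eq_iff[of "arc_of Y" p] p by simp
        then have "H_class p = h_map u E X" using p Y(1) by blast
        then show ?thesis using hc[OF X] H_class_eq_iff[of "arc_of X" p] p by simp
      qed
      then show "p \<in> H_tilde - ?A" using p by blast
    next
      fix p assume p: "p \<in> H_tilde - ?A"
      have "H_class p = h_map u E X" if "Y \<in> L" "H_class p = h_map u E Y" for Y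
      proof -
        have "same_arc (arc_of Y) p" using that hc[OF that(1)] H_class_eq_iff[of "arc_of Y" p] p by simp
        then have "p \<in> arcs L" using that(1) unfolding arcs_def by blast
        then have "same_arc (arc_of X) p" using p by blast
        then show ?thesis using hc[OF X] H_class_eq_iff[of "arc_of X" p] p by simp
      qed
      then show "p \<in> {p \<in> H_tilde. H_class p \<in> ?U}" using p by blast
    qed
    moreover have "openin (top_of_set H_tilde) (H_tilde - ?A)" by (rule locally_finite_closed[OF fin]) auto
    ultimately have "openin H_space ?U" unfolding openin_H_space by auto
    moreover have "{h_map u E X} = ?U \<inter> ?h" using X hc(1)[OF X] imageI[OF hc(2)[OF X], of H_class] by auto
    ultimately show ?thesis unfolding openin_subtopology by blast
  qed
  then have "discrete_topology ?h = subtopology H_space ?h"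
    unfolding discrete_topology_unique topspace_subtopology using sub by auto
  then show ?thesis using L by (simp add: discrete_lamination_def)
qed

lemma lamination_arc_system: assumes L: "discrete_lamination u E L" shows "arc_system (arcs L)"
proof
  have lam: "lamination u E L" and c: "compatible_set u E L"
    using L by (simp_all add: discrete_lamination_def lamination_def)
  fix x y :: real and e e' :: bool and k :: int and p q :: point and \<delta> N :: real
  show "(x, y, e) \<in> arcs L \<Longrightarrow> x < y \<and> y \<le> x + pi" using arcs_H_tilde[OF c] by (auto simp: H_tilde_def)
  show "(x, y, e) \<in> arcs L \<Longrightarrow> (x + of_int k * pi, y + of_int k * pi, e) \<in> arcs L"
    using arcs_same_arc same_arc_shift by blast
  show "(x, y, e) \<in> arcs L \<Longrightarrow> y < x + pi \<Longrightarrow> (x, y, e') \<in> arcs L"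
    by (erule arcs_same_arc) (auto simp: same_arc_def intro: exI[of _ 0])
  show "p \<in> arcs L \<Longrightarrow> q \<in> arcs L \<Longrightarrow> \<not> tagged_cross p q" using arcs_noncrossing[OF c] by blast
  show "x < y \<Longrightarrow> y \<le> x + pi \<Longrightarrow> (\<And>q. q \<in> arcs L \<Longrightarrow> \<not> tagged_cross (x, y, e) q) \<Longrightarrow> (x, y, e) \<in> arcs L"
    by (rule lamination_maximal[OF lam]) (auto simp: H_tilde_def)
  show "0 < \<delta> \<Longrightarrow> finite {(x, y, e) \<in> arcs L. \<bar>x\<bar> \<le> N \<and> \<delta> \<le> y - x}"
    using lamination_arcs_locally_finite[OF L] by (simp add: locally_finite_arcs_def)
qed

text \<open>An object is determined up to isomorphism by its class of arcs, so the arc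
  \<open>s\<close> of the exchange determines \<open>T'\<close>. Local finiteness survives because
  only one class of arcs is added.\<close>

lemma exchange_lamination:
  assumes L: "discrete_lamination u E L" and T: "T \<in> L"
  shows "\<exists>T'. (indec T' \<and> \<not> iso T' T \<and> discrete_lamination u E ((L - {T}) \<union> {T'})) \<and>
    (\<forall>T''. indec T'' \<and> \<not> iso T'' T \<and> discrete_lamination u E ((L - {T}) \<union> {T''}) \<longrightarrow> iso T'' T')"
proof -
  have lam: "lamination u E L" and c: "compatible_set u E L"
    using L by (simp_all add: discrete_lamination_def lamination_def)
  interpret arc_system "arcs L" by (rule lamination_arc_system[OF L])
  let ?t = "arc_of T" and ?R = "L - {T}"
  have iT: "indec T" by (rule compatible_set_indec[OF c T])
  have t: "?t \<in> arcs L" unfolding arcs_def using T same_arc_refl by blast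
  obtain s where "exchange ?t s" using exchange_exists[OF t] by blast
  then have sH: "s \<in> H_tilde" and s_new: "s \<notin> arcs L"
    and s_cross: "\<And>q. q \<in> arcs L \<Longrightarrow> \<not> same_arc ?t q \<Longrightarrow> \<not> tagged_cross s q"
    and s_unique: "\<And>p. p \<in> H_tilde \<Longrightarrow> p \<notin> arcs L \<Longrightarrow> (\<And>q. q \<in> arcs L \<Longrightarrow> \<not> same_arc ?t q \<Longrightarrow> \<not> tagged_cross p q) \<Longrightarrow> same_arc p s"
    unfolding exchange_def H_tilde_iff by blast+
  obtain T' where T': "indec T'" "same_arc (arc_of T') s" using arc_object[OF sH] .
  have R: "q \<in> arcs ?R \<longleftrightarrow> q \<in> arcs L \<and> \<not> same_arc ?t q" for q
  proof
    assume "q \<in> arcs ?R"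
    then obtain X where X: "X \<in> L" "X \<noteq> T" "same_arc (arc_of X) q" by (auto simp: arcs_def)
    then have "\<not> same_arc ?t (arc_of X)" using compatible_setD[OF c T X(1)] by auto
    then show "q \<in> arcs L \<and> \<not> same_arc ?t q" using X same_arc_sym same_arc_trans unfolding arcs_def by blast
  qed (auto simp: arcs_def)
  have cR: "compatible_set u E ?R" by (rule compatible_set_subset[OF c]) auto
  have "\<not> iso T' T" using iso_iff[OF T'(1) iT] s_new t T'(2) arcs_same_arc same_arc_sym same_arc_trans by blast
  moreover have "discrete_lamination u E (?R \<union> {T'})"
  proof (rule discrete_laminationI)
    have cL: "compatible_set u E (?R \<union> {T'})"
      using compatible_set_insert[OF cR T'] s_cross s_new R by auto
    show "lamination u E (?R \<union> {T'})"
      unfolding lamination_def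
    proof (intro conjI allI impI, rule cL)
      fix L' assume L': "compatible_set u E L'" "?R \<union> {T'} \<subseteq> L'"
      show "L' = ?R \<union> {T'}"
      proof (rule ccontr)
        assume "L' \<noteq> ?R \<union> {T'}"
        then obtain Z where Z: "Z \<in> L'" "Z \<notin> ?R" "Z \<noteq> T'" using L'(2) by blast
        let ?p = "arc_of Z"
        have iZ: "indec Z" by (rule compatible_set_indec[OF L'(1) Z(1)])
        have pL: "?p \<in> arcs L'" using Z(1) same_arc_refl unfolding arcs_def by blast
        have sub: "q \<in> arcs L'" if "q \<in> arcs ?R" for q using that L'(2) unfolding arcs_def by blast
        have pR: "?p \<notin> arcs ?R"
        proof
          assume "?p \<in> arcs ?R"
          then obtain Y where Y: "Y \<in> ?R" "same_arc (arc_of Y) ?p" by (auto simp: arcs_def)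
          then show False using compatible_setD(1)[OF L'(1) _ Z(1), of Y] L'(2) Z(2) by blast
        qed
        have T'L: "T' \<in> L'" using L'(2) by blast
        have ps: "\<not> same_arc ?p s" using compatible_setD(1)[OF L'(1) Z(1) T'L Z(3)] T'(2) same_arc_sym same_arc_trans by blast
        have sL: "s \<in> arcs L'" using T'L T'(2) unfolding arcs_def by blast
        show False
        proof (cases "?p \<in> arcs L")
          case True
          \<comment> \<open>\<open>Z\<close> then has the arc of \<open>T\<close> and is compatible
            with \<open>T'\<close>, so \<open>s\<close> crosses no arc of \<open>L\<close> at all
            and would belong to \<open>arcs L\<close>.\<close>
          then have tp: "same_arc ?t ?p" using pR R by blast
          have "\<not> tagged_cross s q" if q: "q \<in> arcs L" for q
          proof (cases "same_arc ?t q")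
            case True
            then have "q \<in> arcs L'" using tp arcs_same_arc[OF pL] same_arc_sym same_arc_trans by blast
            then show ?thesis using arcs_noncrossing[OF L'(1) sL] by blast
          qed (use s_cross q in blast)
          then have "s \<in> arcs L" by (rule lamination_maximal[OF lam sH])
          then show False using s_new by blast
        next
          case False
          \<comment> \<open>Here the arc of \<open>Z\<close> satisfies the conditions that
            characterise \<open>s\<close>, so \<open>Z\<close> repeats \<open>T'\<close>.\<close>
          have "same_arc ?p s"
            by (rule s_unique[OF arc_of_H_tilde[OF iZ] False]) (use R sub arcs_noncrossing[OF L'(1) pL] in blast)
          then show False using ps by blast
        qed
      qed
    qed
    show "locally_finite_arcs (arcs (?R \<union> {T'}))"
      unfolding locally_finite_arcs_def
    proof (intro allI impI)
      fix \<delta> N :: real assume "0 < \<delta>"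
      have "{(x, y, e) \<in> arcs (?R \<union> {T'}). \<bar>x\<bar> \<le> N \<and> \<delta> \<le> y - x} \<subseteq>
          {(x, y, e) \<in> arcs L. \<bar>x\<bar> \<le> N \<and> \<delta> \<le> y - x} \<union> {q. same_arc (arc_of T') q \<and> \<bar>fst q\<bar> \<le> N}"
        by (auto simp: arcs_def)
      then show "finite {(x, y, e) \<in> arcs (?R \<union> {T'}). \<bar>x\<bar> \<le> N \<and> \<delta> \<le> y - x}"
        by (rule finite_subset) (intro finite_UnI locally_finite same_arc_bounded_finite \<open>0 < \<delta>\<close>)
    qed
  qed
  moreover have "iso T'' T'" if T'': "indec T''" "\<not> iso T'' T" and L'': "discrete_lamination u E (?R \<union> {T''})" for T''
  proof -
    let ?p = "arc_of T''"
    have lam'': "lamination u E (?R \<union> {T''})" and c'': "compatible_set u E (?R \<union> {T''})"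
      using L'' by (simp_all add: discrete_lamination_def lamination_def)
    \<comment> \<open>\<open>T''\<close> might literally be an element of \<open>L - {T}\<close>;
      then \<open>L - {T}\<close> would itself be a lamination, properly contained in
      \<open>L\<close>.\<close>
    have notR: "T'' \<notin> ?R"
    proof
      assume "T'' \<in> ?R"
      then have "?R \<union> {T''} = ?R" by blast
      then have "L = ?R" using lam'' c unfolding lamination_def by (metis Diff_subset)
      then show False using T by blast
    qed
    have p: "?p \<in> arcs (?R \<union> {T''})" using same_arc_refl unfolding arcs_def by blast
    have "?p \<notin> arcs L"
    proof
      assume "?p \<in> arcs L"
      then obtain Y where Y: "Y \<in> L" "same_arc (arc_of Y) ?p" by (auto simp: arcs_def)
      then have "Y = T" using compatible_setD(1)[OF c'', of Y T''] notR by blast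
      then show False using T''(2) iso_iff[OF T''(1) iT] Y(2) same_arc_sym by blast
    qed
    moreover have "\<not> tagged_cross ?p q" if "q \<in> arcs L" "\<not> same_arc ?t q" for q
    proof -
      have "q \<in> arcs ?R" using R that by blast
      then have "q \<in> arcs (?R \<union> {T''})" unfolding arcs_def by blast
      then show ?thesis using arcs_noncrossing[OF c'' p] by blast
    qed
    ultimately have "same_arc ?p s" using s_unique[OF arc_of_H_tilde[OF T''(1)]] by blast
    then show ?thesis using iso_iff[OF T''(1) T'(1)] T'(2) same_arc_sym same_arc_trans by blast
  qed
  ultimately show ?thesis using T'(1) by blast
qed

end

theorem theorem2p6p5:
  fixes u :: "'r :: idom" and E :: "'r exacts"
    and L :: "'r pobj set" and T :: "'r pobj"
  assumes "dvr_uniformizer u"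
    and "2 \<notin> principal_ideal u"
    and "\<And>b. 0 < b \<Longrightarrow> b \<le> pi \<Longrightarrow> F_exact_structure u b (E b)"
    and "discrete_lamination u E L"
    and "T \<in> L"
  shows "\<exists>T'. (indecomposable (Cpi u E) T' \<and> \<not> isomorphic (Cpi u E) T' T \<and>
                discrete_lamination u E ((L - {T}) \<union> {T'})) \<and>
          (\<forall>T''. indecomposable (Cpi u E) T'' \<and> \<not> isomorphic (Cpi u E) T'' T \<and>
                discrete_lamination u E ((L - {T}) \<union> {T''}) \<longrightarrow> isomorphic (Cpi u E) T'' T')"
proof -
  interpret F_family u E by unfold_locales (use assms in auto)
  show ?thesis by (rule exchange_lamination[OF assms(4,5)])
qed

end
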